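(* Let $\mathcal{V}$ be a complex vector space, let $\mathcal{E}$ and $\mathcal{N}$ be Hilbert spaces, let $\Xi$ be a full nc subset of $\mathcal{V}_{\rm nc}$, and let $\mathfrak{Q}$ be a Hermitian nc kernel on $\Xi$ with values in $\mathcal{L}(\mathbb{C}_{\rm nc},\mathcal{L}(\mathcal{N})_{\rm nc})$. Put $$\mathbb{P}_{\mathfrak{Q}}=\amalg_{n=1}^\infty\{Z\in\Xi_n:\mathfrak{Q}(Z,Z)(I_n)\succ0\}.$$ Suppose that: (i) $\Omega$ is a subset of $\mathbb{P}_{\mathfrak{Q}}$. (ii) $\mathfrak{S}$ is a Hermitian nc kernel on $\Omega':=[\Omega]_{\rm full}\cap\mathbb{P}_{\mathfrak{Q}}$ with values in $\mathcal{L}(\mathbb{C}_{\rm nc},\mathcal{L}(\mathcal{E})_{\rm nc})$ such that $\mathfrak{S}(Z,Z)(I_n)\succeq0$ for all $Z\in\Omega'_n$, $n\in\mathbb{N}$. (iii) The restriction of $\mathfrak{Q}$ to any finite subset of $\Xi$ is decomposable. (iv) The restriction of $\mathfrak{S}$ to any finite subset of $\Omega'$ is decomposable. Then there exist completely positive nc kernels $\Gamma_1$, $\Gamma_2$ on $\Omega$, with $\Gamma_1$ having values in $\mathcal{L}(\mathcal{L}(\mathcal{N})_{\rm nc},\mathcal{L}(\mathcal{E})_{\rm nc})$ and $\Gamma_2$ having values in $\mathcal{L}(\mathbb{C}_{\rm nc},\mathcal{L}(\mathcal{E})_{\rm nc})$, such that for all $Z\in\Omega_n$, $W\in\Omega_m$,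 $P\in\mathbb{C}^{n\times m}$, $n,m\in\mathbb{N}$, $$\mathfrak{S}(Z,W)(P)=\Gamma_1(Z,W)\big(\mathfrak{Q}(Z,W)(P)\big)+\Gamma_2(Z,W)(P).$$
   Context: $\mathcal{V}_{\rm nc}=\amalg_{n\ge1}\mathcal{V}^{n\times n}$; for $\Omega\subset\mathcal{V}_{\rm nc}$, $\Omega_n=\Omega\cap\mathcal{V}^{n\times n}$; complex matrices act on matrices over vector spaces by matrix multiplication. $T\succeq0$ means positive semidefinite; $T\succ0$ means strictly positive definite, $T\succeq\epsilon I$ for some $\epsilon>0$. Full nc subsets: $\Xi\subset\mathcal{V}_{\rm nc}$ is a full nc subset if it is closed under direct sums and, whenever $Z\in\Xi_n$, $\widetilde Z\in\mathcal{V}^{m\times m}$ and $\mathcal{I}\widetilde Z=Z\mathcal{I}$ for some injective $\mathcal{I}\in\mathbb{C}^{n\times m}$, then $\widetilde Z\in\Xi_m$. For $\Omega\subset\mathcal{V}_{\rm nc}$, $[\Omega]_{\rm full}$ denotes the smallest full nc subset of $\mathcal{V}_{\rm nc}$ containing $\Omega$. Nc kernels: for $C^*$-algebras $\mathcal{A},\mathcal{B}$, a nc kernel on $\Omega$ with values in $\mathcal{L}(\mathcal{A}_{\rm nc},\mathcal{B}_{\rm nc})$ is a function $K$ on $\Omega\times\Omega$ such that (graded) $K(Z,W)$ is a linear map $\mathcal{A}^{n\times m}\to\mathcal{B}^{n\times m}$ for $Z\in\Omega_n$, $W\in\Omega_m$; and (respects intertwinings) whenever $Z\in\Omega_n$,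 $\widetilde Z\in\Omega_{\tilde n}$, $\alpha\in\mathbb{C}^{\tilde n\times n}$, $\alpha Z=\widetilde Z\alpha$, $W\in\Omega_m$, $\widetilde W\in\Omega_{\tilde m}$, $\beta\in\mathbb{C}^{\tilde m\times m}$, $\beta W=\widetilde W\beta$, $P\in\mathcal{A}^{n\times m}$, then $\alpha K(Z,W)(P)\beta^*=K(\widetilde Z,\widetilde W)(\alpha P\beta^* )$. $K$ is Hermitian if $K(Z,W)(P)^*=K(W,Z)(P^* )$ always. $K$ is completely positive (cp) if for all finite lists $Z_1,\dots,Z_k$ in $\Omega$, $Z_i\in\Omega_{n_i}$, the map $[P_{ij}]\mapsto[K(Z_i,Z_j)(P_{ij})]$ ($P_{ij}\in\mathcal{A}^{n_i\times n_j}$) is completely positive from $\mathcal{A}^{N\times N}$ to $\mathcal{B}^{N\times N}$, $N=\sum n_i$. A Hermitian nc kernel on a set is decomposable if it is the difference of two cp nc kernels on that set (with values in the same space). *)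

theory Defs
  imports "HOL-Analysis.Analysis" "Jordan_Normal_Form.Matrix"
begin

section \<open>Complex vector spaces, Hilbert spaces and bounded operators\<close>

class complex_vector = ab_group_add +
  fixes scaleC :: "complex \<Rightarrow> 'a \<Rightarrow> 'a"  (infixr \<open>*\<^sub>C\<close> 75)
  assumes scaleC_add_right: "c *\<^sub>C (x + y) = c *\<^sub>C x + c *\<^sub>C y"
    and scaleC_add_left: "(c + d) *\<^sub>C x = c *\<^sub>C x + d *\<^sub>C x"
    and scaleC_scaleC: "c *\<^sub>C d *\<^sub>C x = (c * d) *\<^sub>C x"
    and scaleC_one: "1 *\<^sub>C x = x"

text \<open>The inner product is linear in its first argument. Its real part is the real inner product
  of the library, so that positivity and the norm come from \<^class>\<open>real_inner\<close>. The zero space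
  is allowed, and so are nonseparable spaces.\<close>

class chilbert_space = complex_vector + real_inner + complete_space +
  fixes cinner :: "'a \<Rightarrow> 'a \<Rightarrow> complex"
  assumes scaleR_scaleC: "r *\<^sub>R x = complex_of_real r *\<^sub>C x"
    and cinner_add_left: "cinner (x + y) z = cinner x z + cinner y z"
    and cinner_scaleC_left: "cinner (c *\<^sub>C x) y = c * cinner x y"
    and cinner_commute: "cinner y x = cnj (cinner x y)"
    and Re_cinner: "Re (cinner x y) = inner x y"

instantiation complex :: chilbert_space
begin
definition "scaleC_complex = ((*) :: complex \<Rightarrow> complex \<Rightarrow> complex)"
definition "cinner_complex (x :: complex) y = x * cnj y"
instance
  by standard
     (simp_all add: scaleC_complex_def cinner_complex_def algebra_simps scaleR_conv_of_real inner_complex_def)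
end

text \<open>The algebra of bounded complex-linear operators on a Hilbert space.\<close>

typedef (overloaded) 'h bop =
  "{f :: 'h::chilbert_space \<Rightarrow> 'h. bounded_linear f \<and> (\<forall>c x. f (c *\<^sub>C x) = c *\<^sub>C f x)}"
  morphisms bop_apply Bop
proof
  have "0 = c *\<^sub>C (0::'h)" for c
    using scaleC_add_right[of c "0::'h" 0] by simp
  then show "(\<lambda>_. 0) \<in> {f :: 'h \<Rightarrow> 'h. bounded_linear f \<and> (\<forall>c x. f (c *\<^sub>C x) = c *\<^sub>C f x)}"
    by simp
qed

setup_lifting type_definition_bop

lemma scaleC_zero_right: "c *\<^sub>C (0::'a::complex_vector) = 0"
  using scaleC_add_right[of c "0::'a" 0] by simp

lemma scaleC_minus_right: "c *\<^sub>C (- x) = - (c *\<^sub>C (x::'a::complex_vector))"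
proof -
  have "c *\<^sub>C x + c *\<^sub>C (- x) = 0"
    using scaleC_add_right[of c x "- x"] by (simp add: scaleC_zero_right)
  then show ?thesis
    by (rule add.inverse_unique[symmetric])
qed

lemma scaleC_diff_right: "c *\<^sub>C (x - y) = c *\<^sub>C x - c *\<^sub>C (y::'a::complex_vector)"
  using scaleC_add_right[of c x "- y"] by (simp add: scaleC_minus_right)

lemma cinner_scaleC_right: "cinner x (c *\<^sub>C y) = cnj c * cinner x (y::'h::chilbert_space)"
  by (metis cinner_commute cinner_scaleC_left complex_cnj_mult)

lemma cinner_add_right: "cinner x (y + z) = cinner x y + cinner x (z::'h::chilbert_space)"
  by (metis cinner_commute cinner_add_left complex_cnj_add)

lemma cinner_eq_iff:
  "cinner x y = cinner u (v::'h::chilbert_space) \<longleftrightarrow>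
    inner x y = inner u v \<and> inner (\<i> *\<^sub>C x) y = inner (\<i> *\<^sub>C u) v"
  by (simp add: complex_eq_iff Re_cinner[symmetric] cinner_scaleC_left)

lemma cinner_ext:
  assumes "\<And>x. cinner x y = cinner x (z::'h::chilbert_space)"
  shows "y = z"
proof -
  have "inner x y = inner x z" for x
    using assms[of x] by (metis Re_cinner)
  then show ?thesis
    by (metis inner_commute vector_eq_rdot)
qed

lemma norm_scaleC: "norm (c *\<^sub>C x) = cmod c * norm (x::'h::chilbert_space)"
proof -
  have im: "Im (cinner x x) = 0"
    using arg_cong[OF cinner_commute[of x x], of Im] by simp
  have "(norm (c *\<^sub>C x))\<^sup>2 = Re (cinner (c *\<^sub>C x) (c *\<^sub>C x))"
    by (simp add: power2_norm_eq_inner Re_cinner)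
  also have "\<dots> = Re ((c * cnj c) * cinner x x)"
    by (simp add: cinner_scaleC_left cinner_scaleC_right algebra_simps)
  also have "\<dots> = (cmod c)\<^sup>2 * (norm x)\<^sup>2"
    by (simp only: complex_norm_square[symmetric])
       (simp add: im Re_cinner power2_norm_eq_inner)
  finally have "(norm (c *\<^sub>C x))\<^sup>2 = (cmod c * norm x)\<^sup>2"
    by (simp add: power_mult_distrib)
  then show ?thesis
    by (simp add: power2_eq_iff_nonneg)
qed

lemma bounded_linear_scaleC: "bounded_linear (\<lambda>x::'h::chilbert_space. c *\<^sub>C x)"
proof (rule bounded_linear_intro[where K = "cmod c"])
  show "c *\<^sub>C (r *\<^sub>R x) = r *\<^sub>R (c *\<^sub>C x)" for r and x :: 'h
    by (simp add: scaleR_scaleC scaleC_scaleC mult.commute)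
qed (simp_all add: scaleC_add_right norm_scaleC mult.commute)

instantiation bop :: (chilbert_space) complex_vector
begin
lift_definition zero_bop :: "'a bop" is "\<lambda>_. 0" by (simp add: scaleC_zero_right)
lift_definition plus_bop :: "'a bop \<Rightarrow> 'a bop \<Rightarrow> 'a bop" is "\<lambda>f g x. f x + g x"
  by (simp add: bounded_linear_add scaleC_add_right)
lift_definition minus_bop :: "'a bop \<Rightarrow> 'a bop \<Rightarrow> 'a bop" is "\<lambda>f g x. f x - g x"
  by (simp add: bounded_linear_sub scaleC_diff_right)
lift_definition uminus_bop :: "'a bop \<Rightarrow> 'a bop" is "\<lambda>f x. - f x"
  by (simp add: bounded_linear_minus scaleC_minus_right)
lift_definition scaleC_bop :: "complex \<Rightarrow> 'a bop \<Rightarrow> 'a bop" is "\<lambda>c f x. c *\<^sub>C f x"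
  by (auto simp: scaleC_scaleC mult.commute
      intro: bounded_linear_compose[OF bounded_linear_scaleC])
instance
  by standard
     (transfer; simp add: fun_eq_iff algebra_simps scaleC_add_right scaleC_add_left scaleC_scaleC scaleC_one)+
end

instantiation bop :: (chilbert_space) one
begin
lift_definition one_bop :: "'a bop" is "\<lambda>x. x" by simp
instance ..
end

subsection \<open>The Hilbert space adjoint\<close>

lemma riesz_real:
  fixes f :: "'a::{real_inner,complete_space} \<Rightarrow> real"
  assumes "bounded_linear f"
  shows "\<exists>z. \<forall>x. f x = inner x z"
proof -
  interpret f: bounded_linear f by fact
  define q where "q = (\<lambda>x. inner x x - 2 * f x)"
  obtain K where K: "\<And>x. norm (f x) \<le> norm x * K"
    using f.bounded by blast
  have lower: "- K\<^sup>2 \<le> q x" for x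
  proof -
    have "0 \<le> (norm x - K)\<^sup>2" by simp
    then have "- K\<^sup>2 \<le> (norm x)\<^sup>2 - 2 * (norm x * K)"
      by (simp add: power2_eq_square algebra_simps)
    also have "\<dots> \<le> q x"
      using K[of x] by (simp add: q_def power2_norm_eq_inner abs_le_iff)
    finally show ?thesis .
  qed
  then have bdd: "bdd_below (range q)"
    by (meson bdd_belowI2)
  define m where "m = Inf (range q)"
  have m_le: "m \<le> q x" for x
    unfolding m_def by (rule cInf_lower[OF _ bdd]) simp
  have par: "q a + q b - 2 * q ((1/2) *\<^sub>R (a + b)) = (norm (a - b))\<^sup>2 / 2" for a b
    by (simp add: q_def f.add f.scaleR power2_norm_eq_inner inner_commute algebra_simps)
  have dist_le: "(norm (a - b))\<^sup>2 \<le> 2 * (q a - m) + 2 * (q b - m)" for a b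
    using par[of a b] m_le[of "(1/2) *\<^sub>R (a + b)"] by simp
  have "\<exists>x. q x < m + 1 / real (Suc n)" for n
  proof -
    have "Inf (range q) < m + 1 / real (Suc n)"
      by (simp add: m_def)
    then show ?thesis
      using cInf_lessD[of "range q"] by blast
  qed
  then obtain X where X: "\<And>n. q (X n) < m + 1 / real (Suc n)"
    by metis
  have "Cauchy X"
  proof (rule metric_CauchyI)
    fix e :: real assume "0 < e"
    then obtain M where M: "1 / real (Suc M) < e\<^sup>2 / 4"
      using nat_approx_posE[of "e\<^sup>2 / 4"] by auto
    have small: "q (X n) - m < e\<^sup>2 / 4" if "n \<ge> M" for n
    proof -
      have "1 / real (Suc n) \<le> 1 / real (Suc M)"
        using that by (simp add: field_simps)
      then show ?thesis
        using X[of n] M by linarith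
    qed
    have "dist (X i) (X j) < e" if "i \<ge> M" "j \<ge> M" for i j
    proof -
      have "(norm (X i - X j))\<^sup>2 < e\<^sup>2"
        proof -
        have "2 * (q (X i) - m) + 2 * (q (X j) - m) < 2 * (e\<^sup>2 / 4) + 2 * (e\<^sup>2 / 4)"
          by (intro add_strict_mono mult_strict_left_mono small that) simp_all
        then show ?thesis
          using dist_le[of "X i" "X j"] by simp
      qed
      then show ?thesis
        using \<open>0 < e\<close> power2_less_imp_less[of _ e] by (simp add: dist_norm)
    qed
    then show "\<exists>M. \<forall>i\<ge>M. \<forall>j\<ge>M. dist (X i) (X j) < e" by blast
  qed
  then obtain z where z: "X \<longlonglongrightarrow> z"
    using Cauchy_convergent convergent_def by blast
  have lim1: "(\<lambda>n. q (X n)) \<longlonglongrightarrow> q z"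
    unfolding q_def by (intro tendsto_intros z f.tendsto)
  have lim2: "(\<lambda>n. m + 1 / real (Suc n)) \<longlonglongrightarrow> m + 0"
    by (intro tendsto_intros LIMSEQ_Suc[OF lim_1_over_n])
  have "q z \<le> m + 0"
    by (rule LIMSEQ_le[OF lim1 lim2]) (use X in \<open>auto intro: less_imp_le\<close>)
  then have min: "q z \<le> q x" for x
    using m_le[of x] by simp
  have "f h = inner h z" for h
  proof (cases "h = 0")
    case True
    then show ?thesis by (simp add: f.zero)
  next
    case False
    define c where "c = inner z h - f h"
    define s where "s = inner h h"
    have s: "s > 0" using False by (simp add: s_def)
    have expand: "q (z + t *\<^sub>R h) = q z + t * t * s + 2 * t * c" for t
      by (simp add: q_def c_def s_def f.add f.scaleR inner_commute[of h z] algebra_simps)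
    have "q z \<le> q (z + (- c / s) *\<^sub>R h)" by (rule min)
    also have "\<dots> = q z - c * c / s"
      unfolding expand using s by (simp add: field_simps)
    finally have "c * c / s \<le> 0" by simp
    then have "c = 0"
      using s by (simp add: divide_le_0_iff) (metis mult_eq_0_iff order_antisym zero_le_square)
    then show ?thesis by (simp add: c_def inner_commute)
  qed
  then show ?thesis by blast
qed

lemma bounded_linear_bop_apply: "bounded_linear (bop_apply T)"
  and bop_apply_scaleC: "bop_apply T (c *\<^sub>C x) = c *\<^sub>C bop_apply T x"
  using bop_apply[of T] by auto

lemma adjoint_exists:
  "\<exists>S. \<forall>x y. cinner (bop_apply T x) y = cinner x (bop_apply S (y::'h::chilbert_space))"
proof -
  note lin = bounded_linear_bop_apply[of T]
  have "\<exists>z. \<forall>x. cinner (bop_apply T x) y = cinner x z" for y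
  proof -
    have "bounded_linear (\<lambda>x. inner (bop_apply T x) y)"
      by (rule bounded_linear_compose[OF bounded_linear_inner_left lin])
    from riesz_real[OF this] obtain z where "\<And>x. inner (bop_apply T x) y = inner x z"
      by blast
    then have "cinner (bop_apply T x) y = cinner x z" for x
      by (simp add: cinner_eq_iff bop_apply_scaleC[symmetric])
    then show ?thesis by blast
  qed
  then obtain S where S: "\<And>x y. cinner (bop_apply T x) y = cinner x (S y)"
    by metis
  have S_add: "S (y + z) = S y + S z" for y z
    by (rule cinner_ext) (simp add: S[symmetric] cinner_add_right)
  have S_scaleC: "S (c *\<^sub>C y) = c *\<^sub>C S y" for c y
    by (rule cinner_ext) (simp add: S[symmetric] cinner_scaleC_right)
  obtain K where K: "K > 0" "\<And>x. norm (bop_apply T x) \<le> norm x * K"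
    using bounded_linear.pos_bounded[OF lin] by blast
  have bound: "norm (S y) \<le> norm y * K" for y
  proof -
    have "norm (S y) * norm (S y) = Re (cinner (S y) (S y))"
      by (simp add: Re_cinner power2_norm_eq_inner[symmetric] power2_eq_square)
    also have "\<dots> = inner (bop_apply T (S y)) y"
      by (simp add: S[symmetric] Re_cinner)
    also have "\<dots> \<le> norm (bop_apply T (S y)) * norm y"
      by (rule norm_cauchy_schwarz)
    also have "\<dots> \<le> norm (S y) * K * norm y"
      by (rule mult_right_mono[OF K(2)]) simp
    finally have "norm (S y) * norm (S y) \<le> norm (S y) * (norm y * K)"
      by (simp add: ac_simps)
    then show ?thesis
      using K(1) by (cases "norm (S y) = 0") auto
  qed
  have "bounded_linear S"
    by (rule bounded_linear_intro[where K = K])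
       (simp_all add: S_add scaleR_scaleC S_scaleC bound)
  then have "bop_apply (Bop S) = S"
    by (intro Bop_inverse) (simp add: S_scaleC)
  then show ?thesis
    using S by metis
qed

lemma adjoint_unique:
  assumes "\<And>x y. cinner x (bop_apply S y) = cinner x (bop_apply S' (y::'h::chilbert_space))"
  shows "S = S'"
  using assms by (metis bop_apply_inject cinner_ext ext)

instantiation bop :: (chilbert_space) conjugate
begin

definition conjugate_bop :: "'a bop \<Rightarrow> 'a bop" where
  "conjugate T = (THE S. \<forall>x y. cinner (bop_apply T x) y = cinner x (bop_apply S y))"

lemma cinner_adjoint: "cinner (bop_apply T x) y = cinner x (bop_apply (conjugate T) (y::'a))"
proof -
  have "\<exists>!S. \<forall>x y. cinner (bop_apply T x) y = cinner x (bop_apply S y)"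
    using adjoint_exists[of T] by (metis adjoint_unique)
  from theI'[OF this] show ?thesis
    unfolding conjugate_bop_def by blast
qed

instance
proof
  show id: "conjugate (conjugate T) = T" for T :: "'a bop"
    by (rule adjoint_unique) (metis cinner_adjoint cinner_commute)
  show "conjugate S = conjugate T \<longleftrightarrow> S = T" for S T :: "'a bop"
    by (metis id)
qed

end


section \<open>Matrices\<close>

definition lact :: "complex mat \<Rightarrow> 'v::complex_vector mat \<Rightarrow> 'v mat" (infixr \<open>\<cdot>\<^sub>L\<close> 70) where
  "\<alpha> \<cdot>\<^sub>L Z = mat (dim_row \<alpha>) (dim_col Z)
     (\<lambda>(i, j). \<Sum>k<dim_row Z. \<alpha> $$ (i, k) *\<^sub>C Z $$ (k, j))"

definition ract :: "'v::complex_vector mat \<Rightarrow> complex mat \<Rightarrow> 'v mat" (infixl \<open>\<cdot>\<^sub>R\<close> 71) where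
  "Z \<cdot>\<^sub>R \<beta> = mat (dim_row Z) (dim_col \<beta>)
     (\<lambda>(i, j). \<Sum>k<dim_col Z. \<beta> $$ (k, j) *\<^sub>C Z $$ (i, k))"

definition adj :: "'a::conjugate mat \<Rightarrow> 'a mat" where
  "adj A = mat (dim_col A) (dim_row A) (\<lambda>(i, j). conjugate (A $$ (j, i)))"

definition subblock :: "'a mat \<Rightarrow> nat \<Rightarrow> nat \<Rightarrow> nat \<Rightarrow> nat \<Rightarrow> 'a mat" where
  "subblock P r c n m = mat n m (\<lambda>(i, j). P $$ (r + i, c + j))"

text \<open>Positivity in \<open>\<A>\<^sup>n\<^sup>\<times>\<^sup>n\<close> for a C*-algebra \<open>\<A>\<close> acting on a Hilbert space \<open>H\<close> through \<open>act\<close>: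
  the matrix is a positive semidefinite operator on \<open>H\<^sup>n\<close>. The action is \<^const>\<open>bop_apply\<close> for
  \<open>\<L>(H)\<close> and multiplication on the Hilbert space \<open>\<complex>\<close> for the algebra \<open>\<complex>\<close>.
  The order on \<open>\<complex>\<close> is that of \<^theory>\<open>HOL-Library.Complex_Order\<close>, where \<open>0 \<le> s\<close> includes that
  \<open>s\<close> is real.\<close>

definition psd :: "('a \<Rightarrow> 'h \<Rightarrow> 'h::chilbert_space) \<Rightarrow> 'a mat \<Rightarrow> bool" where
  "psd act T \<longleftrightarrow> square_mat T \<and>
     (\<forall>x :: nat \<Rightarrow> 'h.
        0 \<le> (\<Sum>i<dim_row T. \<Sum>j<dim_row T. cinner (act (T $$ (i, j)) (x j)) (x i)))"

definition strictly_pd :: "'h::chilbert_space bop mat \<Rightarrow> bool" where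
  "strictly_pd T \<longleftrightarrow>
     (\<exists>\<epsilon>>0. psd bop_apply (T - map_mat ((*\<^sub>C) (complex_of_real \<epsilon>)) (1\<^sub>m (dim_row T))))"

definition mat_clinear ::
    "nat \<Rightarrow> nat \<Rightarrow> nat \<Rightarrow> nat \<Rightarrow> ('a::complex_vector mat \<Rightarrow> 'b::complex_vector mat) \<Rightarrow> bool" where
  "mat_clinear n m n' m' \<phi> \<longleftrightarrow>
     (\<forall>P \<in> carrier_mat n m. \<phi> P \<in> carrier_mat n' m') \<and>
     (\<forall>P \<in> carrier_mat n m. \<forall>Q \<in> carrier_mat n m. \<phi> (P + Q) = \<phi> P + \<phi> Q) \<and>
     (\<forall>c. \<forall>P \<in> carrier_mat n m. \<phi> (map_mat ((*\<^sub>C) c) P) = map_mat ((*\<^sub>C) c) (\<phi> P))"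

text \<open>\<open>amplify r n m \<phi>\<close> applies \<open>\<phi> : \<A>\<^sup>n\<^sup>\<times>\<^sup>n \<rightarrow> \<B>\<^sup>m\<^sup>\<times>\<^sup>m\<close> to each of the \<open>r \<times> r\<close> blocks of a
  matrix in \<open>\<A>\<^sup>r\<^sup>n\<^sup>\<times>\<^sup>r\<^sup>n\<close>.\<close>

definition amplify :: "nat \<Rightarrow> nat \<Rightarrow> nat \<Rightarrow> ('a mat \<Rightarrow> 'b mat) \<Rightarrow> 'a mat \<Rightarrow> 'b mat" where
  "amplify r n m \<phi> P = mat (r * m) (r * m)
     (\<lambda>(i, j). \<phi> (subblock P (i div m * n) (j div m * n) n n) $$ (i mod m, j mod m))"

definition completely_positive ::
    "('a \<Rightarrow> 'h \<Rightarrow> 'h::chilbert_space) \<Rightarrow> ('b \<Rightarrow> 'k \<Rightarrow> 'k::chilbert_space) \<Rightarrow> nat \<Rightarrow> nat \<Rightarrow>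
      ('a::complex_vector mat \<Rightarrow> 'b::complex_vector mat) \<Rightarrow> bool" where
  "completely_positive actA actB n m \<phi> \<longleftrightarrow>
     mat_clinear n n m m \<phi> \<and>
     (\<forall>r. \<forall>P \<in> carrier_mat (r * n) (r * n). psd actA P \<longrightarrow> psd actB (amplify r n m \<phi> P))"


section \<open>Noncommutative sets\<close>

definition nc_space :: "'v mat set" where
  "nc_space = {Z. square_mat Z \<and> dim_row Z \<ge> 1}"

definition full_nc :: "'v::complex_vector mat set \<Rightarrow> bool" where
  "full_nc \<Xi> \<longleftrightarrow> \<Xi> \<subseteq> nc_space \<and>
     (\<forall>Z \<in> \<Xi>. \<forall>W \<in> \<Xi>. diag_block_mat [Z, W] \<in> \<Xi>) \<and>
     (\<forall>Z \<in> \<Xi>. \<forall>Z' \<in> nc_space. \<forall>I \<in> carrier_mat (dim_row Z) (dim_row Z').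
        inj_on ((*\<^sub>v) I) (carrier_vec (dim_row Z')) \<and> I \<cdot>\<^sub>L Z' = Z \<cdot>\<^sub>R I \<longrightarrow> Z' \<in> \<Xi>)"

definition full_hull :: "'v::complex_vector mat set \<Rightarrow> 'v mat set" where
  "full_hull \<Omega> = full_nc hull \<Omega>"


section \<open>Noncommutative kernels\<close>

type_synonym ('v, 'a, 'b) kernel = "'v mat \<Rightarrow> 'v mat \<Rightarrow> 'a mat \<Rightarrow> 'b mat"

definition nc_kernel ::
    "'v::complex_vector mat set \<Rightarrow> ('v, 'a::complex_vector, 'b::complex_vector) kernel \<Rightarrow> bool" where
  "nc_kernel \<Omega> K \<longleftrightarrow>
     (\<forall>Z \<in> \<Omega>. \<forall>W \<in> \<Omega>.
        mat_clinear (dim_row Z) (dim_row W) (dim_row Z) (dim_row W) (K Z W)) \<and>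
     (\<forall>Z \<in> \<Omega>. \<forall>Z' \<in> \<Omega>. \<forall>W \<in> \<Omega>. \<forall>W' \<in> \<Omega>.
        \<forall>\<alpha> \<in> carrier_mat (dim_row Z') (dim_row Z). \<forall>\<beta> \<in> carrier_mat (dim_row W') (dim_row W).
        \<forall>P \<in> carrier_mat (dim_row Z) (dim_row W).
          \<alpha> \<cdot>\<^sub>L Z = Z' \<cdot>\<^sub>R \<alpha> \<and> \<beta> \<cdot>\<^sub>L W = W' \<cdot>\<^sub>R \<beta> \<longrightarrow>
            (\<alpha> \<cdot>\<^sub>L K Z W P) \<cdot>\<^sub>R adj \<beta> = K Z' W' ((\<alpha> \<cdot>\<^sub>L P) \<cdot>\<^sub>R adj \<beta>))"

definition hermitian_kernel ::
    "'v mat set \<Rightarrow> ('v, 'a::conjugate, 'b::conjugate) kernel \<Rightarrow> bool" where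
  "hermitian_kernel \<Omega> K \<longleftrightarrow>
     (\<forall>Z \<in> \<Omega>. \<forall>W \<in> \<Omega>. \<forall>P \<in> carrier_mat (dim_row Z) (dim_row W).
        adj (K Z W P) = K W Z (adj P))"

text \<open>For block sizes \<open>ns\<close>, a global index is sent to the number of its block and the index
  inside that block.\<close>

fun locate :: "nat list \<Rightarrow> nat \<Rightarrow> nat \<times> nat" where
  "locate [] p = (0, p)"
| "locate (n # ns) p = (if p < n then (0, p) else map_prod Suc id (locate ns (p - n)))"

text \<open>The map \<open>[P\<^sub>i\<^sub>j] \<mapsto> [K (Z\<^sub>i, Z\<^sub>j) (P\<^sub>i\<^sub>j)]\<close> for the list \<open>Zs = [Z\<^sub>1, \<dots>, Z\<^sub>k]\<close>.\<close>

definition block_map :: "('v, 'a, 'b) kernel \<Rightarrow> 'v mat list \<Rightarrow> 'a mat \<Rightarrow> 'b mat" where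
  "block_map K Zs P =
     (let ns = map dim_row Zs; N = sum_list ns; off = (\<lambda>i. sum_list (take i ns)) in
      mat N N (\<lambda>(p, q).
        let (i, a) = locate ns p; (j, b) = locate ns q in
        K (Zs ! i) (Zs ! j) (subblock P (off i) (off j) (ns ! i) (ns ! j)) $$ (a, b)))"

definition cp_nc_kernel ::
    "('a \<Rightarrow> 'h \<Rightarrow> 'h::chilbert_space) \<Rightarrow> ('b \<Rightarrow> 'k \<Rightarrow> 'k::chilbert_space) \<Rightarrow>
      'v::complex_vector mat set \<Rightarrow> ('v, 'a::complex_vector, 'b::complex_vector) kernel \<Rightarrow> bool" where
  "cp_nc_kernel actA actB \<Omega> K \<longleftrightarrow> nc_kernel \<Omega> K \<and>
     (\<forall>Zs. set Zs \<subseteq> \<Omega> \<longrightarrow>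
        (let N = sum_list (map dim_row Zs) in
         completely_positive actA actB N N (block_map K Zs)))"

definition decomposable ::
    "('a \<Rightarrow> 'h \<Rightarrow> 'h::chilbert_space) \<Rightarrow> ('b \<Rightarrow> 'k \<Rightarrow> 'k::chilbert_space) \<Rightarrow>
      'v::complex_vector mat set \<Rightarrow>
      ('v, 'a::{complex_vector,conjugate}, 'b::{complex_vector,conjugate}) kernel \<Rightarrow> bool" where
  "decomposable actA actB \<Omega> K \<longleftrightarrow> nc_kernel \<Omega> K \<and> hermitian_kernel \<Omega> K \<and>
     (\<exists>K1 K2. cp_nc_kernel actA actB \<Omega> K1 \<and> cp_nc_kernel actA actB \<Omega> K2 \<and>
        (\<forall>Z \<in> \<Omega>. \<forall>W \<in> \<Omega>. \<forall>P \<in> carrier_mat (dim_row Z) (dim_row W).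
           K Z W P = K1 Z W P - K2 Z W P))"

definition pos_set ::
    "'v::complex_vector mat set \<Rightarrow> ('v, complex, 'h::chilbert_space bop) kernel \<Rightarrow> 'v mat set" where
  "pos_set \<Xi> Q = {Z \<in> \<Xi>. strictly_pd (Q Z Z (1\<^sub>m (dim_row Z)))}"

end

theory Submission
  imports Defs "HOL-Library.Function_Algebras" "HOL-Computational_Algebra.Computational_Algebra"
    "Jordan_Normal_Form.Determinant"
begin

text \<open>Put \<open>q Z W P = (Q Z W P, P)\<close>, with values in \<open>\<L>(\<N>) \<oplus> \<complex>\<close>. It suffices to find one completely
  positive kernel \<open>\<Gamma>\<close> with \<open>S = \<Gamma> \<circ> q\<close>, since \<open>\<Gamma>\<^sub>1\<close> and \<open>\<Gamma>\<^sub>2\<close> are its restrictions to the two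
  summands. The point set \<open>\<Omega>'\<close> is closed under direct sums, similarities and compressions to ranges
  of idempotent intertwiners; a change of basis turns any strictly positive \<open>P\<close> into the identity of
  another point, so positivity of \<open>S Z Z 1\<close> means that \<open>S\<close> is dominated by \<open>q\<close>. The Hahn-Banach theorem
  and compactness then give a positive \<open>\<Gamma>\<close> with \<open>S = \<Gamma> \<circ> q\<close>, which need not respect intertwinings.

  To make it respect the endomorphisms of a point \<open>Y\<close>, average it over invertible endomorphisms.
  This needs an amenable group. Among the points of which all the given ones are summands of
  multiples, take \<open>Y\<close> of least size: then no proper corner of its endomorphism algebra is Morita
  equivalent to the whole, the algebra is commutative modulo its radical, and the averaging
  proceeds along a filtration with commutative quotients. The averaged kernel at \<open>Y\<close> determines one
  at all the given points, and compactness passes to \<open>\<Omega>'\<close>.\<close>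

section \<open>The Hahn-Banach theorem\<close>

text \<open>Averaging is needed because the Hahn-Banach functional is arbitrary along endomorphisms.
  An invertible endomorphism g of Y acts on the positive extensions at Y by replacing R with g R g^*
  and the vectors with their images under the inverse of g^*; intertwining under g means being fixed
  by this action. The extensions form a compact convex set, but a group such as GL_2, which appears
  as soon as Y contains two copies of one summand, has no invariant mean and need not have a fixed
  point. Only one group element is averaged at a time, by Cesaro means, so the conditions won
  earlier must be stable under conjugation by the new element; that stability is what the filtration
  provides. Strict positivity of Q(Z,Z)(1) enters twice: it supplies the order unit behind the
  bounds and the Hahn-Banach step, and it survives direct sums and compressions. The second
  coordinate of q serves the change of basis: positivity of Q(Z,Z)(P) alone says nothing about P,
  while strict positivity of the pair makes P itself definite.\<close>

lemma scaleC_zero_left: "0 *\<^sub>C (x::'a::complex_vector) = 0"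
  using scaleC_add_left[of 0 0 x] by simp

lemma scaleC_minus_left: "(- c) *\<^sub>C (x::'a::complex_vector) = - (c *\<^sub>C x)"
proof -
  have "c *\<^sub>C x + (- c) *\<^sub>C x = 0"
    using scaleC_add_left[of c "- c" x] by (simp add: scaleC_zero_left)
  then show ?thesis
    by (rule add.inverse_unique[symmetric])
qed

lemma scaleC_sum_right: "c *\<^sub>C (\<Sum>i\<in>I. f i) = (\<Sum>i\<in>I. c *\<^sub>C (f i :: 'a::complex_vector))"
  by (induction I rule: infinite_finite_induct) (auto simp: scaleC_zero_right scaleC_add_right)

lemma scaleC_sum_left: "(\<Sum>i\<in>I. c i) *\<^sub>C (x :: 'a::complex_vector) = (\<Sum>i\<in>I. c i *\<^sub>C x)"
  by (induction I rule: infinite_finite_induct) (auto simp: scaleC_zero_left scaleC_add_left)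

text \<open>Matrices and block vectors are functions of natural-number indices in what follows, with
  the size kept apart and entries beyond it disregarded; this is their pointwise linear
  structure.\<close>

instantiation "fun" :: (type, complex_vector) complex_vector
begin
definition "scaleC_fun c f = (\<lambda>x. c *\<^sub>C f x)"
instance
  by standard (auto simp: scaleC_fun_def plus_fun_def fun_eq_iff scaleC_add_right scaleC_add_left
      scaleC_scaleC scaleC_one)
end

text \<open>Homogeneous only for nonnegative real scalars: the Hahn-Banach theorem is proved for
  real-linear functionals on a complex space, and a complex-linear one is recovered later as f u - i
  f (i u).\<close>

definition sublinear :: "('u::complex_vector \<Rightarrow> real) \<Rightarrow> bool" where
  "sublinear p \<longleftrightarrow> (\<forall>u v. p (u + v) \<le> p u + p v) \<and>
     (\<forall>r u. 0 \<le> r \<longrightarrow> p (complex_of_real r *\<^sub>C u) = r * p u)"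

text \<open>Applying \<open>scale\<close> to the factor 1/r gives the reverse inequality, so one
  inequality for positive r suffices.\<close>

lemma sublinearI:
  assumes add: "\<And>u v. p (u + v) \<le> p u + p v"
    and scale: "\<And>r u. 0 < r \<Longrightarrow> p (complex_of_real r *\<^sub>C u) \<le> r * p u"
    and zero: "p 0 = 0"
  shows "sublinear p"
proof -
  have "r * p u \<le> p (complex_of_real r *\<^sub>C u)" if "0 < r" for r u
  proof -
    have "p (complex_of_real (1/r) *\<^sub>C complex_of_real r *\<^sub>C u) \<le> (1/r) * p (complex_of_real r *\<^sub>C u)"
      by (rule scale) (use that in simp)
    moreover have "complex_of_real (1/r) *\<^sub>C complex_of_real r *\<^sub>C u = u"
      using that by (simp add: scaleC_scaleC scaleC_one)
    ultimately show ?thesis using that by (simp add: field_simps)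
  qed
  then have "p (complex_of_real r *\<^sub>C u) = r * p u" if "0 \<le> r" for r u
    using that scale[of r u] by (cases "r = 0") (auto simp: scaleC_zero_left zero intro: antisym)
  then show ?thesis using add by (auto simp: sublinear_def)
qed

lemma sublinear_zero: "sublinear p \<Longrightarrow> p 0 = 0"
  unfolding sublinear_def by (metis mult_zero_left of_real_0 order_refl scaleC_zero_left)

lemma sublinear_lower:
  assumes "sublinear p" shows "- p (- u) \<le> p u"
proof -
  have "p (u + - u) \<le> p u + p (- u)" using assms unfolding sublinear_def by blast
  then show ?thesis using sublinear_zero[OF assms] by simp
qed

text \<open>A minimal sublinear functional is linear, so the Hahn-Banach theorem follows from Zorn's
  lemma applied to the sublinear functionals below the given one.\<close>

lemma minimal_sublinear_additive:
  fixes q :: "'u::complex_vector \<Rightarrow> real"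
  assumes q: "sublinear q"
    and min: "\<And>q'. sublinear q' \<Longrightarrow> (\<And>u. q' u \<le> q u) \<Longrightarrow> q' = q"
  shows "q (u + v) = q u + q v"
proof -
  let ?g = "\<lambda>u t. q (u + complex_of_real t *\<^sub>C v) - t * q v"
  \<comment> \<open>The best decrease of \<open>q\<close> along the ray spanned by v. It is again
    sublinear and lies below \<open>q\<close> (take t = 0), and t = 1 shows q' u \<le> q (u + v) - q
    v. Minimality forces q' = q, which gives superadditivity.\<close>
  define q' where "q' = (\<lambda>u. INF t\<in>{0..}. ?g u t)"
  have qadd: "q (a + b) \<le> q a + q b" for a b using q unfolding sublinear_def by blast
  have qsc: "q (complex_of_real r *\<^sub>C a) = r * q a" if "0 \<le> r" for r a
    using q that unfolding sublinear_def by blast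
  have lower: "- q (- u) \<le> ?g u t" if "0 \<le> t" for u t
  proof -
    have "t * q v = q ((u + complex_of_real t *\<^sub>C v) + - u)" using qsc[OF that, of v] by simp
    also have "\<dots> \<le> q (u + complex_of_real t *\<^sub>C v) + q (- u)" by (rule qadd)
    finally show ?thesis by simp
  qed
  have bdd: "bdd_below (?g u ` {0..})" for u
    by (rule bdd_belowI2[where m = "- q (- u)"]) (use lower in auto)
  have le: "q' u \<le> ?g u t" if "0 \<le> t" for u t
    unfolding q'_def by (rule cINF_lower[OF bdd]) (use that in auto)
  have ge: "m \<le> q' u" if "\<And>t. 0 \<le> t \<Longrightarrow> m \<le> ?g u t" for m u
    unfolding q'_def by (rule cINF_greatest) (use that in auto)
  have le_q: "q' u \<le> q u" for u using le[of 0 u] by (simp add: scaleC_zero_left)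
  have "sublinear q'"
  proof (rule sublinearI)
    fix a b
    have "q' (a + b) \<le> ?g a s + ?g b t" if "0 \<le> s" "0 \<le> t" for s t
    proof -
      have "q' (a + b) \<le> ?g (a + b) (s + t)" by (rule le) (use that in simp)
      also have "\<dots> \<le> ?g a s + ?g b t"
        using qadd[of "a + complex_of_real s *\<^sub>C v" "b + complex_of_real t *\<^sub>C v"]
        by (simp add: scaleC_add_left algebra_simps)
      finally show ?thesis .
    qed
    then have "q' (a + b) - ?g a s \<le> q' b" if "0 \<le> s" for s
      by (intro ge) (smt (verit) that)
    then have "q' (a + b) - q' b \<le> q' a"
      by (intro ge) (auto simp: algebra_simps)
    then show "q' (a + b) \<le> q' a + q' b" by simp
  next
    fix r :: real and a assume r: "0 < r"
    have "q' (complex_of_real r *\<^sub>C a) / r \<le> q' a"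
    proof (rule ge)
      fix t :: real assume "0 \<le> t"
      then have "q' (complex_of_real r *\<^sub>C a) \<le> ?g (complex_of_real r *\<^sub>C a) (r * t)"
        using r by (intro le) simp
      also have "complex_of_real r *\<^sub>C a + complex_of_real (r * t) *\<^sub>C v =
          complex_of_real r *\<^sub>C (a + complex_of_real t *\<^sub>C v)"
        by (simp add: scaleC_add_right scaleC_scaleC)
      finally show "q' (complex_of_real r *\<^sub>C a) / r \<le> ?g a t"
        using r qsc[of r "a + complex_of_real t *\<^sub>C v"] by (simp add: field_simps)
    qed
    then show "q' (complex_of_real r *\<^sub>C a) \<le> r * q' a" using r by (simp add: field_simps)
  next
    show "q' 0 = 0"
      using le_q[of 0] ge[of 0 0] lower[of _ 0] sublinear_zero[OF q] by (intro antisym) auto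
  qed
  from min[OF this le_q] have "q' = q" .
  then have "q u \<le> q (u + v) - q v" using le[of 1 u] by (simp add: scaleC_one)
  then show ?thesis using qadd[of u v] by simp
qed

theorem hahn_banach_sublinear:
  fixes p :: "'u::complex_vector \<Rightarrow> real"
  assumes p: "sublinear p"
  obtains f where "\<And>u v. f (u + v) = f u + f v" "\<And>r u. f (complex_of_real r *\<^sub>C u) = r * f u"
    "\<And>u. f u \<le> p u"
proof -
  define A where "A = {q. sublinear q \<and> (\<forall>u. q u \<le> p u)}"
  \<comment> \<open>The pointwise order reversed, so that the maximal element given by Zorn's lemma
    is a minimal functional.\<close>
  define P where "P = (\<lambda>q q' :: 'u \<Rightarrow> real. \<forall>u. q' u \<le> q u)"
  have po: "partial_order_on A (relation_of P A)"
    unfolding partial_order_on_def preorder_on_def refl_on_def trans_def antisym_def relation_of_def P_def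
    by (auto intro: order_trans intro!: ext antisym)
  have "\<exists>m\<in>A. \<forall>q\<in>A. P m q \<longrightarrow> q = m"
  proof (rule predicate_Zorn[OF po])
    fix C assume C: "C \<in> Chains (relation_of P A)"
    then have CA: "C \<subseteq> A" unfolding Chains_def relation_of_def by auto
    have chain: "P q q' \<or> P q' q" if "q \<in> C" "q' \<in> C" for q q'
      using C that unfolding Chains_def relation_of_def by auto
    show "\<exists>q\<in>A. \<forall>q'\<in>C. P q' q"
    proof (cases "C = {}")
      case True
      have "p \<in> A" using p by (simp add: A_def)
      then show ?thesis using True by auto
    next
      case False
      \<comment> \<open>This infimum is finite, since a sublinear q below p satisfies q u \<ge> - p
        (- u). It is subadditive because any two members of the chain have a common lower
        one.\<close>
      define m where "m = (\<lambda>u. INF q\<in>C. q u)"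
      have sub: "sublinear q" "q u \<le> p u" if "q \<in> C" for q u using that CA by (auto simp: A_def)
      have bdd: "bdd_below ((\<lambda>q. q u) ` C)" for u
      proof (rule bdd_belowI2)
        fix q assume q: "q \<in> C"
        show "- p (- u) \<le> q u" using sublinear_lower[OF sub(1)[OF q], of u] sub(2)[OF q, of "- u"] by simp
      qed
      have le: "m u \<le> q u" if "q \<in> C" for q u unfolding m_def by (rule cINF_lower[OF bdd that])
      have ge: "r \<le> m u" if "\<And>q. q \<in> C \<Longrightarrow> r \<le> q u" for r u
        unfolding m_def by (rule cINF_greatest[OF False that])
      have "sublinear m"
      proof (rule sublinearI)
        fix a b
        have *: "m (a + b) \<le> q a + q' b" if q: "q \<in> C" "q' \<in> C" for q q'
        proof -
          obtain r where r: "r \<in> C" "\<And>u. r u \<le> q u" "\<And>u. r u \<le> q' u"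
            using chain[OF q] q unfolding P_def by (metis order_refl)
          have "m (a + b) \<le> r (a + b)" by (rule le[OF r(1)])
          also have "\<dots> \<le> r a + r b" using sub(1)[OF r(1)] unfolding sublinear_def by blast
          also have "\<dots> \<le> q a + q' b" by (intro add_mono r)
          finally show ?thesis .
        qed
        then have "m (a + b) - q a \<le> m b" if "q \<in> C" for q
          by (intro ge) (smt (verit) that)
        then have "m (a + b) - m b \<le> m a" by (intro ge) (auto simp: algebra_simps)
        then show "m (a + b) \<le> m a + m b" by simp
      next
        fix r :: real and a assume r: "0 < r"
        have "m (complex_of_real r *\<^sub>C a) / r \<le> m a"
        proof (rule ge)
          fix q assume q: "q \<in> C"
          have "m (complex_of_real r *\<^sub>C a) \<le> q (complex_of_real r *\<^sub>C a)" by (rule le[OF q])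
          also have "\<dots> = r * q a" using sub(1)[OF q] r unfolding sublinear_def by simp
          finally show "m (complex_of_real r *\<^sub>C a) / r \<le> q a" using r by (simp add: field_simps)
        qed
        then show "m (complex_of_real r *\<^sub>C a) \<le> r * m a" using r by (simp add: field_simps)
      next
        obtain q where q: "q \<in> C" using False by blast
        have "m 0 \<le> 0" using le[OF q, of 0] sublinear_zero[OF sub(1)[OF q]] by simp
        moreover have "0 \<le> m 0" by (rule ge) (simp add: sublinear_zero[OF sub(1)])
        ultimately show "m 0 = 0" by simp
      qed
      moreover have "m u \<le> p u" for u
        using False le sub(2) by (meson ex_in_conv order_trans)
      ultimately have "m \<in> A" by (simp add: A_def)
      then show ?thesis using le by (auto simp: P_def)
    qed
  qed
  then obtain m where m: "m \<in> A" "\<And>q. q \<in> A \<Longrightarrow> P m q \<Longrightarrow> q = m" by blast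
  have sm: "sublinear m" and mp: "m u \<le> p u" for u using m(1) by (auto simp: A_def)
  have add: "m (u + v) = m u + m v" for u v
  proof (rule minimal_sublinear_additive[OF sm])
    fix q' :: "'u \<Rightarrow> real" assume q': "sublinear q'" and le: "\<And>u. q' u \<le> m u"
    show "q' = m"
    proof (rule m(2))
      show "q' \<in> A" using q' le mp by (auto simp: A_def intro: order_trans)
      show "P m q'" using le by (simp add: P_def)
    qed
  qed
  have neg: "m (- u) = - m u" for u using add[of u "- u"] sublinear_zero[OF sm] by simp
  have "m (complex_of_real r *\<^sub>C u) = r * m u" for r u
  proof (cases "0 \<le> r")
    case True
    then show ?thesis using sm unfolding sublinear_def by blast
  next
    case False
    then have "0 \<le> - r" by simp
    then have "m (complex_of_real (- r) *\<^sub>C u) = (- r) * m u" using sm unfolding sublinear_def by blast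
    then show ?thesis by (simp add: scaleC_minus_left neg)
  qed
  with add mp show thesis by (intro that)
qed

section \<open>Forms of operator-valued matrices\<close>

lemma scaleC_fun_apply: "(c *\<^sub>C f) x = c *\<^sub>C f x"
  by (simp add: scaleC_fun_def)

lemma scaleC_complex: "c *\<^sub>C (z::complex) = c * z"
  by (simp add: scaleC_complex_def)

lemma cinner_zero_left: "cinner 0 (y::'h::chilbert_space) = 0"
  using cinner_add_left[of 0 0 y] by simp

lemma cinner_zero_right: "cinner y (0::'h::chilbert_space) = 0"
  using cinner_add_right[of y 0 0] by simp

lemma cinner_sum_left: "cinner (\<Sum>i\<in>I. f i) y = (\<Sum>i\<in>I. cinner (f i) (y::'h::chilbert_space))"
  by (induction I rule: infinite_finite_induct) (auto simp: cinner_zero_left cinner_add_left)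

lemma cinner_sum_right: "cinner y (\<Sum>i\<in>I. f i) = (\<Sum>i\<in>I. cinner y (f i :: 'h::chilbert_space))"
  by (induction I rule: infinite_finite_induct) (auto simp: cinner_zero_right cinner_add_right)

text \<open>Multiplying x by a unit scalar makes the inner product real and nonnegative, and then
  the real Cauchy-Schwarz inequality applies.\<close>

lemma cmod_cinner_le: "cmod (cinner x y) \<le> norm x * norm (y::'h::chilbert_space)"
proof (cases "cinner x y = 0")
  case False
  define c where "c = cnj (cinner x y) / complex_of_real (cmod (cinner x y))"
  have c: "cmod c = 1" using False by (simp add: c_def norm_divide)
  have "cinner (c *\<^sub>C x) y = complex_of_real (cmod (cinner x y))"
    using False by (simp add: cinner_scaleC_left c_def complex_norm_square[symmetric] power2_eq_square mult.commute)
  then have "cmod (cinner x y) = inner (c *\<^sub>C x) y" by (metis Re_cinner Re_complex_of_real)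
  also have "\<dots> \<le> norm (c *\<^sub>C x) * norm y" by (rule norm_cauchy_schwarz)
  finally show ?thesis by (simp add: norm_scaleC c)
qed simp

lemma sum_scaleC_apply: "(\<Sum>j\<in>J. c j *\<^sub>C \<xi> j) a = (\<Sum>j\<in>J. c j *\<^sub>C (\<xi> j a :: 'h::complex_vector))"
  by (induction J rule: infinite_finite_induct) (auto simp: scaleC_fun_apply)

text \<open>The matrix \<open>\<alpha> R \<beta>\<^sup>*\<close> and the vector \<open>\<alpha>\<^sup>* x\<close>, with matrices and vectors over a vector
  space encoded as functions of their indices.\<close>

definition sandwich :: "complex mat \<Rightarrow> complex mat \<Rightarrow> (nat \<Rightarrow> nat \<Rightarrow> 'a::complex_vector) \<Rightarrow> nat \<Rightarrow> nat \<Rightarrow> 'a" where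
  "sandwich \<alpha> \<beta> R a b = (\<Sum>k<dim_col \<alpha>. \<Sum>l<dim_col \<beta>. (\<alpha> $$ (a, k) * cnj (\<beta> $$ (b, l))) *\<^sub>C R k l)"

definition adj_vec :: "complex mat \<Rightarrow> (nat \<Rightarrow> 'h::complex_vector) \<Rightarrow> nat \<Rightarrow> 'h" where
  "adj_vec \<alpha> x k = (\<Sum>a<dim_row \<alpha>. cnj (\<alpha> $$ (a, k)) *\<^sub>C x a)"

definition unit_fun :: "nat \<Rightarrow> nat \<Rightarrow> complex" where
  "unit_fun a b = (if a = b then 1 else 0)"

lemma adj_vec_add: "adj_vec \<alpha> (x + y) = adj_vec \<alpha> x + adj_vec \<alpha> y"
  by (rule ext) (simp add: adj_vec_def scaleC_add_right sum.distrib)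

lemma adj_vec_cong: "(\<And>a. a < dim_row \<alpha> \<Longrightarrow> x a = y a) \<Longrightarrow> adj_vec \<alpha> x = adj_vec \<alpha> y"
  by (rule ext) (auto simp: adj_vec_def intro!: sum.cong)

lemma adj_vec_mult:
  assumes "\<alpha> \<in> carrier_mat n m" "\<beta> \<in> carrier_mat m l" "k < l"
  shows "adj_vec (\<alpha> * \<beta>) x k = adj_vec \<beta> (adj_vec \<alpha> x) k"
proof -
  have "adj_vec (\<alpha> * \<beta>) x k = (\<Sum>a<n. \<Sum>b<m. (cnj (\<beta> $$ (b, k)) * cnj (\<alpha> $$ (a, b))) *\<^sub>C x a)"
    using assms by (auto simp: adj_vec_def scalar_prod_def scaleC_sum_left[symmetric] atLeast0LessThan
        mult.commute intro!: sum.cong)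
  also have "\<dots> = (\<Sum>b<m. \<Sum>a<n. (cnj (\<beta> $$ (b, k)) * cnj (\<alpha> $$ (a, b))) *\<^sub>C x a)"
    by (rule sum.swap)
  also have "\<dots> = adj_vec \<beta> (adj_vec \<alpha> x) k"
    using assms by (simp add: adj_vec_def scaleC_sum_right scaleC_scaleC)
  finally show ?thesis .
qed

lemma adj_vec_one: "k < n \<Longrightarrow> adj_vec (1\<^sub>m n) x k = x k"
proof -
  assume k: "k < n"
  then have "adj_vec (1\<^sub>m n) x k = (\<Sum>a<n. if a = k then x a else 0)"
    unfolding adj_vec_def by (intro sum.cong) (auto simp: scaleC_zero_left scaleC_one)
  then show ?thesis using k by simp
qed

lemma sandwich_add: "sandwich \<alpha> \<beta> (R + T) = sandwich \<alpha> \<beta> R + sandwich \<alpha> \<beta> T"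
  by (intro ext) (simp add: sandwich_def scaleC_add_right sum.distrib)

lemma sandwich_scaleC: "sandwich \<alpha> \<beta> (c *\<^sub>C R) = c *\<^sub>C sandwich \<alpha> \<beta> R"
  by (intro ext) (simp add: sandwich_def scaleC_fun_apply scaleC_sum_right scaleC_scaleC mult.commute)

lemma sum_swap_pairs:
  "(\<Sum>a\<in>A. \<Sum>b\<in>B. \<Sum>k\<in>C. \<Sum>l\<in>D. f a b k l) = (\<Sum>k\<in>C. \<Sum>l\<in>D. \<Sum>a\<in>A. \<Sum>b\<in>B. f a b k l)"
proof -
  have "(\<Sum>a\<in>A. \<Sum>b\<in>B. \<Sum>k\<in>C. \<Sum>l\<in>D. f a b k l) =
    (\<Sum>p\<in>A \<times> B. \<Sum>r\<in>C \<times> D. f (fst p) (snd p) (fst r) (snd r))"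
    by (simp add: sum.cartesian_product')
  also have "\<dots> = (\<Sum>r\<in>C \<times> D. \<Sum>p\<in>A \<times> B. f (fst p) (snd p) (fst r) (snd r))"
    by (rule sum.swap)
  finally show ?thesis
    by (simp add: sum.cartesian_product')
qed

lemma sandwich_sandwich:
  assumes "\<alpha> \<in> carrier_mat n m" "\<beta> \<in> carrier_mat m l" "\<alpha>' \<in> carrier_mat n' m'" "\<beta>' \<in> carrier_mat m' l'"
    "a < n" "b < n'"
  shows "sandwich (\<alpha> * \<beta>) (\<alpha>' * \<beta>') R a b = sandwich \<alpha> \<alpha>' (sandwich \<beta> \<beta>' R) a b"
proof -
  have "sandwich (\<alpha> * \<beta>) (\<alpha>' * \<beta>') R a b =
    (\<Sum>k<l. \<Sum>k'<l'. \<Sum>i<m. \<Sum>j<m'. (\<alpha> $$ (a,i) * cnj (\<alpha>' $$ (b,j)) * (\<beta> $$ (i,k) * cnj (\<beta>' $$ (j,k')))) *\<^sub>C R k k')"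
    using assms by (auto simp: sandwich_def scalar_prod_def scaleC_sum_left[symmetric] atLeast0LessThan
        sum_product algebra_simps intro!: sum.cong)
  also have "\<dots> = (\<Sum>k<l. \<Sum>i<m. \<Sum>k'<l'. \<Sum>j<m'. (\<alpha> $$ (a,i) * cnj (\<alpha>' $$ (b,j)) * (\<beta> $$ (i,k) * cnj (\<beta>' $$ (j,k')))) *\<^sub>C R k k')"
    by (intro sum.cong refl sum.swap)
  also have "\<dots> = (\<Sum>i<m. \<Sum>k<l. \<Sum>j<m'. \<Sum>k'<l'. (\<alpha> $$ (a,i) * cnj (\<alpha>' $$ (b,j)) * (\<beta> $$ (i,k) * cnj (\<beta>' $$ (j,k')))) *\<^sub>C R k k')"
    by (subst sum.swap) (intro sum.cong refl sum.swap)
  also have "\<dots> = (\<Sum>i<m. \<Sum>j<m'. \<Sum>k<l. \<Sum>k'<l'. (\<alpha> $$ (a,i) * cnj (\<alpha>' $$ (b,j)) * (\<beta> $$ (i,k) * cnj (\<beta>' $$ (j,k')))) *\<^sub>C R k k')"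
    by (intro sum.cong refl sum.swap)
  also have "\<dots> = sandwich \<alpha> \<alpha>' (sandwich \<beta> \<beta>' R) a b"
    using assms by (simp add: sandwich_def scaleC_sum_right scaleC_scaleC)
  finally show ?thesis .
qed

lemma sandwich_cong:
  assumes "\<And>k l. k < dim_col \<alpha> \<Longrightarrow> l < dim_col \<beta> \<Longrightarrow> R k l = T k l"
  shows "sandwich \<alpha> \<beta> R = sandwich \<alpha> \<beta> T"
  by (intro ext) (simp add: sandwich_def assms)

lemma sandwich_one:
  assumes "i < k" "j < l"
  shows "sandwich (1\<^sub>m k) (1\<^sub>m l) R i j = R i j"
proof -
  have "sandwich (1\<^sub>m k) (1\<^sub>m l) R i j = (\<Sum>a<k. \<Sum>b<l. if a = i \<and> b = j then R i j else 0)"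
    unfolding sandwich_def using assms by (intro sum.cong) (auto simp: scaleC_one scaleC_zero_left)
  also have "\<dots> = (\<Sum>a<k. if a = i then \<Sum>b<l. if b = j then R i j else 0 else 0)"
    by (intro sum.cong) auto
  also have "\<dots> = R i j" using assms by simp
  finally show ?thesis .
qed

text \<open>The form of the operator matrix R, with R applied to y and paired with x; so the first
  vector is the conjugate-linear argument. Rows belong to the block of x and columns to that of
  y.\<close>

definition bform :: "('a \<Rightarrow> 'h \<Rightarrow> 'h::chilbert_space) \<Rightarrow> nat \<Rightarrow> nat \<Rightarrow> (nat \<Rightarrow> nat \<Rightarrow> 'a) \<Rightarrow>
    (nat \<Rightarrow> 'h) \<Rightarrow> (nat \<Rightarrow> 'h) \<Rightarrow> complex" where
  "bform act n m R x y = (\<Sum>a<n. \<Sum>b<m. cinner (act (R a b) (y b)) (x a))"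

text \<open>Three actions are used: bounded operators on a Hilbert space, complex numbers on
  \<complex> by multiplication, and the direct sum of the two. What the calculus of forms needs of
  them is collected here.\<close>

locale op_action =
  fixes act :: "'a::complex_vector \<Rightarrow> 'h \<Rightarrow> 'h::chilbert_space"
  assumes act_add_left: "act (a + b) x = act a x + act b x"
    and act_scaleC_left: "act (c *\<^sub>C a) x = c *\<^sub>C act a x"
    and act_add_right: "act a (x + y) = act a x + act a y"
    and act_scaleC_right: "act a (c *\<^sub>C x) = c *\<^sub>C act a x"
    and act_bounded: "\<exists>K. \<forall>x. norm (act a x) \<le> K * norm x"
begin

lemma act_zero_left: "act 0 x = 0"
  using act_scaleC_left[of 0 0 x] by (simp add: scaleC_zero_left)

lemma act_zero_right: "act a 0 = 0"
  using act_scaleC_right[of a 0 0] by (simp add: scaleC_zero_left)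

lemma act_sum_left: "act (\<Sum>i\<in>I. f i) x = (\<Sum>i\<in>I. act (f i) x)"
  by (induction I rule: infinite_finite_induct) (auto simp: act_zero_left act_add_left)

lemma act_sum_right: "act a (\<Sum>i\<in>I. f i) = (\<Sum>i\<in>I. act a (f i))"
  by (induction I rule: infinite_finite_induct) (auto simp: act_zero_right act_add_right)

lemma bform_add: "bform act n m (R + T) x y = bform act n m R x y + bform act n m T x y"
  by (simp add: bform_def act_add_left cinner_add_left sum.distrib)

lemma bform_scaleC: "bform act n m (c *\<^sub>C R) x y = c * bform act n m R x y"
  by (simp add: bform_def act_scaleC_left cinner_scaleC_left scaleC_fun_apply sum_distrib_left)

lemma bform_zero: "bform act n m 0 x y = 0"
  by (simp add: bform_def act_zero_left cinner_zero_left)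

lemma bform_sum: "bform act n m (\<Sum>i\<in>I. R i) x y = (\<Sum>i\<in>I. bform act n m (R i) x y)"
  by (induction I rule: infinite_finite_induct) (auto simp: bform_zero bform_add simp del: plus_fun_apply zero_fun_apply)

lemma bform_add_left: "bform act n m R (x + x') y = bform act n m R x y + bform act n m R x' y"
  by (simp add: bform_def cinner_add_right sum.distrib)

lemma bform_scaleC_left: "bform act n m R (c *\<^sub>C x) y = cnj c * bform act n m R x y"
  by (simp add: bform_def cinner_scaleC_right scaleC_fun_apply sum_distrib_left)

lemma bform_add_right: "bform act n m R x (y + y') = bform act n m R x y + bform act n m R x y'"
  by (simp add: bform_def cinner_add_left act_add_right sum.distrib)

lemma bform_scaleC_right: "bform act n m R x (c *\<^sub>C y) = c * bform act n m R x y"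
  by (simp add: bform_def act_scaleC_right cinner_scaleC_left scaleC_fun_apply sum_distrib_left)

lemma bform_zero_left: "bform act n m R 0 y = 0"
  by (simp add: bform_def cinner_zero_right)

lemma bform_zero_right: "bform act n m R x 0 = 0"
  by (simp add: bform_def act_zero_right cinner_zero_left)

lemma bform_lincomb_left:
  "bform act n m R (\<Sum>j\<in>J. c j *\<^sub>C \<xi> j) y = (\<Sum>j\<in>J. cnj (c j) * bform act n m R (\<xi> j) y)"
  by (induction J rule: infinite_finite_induct)
    (auto simp: bform_add_left bform_scaleC_left bform_zero_left simp del: plus_fun_apply zero_fun_apply)

lemma bform_lincomb_right:
  "bform act n m R x (\<Sum>j\<in>J. c j *\<^sub>C \<xi> j) = (\<Sum>j\<in>J. c j * bform act n m R x (\<xi> j))"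
  by (induction J rule: infinite_finite_induct)
    (auto simp: bform_add_right bform_scaleC_right bform_zero_right simp del: plus_fun_apply zero_fun_apply)

text \<open>Scalars commute with the action of the algebra, so the outer factors pass to the vectors
  as adjoints. This turns intertwining identities for matrices into identities for forms.\<close>

lemma bform_sandwich:
  "bform act (dim_row \<alpha>) (dim_row \<beta>) (sandwich \<alpha> \<beta> R) x y =
   bform act (dim_col \<alpha>) (dim_col \<beta>) R (adj_vec \<alpha> x) (adj_vec \<beta> y)"
proof -
  let ?f = "\<lambda>a b k l. \<alpha> $$ (a, k) * cnj (\<beta> $$ (b, l)) * cinner (act (R k l) (y b)) (x a)"
  have "bform act (dim_row \<alpha>) (dim_row \<beta>) (sandwich \<alpha> \<beta> R) x y =
    (\<Sum>a<dim_row \<alpha>. \<Sum>b<dim_row \<beta>. \<Sum>k<dim_col \<alpha>. \<Sum>l<dim_col \<beta>. ?f a b k l)"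
    by (simp add: bform_def sandwich_def act_sum_left cinner_sum_left act_scaleC_left cinner_scaleC_left)
  also have "\<dots> = (\<Sum>k<dim_col \<alpha>. \<Sum>l<dim_col \<beta>. \<Sum>a<dim_row \<alpha>. \<Sum>b<dim_row \<beta>. ?f a b k l)"
    by (rule sum_swap_pairs)
  also have "\<dots> = bform act (dim_col \<alpha>) (dim_col \<beta>) R (adj_vec \<alpha> x) (adj_vec \<beta> y)"
    by (simp add: bform_def adj_vec_def act_sum_right cinner_sum_left cinner_sum_right act_scaleC_right
        cinner_scaleC_left cinner_scaleC_right sum_distrib_left mult.assoc)
  finally show ?thesis .
qed

text \<open>The bound is a sum of squares rather than a product of norms, so that strictly positive
  diagonal forms can absorb it.\<close>

lemma bform_bounded:
  "\<exists>K\<ge>0. \<forall>x y. cmod (bform act n m R x y) \<le> K * ((\<Sum>a<n. (norm (x a))\<^sup>2) + (\<Sum>b<m. (norm (y b))\<^sup>2))"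
proof -
  obtain k where k: "\<And>a x. norm (act a x) \<le> k a * norm x" using act_bounded by metis
  define K where "K = (\<Sum>a<n. \<Sum>b<m. \<bar>k (R a b)\<bar>)"
  have "cmod (bform act n m R x y) \<le> K * ((\<Sum>a<n. (norm (x a))\<^sup>2) + (\<Sum>b<m. (norm (y b))\<^sup>2))" for x y
  proof -
    let ?N = "(\<Sum>a<n. (norm (x a))\<^sup>2) + (\<Sum>b<m. (norm (y b))\<^sup>2)"
    have "cmod (cinner (act (R a b) (y b)) (x a)) \<le> \<bar>k (R a b)\<bar> * ?N" if "a < n" "b < m" for a b
    proof -
      have "cmod (cinner (act (R a b) (y b)) (x a)) \<le> norm (act (R a b) (y b)) * norm (x a)"
        by (rule cmod_cinner_le)
      also have "\<dots> \<le> (\<bar>k (R a b)\<bar> * norm (y b)) * norm (x a)"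
        by (intro mult_right_mono order_trans[OF k]) auto
      also have "\<dots> = \<bar>k (R a b)\<bar> * (norm (y b) * norm (x a))" by simp
      also have "\<dots> \<le> \<bar>k (R a b)\<bar> * ?N"
      proof (intro mult_left_mono)
        have "norm (y b) * norm (x a) \<le> (norm (x a))\<^sup>2 + (norm (y b))\<^sup>2"
          using sum_squares_bound[of "norm (y b)" "norm (x a)"] mult_nonneg_nonneg[OF norm_ge_zero[of "y b"] norm_ge_zero[of "x a"]]
          by linarith
        also have "\<dots> \<le> ?N"
          using that by (intro add_mono member_le_sum[of a "{..<n}" "\<lambda>a. (norm (x a))\<^sup>2"] member_le_sum[of b "{..<m}" "\<lambda>a. (norm (y a))\<^sup>2"]) auto
        finally show "norm (y b) * norm (x a) \<le> ?N" .
      qed simp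
      finally show ?thesis .
    qed
    then have "cmod (bform act n m R x y) \<le> (\<Sum>a<n. \<Sum>b<m. \<bar>k (R a b)\<bar> * ?N)"
      unfolding bform_def by (intro order_trans[OF norm_sum] sum_mono) auto
    then show ?thesis by (simp add: K_def sum_distrib_right)
  qed
  moreover have "K \<ge> 0" unfolding K_def by (intro sum_nonneg) auto
  ultimately show ?thesis by blast
qed

end

section \<open>Positive extensions of dominated kernels\<close>

text \<open>The value at Z W R x y stands for the inner product of \<Gamma>(Z,W)(R) y with x. No
  linearity in R, x or y is built into the type.\<close>

type_synonym ('p, 'a, 'e) form_kernel =
  "'p \<Rightarrow> 'p \<Rightarrow> (nat \<Rightarrow> nat \<Rightarrow> 'a) \<Rightarrow> (nat \<Rightarrow> 'e) \<Rightarrow> (nat \<Rightarrow> 'e) \<Rightarrow> complex"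

text \<open>Points are abstract and carry only a size. \<open>q\<close> maps scalar matrices to
  matrices over the acting algebra, \<open>s\<close> gives the forms of the kernel that is to be
  factored through \<open>q\<close>, and \<open>dominated\<close> says that \<open>s\<close> is
  nonnegative in real part wherever \<open>q\<close> is. Real parts are used since the arguments
  need not be Hermitian.\<close>

locale dominated_kernel = op_action act
  for act :: "'a::complex_vector \<Rightarrow> 'h \<Rightarrow> 'h::chilbert_space" +
  fixes pts :: "'p set" and d :: "'p \<Rightarrow> nat"
    and q :: "'p \<Rightarrow> 'p \<Rightarrow> (nat \<Rightarrow> nat \<Rightarrow> complex) \<Rightarrow> nat \<Rightarrow> nat \<Rightarrow> 'a"
    and s :: "('p, complex, 'e::complex_vector) form_kernel"
  assumes q_add: "\<lbrakk>Z \<in> pts; W \<in> pts\<rbrakk> \<Longrightarrow> q Z W (P + P') = q Z W P + q Z W P'"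
    and q_scaleC: "\<lbrakk>Z \<in> pts; W \<in> pts\<rbrakk> \<Longrightarrow> q Z W (c *\<^sub>C P) = c *\<^sub>C q Z W P"
    and s_add: "\<lbrakk>Z \<in> pts; W \<in> pts\<rbrakk> \<Longrightarrow> s Z W (P + P') x y = s Z W P x y + s Z W P' x y"
    and s_scaleC: "\<lbrakk>Z \<in> pts; W \<in> pts\<rbrakk> \<Longrightarrow> s Z W (c *\<^sub>C P) x y = c * s Z W P x y"
    and s_add_left: "\<lbrakk>Z \<in> pts; W \<in> pts\<rbrakk> \<Longrightarrow> s Z W P (x + x') y = s Z W P x y + s Z W P x' y"
    and s_scaleC_left: "\<lbrakk>Z \<in> pts; W \<in> pts\<rbrakk> \<Longrightarrow> s Z W P (c *\<^sub>C x) y = cnj c * s Z W P x y"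
    and s_add_right: "\<lbrakk>Z \<in> pts; W \<in> pts\<rbrakk> \<Longrightarrow> s Z W P x (y + y') = s Z W P x y + s Z W P x y'"
    and s_scaleC_right: "\<lbrakk>Z \<in> pts; W \<in> pts\<rbrakk> \<Longrightarrow> s Z W P x (c *\<^sub>C y) = c * s Z W P x y"
    and s_cong: "\<lbrakk>Z \<in> pts; W \<in> pts; \<And>a. a < d Z \<Longrightarrow> x a = x' a; \<And>b. b < d W \<Longrightarrow> y b = y' b\<rbrakk>
      \<Longrightarrow> s Z W P x y = s Z W P x' y'"
    and q_unit: "Z \<in> pts \<Longrightarrow> \<exists>\<epsilon>>0. \<forall>\<xi>. \<epsilon> * (\<Sum>a<d Z. (norm (\<xi> a))\<^sup>2) \<le> Re (bform act (d Z) (d Z) (q Z Z unit_fun) \<xi> \<xi>)"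
    and dominated: "\<lbrakk>finite (I::nat set); \<And>i. i \<in> I \<Longrightarrow> p i \<in> pts;
      \<And>\<xi>\<xi>. 0 \<le> Re (\<Sum>i\<in>I. \<Sum>j\<in>I. bform act (d (p i)) (d (p j)) (q (p i) (p j) (PP i j)) (\<xi>\<xi> i) (\<xi>\<xi> j))\<rbrakk>
      \<Longrightarrow> 0 \<le> Re (\<Sum>i\<in>I. \<Sum>j\<in>I. s (p i) (p j) (PP i j) (xx i) (xx j))"
begin

text \<open>Skew-Hermitian parts are unrestricted. Genuine nonnegativity of a value is regained by
  applying this to the multiples by 1, i and -i.\<close>

definition accretive :: "'i set \<Rightarrow> ('i \<Rightarrow> 'p) \<Rightarrow> ('i \<Rightarrow> 'i \<Rightarrow> nat \<Rightarrow> nat \<Rightarrow> 'a) \<Rightarrow> bool" where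
  "accretive I p u \<longleftrightarrow>
     (\<forall>\<xi>. 0 \<le> Re (\<Sum>i\<in>I. \<Sum>j\<in>I. bform act (d (p i)) (d (p j)) (u i j) (\<xi> i) (\<xi> j)))"

text \<open>The set X restricts points together with vectors, so a finite X poses a Hahn-Banach
  problem with finitely many blocks. Sesquilinearity in the vectors is not demanded, as such an X is
  not closed under linear combinations. Points may repeat in the family p, which makes the first
  clause a complete positivity.\<close>

definition extends_on :: "('p \<times> (nat \<Rightarrow> 'e)) set \<Rightarrow> ('p, 'a, 'e) form_kernel \<Rightarrow> bool" where
  "extends_on X \<kappa> \<longleftrightarrow>
     (\<forall>I p x u. finite (I :: nat set) \<longrightarrow> (\<forall>i\<in>I. (p i, x i) \<in> X) \<longrightarrow> accretive I p u \<longrightarrow>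
        0 \<le> Re (\<Sum>i\<in>I. \<Sum>j\<in>I. \<kappa> (p i) (p j) (u i j) (x i) (x j))) \<and>
     (\<forall>Z x W y. (Z, x) \<in> X \<longrightarrow> (W, y) \<in> X \<longrightarrow>
        (\<forall>R T. \<kappa> Z W (R + T) x y = \<kappa> Z W R x y + \<kappa> Z W T x y) \<and>
        (\<forall>c R. \<kappa> Z W (c *\<^sub>C R) x y = c * \<kappa> Z W R x y) \<and>
        (\<forall>P. \<kappa> Z W (q Z W P) x y = s Z W P x y))"

lemma extends_onI:
  assumes "\<And>I p x u. finite (I :: nat set) \<Longrightarrow> (\<And>i. i \<in> I \<Longrightarrow> (p i, x i) \<in> X) \<Longrightarrow> accretive I p u \<Longrightarrow>
        0 \<le> Re (\<Sum>i\<in>I. \<Sum>j\<in>I. \<kappa> (p i) (p j) (u i j) (x i) (x j))"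
    and "\<And>Z x W y R T. (Z, x) \<in> X \<Longrightarrow> (W, y) \<in> X \<Longrightarrow> \<kappa> Z W (R + T) x y = \<kappa> Z W R x y + \<kappa> Z W T x y"
    and "\<And>Z x W y c R. (Z, x) \<in> X \<Longrightarrow> (W, y) \<in> X \<Longrightarrow> \<kappa> Z W (c *\<^sub>C R) x y = c * \<kappa> Z W R x y"
    and "\<And>Z x W y P. (Z, x) \<in> X \<Longrightarrow> (W, y) \<in> X \<Longrightarrow> \<kappa> Z W (q Z W P) x y = s Z W P x y"
  shows "extends_on X \<kappa>"
  unfolding extends_on_def by (intro conjI allI impI; rule assms) auto

lemma extends_pos_nat:
  assumes "extends_on X \<kappa>" "finite (I :: nat set)" "\<And>i. i \<in> I \<Longrightarrow> (p i, x i) \<in> X" "accretive I p u"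
  shows "0 \<le> Re (\<Sum>i\<in>I. \<Sum>j\<in>I. \<kappa> (p i) (p j) (u i j) (x i) (x j))"
  using assms(1)[unfolded extends_on_def, THEN conjunct1, rule_format, OF assms(2) _ assms(4), of x] assms(3)
  by simp

lemma
  assumes "extends_on X \<kappa>" "(Z, x) \<in> X" "(W, y) \<in> X"
  shows extends_add: "\<kappa> Z W (R + T) x y = \<kappa> Z W R x y + \<kappa> Z W T x y"
    and extends_scaleC: "\<kappa> Z W (c *\<^sub>C R) x y = c * \<kappa> Z W R x y"
    and extends_eq: "\<kappa> Z W (q Z W P) x y = s Z W P x y"
  using assms(1)[unfolded extends_on_def, THEN conjunct2, rule_format, OF assms(2,3)] by simp_all

lemma extends_on_mono:
  assumes "extends_on X \<kappa>" "Y \<subseteq> X"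
  shows "extends_on Y \<kappa>"
proof (rule extends_onI)
  fix I :: "nat set" and p x u
  assume "finite I" "\<And>i. i \<in> I \<Longrightarrow> (p i, x i) \<in> Y" "accretive I p u"
  then show "0 \<le> Re (\<Sum>i\<in>I. \<Sum>j\<in>I. \<kappa> (p i) (p j) (u i j) (x i) (x j))"
    using assms(2) by (intro extends_pos_nat[OF assms(1)]) auto
qed (use assms in \<open>auto intro: extends_add extends_scaleC extends_eq simp del: plus_fun_apply\<close>)

lemma extends_zero: "extends_on X \<kappa> \<Longrightarrow> (Z, x) \<in> X \<Longrightarrow> (W, y) \<in> X \<Longrightarrow> \<kappa> Z W 0 x y = 0"
  using extends_scaleC[of X \<kappa> Z x W y 0 0] by (simp add: scaleC_zero_left)

lemma extends_sum: "extends_on X \<kappa> \<Longrightarrow> (Z, x) \<in> X \<Longrightarrow> (W, y) \<in> X \<Longrightarrow>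
    \<kappa> Z W (\<Sum>i\<in>I. R i) x y = (\<Sum>i\<in>I. \<kappa> Z W (R i) x y)"
  by (induction I rule: infinite_finite_induct)
    (auto simp: extends_zero extends_add simp del: plus_fun_apply zero_fun_apply)

text \<open>The definition quantifies over finite sets of natural numbers only, since it cannot
  quantify over index types; an injection transports it to any finite index set.\<close>

lemma extends_pos:
  assumes ext: "extends_on X \<kappa>" and I: "finite (I :: 'i set)"
    and pX: "\<And>i. i \<in> I \<Longrightarrow> (p i, x i) \<in> X" and acc: "accretive I p u"
  shows "0 \<le> Re (\<Sum>i\<in>I. \<Sum>j\<in>I. \<kappa> (p i) (p j) (u i j) (x i) (x j))"
proof -
  obtain f :: "'i \<Rightarrow> nat" and n where f: "inj_on f I" using finite_imp_inj_to_nat_seg[OF I] by metis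
  define g where "g = the_inv_into I f"
  have g: "g (f i) = i" if "i \<in> I" for i using the_inv_into_f_f[OF f that] by (simp add: g_def)
  have re: "(\<Sum>a\<in>f ` I. \<Sum>b\<in>f ` I. F (g a) (g b) a b) = (\<Sum>i\<in>I. \<Sum>j\<in>I. F i j (f i) (f j))" for F :: "'i \<Rightarrow> 'i \<Rightarrow> nat \<Rightarrow> nat \<Rightarrow> complex"
    by (simp add: sum.reindex[OF f] g cong: sum.cong)
  have "accretive (f ` I) (p \<circ> g) (\<lambda>a b. u (g a) (g b))"
    unfolding accretive_def
  proof
    fix \<xi> :: "nat \<Rightarrow> nat \<Rightarrow> 'h"
    show "0 \<le> Re (\<Sum>a\<in>f ` I. \<Sum>b\<in>f ` I. bform act (d ((p \<circ> g) a)) (d ((p \<circ> g) b)) (u (g a) (g b)) (\<xi> a) (\<xi> b))"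
      using acc[unfolded accretive_def, rule_format, of "\<xi> \<circ> f"]
        re[of "\<lambda>i j a b. bform act (d (p i)) (d (p j)) (u i j) (\<xi> a) (\<xi> b)"] by simp
  qed
  moreover have "\<forall>a\<in>f ` I. ((p \<circ> g) a, (x \<circ> g) a) \<in> X" using pX by (auto simp: g)
  ultimately have "0 \<le> Re (\<Sum>a\<in>f ` I. \<Sum>b\<in>f ` I. \<kappa> ((p \<circ> g) a) ((p \<circ> g) b) (u (g a) (g b)) ((x \<circ> g) a) ((x \<circ> g) b))"
    using extends_pos_nat[OF ext, of "f ` I" "p \<circ> g" "x \<circ> g"] I by blast
  then show ?thesis using re[of "\<lambda>i j a b. \<kappa> (p i) (p j) (u i j) (x i) (x j)"] by simp
qed

text \<open>The block matrix with diagonal t q(Z,Z)(1), t q(W,W)(1) and off-diagonal entry z R is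
  accretive for large t and every unit z, by strict positivity of the diagonal. Positivity of the
  extension there bounds its value at R by values of \<open>s\<close>, uniformly over all
  extensions. This is the source of compactness.\<close>

lemma extends_bounded_form:
  assumes "Z \<in> pts" "W \<in> pts"
  shows "\<exists>t\<ge>0. \<forall>X \<kappa> x y. extends_on X \<kappa> \<longrightarrow> (Z, x) \<in> X \<longrightarrow> (W, y) \<in> X \<longrightarrow>
    cmod (\<kappa> Z W R x y) \<le> t * (Re (s Z Z unit_fun x x) + Re (s W W unit_fun y y))"
proof -
  obtain \<epsilon> where \<epsilon>: "\<epsilon> > 0" "\<And>\<xi>. \<epsilon> * (\<Sum>a<d Z. (norm (\<xi> a))\<^sup>2) \<le> Re (bform act (d Z) (d Z) (q Z Z unit_fun) \<xi> \<xi>)"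
    using q_unit[OF assms(1)] by metis
  obtain \<delta> where \<delta>: "\<delta> > 0" "\<And>\<xi>. \<delta> * (\<Sum>a<d W. (norm (\<xi> a))\<^sup>2) \<le> Re (bform act (d W) (d W) (q W W unit_fun) \<xi> \<xi>)"
    using q_unit[OF assms(2)] by metis
  obtain K where K: "K \<ge> 0" "\<And>\<xi> \<eta>. cmod (bform act (d Z) (d W) R \<xi> \<eta>) \<le> K * ((\<Sum>a<d Z. (norm (\<xi> a))\<^sup>2) + (\<Sum>b<d W. (norm (\<eta> b))\<^sup>2))"
    using bform_bounded by metis
  \<comment> \<open>Large enough that t times \<epsilon> and t times \<delta> are both at least
    K.\<close>
  define t where "t = K / \<epsilon> + K / \<delta>"
  have t: "t \<ge> 0" "K \<le> t * \<epsilon>" "K \<le> t * \<delta>" using K(1) \<epsilon>(1) \<delta>(1) by (auto simp: t_def field_simps)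
  have "cmod (\<kappa> Z W R x y) \<le> t * (Re (s Z Z unit_fun x x) + Re (s W W unit_fun y y))"
    if ext: "extends_on X \<kappa>" and X: "(Z, x) \<in> X" "(W, y) \<in> X" for X \<kappa> x y
  proof -
    define B where "B = t * (Re (s Z Z unit_fun x x) + Re (s W W unit_fun y y))"
    have main: "0 \<le> B + Re (z * \<kappa> Z W R x y)" if z: "cmod z = 1" for z
    proof -
      define u where "u = (\<lambda>i j. if i then (if j then complex_of_real t *\<^sub>C q Z Z unit_fun else z *\<^sub>C R)
          else (if j then 0 else complex_of_real t *\<^sub>C q W W unit_fun))"
      define p where "p = (\<lambda>i. if i then Z else W)"
      define v where "v = (\<lambda>i. if i then x else y)"
      have "accretive UNIV p u"
        unfolding accretive_def
      proof
        fix \<xi> :: "bool \<Rightarrow> nat \<Rightarrow> 'h"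
        let ?N = "(\<Sum>a<d Z. (norm (\<xi> True a))\<^sup>2)" and ?M = "(\<Sum>a<d W. (norm (\<xi> False a))\<^sup>2)"
        have "K * (?N + ?M) \<le> t * \<epsilon> * ?N + t * \<delta> * ?M"
          unfolding distrib_left by (intro add_mono mult_right_mono t sum_nonneg) auto
        also have "\<dots> \<le> t * Re (bform act (d Z) (d Z) (q Z Z unit_fun) (\<xi> True) (\<xi> True)) +
          t * Re (bform act (d W) (d W) (q W W unit_fun) (\<xi> False) (\<xi> False))"
          using mult_left_mono[OF \<epsilon>(2) t(1)] mult_left_mono[OF \<delta>(2) t(1)]
          by (intro add_mono) (auto simp: mult.assoc)
        finally have 1: "K * (?N + ?M) \<le> \<dots>" .
        have "cmod (z * bform act (d Z) (d W) R (\<xi> True) (\<xi> False)) \<le> K * (?N + ?M)"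
          using K(2) z by (simp add: norm_mult)
        then have "- (K * (?N + ?M)) \<le> Re (z * bform act (d Z) (d W) R (\<xi> True) (\<xi> False))"
          using abs_Re_le_cmod[of "z * bform act (d Z) (d W) R (\<xi> True) (\<xi> False)"] by linarith
        with 1 show "0 \<le> Re (\<Sum>i\<in>UNIV. \<Sum>j\<in>UNIV. bform act (d (p i)) (d (p j)) (u i j) (\<xi> i) (\<xi> j))"
          by (simp add: UNIV_bool u_def p_def bform_scaleC bform_zero)
      qed
      then have "0 \<le> Re (\<Sum>i\<in>UNIV. \<Sum>j\<in>UNIV. \<kappa> (p i) (p j) (u i j) (v i) (v j))"
        by (intro extends_pos[OF ext]) (auto simp: p_def v_def X)
      then show ?thesis
        by (simp add: UNIV_bool u_def p_def v_def extends_scaleC[OF ext] extends_zero[OF ext] extends_eq[OF ext] X B_def algebra_simps)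
    qed
    show ?thesis
    proof (cases "\<kappa> Z W R x y = 0")
      case True
      then show ?thesis using main[of 1] by (simp add: B_def)
    next
      case False
      define z where "z = - cnj (\<kappa> Z W R x y) / complex_of_real (cmod (\<kappa> Z W R x y))"
      have "cmod z = 1" using False by (simp add: z_def norm_divide)
      moreover have "z * \<kappa> Z W R x y = - complex_of_real (cmod (\<kappa> Z W R x y))"
        using False by (simp add: z_def complex_norm_square[symmetric] power2_eq_square mult.commute)
      ultimately show ?thesis using main[of z] by (simp add: B_def)
    qed
  qed
  then show ?thesis using t(1) by (intro exI[of _ t]) simp
qed

corollary extends_bounded:
  assumes "Z \<in> pts" "W \<in> pts"
  shows "\<exists>B. \<forall>X \<kappa>. extends_on X \<kappa> \<longrightarrow> (Z, x) \<in> X \<longrightarrow> (W, y) \<in> X \<longrightarrow> cmod (\<kappa> Z W R x y) \<le> B"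
proof -
  obtain t where t: "\<forall>X \<kappa> x y. extends_on X \<kappa> \<longrightarrow> (Z, x) \<in> X \<longrightarrow> (W, y) \<in> X \<longrightarrow>
    cmod (\<kappa> Z W R x y) \<le> t * (Re (s Z Z unit_fun x x) + Re (s W W unit_fun y y))"
    using extends_bounded_form[OF assms, of R] by (elim exE conjE) (rule that)
  show ?thesis
    by (rule exI[of _ "t * (Re (s Z Z unit_fun x x) + Re (s W W unit_fun y y))"]) (use t in simp)
qed

text \<open>The rotation with z w = -|w| gives |w| \<le> t C for every t > 0; the t chosen in the
  proof makes the right side at most |w|/2.\<close>

lemma complex_zero_from_rotations:
  fixes w :: complex
  assumes "\<And>z t. cmod z = 1 \<Longrightarrow> t > 0 \<Longrightarrow> 0 \<le> t * C + Re (z * w)"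
  shows "w = 0"
proof (rule ccontr)
  assume w: "w \<noteq> 0"
  define z where "z = - cnj w / complex_of_real (cmod w)"
  have z: "cmod z = 1" using w by (simp add: z_def norm_divide)
  have zw: "Re (z * w) = - cmod w"
    using w by (simp add: z_def complex_norm_square[symmetric] power2_eq_square mult.commute)
  define t where "t = cmod w / (2 * (\<bar>C\<bar> + 1))"
  have "t > 0" using w by (simp add: t_def)
  then have "cmod w \<le> t * C" using assms[OF z, of t] zw by simp
  also have "\<dots> \<le> t * (\<bar>C\<bar> + 1)" using \<open>t > 0\<close> by (intro mult_left_mono) auto
  also have "\<dots> = cmod w / 2" by (simp add: t_def field_simps)
  finally show False using w by simp
qed

text \<open>Sesquilinearity in the two vectors is forced by positivity: the weight \<open>\<tau>\<close> on the null
  combination costs nothing, so Cauchy-Schwarz leaves only a vanishing bound.\<close>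

lemma
  assumes ext: "extends_on X \<kappa>" and Z: "Z \<in> pts" and W: "W \<in> pts"
    and J: "finite (J :: 'i set)" and X: "\<And>j. j \<in> J \<Longrightarrow> (Z, x j) \<in> X" "(W, y) \<in> X"
    and null: "\<And>a. a < d Z \<Longrightarrow> (\<Sum>j\<in>J. c j *\<^sub>C x j a) = 0"
  shows extends_null_left: "(\<Sum>j\<in>J. cnj (c j) * \<kappa> Z W R (x j) y) = 0"
    and extends_null_right: "(\<Sum>j\<in>J. c j * \<kappa> W Z R y (x j)) = 0"
proof -
  obtain \<epsilon> where \<epsilon>: "\<epsilon> > 0" "\<And>\<xi>. \<epsilon> * (\<Sum>a<d Z. (norm (\<xi> a))\<^sup>2) \<le> Re (bform act (d Z) (d Z) (q Z Z unit_fun) \<xi> \<xi>)"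
    using q_unit[OF Z] by metis
  obtain \<delta> where \<delta>: "\<delta> > 0" "\<And>\<xi>. \<delta> * (\<Sum>a<d W. (norm (\<xi> a))\<^sup>2) \<le> Re (bform act (d W) (d W) (q W W unit_fun) \<xi> \<xi>)"
    using q_unit[OF W] by metis
  \<comment> \<open>\<open>s\<close> is sesquilinear by assumption, so the null combination
    contributes nothing to the value of the block matrix built below.\<close>
  have s0: "(\<Sum>i\<in>J. \<Sum>j\<in>J. cnj (c i) * c j * s Z Z unit_fun (x i) (x j)) = 0"
  proof -
    have s_zero: "s Z Z P 0 y = 0" "s Z Z P y 0 = 0" for P y
      using s_scaleC_left[OF Z Z, of P 0 0 y] s_scaleC_right[OF Z Z, of P y 0 0] by (auto simp: scaleC_zero_left)
    have l: "s Z Z P (\<Sum>j\<in>J. c j *\<^sub>C x j) y = (\<Sum>j\<in>J. cnj (c j) * s Z Z P (x j) y)" for P y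
      using J by (induction J) (auto simp: s_add_left s_scaleC_left s_zero Z simp del: plus_fun_apply zero_fun_apply)
    have r: "s Z Z P y (\<Sum>j\<in>J. c j *\<^sub>C x j) = (\<Sum>j\<in>J. c j * s Z Z P y (x j))" for P y
      using J by (induction J) (auto simp: s_add_right s_scaleC_right s_zero Z simp del: plus_fun_apply zero_fun_apply)
    have "s Z Z unit_fun (\<Sum>j\<in>J. c j *\<^sub>C x j) (\<Sum>j\<in>J. c j *\<^sub>C x j) = s Z Z unit_fun 0 0"
      by (rule s_cong) (simp_all add: Z sum_scaleC_apply null)
    then show ?thesis
      unfolding l r s_zero by (subst sum.swap) (simp add: sum_distrib_left ac_simps)
  qed
  \<comment> \<open>The two scalars have modulus at most 1 rather than equal to 1, so that either of
    the two sums can be switched off by taking its scalar to be 0.\<close>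
  have key: "0 \<le> t * Re (s W W unit_fun y y) + Re (z * (\<Sum>j\<in>J. cnj (c j) * \<kappa> Z W R (x j) y)) + Re (z' * (\<Sum>j\<in>J. c j * \<kappa> W Z R' y (x j)))"
    if z: "cmod z \<le> 1" "cmod z' \<le> 1" and t: "t > 0" for t z z' R R'
  proof -
    obtain K where K: "K \<ge> 0" "\<And>\<xi> \<eta>. cmod (bform act (d Z) (d W) R \<xi> \<eta>) \<le> K * ((\<Sum>a<d Z. (norm (\<xi> a))\<^sup>2) + (\<Sum>b<d W. (norm (\<eta> b))\<^sup>2))"
      using bform_bounded by metis
    obtain K' where K': "K' \<ge> 0" "\<And>\<xi> \<eta>. cmod (bform act (d W) (d Z) R' \<xi> \<eta>) \<le> K' * ((\<Sum>a<d W. (norm (\<xi> a))\<^sup>2) + (\<Sum>b<d Z. (norm (\<eta> b))\<^sup>2))"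
      using bform_bounded by metis
    \<comment> \<open>Chosen so that (K + K') / \<mu>^2 \<le> t \<delta>: the share of the cross
      terms that falls on W is covered by t times the identity there. The summand 1 keeps \<mu>
      positive when K + K' = 0.\<close>
    define \<mu> where "\<mu> = sqrt ((K + K' + 1) / (t * \<delta>))"
    have \<mu>: "\<mu> > 0" "\<mu>\<^sup>2 = (K + K' + 1) / (t * \<delta>)" using K K' t \<delta>(1) by (auto simp: \<mu>_def)
    \<comment> \<open>Covers the share on Z, which rescaling by \<mu> may make large; it multiplies
      a term that vanishes by \<open>s0\<close>.\<close>
    define \<tau> where "\<tau> = (K + K') * \<mu>\<^sup>2 / \<epsilon>"
    have \<tau>: "\<tau> \<ge> 0" using K K' \<epsilon> by (simp add: \<tau>_def)
    define u where "u = (\<lambda>i j. case i of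
        Some i' \<Rightarrow> (case j of Some j' \<Rightarrow> (complex_of_real \<tau> * (cnj (c i') * c j')) *\<^sub>C q Z Z unit_fun | None \<Rightarrow> (z * cnj (c i')) *\<^sub>C R)
      | None \<Rightarrow> (case j of Some j' \<Rightarrow> (z' * c j') *\<^sub>C R' | None \<Rightarrow> complex_of_real t *\<^sub>C q W W unit_fun))"
    define p where "p = (\<lambda>i :: 'i option. case i of Some _ \<Rightarrow> Z | None \<Rightarrow> W)"
    define v where "v = (\<lambda>i. case i of Some i' \<Rightarrow> x i' | None \<Rightarrow> y)"
    define I where "I = insert None (Some ` J)"
    have sumI: "(\<Sum>i\<in>I. f i) = f None + (\<Sum>j\<in>J. f (Some j))" for f :: "'i option \<Rightarrow> complex"
      unfolding I_def using J by (subst sum.insert) (auto simp: sum.reindex)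
    have "accretive I p u"
      unfolding accretive_def
    proof
      fix \<xi> :: "'i option \<Rightarrow> nat \<Rightarrow> 'h"
      define \<eta> where "\<eta> = (\<Sum>j\<in>J. c j *\<^sub>C \<xi> (Some j))"
      define \<zeta> where "\<zeta> = \<xi> None"
      let ?N = "(\<Sum>a<d Z. (norm (\<eta> a))\<^sup>2)" and ?M = "(\<Sum>a<d W. (norm (\<zeta> a))\<^sup>2)"
      have dbl: "(\<Sum>i\<in>J. \<Sum>j\<in>J. cnj (c i) * c j * bform act (d Z) (d Z) (q Z Z unit_fun) (\<xi> (Some i)) (\<xi> (Some j))) =
        bform act (d Z) (d Z) (q Z Z unit_fun) \<eta> \<eta>"
        unfolding \<eta>_def bform_lincomb_left bform_lincomb_right
        by (subst sum.swap) (simp add: sum_distrib_left ac_simps)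
      have total: "(\<Sum>i\<in>I. \<Sum>j\<in>I. bform act (d (p i)) (d (p j)) (u i j) (\<xi> i) (\<xi> j)) =
        complex_of_real t * bform act (d W) (d W) (q W W unit_fun) \<zeta> \<zeta> + z' * bform act (d W) (d Z) R' \<zeta> \<eta> +
        z * bform act (d Z) (d W) R \<eta> \<zeta> + complex_of_real \<tau> * bform act (d Z) (d Z) (q Z Z unit_fun) \<eta> \<eta>"
        unfolding dbl[symmetric] unfolding \<eta>_def bform_lincomb_left bform_lincomb_right
        by (simp add: sumI u_def p_def bform_scaleC \<zeta>_def sum.distrib sum_distrib_left algebra_simps)
      have sc: "bform act (d Z) (d W) R \<eta> \<zeta> = bform act (d Z) (d W) R (complex_of_real \<mu> *\<^sub>C \<eta>) (complex_of_real (1/\<mu>) *\<^sub>C \<zeta>)"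
        "bform act (d W) (d Z) R' \<zeta> \<eta> = bform act (d W) (d Z) R' (complex_of_real (1/\<mu>) *\<^sub>C \<zeta>) (complex_of_real \<mu> *\<^sub>C \<eta>)"
        using \<mu> by (simp_all add: bform_scaleC_left bform_scaleC_right)
      have nn: "(\<Sum>a<n. (norm ((complex_of_real r *\<^sub>C \<xi>) a))\<^sup>2) = r\<^sup>2 * (\<Sum>a<n. (norm (\<xi> a))\<^sup>2)" for n r and \<xi> :: "nat \<Rightarrow> 'h"
        by (simp add: scaleC_fun_apply norm_scaleC power_mult_distrib sum_distrib_left)
      have b1: "cmod (bform act (d Z) (d W) R \<eta> \<zeta>) \<le> K * (\<mu>\<^sup>2 * ?N + (1/\<mu>)\<^sup>2 * ?M)"
        unfolding sc(1) using K(2)[of "complex_of_real \<mu> *\<^sub>C \<eta>" "complex_of_real (1/\<mu>) *\<^sub>C \<zeta>"] unfolding nn .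
      have b2: "cmod (bform act (d W) (d Z) R' \<zeta> \<eta>) \<le> K' * ((1/\<mu>)\<^sup>2 * ?M + \<mu>\<^sup>2 * ?N)"
        unfolding sc(2) using K'(2)[of "complex_of_real (1/\<mu>) *\<^sub>C \<zeta>" "complex_of_real \<mu> *\<^sub>C \<eta>"] unfolding nn .
      have c1: "- (K * (\<mu>\<^sup>2 * ?N + (1/\<mu>)\<^sup>2 * ?M)) \<le> Re (z * bform act (d Z) (d W) R \<eta> \<zeta>)"
        using b1 z(1) abs_Re_le_cmod[of "z * bform act (d Z) (d W) R \<eta> \<zeta>"]
          mult_mono[OF z(1) b1] by (simp add: norm_mult)
      have c2: "- (K' * ((1/\<mu>)\<^sup>2 * ?M + \<mu>\<^sup>2 * ?N)) \<le> Re (z' * bform act (d W) (d Z) R' \<zeta> \<eta>)"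
        using b2 z(2) abs_Re_le_cmod[of "z' * bform act (d W) (d Z) R' \<zeta> \<eta>"]
          mult_mono[OF z(2) b2] by (simp add: norm_mult)
      have c3: "(K + K') * \<mu>\<^sup>2 * ?N \<le> \<tau> * Re (bform act (d Z) (d Z) (q Z Z unit_fun) \<eta> \<eta>)"
      proof -
        have "(K + K') * \<mu>\<^sup>2 * ?N = \<tau> * (\<epsilon> * ?N)" using \<epsilon>(1) by (simp add: \<tau>_def)
        then show ?thesis using mult_left_mono[OF \<epsilon>(2)[of \<eta>] \<tau>] by linarith
      qed
      have M: "?M \<ge> 0" by (intro sum_nonneg) auto
      have "(K + K') * (1/\<mu>)\<^sup>2 * ?M \<le> (t * \<delta>) * ?M"
      proof (intro mult_right_mono M)
        have "(1/\<mu>)\<^sup>2 = (t * \<delta>) / (K + K' + 1)" using \<mu> t \<delta> K K' by (simp add: power_divide)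
        then have "(K + K') * (1/\<mu>)\<^sup>2 = (t * \<delta>) * ((K + K') / (K + K' + 1))" by simp
        also have "\<dots> \<le> (t * \<delta>) * 1" using t \<delta> K K' by (intro mult_left_mono) auto
        finally show "(K + K') * (1/\<mu>)\<^sup>2 \<le> t * \<delta>" by simp
      qed
      also have "\<dots> \<le> t * Re (bform act (d W) (d W) (q W W unit_fun) \<zeta> \<zeta>)"
        using mult_left_mono[OF \<delta>(2)[of \<zeta>], of t] t by (simp add: mult.assoc)
      finally have c4: "(K + K') * (1/\<mu>)\<^sup>2 * ?M \<le> t * Re (bform act (d W) (d W) (q W W unit_fun) \<zeta> \<zeta>)" .
      have e: "K * (\<mu>\<^sup>2 * ?N + (1/\<mu>)\<^sup>2 * ?M) + K' * ((1/\<mu>)\<^sup>2 * ?M + \<mu>\<^sup>2 * ?N) = (K + K') * \<mu>\<^sup>2 * ?N + (K + K') * (1/\<mu>)\<^sup>2 * ?M"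
        by (simp add: algebra_simps)
      have "0 \<le> Re (complex_of_real t * bform act (d W) (d W) (q W W unit_fun) \<zeta> \<zeta> + z' * bform act (d W) (d Z) R' \<zeta> \<eta> +
        z * bform act (d Z) (d W) R \<eta> \<zeta> + complex_of_real \<tau> * bform act (d Z) (d Z) (q Z Z unit_fun) \<eta> \<eta>)"
      proof -
        have re: "Re (complex_of_real r * w) = r * Re w" for r w by simp
        show ?thesis unfolding plus_complex.sel re using c1 c2 c3 c4 e by linarith
      qed
      then show "0 \<le> Re (\<Sum>i\<in>I. \<Sum>j\<in>I. bform act (d (p i)) (d (p j)) (u i j) (\<xi> i) (\<xi> j))"
        unfolding total .
    qed
    then have "0 \<le> Re (\<Sum>i\<in>I. \<Sum>j\<in>I. \<kappa> (p i) (p j) (u i j) (v i) (v j))"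
      by (intro extends_pos[OF ext]) (auto simp: I_def p_def v_def X J)
    also have "(\<Sum>i\<in>I. \<Sum>j\<in>I. \<kappa> (p i) (p j) (u i j) (v i) (v j)) =
       complex_of_real t * s W W unit_fun y y + z * (\<Sum>j\<in>J. cnj (c j) * \<kappa> Z W R (x j) y) + z' * (\<Sum>j\<in>J. c j * \<kappa> W Z R' y (x j))
       + complex_of_real \<tau> * (\<Sum>i\<in>J. \<Sum>j\<in>J. cnj (c i) * c j * s Z Z unit_fun (x i) (x j))"
      by (simp add: sumI u_def p_def v_def extends_scaleC[OF ext] extends_eq[OF ext] X sum.distrib sum_distrib_left algebra_simps cong: sum.cong)
    finally show ?thesis by (simp add: s0)
  qed
  show "(\<Sum>j\<in>J. cnj (c j) * \<kappa> Z W R (x j) y) = 0"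
    by (rule complex_zero_from_rotations[of "Re (s W W unit_fun y y)"]) (use key[of _ 0 _ R] in simp)
  show "(\<Sum>j\<in>J. c j * \<kappa> W Z R y (x j)) = 0"
    by (rule complex_zero_from_rotations[of "Re (s W W unit_fun y y)"]) (use key[of 0 _ _ _ R] in simp)
qed

end

section \<open>Existence of extensions\<close>

text \<open>Tychonoff's theorem for nets of complex functions: a filter plays the net and a finer
  filter the subnet. The bounds need to hold only eventually, and separately for each
  coordinate.\<close>

lemma bounded_net_convergent_subnet:
  fixes f :: "'d \<Rightarrow> 'i \<Rightarrow> complex"
  assumes D: "D \<noteq> bot" and bound: "\<And>i. \<exists>B. \<forall>\<^sub>F d in D. cmod (f d i) \<le> B"
  obtains D' l where "D' \<le> D" "D' \<noteq> bot" "\<And>i. ((\<lambda>d. f d i) \<longlongrightarrow> l i) D'"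
proof -
  obtain B where B: "\<And>i. \<forall>\<^sub>F d in D. cmod (f d i) \<le> B i" using bound by metis
  \<comment> \<open>Truncation puts every member into one product of closed discs; in each single
    coordinate it eventually changes nothing.\<close>
  define g where "g = (\<lambda>d i. if cmod (f d i) \<le> B i then f d i else 0)"
  define K :: "('i \<Rightarrow> complex) set" where "K = (\<Pi>\<^sub>E i\<in>UNIV. cball 0 \<bar>B i\<bar>)"
  have "compactin (product_topology (\<lambda>_. euclidean) UNIV) K"
    unfolding K_def compactin_PiE by auto
  then have K: "compact K"
    by (metis compactin_euclidean_iff euclidean_product_topology)
  have gK: "g d \<in> K" for d by (auto simp: g_def K_def)
  have "filtermap g D \<noteq> bot" using D by (simp add: filtermap_bot_iff)
  moreover have "eventually (\<lambda>h. h \<in> K) (filtermap g D)" using gK by (simp add: eventually_filtermap)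
  ultimately obtain l where l: "inf (nhds l) (filtermap g D) \<noteq> bot"
    using K unfolding compact_filter by blast
  \<comment> \<open>The filter D refined by the condition that the truncated function is near l; it
    is proper because l is a cluster point.\<close>
  define D' where "D' = inf D (filtercomap g (nhds l))"
  have "D' \<noteq> bot"
  proof
    assume "D' = bot"
    then have "eventually (\<lambda>_. False) D'" by simp
    then obtain P R where P: "eventually P D" and R: "eventually R (filtercomap g (nhds l))"
      and PR: "\<And>d. \<not> (P d \<and> R d)"
      unfolding D'_def eventually_inf by metis
    from R obtain Q where Q: "eventually Q (nhds l)" and QR: "\<And>d. Q (g d) \<Longrightarrow> R d"
      unfolding eventually_filtercomap by metis
    have PQ: "\<not> Q (g d)" if "P d" for d using PR QR that by metis
    have "eventually (\<lambda>h. \<not> Q h) (filtermap g D)"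
      unfolding eventually_filtermap by (rule eventually_mono[OF P]) (rule PQ)
    with Q have "eventually (\<lambda>_. False) (inf (nhds l) (filtermap g D))"
      unfolding eventually_inf by (intro exI[of _ Q] exI[of _ "\<lambda>h. \<not> Q h"]) simp
    with l show False by (simp add: trivial_limit_def)
  qed
  moreover have "D' \<le> D" by (simp add: D'_def)
  moreover have "((\<lambda>d. f d i) \<longlongrightarrow> l i) D'" for i
  proof -
    have lim: "filterlim g (nhds l) D'"
      by (rule filterlim_mono[OF filterlim_filtercomap order_refl]) (simp add: D'_def)
    have *: "((\<lambda>d. g d i) \<longlongrightarrow> l i) D'"
    proof (rule topological_tendstoI)
      fix S :: "complex set" assume S: "open S" "l i \<in> S"
      have "open ((\<lambda>h :: 'i \<Rightarrow> complex. h i) -` S)"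
        by (rule open_vimage[OF S(1)]) simp
      then have "\<forall>\<^sub>F d in D'. g d \<in> (\<lambda>h. h i) -` S"
        by (rule topological_tendstoD[OF lim]) (use S in simp)
      then show "\<forall>\<^sub>F d in D'. g d i \<in> S" by simp
    qed
    have "\<forall>\<^sub>F d in D'. cmod (f d i) \<le> B i" using B \<open>D' \<le> D\<close> by (rule filter_leD[rotated])
    then have "\<forall>\<^sub>F d in D'. g d i = f d i" by eventually_elim (simp add: g_def)
    then show ?thesis by (rule Lim_transform_eventually[OF *])
  qed
  ultimately show thesis by (intro that)
qed

section \<open>Compactness of the set of extensions, and Hahn-Banach for finitely many
  blocks\<close>

context dominated_kernel begin

text \<open>Every clause of \<open>extends_on\<close> involves finitely many values and is closed
  under pointwise limits, and \<open>extends_bounded\<close> bounds the net at each argument. It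
  suffices that each finite part of X is eventually extended.\<close>

lemma extends_compact:
  assumes X: "X \<subseteq> pts \<times> UNIV" and D: "D \<noteq> bot"
    and ev: "\<And>Y. finite Y \<Longrightarrow> Y \<subseteq> X \<Longrightarrow> \<forall>\<^sub>F d in D. extends_on Y (\<kappa> d)"
  obtains D' \<kappa>' where "D' \<le> D" "D' \<noteq> bot" "extends_on X \<kappa>'"
    "\<And>Z x W y R. (Z, x) \<in> X \<Longrightarrow> (W, y) \<in> X \<Longrightarrow> ((\<lambda>d. \<kappa> d Z W R x y) \<longlongrightarrow> \<kappa>' Z W R x y) D'"
proof -
  define f where "f = (\<lambda>d (Z, W, R, x, y). if (Z, x) \<in> X \<and> (W, y) \<in> X then \<kappa> d Z W R x y else 0)"
  have "\<exists>B. \<forall>\<^sub>F d in D. cmod (f d i) \<le> B" for i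
  proof -
    obtain Z W R x y where i: "i = (Z, W, R, x, y)" by (rule prod_cases5)
    show ?thesis
    proof (cases "(Z, x) \<in> X \<and> (W, y) \<in> X")
      case True
      then have "Z \<in> pts" "W \<in> pts" using X by auto
      from extends_bounded[OF this, of x y R]
      obtain B where B: "\<forall>X \<kappa>. extends_on X \<kappa> \<longrightarrow> (Z, x) \<in> X \<longrightarrow> (W, y) \<in> X \<longrightarrow> cmod (\<kappa> Z W R x y) \<le> B" ..
      have "\<forall>\<^sub>F d in D. extends_on {(Z, x), (W, y)} (\<kappa> d)" by (rule ev) (use True in auto)
      moreover have "cmod (f d i) \<le> B" if "extends_on {(Z, x), (W, y)} (\<kappa> d)" for d
        using B[rule_format, OF that] True by (simp add: f_def i)
      ultimately have "\<forall>\<^sub>F d in D. cmod (f d i) \<le> B" by (rule eventually_mono)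
      then show ?thesis by blast
    next
      case False
      then have "f d i = 0" for d by (auto simp: f_def i)
      then show ?thesis by (intro exI[of _ 0]) simp
    qed
  qed
  then have bd: "\<And>i. \<exists>B. \<forall>\<^sub>F d in D. cmod (f d i) \<le> B" .
  obtain D' l where D': "D' \<le> D" "D' \<noteq> bot" and l: "\<And>i. ((\<lambda>d. f d i) \<longlongrightarrow> l i) D'"
    by (rule bounded_net_convergent_subnet[OF D bd]) (rule that)
  define \<kappa>' where "\<kappa>' = (\<lambda>Z W R x y. l (Z, W, R, x, y))"
  have lim: "((\<lambda>d. \<kappa> d Z W R x y) \<longlongrightarrow> \<kappa>' Z W R x y) D'" if "(Z, x) \<in> X" "(W, y) \<in> X" for Z x W y R
    using l[of "(Z, W, R, x, y)"] that by (simp add: f_def \<kappa>'_def)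
  have ev': "\<forall>\<^sub>F d in D'. extends_on Y (\<kappa> d)" if "finite Y" "Y \<subseteq> X" for Y
    using ev[OF that] D'(1) by (rule filter_leD[rotated])
  have "extends_on X \<kappa>'"
  proof (rule extends_onI)
    fix I :: "nat set" and p x u
    assume I: "finite I" and pX: "\<And>i. i \<in> I \<Longrightarrow> (p i, x i) \<in> X" and acc: "accretive I p u"
    have "((\<lambda>d. Re (\<Sum>i\<in>I. \<Sum>j\<in>I. \<kappa> d (p i) (p j) (u i j) (x i) (x j))) \<longlongrightarrow> Re (\<Sum>i\<in>I. \<Sum>j\<in>I. \<kappa>' (p i) (p j) (u i j) (x i) (x j))) D'"
      by (intro tendsto_intros lim pX)
    moreover have "\<forall>\<^sub>F d in D'. extends_on ((\<lambda>i. (p i, x i)) ` I) (\<kappa> d)" by (rule ev') (use I pX in auto)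
    then have "\<forall>\<^sub>F d in D'. 0 \<le> Re (\<Sum>i\<in>I. \<Sum>j\<in>I. \<kappa> d (p i) (p j) (u i j) (x i) (x j))"
      by (rule eventually_mono) (rule extends_pos_nat[OF _ I _ acc], assumption, blast)
    ultimately show "0 \<le> Re (\<Sum>i\<in>I. \<Sum>j\<in>I. \<kappa>' (p i) (p j) (u i j) (x i) (x j))"
      using D'(2) by (rule tendsto_lowerbound)
  next
    fix Z x W y assume zw: "(Z, x) \<in> X" "(W, y) \<in> X"
    have e: "\<forall>\<^sub>F d in D'. extends_on {(Z, x), (W, y)} (\<kappa> d)" by (rule ev') (use zw in auto)
    show "\<kappa>' Z W (R + T) x y = \<kappa>' Z W R x y + \<kappa>' Z W T x y" for R T
    proof (rule tendsto_unique[OF D'(2) lim[OF zw]])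
      have "\<forall>\<^sub>F d in D'. \<kappa> d Z W R x y + \<kappa> d Z W T x y = \<kappa> d Z W (R + T) x y"
        using e by (rule eventually_mono) (simp add: extends_add)
      then show "((\<lambda>d. \<kappa> d Z W (R + T) x y) \<longlongrightarrow> \<kappa>' Z W R x y + \<kappa>' Z W T x y) D'"
        by (rule Lim_transform_eventually[rotated]) (intro tendsto_intros lim zw)
    qed
    show "\<kappa>' Z W (c *\<^sub>C R) x y = c * \<kappa>' Z W R x y" for c R
    proof (rule tendsto_unique[OF D'(2) lim[OF zw]])
      have "\<forall>\<^sub>F d in D'. c * \<kappa> d Z W R x y = \<kappa> d Z W (c *\<^sub>C R) x y"
        using e by (rule eventually_mono) (simp add: extends_scaleC)
      then show "((\<lambda>d. \<kappa> d Z W (c *\<^sub>C R) x y) \<longlongrightarrow> c * \<kappa>' Z W R x y) D'"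
        by (rule Lim_transform_eventually[rotated]) (intro tendsto_intros lim zw)
    qed
    show "\<kappa>' Z W (q Z W P) x y = s Z W P x y" for P
    proof (rule tendsto_unique[OF D'(2) lim[OF zw]])
      have "\<forall>\<^sub>F d in D'. s Z W P x y = \<kappa> d Z W (q Z W P) x y"
        using e by (rule eventually_mono) (simp add: extends_eq)
      then show "((\<lambda>d. \<kappa> d Z W (q Z W P) x y) \<longlongrightarrow> s Z W P x y) D'"
        by (rule Lim_transform_eventually[rotated]) (intro tendsto_intros)
    qed
  qed
  from that[OF D' this lim] show thesis .
qed

lemma dominated_finite:
  assumes I: "finite (I :: 'i set)" and p: "\<And>i. i \<in> I \<Longrightarrow> p i \<in> pts"
    and pos: "\<And>\<xi>. 0 \<le> Re (\<Sum>i\<in>I. \<Sum>j\<in>I. bform act (d (p i)) (d (p j)) (q (p i) (p j) (P i j)) (\<xi> i) (\<xi> j))"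
  shows "0 \<le> Re (\<Sum>i\<in>I. \<Sum>j\<in>I. s (p i) (p j) (P i j) (x i) (x j))"
proof -
  obtain f :: "'i \<Rightarrow> nat" and n where f: "inj_on f I" using finite_imp_inj_to_nat_seg[OF I] by metis
  define g where "g = the_inv_into I f"
  have g: "g (f i) = i" if "i \<in> I" for i using the_inv_into_f_f[OF f that] by (simp add: g_def)
  have re: "(\<Sum>a\<in>f ` I. \<Sum>b\<in>f ` I. F (g a) (g b) a b) = (\<Sum>i\<in>I. \<Sum>j\<in>I. F i j (f i) (f j))" for F :: "'i \<Rightarrow> 'i \<Rightarrow> nat \<Rightarrow> nat \<Rightarrow> complex"
    by (simp add: sum.reindex[OF f] g cong: sum.cong)
  have "0 \<le> Re (\<Sum>a\<in>f ` I. \<Sum>b\<in>f ` I. s (p (g a)) (p (g b)) (P (g a) (g b)) (x (g a)) (x (g b)))"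
  proof (rule dominated)
    fix \<xi> :: "nat \<Rightarrow> nat \<Rightarrow> 'h"
    show "0 \<le> Re (\<Sum>a\<in>f ` I. \<Sum>b\<in>f ` I. bform act (d (p (g a))) (d (p (g b))) (q (p (g a)) (p (g b)) (P (g a) (g b))) (\<xi> a) (\<xi> b))"
      using pos[of "\<xi> \<circ> f"]
        re[of "\<lambda>i j a b. bform act (d (p i)) (d (p j)) (q (p i) (p j) (P i j)) (\<xi> a) (\<xi> b)"] by simp
  qed (use I p g in auto)
  then show ?thesis using re[of "\<lambda>i j a b. s (p i) (p j) (P i j) (x i) (x j)"] by simp
qed

lemma q_zero: "Z \<in> pts \<Longrightarrow> W \<in> pts \<Longrightarrow> q Z W 0 = 0"
  using q_scaleC[of Z W 0 0] by (simp add: scaleC_zero_left)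

lemma s_zero: "Z \<in> pts \<Longrightarrow> W \<in> pts \<Longrightarrow> s Z W 0 x y = 0"
  using s_scaleC[of Z W 0 0 x y] by (simp add: scaleC_zero_left)

text \<open>Among all block matrices over X, those of the form q(P) are a subspace on which
  \<open>s\<close> prescribes the value, nonnegative in real part at accretive arguments. A positive
  functional extends it because the subspace contains order units. Blocks are indexed by the
  elements of X, so one point with two vectors gives two blocks.\<close>

lemma extends_finite_exists:
  assumes X: "finite X" "X \<subseteq> pts \<times> UNIV"
  shows "\<exists>\<kappa>. extends_on X \<kappa>"
proof -
  have pts: "fst v \<in> pts" if "v \<in> X" for v using that X by auto
  have pts2: "a \<in> pts" if "(a, b) \<in> X" for a b using pts[OF that] by simp
  define F where "F = (\<lambda>u \<xi>. \<Sum>v\<in>X. \<Sum>w\<in>X. bform act (d (fst v)) (d (fst w)) (u v w) (\<xi> v) (\<xi> w))"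
  define qq where "qq = (\<lambda>P v w. if v \<in> X \<and> w \<in> X then q (fst v) (fst w) (P v w) else 0)"
  define ss where "ss = (\<lambda>P. \<Sum>v\<in>X. \<Sum>w\<in>X. s (fst v) (fst w) (P v w) (snd v) (snd w))"
  \<comment> \<open>The scalar block matrices whose image under \<open>q\<close> dominates u in real
    part; the gauge p u is the infimum of \<open>s\<close> on them. \<open>dominated\<close> keeps
    the values on A 0 nonnegative, and with A (- u) nonempty this makes p finite.\<close>
  define A where "A = (\<lambda>u. {P. \<forall>\<xi>. Re (F u \<xi>) \<le> Re (F (qq P) \<xi>)})"
  define p where "p = (\<lambda>u. INF P\<in>A u. Re (ss P))"
  have F_add: "F (u + u') \<xi> = F u \<xi> + F u' \<xi>" for u u' \<xi>
    by (simp add: F_def bform_add sum.distrib plus_fun_def[of "u" "u'"] plus_fun_def[of "u _" "u' _"] del: plus_fun_apply)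
  have F_scaleC: "F (c *\<^sub>C u) \<xi> = c * F u \<xi>" for c u \<xi>
    by (simp add: F_def bform_scaleC scaleC_fun_apply[of c u] scaleC_fun_apply[of c "u _"] sum_distrib_left)
  have F_minus: "F (- u) \<xi> = - F u \<xi>" for u \<xi>
    using F_scaleC[of "-1" u \<xi>] by (simp add: scaleC_minus_left scaleC_one)
  have qq_add: "qq (P + P') = qq P + qq P'" for P P'
    by (intro ext) (auto simp: qq_def q_add pts)
  have qq_scaleC: "qq (c *\<^sub>C P) = c *\<^sub>C qq P" for c P
    by (intro ext) (auto simp: qq_def scaleC_fun_apply q_scaleC pts scaleC_zero_right)
  have ss_add: "ss (P + P') = ss P + ss P'" for P P'
    by (simp add: ss_def s_add pts sum.distrib)
  have ss_scaleC: "ss (c *\<^sub>C P) = c * ss P" for c P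
    by (simp add: ss_def scaleC_fun_apply[of c P] scaleC_fun_apply[of c "P _"] s_scaleC pts sum_distrib_left)
  have A_add: "P + P' \<in> A (u + u')" if "P \<in> A u" "P' \<in> A u'" for P P' u u'
    using that by (auto simp: A_def F_add qq_add intro: add_mono)
  have A_scale: "complex_of_real r *\<^sub>C P \<in> A (complex_of_real r *\<^sub>C u)" if "P \<in> A u" "r > 0" for P u r
    using that by (auto simp: A_def F_scaleC qq_scaleC)
  have A_zero: "0 \<le> Re (ss P)" if "P \<in> A 0" for P
    unfolding ss_def
  proof (rule dominated_finite[OF X(1) pts])
    fix \<xi> :: "'p \<times> (nat \<Rightarrow> 'e) \<Rightarrow> nat \<Rightarrow> 'h"
    have "F 0 \<xi> = 0" using F_scaleC[of 0 0 \<xi>] by (simp add: scaleC_zero_left)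
    moreover have "Re (F 0 \<xi>) \<le> Re (F (qq P) \<xi>)" using that by (simp add: A_def)
    ultimately have "0 \<le> Re (F (qq P) \<xi>)" by simp
    then show "0 \<le> Re (\<Sum>v\<in>X. \<Sum>w\<in>X. bform act (d (fst v)) (d (fst w)) (q (fst v) (fst w) (P v w)) (\<xi> v) (\<xi> w))"
      by (simp add: F_def qq_def)
  qed
  have A_ne: "A u \<noteq> {}" for u
  proof -
    define N where "N = (\<lambda>v (\<xi> :: nat \<Rightarrow> 'h). \<Sum>a<d v. (norm (\<xi> a))\<^sup>2)"
    have N0: "N v \<xi> \<ge> 0" for v \<xi> unfolding N_def by (intro sum_nonneg) auto
    have "\<forall>v\<in>pts. \<exists>\<epsilon>. 0 < \<epsilon> \<and> (\<forall>\<xi>. \<epsilon> * N v \<xi> \<le> Re (bform act (d v) (d v) (q v v unit_fun) \<xi> \<xi>))"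
      using q_unit unfolding N_def by (intro ballI)
    from bchoice[OF this] obtain \<epsilon> where
      \<epsilon>0: "\<forall>v\<in>pts. 0 < \<epsilon> v \<and> (\<forall>\<xi>. \<epsilon> v * N v \<xi> \<le> Re (bform act (d v) (d v) (q v v unit_fun) \<xi> \<xi>))" ..
    have \<epsilon>: "\<And>v. v \<in> pts \<Longrightarrow> \<epsilon> v > 0"
      "\<And>v \<xi>. v \<in> pts \<Longrightarrow> \<epsilon> v * N v \<xi> \<le> Re (bform act (d v) (d v) (q v v unit_fun) \<xi> \<xi>)"
      using \<epsilon>0 by simp_all
    have "\<forall>vw. \<exists>K. 0 \<le> K \<and> (\<forall>\<xi> \<eta>. cmod (bform act (d (fst (fst vw))) (d (fst (snd vw))) (u (fst vw) (snd vw)) \<xi> \<eta>) \<le>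
        K * (N (fst (fst vw)) \<xi> + N (fst (snd vw)) \<eta>))"
      unfolding N_def using bform_bounded by (intro allI)
    from choice[OF this] obtain K' where K': "\<forall>vw. 0 \<le> K' vw \<and> (\<forall>\<xi> \<eta>. cmod (bform act (d (fst (fst vw))) (d (fst (snd vw))) (u (fst vw) (snd vw)) \<xi> \<eta>) \<le>
        K' vw * (N (fst (fst vw)) \<xi> + N (fst (snd vw)) \<eta>))" ..
    define K where "K = (\<lambda>v w. K' (v, w))"
    have K: "\<And>v w. K v w \<ge> 0"
      "\<And>v w \<xi> \<eta>. cmod (bform act (d (fst v)) (d (fst w)) (u v w) \<xi> \<eta>) \<le> K v w * (N (fst v) \<xi> + N (fst w) \<eta>)"
      using K'[rule_format, of "(_, _)"] by (simp_all add: K_def)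
    define M where "M = (\<Sum>v\<in>X. \<Sum>w\<in>X. 2 * K v w)"
    have M: "M \<ge> 0" unfolding M_def by (intro sum_nonneg) (use K in auto)
    define t where "t = (\<Sum>v\<in>X. M / \<epsilon> (fst v))"
    \<comment> \<open>A large multiple of the identity on the diagonal dominates any u: t times the
      constant \<epsilon> of each point of X is at least the bound M for the form of u.\<close>
    define P where "P = (\<lambda>v w :: 'p \<times> (nat \<Rightarrow> 'e). if v = w then complex_of_real t *\<^sub>C unit_fun else 0)"
    have "P \<in> A u"
      unfolding A_def
    proof (intro CollectI allI)
      fix \<xi> :: "'p \<times> (nat \<Rightarrow> 'e) \<Rightarrow> nat \<Rightarrow> 'h"
      let ?T = "\<Sum>v\<in>X. N (fst v) (\<xi> v)"
      have le: "N (fst v) (\<xi> v) \<le> ?T" if "v \<in> X" for v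
        using member_le_sum[OF that, of "\<lambda>v. N (fst v) (\<xi> v)"] N0 X by simp
      have "Re (F u \<xi>) \<le> cmod (F u \<xi>)" by (rule complex_Re_le_cmod)
      also have "\<dots> \<le> (\<Sum>v\<in>X. \<Sum>w\<in>X. K v w * (N (fst v) (\<xi> v) + N (fst w) (\<xi> w)))"
        unfolding F_def by (intro order_trans[OF norm_sum] sum_mono K)
      also have "\<dots> \<le> (\<Sum>v\<in>X. \<Sum>w\<in>X. K v w * (?T + ?T))"
        by (intro sum_mono mult_left_mono add_mono le K)
      also have "\<dots> = M * ?T"
        unfolding M_def sum_distrib_right by (intro sum.cong refl) (simp add: algebra_simps)
      also have "\<dots> = (\<Sum>v\<in>X. M * N (fst v) (\<xi> v))" by (simp add: sum_distrib_left)
      also have "\<dots> \<le> (\<Sum>v\<in>X. t * Re (bform act (d (fst v)) (d (fst v)) (q (fst v) (fst v) unit_fun) (\<xi> v) (\<xi> v)))"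
      proof (rule sum_mono)
        fix v assume v: "v \<in> X"
        have "M / \<epsilon> (fst v) \<le> t"
          unfolding t_def using member_le_sum[OF v, of "\<lambda>v. M / \<epsilon> (fst v)"] X M \<epsilon>(1)[OF pts] by (simp add: less_imp_le)
        then have "M \<le> t * \<epsilon> (fst v)" using \<epsilon>(1)[OF pts[OF v]] by (simp add: field_simps)
        then have "M * N (fst v) (\<xi> v) \<le> t * (\<epsilon> (fst v) * N (fst v) (\<xi> v))"
          using mult_right_mono[OF _ N0] by (simp add: mult.assoc[symmetric])
        also have "\<dots> \<le> t * Re (bform act (d (fst v)) (d (fst v)) (q (fst v) (fst v) unit_fun) (\<xi> v) (\<xi> v))"
        proof (intro mult_left_mono \<epsilon>(2) pts v)
          show "0 \<le> t" unfolding t_def by (intro sum_nonneg) (use M \<epsilon>(1)[OF pts] in \<open>simp add: less_imp_le\<close>)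
        qed
        finally show "M * N (fst v) (\<xi> v) \<le> t * Re (bform act (d (fst v)) (d (fst v)) (q (fst v) (fst v) unit_fun) (\<xi> v) (\<xi> v))" .
      qed
      also have "\<dots> = Re (F (qq P) \<xi>)"
      proof -
        have "F (qq P) \<xi> = (\<Sum>v\<in>X. \<Sum>w\<in>X. if v = w then complex_of_real t * bform act (d (fst v)) (d (fst v)) (q (fst v) (fst v) unit_fun) (\<xi> v) (\<xi> v) else 0)"
          unfolding F_def by (intro sum.cong refl) (auto simp: qq_def P_def q_scaleC q_zero pts bform_scaleC bform_zero)
        then show ?thesis using X by simp
      qed
      finally show "Re (F u \<xi>) \<le> Re (F (qq P) \<xi>)" .
    qed
    then show ?thesis by blast
  qed
  have lower: "- Re (ss P') \<le> Re (ss P)" if "P \<in> A u" "P' \<in> A (- u)" for P P' u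
    using A_zero[of "P + P'"] A_add[OF that] by (simp add: ss_add)
  have bdd: "bdd_below ((\<lambda>P. Re (ss P)) ` A u)" for u
    using A_ne[of "- u"] lower by (meson bdd_belowI2 ex_in_conv)
  have le: "p u \<le> Re (ss P)" if "P \<in> A u" for u P unfolding p_def by (rule cINF_lower[OF bdd that])
  have ge: "m \<le> p u" if "\<And>P. P \<in> A u \<Longrightarrow> m \<le> Re (ss P)" for m u
    unfolding p_def by (rule cINF_greatest[OF A_ne that])
  have zero_A: "0 \<in> A u" if "\<And>\<xi>. Re (F u \<xi>) \<le> 0" for u
    using that qq_scaleC[of 0 0] F_scaleC[of 0 0] by (auto simp: A_def scaleC_zero_left)
  have ss0: "ss 0 = 0" using ss_scaleC[of 0 0] by (simp add: scaleC_zero_left)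
  have "sublinear p"
  proof (rule sublinearI)
    fix u u'
    have "p (u + u') \<le> Re (ss P) + Re (ss P')" if "P \<in> A u" "P' \<in> A u'" for P P'
      using le[OF A_add[OF that]] by (simp add: ss_add)
    then have "p (u + u') - Re (ss P) \<le> p u'" if "P \<in> A u" for P
      by (intro ge) (smt (verit) that)
    then have "p (u + u') - p u' \<le> p u" by (intro ge) (auto simp: algebra_simps)
    then show "p (u + u') \<le> p u + p u'" by simp
  next
    fix r :: real and u assume r: "0 < r"
    have "p (complex_of_real r *\<^sub>C u) / r \<le> p u"
    proof (rule ge)
      fix P assume "P \<in> A u"
      then have "p (complex_of_real r *\<^sub>C u) \<le> Re (ss (complex_of_real r *\<^sub>C P))" by (intro le A_scale r)
      then show "p (complex_of_real r *\<^sub>C u) / r \<le> Re (ss P)" using r by (simp add: ss_scaleC field_simps)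
    qed
    then show "p (complex_of_real r *\<^sub>C u) \<le> r * p u" using r by (simp add: field_simps)
  next
    have "F 0 \<xi> = 0" for \<xi> using F_scaleC[of 0 0 \<xi>] by (simp add: scaleC_zero_left)
    then have "p 0 \<le> 0" using le[OF zero_A, of 0] ss0 by simp
    moreover have "0 \<le> p 0" by (rule ge) (rule A_zero)
    ultimately show "p 0 = 0" by simp
  qed
  from hahn_banach_sublinear[OF this] obtain f where
    f_add: "\<And>u v. f (u + v) = f u + f v" and f_scale: "\<And>r u. f (complex_of_real r *\<^sub>C u) = r * f u"
    and f_le: "\<And>u. f u \<le> p u" by blast
  have f_minus: "f (- u) = - f u" for u using f_scale[of "-1" u] by (simp add: scaleC_minus_left scaleC_one)
  \<comment> \<open>The complex-linear functional with real part f.\<close>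
  define \<sigma> where "\<sigma> = (\<lambda>u. Complex (f u) (- f (\<i> *\<^sub>C u)))"
  have \<sigma>_add: "\<sigma> (u + v) = \<sigma> u + \<sigma> v" for u v
    by (simp add: \<sigma>_def f_add scaleC_add_right complex_eq_iff)
  have \<sigma>_scaleC: "\<sigma> (c *\<^sub>C u) = c * \<sigma> u" for c u
  proof -
    have fc: "f (c *\<^sub>C u) = Re c * f u + Im c * f (\<i> *\<^sub>C u)" for c u
    proof -
      have "c *\<^sub>C u = complex_of_real (Re c) *\<^sub>C u + complex_of_real (Im c) *\<^sub>C (\<i> *\<^sub>C u)"
      proof -
        have "c = complex_of_real (Re c) + complex_of_real (Im c) * \<i>" by (simp add: complex_eq_iff)
        then have "c *\<^sub>C u = (complex_of_real (Re c) + complex_of_real (Im c) * \<i>) *\<^sub>C u"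
          by (rule arg_cong)
        then show ?thesis by (simp only: scaleC_add_left scaleC_scaleC)
      qed
      then show ?thesis by (simp only: f_add f_scale)
    qed
    have "f (\<i> *\<^sub>C c *\<^sub>C u) = Re c * f (\<i> *\<^sub>C u) - Im c * f u"
      using fc[of "\<i> * c" u] by (simp only: scaleC_scaleC) simp
    then show ?thesis by (simp add: \<sigma>_def complex_eq_iff fc[of c u])
  qed
  have \<sigma>_sum: "\<sigma> (\<Sum>i\<in>I. u i) = (\<Sum>i\<in>I. \<sigma> (u i))" for u and I :: "nat set"
    using \<sigma>_scaleC[of 0 0] by (induction I rule: infinite_finite_induct)
      (auto simp: \<sigma>_add scaleC_zero_left simp del: plus_fun_apply zero_fun_apply)
  have \<sigma>_pos: "0 \<le> Re (\<sigma> u)" if "\<And>\<xi>. 0 \<le> Re (F u \<xi>)" for u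
  proof -
    \<comment> \<open>For accretive u the zero matrix dominates - u, so f (- u) \<le> 0.\<close>
    have "f (- u) \<le> p (- u)" by (rule f_le)
    also have "\<dots> \<le> Re (ss 0)" by (intro le zero_A) (use that in \<open>simp add: F_minus\<close>)
    finally show ?thesis by (simp add: ss0 f_minus \<sigma>_def)
  qed
  have f_qq: "f (qq P) = Re (ss P)" for P
  proof -
    have a: "f (qq P) \<le> Re (ss P)" for P
      by (rule order_trans[OF f_le le]) (simp add: A_def)
    have "qq (- P) = - qq P" "ss (- P) = - ss P"
      using qq_scaleC[of "-1" P] ss_scaleC[of "-1" P] by (simp_all add: scaleC_minus_left scaleC_one)
    then show ?thesis using a[of P] a[of "- P"] by (simp add: f_minus)
  qed
  have \<sigma>_qq: "\<sigma> (qq P) = ss P" for P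
    using f_qq[of P] f_qq[of "\<i> *\<^sub>C P"] by (simp add: \<sigma>_def complex_eq_iff qq_scaleC ss_scaleC)
  \<comment> \<open>The block matrix whose only nonzero block is R at position (v, w). Pairs that
    repeat in a family add their blocks at the same position, which corresponds to testing with
    equal vectors there.\<close>
  define \<delta> :: "'p \<times> (nat \<Rightarrow> 'e) \<Rightarrow> 'p \<times> (nat \<Rightarrow> 'e) \<Rightarrow> (nat \<Rightarrow> nat \<Rightarrow> 'a) \<Rightarrow> _"
    where "\<delta> = (\<lambda>v w R v' w'. if v' = v \<and> w' = w then R else 0)"
  define \<kappa> where "\<kappa> = (\<lambda>Z W R x y. \<sigma> (\<delta> (Z, x) (W, y) R))"
  have "extends_on X \<kappa>"
  proof (rule extends_onI)
    fix I :: "nat set" and p x u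
    assume I: "finite I" and pX: "\<And>i. i \<in> I \<Longrightarrow> (p i, x i) \<in> X" and acc: "accretive I p u"
    have "(\<Sum>i\<in>I. \<Sum>j\<in>I. \<kappa> (p i) (p j) (u i j) (x i) (x j)) = \<sigma> (\<Sum>i\<in>I. \<Sum>j\<in>I. \<delta> (p i, x i) (p j, x j) (u i j))"
      by (simp add: \<kappa>_def \<sigma>_sum)
    also have "0 \<le> Re \<dots>"
    proof (rule \<sigma>_pos)
      fix \<xi> :: "'p \<times> (nat \<Rightarrow> 'e) \<Rightarrow> nat \<Rightarrow> 'h"
      have F0: "F 0 \<xi> = 0" using F_scaleC[of 0 0 \<xi>] by (simp add: scaleC_zero_left)
      have F_sum: "F (\<Sum>i\<in>I. u i) \<xi> = (\<Sum>i\<in>I. F (u i) \<xi>)" for u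
        using I by (induction I) (auto simp: F_add F0 simp del: plus_fun_apply zero_fun_apply)
      have "F (\<delta> v w R) \<xi> = bform act (d (fst v)) (d (fst w)) R (\<xi> v) (\<xi> w)" if "v \<in> X" "w \<in> X" for v w R
      proof -
        have "F (\<delta> v w R) \<xi> = (\<Sum>v'\<in>X. if v' = v then \<Sum>w'\<in>X. if w' = w then bform act (d (fst v)) (d (fst w)) R (\<xi> v) (\<xi> w) else 0 else 0)"
          unfolding F_def by (intro sum.cong refl) (auto simp: \<delta>_def bform_zero intro!: sum.neutral sum.cong)
        then show ?thesis using X that by simp
      qed
      then have "F (\<Sum>i\<in>I. \<Sum>j\<in>I. \<delta> (p i, x i) (p j, x j) (u i j)) \<xi> =
          (\<Sum>i\<in>I. \<Sum>j\<in>I. bform act (d (p i)) (d (p j)) (u i j) (\<xi> (p i, x i)) (\<xi> (p j, x j)))"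
        using pX by (simp add: F_sum)
      then show "0 \<le> Re (F (\<Sum>i\<in>I. \<Sum>j\<in>I. \<delta> (p i, x i) (p j, x j) (u i j)) \<xi>)"
        using acc[unfolded accretive_def, rule_format, of "\<lambda>i. \<xi> (p i, x i)"] by simp
    qed
    finally show "0 \<le> Re (\<Sum>i\<in>I. \<Sum>j\<in>I. \<kappa> (p i) (p j) (u i j) (x i) (x j))" .
  next
    fix Z x W y assume zw: "(Z, x) \<in> X" "(W, y) \<in> X"
    have "\<delta> v w (R + T) = \<delta> v w R + \<delta> v w T" for v w R T by (intro ext) (simp add: \<delta>_def)
    then show "\<kappa> Z W (R + T) x y = \<kappa> Z W R x y + \<kappa> Z W T x y" for R T by (simp add: \<kappa>_def \<sigma>_add)
    have "\<delta> v w (c *\<^sub>C R) = c *\<^sub>C \<delta> v w R" for v w c R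
      by (intro ext) (simp add: \<delta>_def scaleC_fun_apply scaleC_zero_right)
    then show "\<kappa> Z W (c *\<^sub>C R) x y = c * \<kappa> Z W R x y" for c R by (simp add: \<kappa>_def \<sigma>_scaleC)
    show "\<kappa> Z W (q Z W P) x y = s Z W P x y" for P
    proof -
      define P' where "P' = (\<lambda>v w. if v = (Z, x) \<and> w = (W, y) then P else 0)"
      have "\<delta> (Z, x) (W, y) (q Z W P) = qq P'"
        using zw by (intro ext) (auto simp: \<delta>_def qq_def P'_def q_zero pts)
      moreover have "ss P' = (\<Sum>v\<in>X. if v = (Z, x) then \<Sum>w\<in>X. if w = (W, y) then s Z W P x y else 0 else 0)"
        unfolding ss_def by (intro sum.cong refl) (auto simp: P'_def s_zero pts pts2 intro!: sum.neutral sum.cong)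
      ultimately show ?thesis using zw X by (simp add: \<kappa>_def \<sigma>_qq)
    qed
  qed
  then show ?thesis by blast
qed

text \<open>A limit over finite sets of pairs. With all vectors available, the null-combination
  lemmas apply to every linear combination and make the extension sesquilinear.\<close>

theorem extends_exists: "\<exists>\<kappa>. extends_on (pts \<times> UNIV) \<kappa>"
proof -
  define D :: "('p \<times> (nat \<Rightarrow> 'e)) set filter" where "D = finite_subsets_at_top (pts \<times> UNIV)"
  define \<kappa> where "\<kappa> = (\<lambda>X. SOME \<kappa>. extends_on X \<kappa>)"
  have \<kappa>: "extends_on X (\<kappa> X)" if "finite X" "X \<subseteq> pts \<times> UNIV" for X
    unfolding \<kappa>_def by (rule someI_ex[OF extends_finite_exists[OF that]])
  have ev: "\<forall>\<^sub>F X in D. extends_on Y (\<kappa> X)" if Y: "finite Y" "Y \<subseteq> pts \<times> UNIV" for Y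
  proof -
    have "extends_on Y (\<kappa> X)" if X: "finite X \<and> Y \<subseteq> X \<and> X \<subseteq> pts \<times> UNIV" for X
      using \<kappa>[of X] X extends_on_mono by blast
    then show ?thesis
      unfolding D_def eventually_finite_subsets_at_top by (intro exI[of _ Y] conjI Y allI impI)
  qed
  have "D \<noteq> bot" by (simp add: D_def)
  from extends_compact[OF order_refl this ev] show ?thesis by metis
qed

end

section \<open>Averaging over intertwiners\<close>

context dominated_kernel begin

text \<open>This lemma and the next two apply \<open>extends_null_left\<close> and
  \<open>extends_null_right\<close> with coefficients (1, -1), (1, 1, -1) and (k, -1).\<close>

lemma extends_vec_cong:
  assumes ext: "extends_on X \<kappa>" and pts: "Z \<in> pts" "W \<in> pts"
    and X: "(Z, x) \<in> X" "(Z, x') \<in> X" "(W, y) \<in> X" and eq: "\<And>a. a < d Z \<Longrightarrow> x a = x' a"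
  shows "\<kappa> Z W R x y = \<kappa> Z W R x' y" "\<kappa> W Z R' y x = \<kappa> W Z R' y x'"
proof -
  let ?c = "\<lambda>i. if i then 1 else - 1 :: complex" and ?v = "\<lambda>i. if i then x else x'"
  have null: "(\<Sum>j\<in>UNIV. ?c j *\<^sub>C ?v j a) = 0" if "a < d Z" for a
    using eq[OF that] by (simp add: UNIV_bool scaleC_minus_left scaleC_one)
  have v: "(Z, ?v j) \<in> X" for j using X by simp
  show "\<kappa> Z W R x y = \<kappa> Z W R x' y"
    using extends_null_left[OF ext pts finite v X(3) null, of R] by (simp add: UNIV_bool)
  show "\<kappa> W Z R' y x = \<kappa> W Z R' y x'"
    using extends_null_right[OF ext pts finite v X(3) null, of R'] by (simp add: UNIV_bool)
qed

lemma extends_add_vec: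
  assumes ext: "extends_on X \<kappa>" and pts: "Z \<in> pts" "W \<in> pts"
    and X: "(Z, x) \<in> X" "(Z, x') \<in> X" "(Z, x + x') \<in> X" "(W, y) \<in> X"
  shows "\<kappa> Z W R (x + x') y = \<kappa> Z W R x y + \<kappa> Z W R x' y"
    "\<kappa> W Z R' y (x + x') = \<kappa> W Z R' y x + \<kappa> W Z R' y x'"
proof -
  let ?c = "\<lambda>i :: bool option. (case i of None \<Rightarrow> - 1 | Some _ \<Rightarrow> (1 :: complex))"
  let ?v = "\<lambda>i :: bool option. case i of None \<Rightarrow> x + x' | Some b \<Rightarrow> if b then x else x'"
  have U: "(UNIV :: bool option set) = {None, Some True, Some False}"
    by (auto simp: UNIV_option_conv UNIV_bool)
  have sumU: "(\<Sum>i\<in>UNIV. f i) = f None + (f (Some True) + f (Some False))" for f :: "bool option \<Rightarrow> 'z::comm_monoid_add"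
    unfolding U by simp
  have null: "(\<Sum>j\<in>UNIV. ?c j *\<^sub>C ?v j a) = 0" if "a < d Z" for a
    unfolding sumU by (simp add: scaleC_minus_left scaleC_one)
  have v: "(Z, ?v j) \<in> X" for j using X by (simp split: option.split)
  show "\<kappa> Z W R (x + x') y = \<kappa> Z W R x y + \<kappa> Z W R x' y"
    using extends_null_left[OF ext pts finite v X(4) null, of R] unfolding sumU
    by (simp add: add_eq_0_iff del: plus_fun_apply)
  show "\<kappa> W Z R' y (x + x') = \<kappa> W Z R' y x + \<kappa> W Z R' y x'"
    using extends_null_right[OF ext pts finite v X(4) null, of R'] unfolding sumU
    by (simp add: add_eq_0_iff del: plus_fun_apply)
qed

lemma extends_scaleC_vec:
  assumes ext: "extends_on X \<kappa>" and pts: "Z \<in> pts" "W \<in> pts"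
    and X: "(Z, x) \<in> X" "(Z, k *\<^sub>C x) \<in> X" "(W, y) \<in> X"
  shows "\<kappa> Z W R (k *\<^sub>C x) y = cnj k * \<kappa> Z W R x y"
    "\<kappa> W Z R' y (k *\<^sub>C x) = k * \<kappa> W Z R' y x"
proof -
  let ?c = "\<lambda>i. if i then k else - 1 :: complex" and ?v = "\<lambda>i. if i then x else k *\<^sub>C x"
  have null: "(\<Sum>j\<in>UNIV. ?c j *\<^sub>C ?v j a) = 0" if "a < d Z" for a
    by (simp add: UNIV_bool scaleC_minus_left scaleC_one scaleC_fun_apply)
  have v: "(Z, ?v j) \<in> X" for j using X by simp
  show "\<kappa> Z W R (k *\<^sub>C x) y = cnj k * \<kappa> Z W R x y"
    using extends_null_left[OF ext pts finite v X(3) null, of R] by (simp add: UNIV_bool)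
  show "\<kappa> W Z R' y (k *\<^sub>C x) = k * \<kappa> W Z R' y x"
    using extends_null_right[OF ext pts finite v X(3) null, of R'] by (simp add: UNIV_bool)
qed

text \<open>A matrix that vanishes on the relevant block has zero form, so all its complex multiples
  are accretive and its value must be 0.\<close>

lemma extends_mat_cong:
  assumes ext: "extends_on X \<kappa>" and X: "(Z, x) \<in> X" "(W, y) \<in> X"
    and eq: "\<And>a b. a < d Z \<Longrightarrow> b < d W \<Longrightarrow> R a b = R' a b"
  shows "\<kappa> Z W R x y = \<kappa> Z W R' x y"
proof -
  define T where "T = R + (-1) *\<^sub>C R'"
  have T0: "T a b = 0" if "a < d Z" "b < d W" for a b
    using eq[OF that] by (simp add: T_def scaleC_fun_apply scaleC_minus_left scaleC_one)
  have bf: "bform act (d Z) (d W) T \<xi> \<eta> = 0" for \<xi> \<eta>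
    by (simp add: bform_def T0 act_zero_left cinner_zero_left)
  have "\<kappa> Z W T x y = 0"
  proof (rule complex_zero_from_rotations[of 0])
    fix z :: complex and t :: real
    define u where "u = (\<lambda>i j. if i \<and> \<not> j then z *\<^sub>C T else 0)"
    define p where "p = (\<lambda>i. if i then Z else W)"
    define v where "v = (\<lambda>i. if i then x else y)"
    have "accretive UNIV p u"
      unfolding accretive_def by (simp add: UNIV_bool u_def p_def bform_scaleC bform_zero bf)
    then have "0 \<le> Re (\<Sum>i\<in>UNIV. \<Sum>j\<in>UNIV. \<kappa> (p i) (p j) (u i j) (v i) (v j))"
      by (intro extends_pos[OF ext]) (auto simp: p_def v_def X)
    then show "0 \<le> t * 0 + Re (z * \<kappa> Z W T x y)"
      by (simp add: UNIV_bool u_def p_def v_def extends_scaleC[OF ext] extends_zero[OF ext] X)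
  qed
  then show ?thesis unfolding T_def by (simp add: extends_add[OF ext X] extends_scaleC[OF ext X] del: plus_fun_apply)
qed

lemma extends_cong:
  assumes ext: "extends_on (F \<times> UNIV) \<kappa>" and pts: "F \<subseteq> pts" "Z \<in> F" "W \<in> F"
    and "\<And>a b. a < d Z \<Longrightarrow> b < d W \<Longrightarrow> R a b = R' a b"
    and "\<And>a. a < d Z \<Longrightarrow> x a = x' a" "\<And>a. a < d W \<Longrightarrow> y a = y' a"
  shows "\<kappa> Z W R x y = \<kappa> Z W R' x' y'"
proof -
  have "\<kappa> Z W R x y = \<kappa> Z W R' x y"
    by (rule extends_mat_cong[OF ext]) (use assms in auto)
  also have "\<dots> = \<kappa> Z W R' x' y"
    by (rule extends_vec_cong(1)[OF ext]) (use assms in auto)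
  also have "\<dots> = \<kappa> Z W R' x' y'"
    by (rule extends_vec_cong(2)[OF ext]) (use assms in auto)
  finally show ?thesis .
qed

text \<open>The set of extensions is convex. There are N + 1 terms, so the divisor is never
  zero.\<close>

lemma extends_average:
  assumes ext: "\<And>k. extends_on X (\<kappa> k)"
  shows "extends_on X (\<lambda>Z W R x y. (\<Sum>k\<le>(N::nat). \<kappa> k Z W R x y) / of_nat (Suc N))"
proof (rule extends_onI)
  fix I :: "nat set" and p x u
  assume I: "finite I" and pX: "\<And>i. i \<in> I \<Longrightarrow> (p i, x i) \<in> X" and acc: "accretive I p u"
  have "(\<Sum>i\<in>I. \<Sum>j\<in>I. (\<Sum>k\<le>N. \<kappa> k (p i) (p j) (u i j) (x i) (x j)) / of_nat (Suc N)) =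
      (\<Sum>k\<le>N. \<Sum>i\<in>I. \<Sum>j\<in>I. \<kappa> k (p i) (p j) (u i j) (x i) (x j)) / of_nat (Suc N)"
    unfolding sum_divide_distrib[symmetric]
    by (subst sum.swap[of _ "{..N}"], subst sum.swap[of _ "{..N}"]) (rule refl)
  also have "0 \<le> Re \<dots>"
  proof -
    have "0 \<le> (\<Sum>k\<le>N. Re (\<Sum>i\<in>I. \<Sum>j\<in>I. \<kappa> k (p i) (p j) (u i j) (x i) (x j)))"
      by (intro sum_nonneg extends_pos_nat[OF ext I pX acc])
    then show ?thesis by (simp only: Re_divide_of_nat Re_sum) simp
  qed
  finally show "0 \<le> Re (\<Sum>i\<in>I. \<Sum>j\<in>I. (\<Sum>k\<le>N. \<kappa> k (p i) (p j) (u i j) (x i) (x j)) / of_nat (Suc N))" .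
next
  fix Z x W y assume zw: "(Z, x) \<in> X" "(W, y) \<in> X"
  note r = extends_add[OF ext zw] extends_scaleC[OF ext zw] extends_eq[OF ext zw]
  show "(\<Sum>k\<le>N. \<kappa> k Z W (R + T) x y) / of_nat (Suc N) = (\<Sum>k\<le>N. \<kappa> k Z W R x y) / of_nat (Suc N) + (\<Sum>k\<le>N. \<kappa> k Z W T x y) / of_nat (Suc N)" for R T
    unfolding r sum.distrib add_divide_distrib ..
  show "(\<Sum>k\<le>N. \<kappa> k Z W (c *\<^sub>C R) x y) / of_nat (Suc N) = c * ((\<Sum>k\<le>N. \<kappa> k Z W R x y) / of_nat (Suc N))" for c R
    unfolding r sum_distrib_left[symmetric] by simp
  show "(\<Sum>k\<le>N. \<kappa> k Z W (q Z W P) x y) / of_nat (Suc N) = s Z W P x y" for P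
  proof -
    have "of_nat (Suc N) \<noteq> (0 :: complex)" by (rule of_nat_neq_0)
    then show ?thesis unfolding r by (simp del: of_nat_Suc)
  qed
qed

end

text \<open>\<open>Hom\<close> abstracts the intertwiners to a linear category of matrices. The
  identity \<open>q_int\<close> is asked only at indices inside the block, because entries outside
  need not transform.\<close>

locale dominated_nc_kernel = dominated_kernel act pts d q s
  for act :: "'a::complex_vector \<Rightarrow> 'h \<Rightarrow> 'h::chilbert_space" and pts :: "'p set" and d q
    and s :: "('p, complex, 'e::complex_vector) form_kernel" +
  fixes Hom :: "'p \<Rightarrow> 'p \<Rightarrow> complex mat set"
  assumes Hom_carrier: "\<alpha> \<in> Hom Z W \<Longrightarrow> \<alpha> \<in> carrier_mat (d W) (d Z)"
    and Hom_one: "Z \<in> pts \<Longrightarrow> 1\<^sub>m (d Z) \<in> Hom Z Z"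
    and Hom_mult: "\<lbrakk>Z \<in> pts; W \<in> pts; V \<in> pts; \<alpha> \<in> Hom Z W; \<beta> \<in> Hom W V\<rbrakk> \<Longrightarrow> \<beta> * \<alpha> \<in> Hom Z V"
    and Hom_add: "\<lbrakk>Z \<in> pts; W \<in> pts; \<alpha> \<in> Hom Z W; \<beta> \<in> Hom Z W\<rbrakk> \<Longrightarrow> \<alpha> + \<beta> \<in> Hom Z W"
    and Hom_smult: "\<lbrakk>Z \<in> pts; W \<in> pts; \<alpha> \<in> Hom Z W\<rbrakk> \<Longrightarrow> c \<cdot>\<^sub>m \<alpha> \<in> Hom Z W"
    and Hom_inverse: "\<lbrakk>Z \<in> pts; W \<in> pts; \<alpha> \<in> Hom Z W; \<beta> \<in> carrier_mat (d Z) (d W); \<alpha> * \<beta> = 1\<^sub>m (d W);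
      \<beta> * \<alpha> = 1\<^sub>m (d Z)\<rbrakk> \<Longrightarrow> \<beta> \<in> Hom W Z"
    and q_int: "\<lbrakk>Z \<in> pts; Z' \<in> pts; W \<in> pts; W' \<in> pts; \<alpha> \<in> Hom Z Z'; \<beta> \<in> Hom W W'; a < d Z'; b < d W'\<rbrakk> \<Longrightarrow>
      q Z' W' (sandwich \<alpha> \<beta> P) a b = sandwich \<alpha> \<beta> (q Z W P) a b"
    and s_int: "\<lbrakk>Z \<in> pts; Z' \<in> pts; W \<in> pts; W' \<in> pts; \<alpha> \<in> Hom Z Z'; \<beta> \<in> Hom W W'\<rbrakk> \<Longrightarrow>
      s Z' W' (sandwich \<alpha> \<beta> P) x y = s Z W P (adj_vec \<alpha> x) (adj_vec \<beta> y)"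

section \<open>The action of invertible endomorphisms on extensions at one point\<close>

locale kernel_at_point = dominated_nc_kernel act pts d q s Hom
  for act :: "'a::complex_vector \<Rightarrow> 'h \<Rightarrow> 'h::chilbert_space" and pts :: "'p set" and d q
    and s :: "('p, complex, 'e::complex_vector) form_kernel" and Hom +
  fixes Y :: 'p
  assumes Y: "Y \<in> pts"
begin

abbreviation "n \<equiv> d Y"
abbreviation "E \<equiv> Hom Y Y"
abbreviation "ext \<kappa> \<equiv> extends_on ({Y} \<times> UNIV) \<kappa>"

definition bimod :: "('p, 'a, 'e) form_kernel \<Rightarrow> complex mat \<Rightarrow> complex mat \<Rightarrow> bool" where
  "bimod \<kappa> \<alpha> \<beta> \<longleftrightarrow> (\<forall>R x y. \<kappa> Y Y (sandwich \<alpha> \<beta> R) x y = \<kappa> Y Y R (adj_vec \<alpha> x) (adj_vec \<beta> y))"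

text \<open>With h inverse to g this is the action of the group of invertible endomorphisms on
  extensions; at Y its fixed points are the kernels with \<open>bimod \<kappa> g g\<close>.\<close>

definition conj_kernel :: "complex mat \<Rightarrow> complex mat \<Rightarrow> ('p, 'a, 'e) form_kernel \<Rightarrow> ('p, 'a, 'e) form_kernel" where
  "conj_kernel g h \<kappa> Z W R x y = \<kappa> Z W (sandwich g g R) (adj_vec h x) (adj_vec h y)"

lemma E_carrier: "\<alpha> \<in> E \<Longrightarrow> \<alpha> \<in> carrier_mat n n"
  by (rule Hom_carrier)

lemmas E_one = Hom_one[OF Y] and E_mem_mult = Hom_mult[OF Y Y Y] and E_add = Hom_add[OF Y Y]
  and E_smult = Hom_smult[OF Y Y] and E_inverse = Hom_inverse[OF Y Y]

lemma E_dims: "\<alpha> \<in> E \<Longrightarrow> dim_row \<alpha> = n" "\<alpha> \<in> E \<Longrightarrow> dim_col \<alpha> = n"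
  using E_carrier by auto

lemmas E_mult = assoc_mult_mat[of _ n n _ n _ n] mult_carrier_mat[of _ n n _ n]
  left_mult_one_mat[of _ n n] right_mult_one_mat[of _ n n]

lemma ext_cong:
  assumes "ext \<kappa>" "\<And>a b. a < n \<Longrightarrow> b < n \<Longrightarrow> R a b = R' a b"
    "\<And>a. a < n \<Longrightarrow> x a = x' a" "\<And>a. a < n \<Longrightarrow> y a = y' a"
  shows "\<kappa> Y Y R x y = \<kappa> Y Y R' x' y'"
  by (rule extends_cong[OF assms(1)]) (use Y assms in auto)

text \<open>Both \<open>q\<close> and \<open>s\<close> respect endomorphisms, so on the image of
  \<open>q\<close> the change of R and the change of the vectors cancel.\<close>

lemma conj_kernel_ext:
  assumes ext: "ext \<kappa>" and g: "g \<in> E" "h \<in> E" "h * g = 1\<^sub>m n"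
  shows "ext (conj_kernel g h \<kappa>)"
proof (rule extends_onI)
  fix I :: "nat set" and p u and x :: "nat \<Rightarrow> nat \<Rightarrow> 'e"
  assume I: "finite I" and pX: "\<And>i. i \<in> I \<Longrightarrow> (p i, x i) \<in> {Y} \<times> UNIV" and acc: "accretive I p u"
  have pY: "p i = Y" if "i \<in> I" for i using pX[OF that] by auto
  have "accretive I p (\<lambda>i j. sandwich g g (u i j))"
    unfolding accretive_def
  proof
    fix \<xi> :: "nat \<Rightarrow> nat \<Rightarrow> 'h"
    have "bform act (d (p i)) (d (p j)) (sandwich g g (u i j)) (\<xi> i) (\<xi> j) =
        bform act (d (p i)) (d (p j)) (u i j) (adj_vec g (\<xi> i)) (adj_vec g (\<xi> j))" if "i \<in> I" "j \<in> I" for i j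
      using bform_sandwich[of g g "u i j" "\<xi> i" "\<xi> j"] by (simp add: pY that E_dims g)
    then show "0 \<le> Re (\<Sum>i\<in>I. \<Sum>j\<in>I. bform act (d (p i)) (d (p j)) (sandwich g g (u i j)) (\<xi> i) (\<xi> j))"
      using acc[unfolded accretive_def, rule_format, of "\<lambda>i. adj_vec g (\<xi> i)"] by simp
  qed
  then show "0 \<le> Re (\<Sum>i\<in>I. \<Sum>j\<in>I. conj_kernel g h \<kappa> (p i) (p j) (u i j) (x i) (x j))"
    unfolding conj_kernel_def by (intro extends_pos_nat[OF ext I]) (use pY in auto)
next
  fix Z W :: 'p and x y :: "nat \<Rightarrow> 'e" assume "(Z, x) \<in> {Y} \<times> UNIV" "(W, y) \<in> {Y} \<times> UNIV"
  then have ZW: "Z = Y" "W = Y" by auto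
  have X: "(Y, x) \<in> {Y} \<times> UNIV" for x :: "nat \<Rightarrow> 'e" by simp
  show "conj_kernel g h \<kappa> Z W (R + T) x y = conj_kernel g h \<kappa> Z W R x y + conj_kernel g h \<kappa> Z W T x y" for R T
    unfolding conj_kernel_def sandwich_add ZW by (rule extends_add[OF ext X X])
  show "conj_kernel g h \<kappa> Z W (c *\<^sub>C R) x y = c * conj_kernel g h \<kappa> Z W R x y" for c R
    unfolding conj_kernel_def sandwich_scaleC ZW by (rule extends_scaleC[OF ext X X])
  show "conj_kernel g h \<kappa> Z W (q Z W P) x y = s Z W P x y" for P
  proof -
    have inv: "adj_vec g (adj_vec h x) a = x a" if "a < n" for x :: "nat \<Rightarrow> 'e" and a
      using adj_vec_mult[OF E_carrier[OF g(2)] E_carrier[OF g(1)] that, of x] adj_vec_one[OF that, of x] g(3) by simp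
    have "conj_kernel g h \<kappa> Y Y (q Y Y P) x y = \<kappa> Y Y (q Y Y (sandwich g g P)) (adj_vec h x) (adj_vec h y)"
      unfolding conj_kernel_def by (rule ext_cong[OF ext]) (simp_all add: q_int[OF Y Y Y Y g(1) g(1)])
    also have "\<dots> = s Y Y (sandwich g g P) (adj_vec h x) (adj_vec h y)"
      by (rule extends_eq[OF ext X X])
    also have "\<dots> = s Y Y P (adj_vec g (adj_vec h x)) (adj_vec g (adj_vec h y))"
      by (rule s_int) (simp_all add: Y g)
    also have "\<dots> = s Y Y P x y" by (rule s_cong[OF Y Y inv inv])
    finally show ?thesis unfolding ZW .
  qed
qed

text \<open>Since g \<alpha> = (g \<alpha> h) g, moving \<alpha> past the conjugation turns it into
  its conjugate.\<close>

lemma conj_kernel_bimod: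
  assumes ext: "ext \<kappa>" and g: "g \<in> E" "h \<in> E" "h * g = 1\<^sub>m n" and \<alpha>: "\<alpha> \<in> E" "\<beta> \<in> E"
    and bi: "bimod \<kappa> (g * \<alpha> * h) (g * \<beta> * h)"
  shows "bimod (conj_kernel g h \<kappa>) \<alpha> \<beta>"
  unfolding bimod_def conj_kernel_def
proof (intro allI)
  fix R and x y :: "nat \<Rightarrow> 'e"
  note c = E_carrier[OF g(1)] E_carrier[OF g(2)] E_carrier[OF \<alpha>(1)] E_carrier[OF \<alpha>(2)]
  have ghg: "g * \<gamma> * h * g = g * \<gamma>" if "\<gamma> \<in> carrier_mat n n" for \<gamma>
    using c that g(3) by (simp add: E_mult del: assoc_mult_mat)
  have cc: "g * \<gamma> * h \<in> carrier_mat n n" if "\<gamma> \<in> carrier_mat n n" for \<gamma> using c that by (simp add: E_mult)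
  have "\<kappa> Y Y (sandwich g g (sandwich \<alpha> \<beta> R)) (adj_vec h x) (adj_vec h y) =
      \<kappa> Y Y (sandwich (g * \<alpha> * h) (g * \<beta> * h) (sandwich g g R)) (adj_vec h x) (adj_vec h y)"
  proof (rule ext_cong[OF ext])
    fix a b assume "a < n" "b < n"
    then have "sandwich g g (sandwich \<alpha> \<beta> R) a b = sandwich (g * \<alpha>) (g * \<beta>) R a b"
      by (rule sandwich_sandwich[OF c(1) c(3) c(1) c(4), symmetric])
    also have "\<dots> = sandwich (g * \<alpha> * h * g) (g * \<beta> * h * g) R a b" using ghg c by simp
    also have "\<dots> = sandwich (g * \<alpha> * h) (g * \<beta> * h) (sandwich g g R) a b"
      by (rule sandwich_sandwich[OF cc c(1) cc c(1)]) (use c \<open>a < n\<close> \<open>b < n\<close> in auto)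
    finally show "sandwich g g (sandwich \<alpha> \<beta> R) a b = sandwich (g * \<alpha> * h) (g * \<beta> * h) (sandwich g g R) a b" .
  qed auto
  also have "\<dots> = \<kappa> Y Y (sandwich g g R) (adj_vec (g * \<alpha> * h) (adj_vec h x)) (adj_vec (g * \<beta> * h) (adj_vec h y))"
    using bi unfolding bimod_def by simp
  also have "\<dots> = \<kappa> Y Y (sandwich g g R) (adj_vec h (adj_vec \<alpha> x)) (adj_vec h (adj_vec \<beta> y))"
  proof (rule ext_cong[OF ext])
    have "adj_vec (g * \<gamma> * h) (adj_vec h x) a = adj_vec h (adj_vec \<gamma> x) a" if \<gamma>: "\<gamma> \<in> carrier_mat n n" and a: "a < n" for \<gamma> x a
    proof -
      have "h * (g * \<gamma> * h) = (h * g) * (\<gamma> * h)"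
        using c \<gamma> by (simp only: assoc_mult_mat[of _ n n _ n _ n] mult_carrier_mat[of _ n n _ n])
      then have "h * (g * \<gamma> * h) = \<gamma> * h" using g(3) c \<gamma> by simp
      then have "adj_vec (\<gamma> * h) x a = adj_vec (g * \<gamma> * h) (adj_vec h x) a"
        using adj_vec_mult[OF c(2) cc[OF \<gamma>] a, of x] by simp
      then show ?thesis using adj_vec_mult[OF \<gamma> c(2) a, of x] by simp
    qed
    then show "\<And>a. a < n \<Longrightarrow> adj_vec (g * \<alpha> * h) (adj_vec h x) a = adj_vec h (adj_vec \<alpha> x) a"
      "\<And>a. a < n \<Longrightarrow> adj_vec (g * \<beta> * h) (adj_vec h y) a = adj_vec h (adj_vec \<beta> y) a"
      using c by auto
  qed auto
  finally show "\<kappa> Y Y (sandwich g g (sandwich \<alpha> \<beta> R)) (adj_vec h x) (adj_vec h y) =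
    \<kappa> Y Y (sandwich g g R) (adj_vec h (adj_vec \<alpha> x)) (adj_vec h (adj_vec \<beta> y))" .
qed

text \<open>The Markov-Kakutani argument for a single affine map: a cluster point of the Cesaro
  means of the orbit is fixed. Conjugation by g maps T into itself, so bimodularity over T holds
  along the whole orbit and passes to the limit.\<close>

lemma mk_step:
  assumes ext: "ext \<kappa>" and g: "g \<in> E" "h \<in> E" "h * g = 1\<^sub>m n" "g * h = 1\<^sub>m n"
    and T: "\<And>\<alpha> \<beta>. (\<alpha>, \<beta>) \<in> T \<Longrightarrow> \<alpha> \<in> E \<and> \<beta> \<in> E \<and> bimod \<kappa> \<alpha> \<beta> \<and> (g * \<alpha> * h, g * \<beta> * h) \<in> T"
  shows "\<exists>\<kappa>'. ext \<kappa>' \<and> (\<forall>(\<alpha>, \<beta>)\<in>T. bimod \<kappa>' \<alpha> \<beta>) \<and> bimod \<kappa>' g g"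
proof -
  define c where "c k = (conj_kernel g h ^^ k) \<kappa>" for k
  have c: "ext (c k) \<and> (\<forall>(\<alpha>, \<beta>)\<in>T. bimod (c k) \<alpha> \<beta>)" for k
  proof (induction k)
    case 0
    then show ?case using ext T by (auto simp: c_def)
  next
    case (Suc k)
    have cS: "c (Suc k) = conj_kernel g h (c k)" by (simp add: c_def)
    have "bimod (c (Suc k)) \<alpha> \<beta>" if ab: "(\<alpha>, \<beta>) \<in> T" for \<alpha> \<beta>
      unfolding cS
    proof (rule conj_kernel_bimod)
      show "bimod (c k) (g * \<alpha> * h) (g * \<beta> * h)" using Suc T[OF ab] by auto
    qed (use Suc g T[OF ab] in simp_all)
    moreover have "ext (c (Suc k))" unfolding cS by (rule conj_kernel_ext) (use Suc g in simp_all)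
    ultimately show ?case by auto
  qed
  define av where "av = (\<lambda>N Z W R x y. (\<Sum>k\<le>(N::nat). c k Z W R x y) / of_nat (Suc N))"
  have av: "ext (av N)" for N unfolding av_def by (rule extends_average) (use c in simp)
  have ev: "\<forall>\<^sub>F N in sequentially. extends_on X (av N)" if "finite X" "X \<subseteq> {Y} \<times> UNIV" for X
    using extends_on_mono[OF av that(2)] by simp
  have sub: "{Y} \<times> UNIV \<subseteq> pts \<times> (UNIV :: (nat \<Rightarrow> 'e) set)" using Y by auto
  obtain D' \<kappa>' where D': "D' \<le> sequentially" "D' \<noteq> bot" and ext': "ext \<kappa>'"
    and lim0: "\<And>Z x W y R. (Z, x) \<in> {Y} \<times> UNIV \<Longrightarrow> (W, y) \<in> {Y} \<times> UNIV \<Longrightarrow> ((\<lambda>N. av N Z W R x y) \<longlongrightarrow> \<kappa>' Z W R x y) D'"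
    by (rule extends_compact[OF sub sequentially_bot ev], assumption+, rule that)
  have lim: "((\<lambda>N. av N Y Y R x y) \<longlongrightarrow> \<kappa>' Y Y R x y) D'" for R x y
    by (rule lim0) simp_all
  have "bimod \<kappa>' \<alpha> \<beta>" if ab: "(\<alpha>, \<beta>) \<in> T" for \<alpha> \<beta>
    unfolding bimod_def
  proof (intro allI)
    fix R and x y :: "nat \<Rightarrow> 'e"
    have "c k Y Y (sandwich \<alpha> \<beta> R) x y = c k Y Y R (adj_vec \<alpha> x) (adj_vec \<beta> y)" for k
      using c[of k] ab unfolding bimod_def by auto
    then have "av N Y Y (sandwich \<alpha> \<beta> R) x y = av N Y Y R (adj_vec \<alpha> x) (adj_vec \<beta> y)" for N
      by (simp add: av_def)
    then show "\<kappa>' Y Y (sandwich \<alpha> \<beta> R) x y = \<kappa>' Y Y R (adj_vec \<alpha> x) (adj_vec \<beta> y)"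
      using tendsto_unique[OF D'(2) lim, of "sandwich \<alpha> \<beta> R" x y] lim[of R "adj_vec \<alpha> x" "adj_vec \<beta> y"] by simp
  qed
  moreover have "bimod \<kappa>' g g"
    unfolding bimod_def
  proof (intro allI)
    fix R and x y :: "nat \<Rightarrow> 'e"
    have fix': "\<kappa>' Y Y (sandwich g g R) (adj_vec h x) (adj_vec h y) = \<kappa>' Y Y R x y" for x y :: "nat \<Rightarrow> 'e"
    proof -
      obtain B where B: "\<forall>X \<kappa>. extends_on X \<kappa> \<longrightarrow> (Y, x) \<in> X \<longrightarrow> (Y, y) \<in> X \<longrightarrow> cmod (\<kappa> Y Y R x y) \<le> B"
        using extends_bounded[OF Y Y, of x y R] ..
      have cB: "cmod (c k Y Y R x y) \<le> B" for k
        by (rule B[rule_format, of "{Y} \<times> UNIV"]) (use c in simp_all)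
      have cS: "c k Y Y (sandwich g g R) (adj_vec h x) (adj_vec h y) = c (Suc k) Y Y R x y" for k
        by (simp add: c_def conj_kernel_def)
      \<comment> \<open>The difference of the two means telescopes to two terms, each bounded by B,
        over N + 1.\<close>
      have diff: "av N Y Y (sandwich g g R) (adj_vec h x) (adj_vec h y) - av N Y Y R x y
          = (c (Suc N) Y Y R x y - c 0 Y Y R x y) / of_nat (Suc N)" for N
      proof -
        have "(\<Sum>k\<le>N. c (Suc k) Y Y R x y) - (\<Sum>k\<le>N. c k Y Y R x y) = c (Suc N) Y Y R x y - c 0 Y Y R x y"
          by (induction N) (auto simp: algebra_simps)
        then show ?thesis unfolding av_def cS diff_divide_distrib[symmetric] by simp
      qed
      have "(\<lambda>N. av N Y Y (sandwich g g R) (adj_vec h x) (adj_vec h y) - av N Y Y R x y) \<longlonglongrightarrow> 0"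
      proof (rule Lim_null_comparison)
        show "\<forall>\<^sub>F N in sequentially. norm (av N Y Y (sandwich g g R) (adj_vec h x) (adj_vec h y) - av N Y Y R x y) \<le> (2 * B) / real (Suc N)"
        proof (rule always_eventually, rule allI)
          fix N
          have "norm (c (Suc N) Y Y R x y - c 0 Y Y R x y) \<le> 2 * B"
            using norm_triangle_ineq4[of "c (Suc N) Y Y R x y" "c 0 Y Y R x y"] cB[of "Suc N"] cB[of 0] by linarith
          then show "norm (av N Y Y (sandwich g g R) (adj_vec h x) (adj_vec h y) - av N Y Y R x y) \<le> (2 * B) / real (Suc N)"
            unfolding diff norm_divide norm_of_nat by (intro divide_right_mono) auto
        qed
        have "(\<lambda>N. (2 * B) * inverse (real (Suc N))) \<longlonglongrightarrow> (2 * B) * 0"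
          by (intro tendsto_intros LIMSEQ_inverse_real_of_nat)
        then show "(\<lambda>N. (2 * B) / real (Suc N)) \<longlonglongrightarrow> 0" by (simp add: divide_inverse)
      qed
      then have "((\<lambda>N. av N Y Y (sandwich g g R) (adj_vec h x) (adj_vec h y) - av N Y Y R x y) \<longlongrightarrow> 0) D'"
        by (rule tendsto_mono[OF D'(1)])
      moreover have "((\<lambda>N. av N Y Y (sandwich g g R) (adj_vec h x) (adj_vec h y) - av N Y Y R x y) \<longlongrightarrow>
          \<kappa>' Y Y (sandwich g g R) (adj_vec h x) (adj_vec h y) - \<kappa>' Y Y R x y) D'"
        by (intro tendsto_diff lim)
      ultimately show ?thesis using tendsto_unique[OF D'(2)] by fastforce
    qed
    have inv: "adj_vec h (adj_vec g x) a = x a" if "a < n" for x :: "nat \<Rightarrow> 'e" and a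
      using adj_vec_mult[OF E_carrier[OF g(1)] E_carrier[OF g(2)] that, of x] adj_vec_one[OF that, of x] g(4) by simp
    have "\<kappa>' Y Y (sandwich g g R) x y = \<kappa>' Y Y (sandwich g g R) (adj_vec h (adj_vec g x)) (adj_vec h (adj_vec g y))"
      by (rule ext_cong[OF ext']) (simp_all add: inv)
    then show "\<kappa>' Y Y (sandwich g g R) x y = \<kappa>' Y Y R (adj_vec g x) (adj_vec g y)"
      by (simp add: fix')
  qed
  ultimately show ?thesis using ext' by auto
qed

end

lemma mat_inverse_exists:
  fixes a :: "complex mat"
  assumes a: "a \<in> carrier_mat n n" and inj: "\<And>v. v \<in> carrier_vec n \<Longrightarrow> a *\<^sub>v v = 0\<^sub>v n \<Longrightarrow> v = 0\<^sub>v n"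
  shows "\<exists>h\<in>carrier_mat n n. a * h = 1\<^sub>m n \<and> h * a = 1\<^sub>m n"
proof -
  have "det a \<noteq> 0" using det_0_iff_vec_prod_zero[OF a] inj by auto
  from det_non_zero_imp_unit[OF a this, of "()"] show ?thesis
    by (auto simp: Units_def ring_mat_def)
qed

text \<open>An estimate in the maximum norm: M dominates every row sum of a, so for |z| = 1 / (M +
  1) the matrix z a is a strict contraction and 1 + z a has trivial null space.\<close>

lemma one_plus_small_invertible:
  fixes a :: "complex mat"
  assumes a: "a \<in> carrier_mat n n"
  shows "\<exists>\<epsilon>>0. \<forall>z. cmod z = \<epsilon> \<longrightarrow> (\<exists>h\<in>carrier_mat n n. (1\<^sub>m n + z \<cdot>\<^sub>m a) * h = 1\<^sub>m n \<and> h * (1\<^sub>m n + z \<cdot>\<^sub>m a) = 1\<^sub>m n)"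
proof -
  define M where "M = (\<Sum>i<n. \<Sum>j<n. cmod (a $$ (i, j)))"
  have M0: "M \<ge> 0" unfolding M_def by (intro sum_nonneg) auto
  have row: "(\<Sum>j<n. cmod (a $$ (i, j))) \<le> M" if "i < n" for i
    unfolding M_def using that by (intro member_le_sum[of i "{..<n}" "\<lambda>i. \<Sum>j<n. cmod (a $$ (i, j))"]) (auto intro: sum_nonneg)
  have "\<exists>h\<in>carrier_mat n n. (1\<^sub>m n + z \<cdot>\<^sub>m a) * h = 1\<^sub>m n \<and> h * (1\<^sub>m n + z \<cdot>\<^sub>m a) = 1\<^sub>m n"
    if z: "cmod z = 1 / (M + 1)" for z
  proof (rule mat_inverse_exists)
    show "1\<^sub>m n + z \<cdot>\<^sub>m a \<in> carrier_mat n n" using a by simp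
    fix v assume v: "v \<in> carrier_vec n" and eq: "(1\<^sub>m n + z \<cdot>\<^sub>m a) *\<^sub>v v = 0\<^sub>v n"
    show "v = 0\<^sub>v n"
    proof (cases "n = 0")
      case True
      then show ?thesis using v by auto
    next
      case False
      define B where "B = Max ((\<lambda>i. cmod (v $ i)) ` {..<n})"
      have le: "cmod (v $ i) \<le> B" if "i < n" for i unfolding B_def using that by (intro Max_ge) auto
      have "B \<in> (\<lambda>i. cmod (v $ i)) ` {..<n}" unfolding B_def using False by (intro Max_in) auto
      then obtain i where i: "i < n" "cmod (v $ i) = B" by auto
      have "((1\<^sub>m n + z \<cdot>\<^sub>m a) *\<^sub>v v) $ i = 0" using eq i by simp
      moreover have "((1\<^sub>m n + z \<cdot>\<^sub>m a) *\<^sub>v v) = v + z \<cdot>\<^sub>v (a *\<^sub>v v)"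
        using a v by (intro eq_vecI) (auto simp: add_mult_distrib_mat_vec[of _ n n])
      ultimately have "v $ i + z * (a *\<^sub>v v) $ i = 0" using a v i by simp
      then have "v $ i = - (z * (a *\<^sub>v v) $ i)" by (simp add: eq_neg_iff_add_eq_0)
      then have Bz: "B = cmod z * cmod ((a *\<^sub>v v) $ i)" using i by (metis norm_minus_cancel norm_mult)
      have "cmod ((a *\<^sub>v v) $ i) \<le> (\<Sum>j<n. cmod (a $$ (i, j)) * B)"
      proof -
        have "(a *\<^sub>v v) $ i = (\<Sum>j<n. a $$ (i, j) * v $ j)"
          using a v i by (auto simp: scalar_prod_def atLeast0LessThan intro!: sum.cong)
        then show ?thesis using le by (auto simp: norm_mult intro!: sum_norm_le mult_left_mono)
      qed
      also have "\<dots> \<le> M * B"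
        unfolding sum_distrib_right[symmetric] using row[OF i(1)] le[OF i(1)] norm_ge_zero[of "v $ i"]
        by (intro mult_right_mono) linarith+
      finally have "cmod z * cmod ((a *\<^sub>v v) $ i) \<le> cmod z * (M * B)" by (rule mult_left_mono) simp
      with Bz have "B \<le> (1 / (M + 1)) * (M * B)" using z by simp
      then have "B * (M + 1) \<le> M * B" using M0 by (simp add: field_simps)
      then have "B \<le> 0" by (simp add: algebra_simps)
      then have "v $ j = 0" if "j < n" for j using order_trans[OF le[OF that] \<open>B \<le> 0\<close>] by simp
      then show ?thesis using v by auto
    qed
  qed
  then show ?thesis using M0 by (intro exI[of _ "1 / (M + 1)"]) auto
qed

section \<open>One-sided bimodularity, gained along a filtration of the endomorphisms\<close>

context kernel_at_point begin

text \<open>One-sided bimodularity. Unlike \<open>bimod \<kappa> \<alpha> \<alpha>\<close>, which is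
  what averaging yields directly, it is a linear condition on the element.\<close>

definition central :: "('p, 'a, 'e) form_kernel \<Rightarrow> complex mat \<Rightarrow> bool" where
  "central \<kappa> \<alpha> \<longleftrightarrow> bimod \<kappa> \<alpha> (1\<^sub>m n) \<and> bimod \<kappa> (1\<^sub>m n) \<alpha>"

lemma sandwich_add_left: "\<alpha> \<in> carrier_mat n n \<Longrightarrow> \<beta> \<in> carrier_mat n n \<Longrightarrow> a < n \<Longrightarrow>
    sandwich (\<alpha> + \<beta>) \<gamma> R a b = sandwich \<alpha> \<gamma> R a b + sandwich \<beta> \<gamma> R a b"
  by (auto simp: sandwich_def distrib_right scaleC_add_left sum.distrib)

lemma sandwich_add_right: "\<alpha> \<in> carrier_mat n n \<Longrightarrow> \<beta> \<in> carrier_mat n n \<Longrightarrow> b < n \<Longrightarrow>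
    sandwich \<gamma> (\<alpha> + \<beta>) R a b = sandwich \<gamma> \<alpha> R a b + sandwich \<gamma> \<beta> R a b"
  by (auto simp: sandwich_def distrib_left scaleC_add_left sum.distrib)

lemma sandwich_smult_left: "\<alpha> \<in> carrier_mat n n \<Longrightarrow> a < n \<Longrightarrow>
    sandwich (c \<cdot>\<^sub>m \<alpha>) \<gamma> R a b = c *\<^sub>C sandwich \<alpha> \<gamma> R a b"
  by (auto simp: sandwich_def scaleC_sum_right scaleC_scaleC mult.assoc)

lemma sandwich_smult_right: "\<alpha> \<in> carrier_mat n n \<Longrightarrow> b < n \<Longrightarrow>
    sandwich \<gamma> (c \<cdot>\<^sub>m \<alpha>) R a b = cnj c *\<^sub>C sandwich \<gamma> \<alpha> R a b"
  by (auto simp: sandwich_def scaleC_sum_right scaleC_scaleC mult.left_commute)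

lemma adj_vec_add_mat: "\<alpha> \<in> carrier_mat n n \<Longrightarrow> \<beta> \<in> carrier_mat n n \<Longrightarrow> a < n \<Longrightarrow>
    adj_vec (\<alpha> + \<beta>) x a = adj_vec \<alpha> x a + adj_vec \<beta> x a"
  by (auto simp: adj_vec_def scaleC_add_left sum.distrib)

lemma adj_vec_smult_mat: "\<alpha> \<in> carrier_mat n n \<Longrightarrow> a < n \<Longrightarrow>
    adj_vec (c \<cdot>\<^sub>m \<alpha>) x a = cnj c *\<^sub>C adj_vec \<alpha> x a"
  by (auto simp: adj_vec_def scaleC_sum_right scaleC_scaleC)

lemma ext_linear:
  assumes "ext \<kappa>"
  shows "\<kappa> Y Y (R + T) x y = \<kappa> Y Y R x y + \<kappa> Y Y T x y"
    "\<kappa> Y Y (c *\<^sub>C R) x y = c * \<kappa> Y Y R x y"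
    "\<kappa> Y Y R (x + x') y = \<kappa> Y Y R x y + \<kappa> Y Y R x' y"
    "\<kappa> Y Y R x (y + x') = \<kappa> Y Y R x y + \<kappa> Y Y R x x'"
    "\<kappa> Y Y R (c *\<^sub>C x) y = cnj c * \<kappa> Y Y R x y"
    "\<kappa> Y Y R x (c *\<^sub>C y) = c * \<kappa> Y Y R x y"
proof -
  have X: "(Y, x) \<in> {Y} \<times> UNIV" for x :: "nat \<Rightarrow> 'e" by simp
  show "\<kappa> Y Y (R + T) x y = \<kappa> Y Y R x y + \<kappa> Y Y T x y" by (rule extends_add[OF assms X X])
  show "\<kappa> Y Y (c *\<^sub>C R) x y = c * \<kappa> Y Y R x y" by (rule extends_scaleC[OF assms X X])
  show "\<kappa> Y Y R (x + x') y = \<kappa> Y Y R x y + \<kappa> Y Y R x' y" by (rule extends_add_vec(1)[OF assms Y Y X X X X])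
  show "\<kappa> Y Y R x (y + x') = \<kappa> Y Y R x y + \<kappa> Y Y R x x'" by (rule extends_add_vec(2)[OF assms Y Y X X X X])
  show "\<kappa> Y Y R (c *\<^sub>C x) y = cnj c * \<kappa> Y Y R x y" by (rule extends_scaleC_vec(1)[OF assms Y Y X X X])
  show "\<kappa> Y Y R x (c *\<^sub>C y) = c * \<kappa> Y Y R x y" by (rule extends_scaleC_vec(2)[OF assms Y Y X X X])
qed

lemma central_add:
  assumes ext: "ext \<kappa>" and E: "\<alpha> \<in> E" "\<beta> \<in> E" and c: "central \<kappa> \<alpha>" "central \<kappa> \<beta>"
  shows "central \<kappa> (\<alpha> + \<beta>)"
proof -
  note ab = E_carrier[OF E(1)] E_carrier[OF E(2)]
  have "\<kappa> Y Y (sandwich (\<alpha> + \<beta>) (1\<^sub>m n) R) x y = \<kappa> Y Y R (adj_vec (\<alpha> + \<beta>) x) (adj_vec (1\<^sub>m n) y)" for R x y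
  proof -
    have "\<kappa> Y Y (sandwich (\<alpha> + \<beta>) (1\<^sub>m n) R) x y = \<kappa> Y Y (sandwich \<alpha> (1\<^sub>m n) R + sandwich \<beta> (1\<^sub>m n) R) x y"
      by (rule ext_cong[OF ext]) (simp_all add: sandwich_add_left[OF ab])
    also have "\<dots> = \<kappa> Y Y R (adj_vec \<alpha> x + adj_vec \<beta> x) (adj_vec (1\<^sub>m n) y)"
      using c unfolding central_def bimod_def ext_linear[OF ext] by simp
    also have "\<dots> = \<kappa> Y Y R (adj_vec (\<alpha> + \<beta>) x) (adj_vec (1\<^sub>m n) y)"
      by (rule ext_cong[OF ext]) (simp_all add: adj_vec_add_mat[OF ab])
    finally show ?thesis .
  qed
  moreover have "\<kappa> Y Y (sandwich (1\<^sub>m n) (\<alpha> + \<beta>) R) x y = \<kappa> Y Y R (adj_vec (1\<^sub>m n) x) (adj_vec (\<alpha> + \<beta>) y)" for R x y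
  proof -
    have "\<kappa> Y Y (sandwich (1\<^sub>m n) (\<alpha> + \<beta>) R) x y = \<kappa> Y Y (sandwich (1\<^sub>m n) \<alpha> R + sandwich (1\<^sub>m n) \<beta> R) x y"
      by (rule ext_cong[OF ext]) (simp_all add: sandwich_add_right[OF ab])
    also have "\<dots> = \<kappa> Y Y R (adj_vec (1\<^sub>m n) x) (adj_vec \<alpha> y + adj_vec \<beta> y)"
      using c unfolding central_def bimod_def ext_linear[OF ext] by simp
    also have "\<dots> = \<kappa> Y Y R (adj_vec (1\<^sub>m n) x) (adj_vec (\<alpha> + \<beta>) y)"
      by (rule ext_cong[OF ext]) (simp_all add: adj_vec_add_mat[OF ab])
    finally show ?thesis .
  qed
  ultimately show ?thesis unfolding central_def bimod_def by blast
qed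

lemma central_smult:
  assumes ext: "ext \<kappa>" and E: "\<alpha> \<in> E" and c: "central \<kappa> \<alpha>"
  shows "central \<kappa> (k \<cdot>\<^sub>m \<alpha>)"
proof -
  note a = E_carrier[OF E]
  have "\<kappa> Y Y (sandwich (k \<cdot>\<^sub>m \<alpha>) (1\<^sub>m n) R) x y = \<kappa> Y Y R (adj_vec (k \<cdot>\<^sub>m \<alpha>) x) (adj_vec (1\<^sub>m n) y)" for R x y
  proof -
    have "\<kappa> Y Y (sandwich (k \<cdot>\<^sub>m \<alpha>) (1\<^sub>m n) R) x y = \<kappa> Y Y (k *\<^sub>C sandwich \<alpha> (1\<^sub>m n) R) x y"
      by (rule ext_cong[OF ext]) (simp_all add: sandwich_smult_left[OF a] scaleC_fun_apply)
    also have "\<dots> = \<kappa> Y Y R (cnj k *\<^sub>C adj_vec \<alpha> x) (adj_vec (1\<^sub>m n) y)"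
      using c unfolding central_def bimod_def ext_linear[OF ext] by simp
    also have "\<dots> = \<kappa> Y Y R (adj_vec (k \<cdot>\<^sub>m \<alpha>) x) (adj_vec (1\<^sub>m n) y)"
      by (rule ext_cong[OF ext]) (simp_all add: adj_vec_smult_mat[OF a] scaleC_fun_apply)
    finally show ?thesis .
  qed
  moreover have "\<kappa> Y Y (sandwich (1\<^sub>m n) (k \<cdot>\<^sub>m \<alpha>) R) x y = \<kappa> Y Y R (adj_vec (1\<^sub>m n) x) (adj_vec (k \<cdot>\<^sub>m \<alpha>) y)" for R x y
  proof -
    have "\<kappa> Y Y (sandwich (1\<^sub>m n) (k \<cdot>\<^sub>m \<alpha>) R) x y = \<kappa> Y Y (cnj k *\<^sub>C sandwich (1\<^sub>m n) \<alpha> R) x y"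
      by (rule ext_cong[OF ext]) (simp_all add: sandwich_smult_right[OF a] scaleC_fun_apply)
    also have "\<dots> = \<kappa> Y Y R (adj_vec (1\<^sub>m n) x) (cnj k *\<^sub>C adj_vec \<alpha> y)"
      using c unfolding central_def bimod_def ext_linear[OF ext] by simp
    also have "\<dots> = \<kappa> Y Y R (adj_vec (1\<^sub>m n) x) (adj_vec (k \<cdot>\<^sub>m \<alpha>) y)"
      by (rule ext_cong[OF ext]) (simp_all add: adj_vec_smult_mat[OF a] scaleC_fun_apply)
    finally show ?thesis .
  qed
  ultimately show ?thesis unfolding central_def bimod_def by blast
qed

text \<open>Three values of z separate the coefficients of z, of its conjugate and of its squared
  modulus: e and -e give c = 0 and p + r = 0, and i e gives p = r.\<close>

lemma three_rotations:
  fixes p r c :: complex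
  assumes e: "e > (0::real)" and eq: "\<And>z. z \<in> {complex_of_real e, - complex_of_real e, \<i> * complex_of_real e} \<Longrightarrow>
    z * p + cnj z * r + z * cnj z * c = 0"
  shows "p = 0" "r = 0"
proof -
  have 1: "complex_of_real e * (p + r + complex_of_real e * c) = 0"
    using eq[of "complex_of_real e"] by (simp add: algebra_simps)
  have 2: "complex_of_real e * (- p - r + complex_of_real e * c) = 0"
    using eq[of "- complex_of_real e"] by (simp add: algebra_simps)
  have 3: "complex_of_real e * (\<i> * p - \<i> * r + complex_of_real e * c) = 0"
    using eq[of "\<i> * complex_of_real e"] by (simp add: algebra_simps)
  have e0: "complex_of_real e \<noteq> 0" using e by simp
  have a: "p + r + complex_of_real e * c = 0" "- p - r + complex_of_real e * c = 0"
    "\<i> * p - \<i> * r + complex_of_real e * c = 0"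
    using 1 2 3 e0 by simp_all
  then have "(p + r + complex_of_real e * c) + (- p - r + complex_of_real e * c) = 0" by simp
  then have "c = 0" using e by simp
  then have b: "p + r = 0" "\<i> * (p - r) = 0" using a by (simp_all add: right_diff_distrib)
  then have "p = r" by simp
  then show "p = 0" "r = 0" using b by simp_all
qed

text \<open>Averaging over the powers of \<open>1 + z a\<close> for three values of \<open>z\<close> and polarizing.\<close>

lemma central_insert:
  assumes ext: "ext \<kappa>" and T: "T \<subseteq> E" "\<And>t. t \<in> T \<Longrightarrow> central \<kappa> t" and a: "a \<in> E"
    and norm: "\<And>t h z. t \<in> T \<Longrightarrow> h \<in> E \<Longrightarrow> (1\<^sub>m n + z \<cdot>\<^sub>m a) * h = 1\<^sub>m n \<Longrightarrow> (1\<^sub>m n + z \<cdot>\<^sub>m a) * t * h \<in> T"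
  shows "\<exists>\<kappa>'. ext \<kappa>' \<and> (\<forall>t\<in>T. central \<kappa>' t) \<and> central \<kappa>' a"
proof -
  note ac = E_carrier[OF a]
  obtain \<epsilon> where \<epsilon>: "\<epsilon> > 0" and inv: "\<forall>z. cmod z = \<epsilon> \<longrightarrow> (\<exists>h\<in>carrier_mat n n. (1\<^sub>m n + z \<cdot>\<^sub>m a) * h = 1\<^sub>m n \<and> h * (1\<^sub>m n + z \<cdot>\<^sub>m a) = 1\<^sub>m n)"
    using one_plus_small_invertible[OF ac] by auto
  define g where "g z = 1\<^sub>m n + z \<cdot>\<^sub>m a" for z
  have gE: "g z \<in> E" for z unfolding g_def by (intro E_add E_one E_smult a)
  have gc: "g z \<in> carrier_mat n n" for z by (rule E_carrier[OF gE])
  \<comment> \<open>As these elements commute with each other, conjugation by one of them leaves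
    bimodularity under the others alone.\<close>
  have comm: "g z * g w = g w * g z" for z w
    unfolding g_def using ac
    by (intro eq_matI) (auto simp: add_mult_distrib_mat[of _ n n _ _ n] mult_add_distrib_mat[of _ n n _ n] algebra_simps)
  have list: "set zs \<subseteq> {z. cmod z = \<epsilon>} \<Longrightarrow> \<exists>\<kappa>'. ext \<kappa>' \<and> (\<forall>t\<in>T. central \<kappa>' t) \<and> (\<forall>z\<in>set zs. bimod \<kappa>' (g z) (g z))" for zs
  proof (induction zs)
    case Nil
    show ?case using ext T by (intro exI[of _ \<kappa>]) simp
  next
    case (Cons z zs)
    then obtain \<kappa>1 where k1: "ext \<kappa>1" "\<forall>t\<in>T. central \<kappa>1 t" "\<forall>w\<in>set zs. bimod \<kappa>1 (g w) (g w)" by auto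
    have "cmod z = \<epsilon>" using Cons.prems by simp
    then obtain h where h: "h \<in> carrier_mat n n" "g z * h = 1\<^sub>m n" "h * g z = 1\<^sub>m n"
      using inv unfolding g_def by auto
    have hE: "h \<in> E" by (rule E_inverse[OF gE h])
    \<comment> \<open>All conditions to be kept: centrality of the members of T, written as pairs
      with the identity on one side, and bimodularity under the elements treated so far.\<close>
    define TT where "TT = (\<lambda>t. (t, 1\<^sub>m n)) ` T \<union> (\<lambda>t. (1\<^sub>m n, t)) ` T \<union> (\<lambda>w. (g w, g w)) ` set zs"
    have one: "g z * 1\<^sub>m n * h = 1\<^sub>m n" using h gc[of z] by simp
    have nT: "g z * t * h \<in> T" if "t \<in> T" for t
      using norm[OF that hE] h(2) unfolding g_def by simp
    have gw: "g z * g w * h = g w" for w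
      using h gc[of z] gc[of w] comm[of z w] by (simp add: E_mult)
    have "\<exists>\<kappa>'. ext \<kappa>' \<and> (\<forall>(\<alpha>, \<beta>)\<in>TT. bimod \<kappa>' \<alpha> \<beta>) \<and> bimod \<kappa>' (g z) (g z)"
    proof (rule mk_step[OF k1(1) gE hE h(3) h(2)])
      fix \<alpha> \<beta> assume "(\<alpha>, \<beta>) \<in> TT"
      then consider t where "t \<in> T" "\<alpha> = t" "\<beta> = 1\<^sub>m n" | t where "t \<in> T" "\<alpha> = 1\<^sub>m n" "\<beta> = t"
        | w where "w \<in> set zs" "\<alpha> = g w" "\<beta> = g w"
        unfolding TT_def by auto
      then show "\<alpha> \<in> E \<and> \<beta> \<in> E \<and> bimod \<kappa>1 \<alpha> \<beta> \<and> (g z * \<alpha> * h, g z * \<beta> * h) \<in> TT"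
      proof cases
        case 1
        then show ?thesis using T k1 nT[of t] E_one one unfolding TT_def central_def by auto
      next
        case 2
        then show ?thesis using T k1 nT[of t] E_one one unfolding TT_def central_def by auto
      next
        case 3
        then show ?thesis using k1 gE gw[of w] unfolding TT_def by auto
      qed
    qed
    then obtain \<kappa>2 where k2: "ext \<kappa>2" "\<forall>(\<alpha>, \<beta>)\<in>TT. bimod \<kappa>2 \<alpha> \<beta>" "bimod \<kappa>2 (g z) (g z)" by auto
    have "\<forall>t\<in>T. central \<kappa>2 t" using k2(2) unfolding TT_def central_def by auto
    moreover have "\<forall>w\<in>set (z # zs). bimod \<kappa>2 (g w) (g w)" using k2 unfolding TT_def by auto
    ultimately show ?case using k2(1) by blast
  qed
  define zs where "zs = [complex_of_real \<epsilon>, - complex_of_real \<epsilon>, \<i> * complex_of_real \<epsilon>]"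
  have "set zs \<subseteq> {z. cmod z = \<epsilon>}" using \<epsilon> by (auto simp: zs_def norm_mult)
  from list[OF this] obtain \<kappa>' where k: "ext \<kappa>'" "\<forall>t\<in>T. central \<kappa>' t" "\<forall>z\<in>set zs. bimod \<kappa>' (g z) (g z)" by auto
  \<comment> \<open>Bimodularity under 1 + z a is expanded: p, r and c are the defects for the pairs
    (a, 1), (1, a) and (a, a), and they enter with coefficients z, its conjugate and its squared
    modulus.\<close>
  have main: "\<kappa>' Y Y (sandwich a (1\<^sub>m n) R) x y = \<kappa>' Y Y R (adj_vec a x) (adj_vec (1\<^sub>m n) y) \<and>
    \<kappa>' Y Y (sandwich (1\<^sub>m n) a R) x y = \<kappa>' Y Y R (adj_vec (1\<^sub>m n) x) (adj_vec a y)" for R x y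
  proof -
    have id: "sandwich (1\<^sub>m n) (1\<^sub>m n) R i j = R i j" if "i < n" "j < n" for i j by (rule sandwich_one[OF that])
    define p where "p = \<kappa>' Y Y (sandwich a (1\<^sub>m n) R) x y - \<kappa>' Y Y R (adj_vec a x) (adj_vec (1\<^sub>m n) y)"
    define r where "r = \<kappa>' Y Y (sandwich (1\<^sub>m n) a R) x y - \<kappa>' Y Y R (adj_vec (1\<^sub>m n) x) (adj_vec a y)"
    define c where "c = \<kappa>' Y Y (sandwich a a R) x y - \<kappa>' Y Y R (adj_vec a x) (adj_vec a y)"
    have "z * p + cnj z * r + z * cnj z * c = 0" if z: "z \<in> set zs" for z
    proof -
      note one = one_carrier_mat[of n] and zc = smult_carrier_mat[OF ac, of z]
      have "\<kappa>' Y Y (sandwich (g z) (g z) R) x y = \<kappa>' Y Y (R + z *\<^sub>C sandwich a (1\<^sub>m n) R + cnj z *\<^sub>C sandwich (1\<^sub>m n) a R + (z * cnj z) *\<^sub>C sandwich a a R) x y"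
        by (rule ext_cong[OF k(1)])
          (simp_all add: g_def sandwich_add_left[OF one zc] sandwich_add_right[OF one zc] sandwich_smult_left[OF ac] sandwich_smult_right[OF ac] id scaleC_fun_apply scaleC_scaleC scaleC_add_right algebra_simps)
      then have L: "\<kappa>' Y Y (sandwich (g z) (g z) R) x y = \<kappa>' Y Y R x y + z * \<kappa>' Y Y (sandwich a (1\<^sub>m n) R) x y + cnj z * \<kappa>' Y Y (sandwich (1\<^sub>m n) a R) x y + z * cnj z * \<kappa>' Y Y (sandwich a a R) x y"
        unfolding ext_linear[OF k(1)] .
      have av: "adj_vec (g z) x i = (adj_vec (1\<^sub>m n) x + cnj z *\<^sub>C adj_vec a x) i" if "i < n" for i and x :: "nat \<Rightarrow> 'e"
        using that by (simp add: g_def adj_vec_add_mat[OF one zc] adj_vec_smult_mat[OF ac] scaleC_fun_apply)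
      have "\<kappa>' Y Y R (adj_vec (g z) x) (adj_vec (g z) y) = \<kappa>' Y Y R (adj_vec (1\<^sub>m n) x + cnj z *\<^sub>C adj_vec a x) (adj_vec (1\<^sub>m n) y + cnj z *\<^sub>C adj_vec a y)"
        by (rule ext_cong[OF k(1) refl av av])
      also have "\<dots> = \<kappa>' Y Y R (adj_vec (1\<^sub>m n) x) (adj_vec (1\<^sub>m n) y) + z * \<kappa>' Y Y R (adj_vec a x) (adj_vec (1\<^sub>m n) y)
         + cnj z * \<kappa>' Y Y R (adj_vec (1\<^sub>m n) x) (adj_vec a y) + z * cnj z * \<kappa>' Y Y R (adj_vec a x) (adj_vec a y)"
        unfolding ext_linear[OF k(1)] by (simp add: algebra_simps)
      also have "\<kappa>' Y Y R (adj_vec (1\<^sub>m n) x) (adj_vec (1\<^sub>m n) y) = \<kappa>' Y Y R x y"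
        by (rule ext_cong[OF k(1)]) (simp_all add: adj_vec_one)
      finally have R: "\<kappa>' Y Y R (adj_vec (g z) x) (adj_vec (g z) y) = \<kappa>' Y Y R x y + z * \<kappa>' Y Y R (adj_vec a x) (adj_vec (1\<^sub>m n) y)
         + cnj z * \<kappa>' Y Y R (adj_vec (1\<^sub>m n) x) (adj_vec a y) + z * cnj z * \<kappa>' Y Y R (adj_vec a x) (adj_vec a y)" .
      have "\<kappa>' Y Y (sandwich (g z) (g z) R) x y = \<kappa>' Y Y R (adj_vec (g z) x) (adj_vec (g z) y)"
        using k(3) z unfolding bimod_def by auto
      then show ?thesis unfolding L R p_def r_def c_def by (simp add: algebra_simps)
    qed
    then have "p = 0" "r = 0" using three_rotations[OF \<epsilon>, of p r c] by (auto simp: zs_def)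
    then show ?thesis by (simp add: p_def r_def)
  qed
  then have "central \<kappa>' a" unfolding central_def bimod_def by blast
  then show ?thesis using k by blast
qed

text \<open>Centrality of one element is a closed condition, so by compactness finite sets of
  elements suffice.\<close>

lemma central_union:
  assumes fin: "\<And>F. finite F \<Longrightarrow> F \<subseteq> J \<Longrightarrow> \<exists>\<kappa>. ext \<kappa> \<and> (\<forall>t\<in>F. central \<kappa> t)"
  shows "\<exists>\<kappa>. ext \<kappa> \<and> (\<forall>t\<in>J. central \<kappa> t)"
proof -
  define \<kappa> where "\<kappa> F = (SOME \<kappa>. ext \<kappa> \<and> (\<forall>t\<in>F. central \<kappa> t))" for F
  have \<kappa>: "ext (\<kappa> F) \<and> (\<forall>t\<in>F. central (\<kappa> F) t)" if "finite F" "F \<subseteq> J" for F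
    unfolding \<kappa>_def by (rule someI_ex[OF fin[OF that]])
  define D where "D = finite_subsets_at_top J"
  have D: "D \<noteq> bot" by (simp add: D_def)
  have ev1: "\<forall>\<^sub>F F in D. ext (\<kappa> F) \<and> F \<subseteq> J \<and> finite F"
    unfolding D_def eventually_finite_subsets_at_top by (intro exI[of _ "{}"]) (use \<kappa> in simp)
  have ev: "\<forall>\<^sub>F F in D. extends_on X (\<kappa> F)" if "finite X" "X \<subseteq> {Y} \<times> UNIV" for X
    using ev1 by (rule eventually_mono) (use extends_on_mono[OF _ that(2)] in simp)
  have sub: "{Y} \<times> UNIV \<subseteq> pts \<times> (UNIV :: (nat \<Rightarrow> 'e) set)" using Y by auto
  obtain D' \<kappa>' where D': "D' \<le> D" "D' \<noteq> bot" and ext': "ext \<kappa>'"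
    and lim0: "\<And>Z x W y R. (Z, x) \<in> {Y} \<times> UNIV \<Longrightarrow> (W, y) \<in> {Y} \<times> UNIV \<Longrightarrow> ((\<lambda>F. \<kappa> F Z W R x y) \<longlongrightarrow> \<kappa>' Z W R x y) D'"
    by (rule extends_compact[OF sub D ev], assumption+, rule that)
  have lim: "((\<lambda>F. \<kappa> F Y Y R x y) \<longlongrightarrow> \<kappa>' Y Y R x y) D'" for R x y
    by (rule lim0) simp_all
  have bim: "bimod \<kappa>' \<alpha> \<beta>" if b: "\<forall>\<^sub>F F in D. bimod (\<kappa> F) \<alpha> \<beta>" for \<alpha> \<beta>
    unfolding bimod_def
  proof (intro allI)
    fix R and x y :: "nat \<Rightarrow> 'e"
    have "\<forall>\<^sub>F F in D'. bimod (\<kappa> F) \<alpha> \<beta>" using b D'(1) by (rule filter_leD[rotated])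
    then have "\<forall>\<^sub>F F in D'. \<kappa> F Y Y R (adj_vec \<alpha> x) (adj_vec \<beta> y) = \<kappa> F Y Y (sandwich \<alpha> \<beta> R) x y"
      by (rule eventually_mono) (simp add: bimod_def)
    then have "((\<lambda>F. \<kappa> F Y Y (sandwich \<alpha> \<beta> R) x y) \<longlongrightarrow> \<kappa>' Y Y R (adj_vec \<alpha> x) (adj_vec \<beta> y)) D'"
      by (rule Lim_transform_eventually[OF lim])
    then show "\<kappa>' Y Y (sandwich \<alpha> \<beta> R) x y = \<kappa>' Y Y R (adj_vec \<alpha> x) (adj_vec \<beta> y)"
      by (rule tendsto_unique[OF D'(2) lim])
  qed
  have "central \<kappa>' t" if t: "t \<in> J" for t
  proof -
    have "\<forall>\<^sub>F F in D. central (\<kappa> F) t"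
      unfolding D_def eventually_finite_subsets_at_top by (intro exI[of _ "{t}"]) (use \<kappa> t in simp)
    then show ?thesis unfolding central_def
      by (intro conjI bim) (auto elim: eventually_mono)
  qed
  with ext' show ?thesis by blast
qed

text \<open>Downward induction along the filtration. Inside J m, conjugating t by 1 + z a changes it
  by an element of J (m + 1), which is already central; so the elements of J m can be treated one
  after another although they need not commute.\<close>

lemma bimodular_exists:
  assumes J: "J 0 = E" "J r \<subseteq> {0\<^sub>m n n}"
    and Jmono: "\<And>m. J (Suc m) \<subseteq> J m"
    and Jadd: "\<And>m a b. a \<in> J m \<Longrightarrow> b \<in> J m \<Longrightarrow> a + b \<in> J m"
    and Jsmult: "\<And>m a c. a \<in> J m \<Longrightarrow> c \<cdot>\<^sub>m a \<in> J m"
    and Jmult: "\<And>m a b. a \<in> J m \<Longrightarrow> b \<in> E \<Longrightarrow> a * b \<in> J m"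
    and Jcomm: "\<And>m a b. a \<in> J m \<Longrightarrow> b \<in> J m \<Longrightarrow> a * b - b * a \<in> J (Suc m)"
  shows "\<exists>\<kappa>. ext \<kappa> \<and> (\<forall>\<alpha>\<in>E. central \<kappa> \<alpha>)"
proof -
  have JE: "J m \<subseteq> E" for m
  proof (induction m)
    case (Suc m)
    then show ?case using Jmono[of m] by simp
  qed (use J in simp)
  obtain \<kappa>0 where "extends_on (pts \<times> UNIV) \<kappa>0" using extends_exists by auto
  then have k0: "ext \<kappa>0" by (rule extends_on_mono) (use Y in auto)
  have "\<exists>\<kappa>. ext \<kappa> \<and> (\<forall>\<alpha>\<in>J (r - k). central \<kappa> \<alpha>)" if "k \<le> r" for k
    using that
  proof (induction k)
    case 0
    have one: "1\<^sub>m n \<in> E" by (rule E_one)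
    have "\<kappa>0 Y Y (sandwich (1\<^sub>m n) (1\<^sub>m n) R) x y = \<kappa>0 Y Y R (adj_vec (1\<^sub>m n) x) (adj_vec (1\<^sub>m n) y)" for R x y
      by (rule ext_cong[OF k0]) (simp_all add: adj_vec_one sandwich_one)
    then have "central \<kappa>0 (1\<^sub>m n)" unfolding central_def bimod_def by simp
    then have "central \<kappa>0 (0 \<cdot>\<^sub>m 1\<^sub>m n)" by (rule central_smult[OF k0 one])
    then have "central \<kappa>0 (0\<^sub>m n n)"
    proof -
      have "0 \<cdot>\<^sub>m 1\<^sub>m n = (0\<^sub>m n n :: complex mat)" by (intro eq_matI) auto
      then show "central \<kappa>0 (0 \<cdot>\<^sub>m 1\<^sub>m n) \<Longrightarrow> central \<kappa>0 (0\<^sub>m n n)" by simp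
    qed
    then show ?case using J(2) k0 by (intro exI[of _ \<kappa>0]) auto
  next
    case (Suc k)
    define m where "m = r - Suc k"
    have m: "Suc m = r - k" using Suc.prems by (simp add: m_def)
    obtain \<kappa>1 where k1: "ext \<kappa>1" "\<forall>\<alpha>\<in>J (Suc m). central \<kappa>1 \<alpha>" using Suc m by auto
    have fin: "\<exists>\<kappa>. ext \<kappa> \<and> (\<forall>t\<in>J (Suc m) \<union> F. central \<kappa> t)" if "finite F" "F \<subseteq> J m" for F
      using that
    proof (induction F rule: finite_induct)
      case empty
      then show ?case using k1 by auto
    next
      case (insert a F)
      then obtain \<kappa>2 where k2: "ext \<kappa>2" "\<forall>t\<in>J (Suc m) \<union> F. central \<kappa>2 t" by auto
      \<comment> \<open>All elements of J m that are already central, not only the listed ones: this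
        set contains J (m + 1) and is closed under addition, hence stable under the conjugations to
        come.\<close>
      define T where "T = {t \<in> J m. central \<kappa>2 t}"
      have aJ: "a \<in> J m" using insert by simp
      have aE: "a \<in> E" using JE aJ by auto
      note ac = E_carrier[OF aE]
      have "\<exists>\<kappa>'. ext \<kappa>' \<and> (\<forall>t\<in>T. central \<kappa>' t) \<and> central \<kappa>' a"
      proof (rule central_insert[OF k2(1) _ _ aE])
        show "T \<subseteq> E" using JE by (auto simp: T_def)
        show "central \<kappa>2 t" if "t \<in> T" for t using that by (simp add: T_def)
        fix t h z assume t: "t \<in> T" and h: "h \<in> E" and inv: "(1\<^sub>m n + z \<cdot>\<^sub>m a) * h = 1\<^sub>m n"
        note hc = E_carrier[OF h]
        have tJ: "t \<in> J m" and tc: "t \<in> carrier_mat n n" using t JE[of m] E_carrier by (auto simp: T_def)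
        \<comment> \<open>With b = 1 + z a one has b t = t b + z (a t - t a), and h is inverse to b;
          hence b t h = t + w.\<close>
        define w where "w = (z \<cdot>\<^sub>m (a * t - t * a)) * h"
        have w: "w \<in> J (Suc m)" unfolding w_def by (intro Jmult Jsmult Jcomm aJ tJ h)
        have "(1\<^sub>m n + z \<cdot>\<^sub>m a) * t * h = t + w"
        proof -
          have "(1\<^sub>m n + z \<cdot>\<^sub>m a) * t = t * (1\<^sub>m n + z \<cdot>\<^sub>m a) + z \<cdot>\<^sub>m (a * t - t * a)"
            using ac tc by (intro eq_matI) (auto simp: add_mult_distrib_mat[of _ n n _ _ n] mult_add_distrib_mat[of _ n n _ n] algebra_simps)
          then have "(1\<^sub>m n + z \<cdot>\<^sub>m a) * t * h = t * (1\<^sub>m n + z \<cdot>\<^sub>m a) * h + w"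
            unfolding w_def using add_mult_distrib_mat[of "t * (1\<^sub>m n + z \<cdot>\<^sub>m a)" n n "z \<cdot>\<^sub>m (a * t - t * a)" h n] ac tc hc
              minus_carrier_mat[OF mult_carrier_mat[OF tc ac], of "a * t"]
            by (simp add: smult_carrier_mat)
          also have "t * (1\<^sub>m n + z \<cdot>\<^sub>m a) * h = t * ((1\<^sub>m n + z \<cdot>\<^sub>m a) * h)"
            by (rule assoc_mult_mat[of _ n n _ n _ n]) (use ac tc hc in auto)
          also have "\<dots> = t" using inv tc by simp
          finally show ?thesis .
        qed
        moreover have "t + w \<in> J m" using w Jmono[of m] by (intro Jadd tJ) auto
        moreover have "central \<kappa>2 (t + w)"
          using w k2 t JE tJ Jmono[of m] by (intro central_add) (auto simp: T_def)
        ultimately show "(1\<^sub>m n + z \<cdot>\<^sub>m a) * t * h \<in> T" by (simp add: T_def)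
      qed
      then obtain \<kappa>' where "ext \<kappa>'" "\<forall>t\<in>T. central \<kappa>' t" "central \<kappa>' a" by auto
      moreover have "J (Suc m) \<union> F \<subseteq> T" using k2 Jmono[of m] insert by (auto simp: T_def)
      ultimately show ?case by (intro exI[of _ \<kappa>']) auto
    qed
    have "\<exists>\<kappa>. ext \<kappa> \<and> (\<forall>t\<in>J m. central \<kappa> t)"
    proof (rule central_union)
      fix F assume "finite F" "F \<subseteq> J m"
      from fin[OF this] show "\<exists>\<kappa>. ext \<kappa> \<and> (\<forall>t\<in>F. central \<kappa> t)" by auto
    qed
    then show ?case by (simp add: m_def)
  qed
  from this[of r] show ?thesis using J(1) by simp
qed

end

section \<open>Idempotents and radicals of complex algebras\<close>

class complex_algebra = complex_vector + ring_1 +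
  assumes scaleC_mult_left: "(c *\<^sub>C x) * y = c *\<^sub>C (x * y)"
    and scaleC_mult_right: "x * (c *\<^sub>C y) = c *\<^sub>C (x * y)"

definition nilpotent :: "'r::ring_1 \<Rightarrow> bool" where
  "nilpotent x \<longleftrightarrow> (\<exists>k. x ^ k = 0)"

inductive_set two_sided :: "'r::ring_1 set \<Rightarrow> 'r \<Rightarrow> 'r set" for A e where
  zero: "0 \<in> two_sided A e"
| add: "x \<in> two_sided A e \<Longrightarrow> a \<in> A \<Longrightarrow> b \<in> A \<Longrightarrow> x + a * e * b \<in> two_sided A e"

lemma nilpotent_one_minus_inverse:
  assumes "(z :: 'r::ring_1) ^ m = 0"
  shows "(1 - z) * (\<Sum>i<m. z ^ i) = 1" "(\<Sum>i<m. z ^ i) * (1 - z) = 1"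
proof -
  have c: "(1 - z) * (\<Sum>i<m. z ^ i) = 1 - z ^ m" for m
  proof (induction m)
    case (Suc m)
    have "(1 - z) * (\<Sum>i<Suc m. z ^ i) = (1 - z) * (\<Sum>i<m. z ^ i) + (1 - z) * z ^ m"
      by (simp only: sum.lessThan_Suc distrib_left)
    then show ?case unfolding Suc by (simp add: left_diff_distrib)
  qed simp
  have d: "(\<Sum>i<m. z ^ i) * (1 - z) = 1 - z ^ m" for m
  proof (induction m)
    case (Suc m)
    have "(\<Sum>i<Suc m. z ^ i) * (1 - z) = (\<Sum>i<m. z ^ i) * (1 - z) + z ^ m * (1 - z)"
      by (simp only: sum.lessThan_Suc distrib_right)
    then show ?case unfolding Suc by (simp add: right_diff_distrib power_commutes)
  qed simp
  show "(1 - z) * (\<Sum>i<m. z ^ i) = 1" using c[of m] assms by simp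
  show "(\<Sum>i<m. z ^ i) * (1 - z) = 1" using d[of m] assms by simp
qed

lemma commuting_power: "x * y = y * (x :: 'r::ring_1) \<Longrightarrow> x ^ k * y = y * x ^ k"
  by (induction k) (simp_all add: mult.assoc, metis mult.assoc)

text \<open>A finite-dimensional algebra that equals no corner up to Morita equivalence: an idempotent
  \<open>g\<close> in the ideal generated by \<open>1 - g\<close> vanishes. Modulo its radical such an algebra is
  commutative.\<close>

locale basic_algebra =
  fixes A :: "'r::complex_algebra set" and D :: nat
  assumes one: "1 \<in> A"
    and add: "x \<in> A \<Longrightarrow> y \<in> A \<Longrightarrow> x + y \<in> A"
    and mult: "x \<in> A \<Longrightarrow> y \<in> A \<Longrightarrow> x * y \<in> A"
    and scale: "x \<in> A \<Longrightarrow> c *\<^sub>C x \<in> A"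
    and dependent: "(\<And>i. i \<le> D \<Longrightarrow> f i \<in> A) \<Longrightarrow> \<exists>c. (\<exists>i\<le>D. c i \<noteq> 0) \<and> (\<Sum>i\<le>D. c i *\<^sub>C f i) = 0"
    and basic: "g \<in> A \<Longrightarrow> g * g = g \<Longrightarrow> g \<in> two_sided A (1 - g) \<Longrightarrow> g = 0"
begin

lemma zero: "0 \<in> A" using scale[OF one, of 0] by (simp add: scaleC_zero_left)
lemma uminus: "x \<in> A \<Longrightarrow> - x \<in> A" using scale[of x "-1"] by (simp add: scaleC_minus_left scaleC_one)
lemma minus: "x \<in> A \<Longrightarrow> y \<in> A \<Longrightarrow> x - y \<in> A" using add[of x "- y"] uminus[of y] by simp
lemma power: "x \<in> A \<Longrightarrow> x ^ k \<in> A" by (induction k) (auto simp: one mult)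
lemma sum: "(\<And>i. i \<in> I \<Longrightarrow> f i \<in> A) \<Longrightarrow> (\<Sum>i\<in>I. f i) \<in> A"
  by (induction I rule: infinite_finite_induct) (auto simp: zero add)

lemma two_sided_A: "e \<in> A \<Longrightarrow> x \<in> two_sided A e \<Longrightarrow> x \<in> A"
  by (erule two_sided.induct) (auto simp: zero add mult)

lemma two_sided_mem: "a \<in> A \<Longrightarrow> b \<in> A \<Longrightarrow> a * e * b \<in> two_sided A e"
  using two_sided.add[OF two_sided.zero, of a A b e] by simp

lemma two_sided_add: "y \<in> two_sided A e \<Longrightarrow> x \<in> two_sided A e \<Longrightarrow> x + y \<in> two_sided A e"
  by (induction rule: two_sided.induct) (auto simp: add.assoc[symmetric] intro: two_sided.add)

lemma two_sided_right: "x \<in> two_sided A e \<Longrightarrow> c \<in> A \<Longrightarrow> x * c \<in> two_sided A e"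
  by (induction rule: two_sided.induct)
    (auto simp: distrib_right mult.assoc intro!: two_sided.zero two_sided.add[unfolded mult.assoc] mult)

lemma two_sided_mono:
  assumes e: "e = e * e'" "e \<in> A" and x: "x \<in> two_sided A e"
  shows "x \<in> two_sided A e'"
  using x
proof (induction rule: two_sided.induct)
  case (add x a b)
  have "a * e * b = (a * e) * e' * b" using e(1) by (metis mult.assoc)
  then show ?case using two_sided.add[OF add(4), of "a * e" b] add e(2) mult by simp
qed (rule two_sided.zero)

text \<open>Fitting's decomposition for x. The lowest nonzero coefficient of a polynomial relation
  gives x^l = x^(l+1) r with r a polynomial in x. Iteration yields an idempotent g in the commutant
  of x such that x is invertible on the corner of g and nilpotent on that of 1 - g.\<close>

lemma fitting:
  assumes x: "x \<in> A"
  obtains l g w where "0 < l" "g \<in> A" "w \<in> A" "g * g = g" "x * g = g * x" "w * x = x * w"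
    "g = x ^ l * w" "x ^ l * g = x ^ l"
proof -
  obtain c where c: "\<exists>i\<le>D. c i \<noteq> 0" "(\<Sum>i\<le>D. c i *\<^sub>C x ^ i) = 0"
    using dependent[of "\<lambda>i. x ^ i"] power[OF x] by auto
  define l where "l = (LEAST i. i \<le> D \<and> c i \<noteq> 0)"
  have l: "l \<le> D" "c l \<noteq> 0" using LeastI_ex[OF c(1)[unfolded Bex_def]] c(1) LeastI_ex[of "\<lambda>i. i \<le> D \<and> c i \<noteq> 0"] by (auto simp: l_def)
  have below: "c i = 0" if "i < l" for i
    using not_less_Least[of i "\<lambda>i. i \<le> D \<and> c i \<noteq> 0"] that l(1) by (auto simp: l_def)
  define r where "r = (- 1 / c l) *\<^sub>C (\<Sum>i\<in>{Suc l..D}. c i *\<^sub>C x ^ (i - Suc l))"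
  have r: "r \<in> A" unfolding r_def by (intro scale sum power x)
  have rx: "x * r = r * x"
    by (simp add: r_def scaleC_mult_left scaleC_mult_right sum_distrib_left sum_distrib_right power_commutes)
  have "0 = (\<Sum>i\<in>{l..D}. c i *\<^sub>C x ^ i)"
    unfolding c(2)[symmetric] by (rule sum.mono_neutral_right) (auto simp: below scaleC_zero_left)
  also have "\<dots> = c l *\<^sub>C x ^ l + (\<Sum>i\<in>{Suc l..D}. c i *\<^sub>C x ^ i)"
    using l(1) by (rule sum.atLeast_Suc_atMost)
  also have "(\<Sum>i\<in>{Suc l..D}. c i *\<^sub>C x ^ i) = x ^ Suc l * (\<Sum>i\<in>{Suc l..D}. c i *\<^sub>C x ^ (i - Suc l))"
    unfolding sum_distrib_left scaleC_mult_right power_add[symmetric] by (intro sum.cong) auto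
  finally have "c l *\<^sub>C x ^ l = - (x ^ Suc l * (\<Sum>i\<in>{Suc l..D}. c i *\<^sub>C x ^ (i - Suc l)))"
    by (metis add_eq_0_iff2)
  then have "(1 / c l) *\<^sub>C c l *\<^sub>C x ^ l = (1 / c l) *\<^sub>C (- (x ^ Suc l * (\<Sum>i\<in>{Suc l..D}. c i *\<^sub>C x ^ (i - Suc l))))"
    by simp
  then have step: "x ^ l = x ^ Suc l * r"
    unfolding r_def scaleC_mult_right using l(2)
    by (simp add: scaleC_scaleC scaleC_one scaleC_minus_right scaleC_minus_left)
  \<comment> \<open>One more than the exponent found, so that the power is positive and g is a
    multiple of x itself.\<close>
  define L where "L = Suc l"
  have stepL: "x ^ L = x ^ L * (x * r)"
    using step unfolding L_def by (metis mult.assoc power_Suc2 power_Suc rx)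
  have it: "x ^ L = x ^ L * (x * r) ^ k" for k
    by (induction k) (use stepL in \<open>simp_all add: mult.assoc[symmetric]\<close>)
  have xrk: "(x * r) ^ k = x ^ k * r ^ k" for k
    by (induction k) (simp, metis (no_types, opaque_lifting) commuting_power mult.assoc power_Suc power_commutes rx)
  define w where "w = r ^ L"
  define g where "g = x ^ L * w"
  have w: "w \<in> A" unfolding w_def by (rule power[OF r])
  have wx: "w * x = x * w" unfolding w_def using commuting_power[of r x] rx by simp
  have xg: "x ^ L * g = x ^ L" using it[of L] unfolding xrk g_def w_def by (simp add: mult.assoc)
  have wxL: "w * x ^ L = x ^ L * w" using commuting_power[of x w L] wx by simp
  have gx: "x * g = g * x" unfolding g_def by (metis mult.assoc power_commutes wx)
  have "g * g = x ^ L * g * w" using commuting_power[of x g L] gx unfolding g_def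
    by (metis mult.assoc wxL)
  then have "g * g = g" using xg by (simp add: g_def)
  moreover have "g \<in> A" unfolding g_def by (intro mult power x w)
  ultimately show thesis using that[of L g w] w wx gx xg by (simp add: L_def g_def)
qed

text \<open>The Fitting idempotent g of z is a multiple of z, hence lies in the ideal of 1 - f. It
  also satisfies f g = g, so 1 - f = (1 - f) (1 - g) and g lies in the ideal of 1 - g. By
  \<open>basic\<close> it is 0.\<close>

lemma nilpotent_corner:
  assumes f: "f \<in> A" "f * f = f" and z: "z \<in> two_sided A (1 - f)" "f * z = z" "z * f = z"
  shows "nilpotent z"
proof -
  have zA: "z \<in> A" by (rule two_sided_A[OF _ z(1)]) (intro minus one f)
  obtain l g w where l: "0 < l" and g: "g \<in> A" "w \<in> A" "g * g = g" "z * g = g * z" "w * z = z * w"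
    "g = z ^ l * w" "z ^ l * g = z ^ l" using fitting[OF zA] by metis
  obtain k where k: "l = Suc k" using l by (cases l) auto
  have gz: "g = z * (z ^ k * w)" using g(6) k by (simp add: mult.assoc)
  have "g \<in> two_sided A (1 - f)"
    unfolding gz by (intro two_sided_right z mult power zA g)
  moreover have "f * g = g" unfolding gz using z(2) by (metis mult.assoc)
  then have "1 - f = (1 - f) * (1 - g)" by (simp add: algebra_simps)
  ultimately have "g \<in> two_sided A (1 - g)" by (intro two_sided_mono[of "1 - f" "1 - g"] minus one f)
  then have "g = 0" by (rule basic[OF g(1) g(3)])
  then show ?thesis using g(7) unfolding nilpotent_def by (metis mult_zero_right)
qed

text \<open>Nilpotents lie in the radical; this fails for 2 by 2 matrices, which
  \<open>basic\<close> excludes. Let g be the Fitting idempotent of \<nu> x. In the corner of g the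
  element c = g \<nu> g has a right inverse, while modulo the nil set \<open>N\<close> its powers
  agree with g \<nu>^i g and so become 0. Hence c is nilpotent as well as right invertible, and g =
  0.\<close>

lemma nilpotent_mult:
  assumes \<nu>: "\<nu> \<in> A" "nilpotent \<nu>" and x: "x \<in> A"
  shows "nilpotent (\<nu> * x)"
proof -
  obtain k where k: "\<nu> ^ k = 0" using \<nu> unfolding nilpotent_def by blast
  define y where "y = \<nu> * x"
  have yA: "y \<in> A" unfolding y_def by (intro mult \<nu> x)
  obtain l g w where l: "0 < l" and g: "g \<in> A" "w \<in> A" "g * g = g" "y * g = g * y" "w * y = y * w"
    "g = y ^ l * w" "y ^ l * g = y ^ l" using fitting[OF yA] by metis
  obtain l' where l': "l = Suc l'" using l by (cases l) auto
  define v where "v = x * (y ^ l' * w)"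
  have vA: "v \<in> A" unfolding v_def by (intro mult power x yA g)
  have gv: "g = \<nu> * v" using g(6) unfolding l' v_def by (simp add: y_def mult.assoc)
  \<comment> \<open>The part of the corner of g that lies in the ideal of 1 - g; by
    \<open>nilpotent_corner\<close> it consists of nilpotents.\<close>
  define N where "N = {z \<in> two_sided A (1 - g). g * z = z \<and> z * g = z}"
  have nilN: "nilpotent z" if "z \<in> N" for z using nilpotent_corner[OF g(1) g(3)] that by (auto simp: N_def)
  have Nmem: "g * a * (1 - g) * b * g \<in> N" if "a \<in> A" "b \<in> A" for a b
  proof -
    have "(g * a) * (1 - g) * (b * g) \<in> two_sided A (1 - g)" by (intro two_sided_mem mult g that)
    moreover have "g * (g * a * (1 - g) * b * g) = g * a * (1 - g) * b * g" by (simp add: mult.assoc[symmetric] g(3))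
    moreover have "(g * a * (1 - g) * b * g) * g = g * a * (1 - g) * b * g" by (simp add: mult.assoc g(3))
    ultimately show ?thesis by (simp add: N_def mult.assoc)
  qed
  define c where "c = g * \<nu> * g"
  define z1 where "z1 = g * \<nu> * (1 - g) * v * g"
  have cA: "c \<in> A" unfolding c_def by (intro mult g \<nu>)
  have gc: "g * c = c" "c * g = c" unfolding c_def by (simp_all add: mult.assoc[symmetric] g(3)) (simp add: mult.assoc g(3))
  have z1: "z1 \<in> N" unfolding z1_def by (rule Nmem[OF \<nu>(1) vA])
  then obtain m where m: "z1 ^ m = 0" using nilN unfolding nilpotent_def by blast
  have gz1: "g * z1 = z1" using z1 by (simp add: N_def)
  have "c * (g * v * g) = g * \<nu> * (g * g) * v * g" unfolding c_def by (simp add: mult.assoc)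
  also have "\<dots> = g * (\<nu> * v) * g - z1" unfolding g(3) z1_def by (simp add: algebra_simps)
  also have "\<dots> = g * (1 - z1)" unfolding gv[symmetric] by (simp add: g(3) gz1 algebra_simps)
  finally have cd: "c * (g * v * g) = g * (1 - z1)" .
  \<comment> \<open>As c (g v g) = g (1 - z1) with z1 nilpotent, the geometric series corrects g v g
    to an exact right inverse of c in the corner.\<close>
  define e where "e = g * v * g * (\<Sum>i<m. z1 ^ i)"
  have ge: "g * e = e" unfolding e_def by (simp add: mult.assoc[symmetric] g(3))
  have ce: "c * e = g"
    unfolding e_def using cd nilpotent_one_minus_inverse(1)[OF m] by (metis mult.assoc mult_1_right)
  have cek: "c ^ Suc i * e ^ Suc i = g" for i
  proof (induction i)
    case (Suc i)
    have "c ^ Suc (Suc i) * e ^ Suc (Suc i) = c * (c ^ Suc i * e ^ Suc i) * e"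
      by (simp only: power_Suc2[of e "Suc i"] power_Suc[of c "Suc i"] mult.assoc)
    then show ?case using Suc gc ce by simp
  qed (use ce in simp)
  \<comment> \<open>Inserting 1 = g + (1 - g) between two factors \<nu>: the second part produces
    only terms in \<open>N\<close>.\<close>
  have pow: "\<exists>z\<in>N. g * \<nu> ^ Suc i * g = c ^ Suc i + z" for i
  proof (induction i)
    case 0
    have "0 \<in> N" by (simp add: N_def two_sided.zero)
    then show ?case by (intro bexI[of _ 0]) (simp_all add: c_def)
  next
    case (Suc i)
    then obtain z where z: "z \<in> N" "g * \<nu> ^ Suc i * g = c ^ Suc i + z" by blast
    define z' where "z' = g * \<nu> ^ Suc i * (1 - g) * \<nu> * g"
    have z': "z' \<in> N" unfolding z'_def by (intro Nmem power \<nu>)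
    have "g * \<nu> ^ Suc (Suc i) * g = g * \<nu> ^ Suc i * (g + (1 - g)) * \<nu> * g"
      by (simp only: power_Suc2[of \<nu> "Suc i"] mult.assoc) simp
    also have "\<dots> = g * \<nu> ^ Suc i * (g * g) * \<nu> * g + z'"
      unfolding z'_def g(3) by (simp only: distrib_left distrib_right)
    also have "\<dots> = (g * \<nu> ^ Suc i * g) * c + z'" unfolding c_def by (simp only: mult.assoc)
    also have "\<dots> = c ^ Suc i * c + (z * c + z')" unfolding z(2) by (simp only: distrib_right add.assoc)
    also have "c ^ Suc i * c = c ^ Suc (Suc i)" by (simp only: power_Suc2)
    finally have eq: "g * \<nu> ^ Suc (Suc i) * g = c ^ Suc (Suc i) + (z * c + z')" .
    have "z * c + z' \<in> N"
      using z z' cA gc unfolding N_def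
      by (auto intro!: two_sided_add two_sided_right simp: distrib_left distrib_right mult.assoc[symmetric])
        (simp add: mult.assoc)
    with eq show ?case by blast
  qed
  have "g = 0"
  proof (cases k)
    case 0
    then have "(1 :: 'r) = 0" using k by simp
    then show ?thesis by simp
  next
    case (Suc k')
    obtain z where z: "z \<in> N" "g * \<nu> ^ Suc k' * g = c ^ Suc k' + z" using pow by blast
    then have cz: "c ^ Suc k' = - z" using k Suc by (simp add: eq_neg_iff_add_eq_0)
    obtain j where j: "z ^ j = 0" using nilN[OF z(1)] unfolding nilpotent_def by blast
    have "(c ^ Suc k') ^ Suc j = 0" unfolding cz by (simp add: power_minus[of z "Suc j"] j del: power_Suc) (simp add: j)
    then have "c ^ (Suc k' * Suc j) = 0" by (simp only: power_mult)
    moreover have "Suc k' * Suc j = Suc (j + k' * Suc j)" by simp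
    ultimately show ?thesis using cek[of "j + k' * Suc j"] by (metis mult_zero_left)
  qed
  then show ?thesis using g(7) unfolding y_def[symmetric] nilpotent_def by (metis mult_zero_right)
qed

lemma nilpotent_mult_left:
  assumes "\<nu> \<in> A" "nilpotent \<nu>" "x \<in> A"
  shows "nilpotent (x * \<nu>)"
proof -
  obtain k where k: "(\<nu> * x) ^ k = 0" using nilpotent_mult[OF assms] unfolding nilpotent_def by blast
  have "(x * \<nu>) ^ Suc j = x * (\<nu> * x) ^ j * \<nu>" for j
    by (induction j) (simp_all add: mult.assoc)
  then have "(x * \<nu>) ^ Suc k = 0" using k by simp
  then show ?thesis unfolding nilpotent_def by blast
qed

section \<open>Composition series of left ideals\<close>

definition left_sub :: "'r set \<Rightarrow> bool" where
  "left_sub V \<longleftrightarrow> V \<subseteq> A \<and> 0 \<in> V \<and> (\<forall>v\<in>V. \<forall>w\<in>V. v + w \<in> V) \<and> (\<forall>a\<in>A. \<forall>v\<in>V. a * v \<in> V)"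

lemma left_subD:
  assumes "left_sub V"
  shows "V \<subseteq> A" "0 \<in> V" "v \<in> V \<Longrightarrow> w \<in> V \<Longrightarrow> v + w \<in> V" "a \<in> A \<Longrightarrow> v \<in> V \<Longrightarrow> a * v \<in> V"
  using assms unfolding left_sub_def by auto

lemma left_sub_scale: "left_sub V \<Longrightarrow> v \<in> V \<Longrightarrow> c *\<^sub>C v \<in> V"
  using left_subD(4)[of V "c *\<^sub>C 1" v] scale[OF one, of c] by (simp add: scaleC_mult_left)

lemma left_sub_diff: "left_sub V \<Longrightarrow> v \<in> V \<Longrightarrow> w \<in> V \<Longrightarrow> v - w \<in> V"
  using left_subD(3)[of V v "- w"] left_sub_scale[of V w "-1"] by (simp add: scaleC_minus_left scaleC_one)

lemma left_sub_sum: "left_sub V \<Longrightarrow> (\<And>i. i \<in> I \<Longrightarrow> f i \<in> V) \<Longrightarrow> (\<Sum>i\<in>I. f i) \<in> V"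
  by (induction I rule: infinite_finite_induct) (auto simp: left_subD)

definition flag :: "nat \<Rightarrow> (nat \<Rightarrow> 'r set) \<Rightarrow> bool" where
  "flag r V \<longleftrightarrow> V 0 = {0} \<and> V r = A \<and> (\<forall>i\<le>r. left_sub (V i)) \<and> (\<forall>i<r. V i \<subset> V (Suc i))"

lemma flag_mono: "flag r V \<Longrightarrow> i \<le> j \<Longrightarrow> j \<le> r \<Longrightarrow> V i \<subseteq> V j"
proof (induction j)
  case (Suc j)
  have "V j \<subset> V (Suc j)" using Suc.prems unfolding flag_def by auto
  then show ?case using Suc by (cases "i = Suc j") auto
qed simp

text \<open>Elements chosen from the successive differences are linearly independent, since the last
  nonzero coefficient m of a relation would put f m into V m; and \<open>dependent\<close> allows at
  most D independent elements.\<close>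

lemma flag_bound:
  assumes V: "flag r V" shows "r \<le> D"
proof (rule ccontr)
  assume r: "\<not> r \<le> D"
  have ex: "\<exists>x. x \<in> V (Suc i) \<and> x \<notin> V i" if "i \<le> D" for i
  proof -
    have "V i \<subset> V (Suc i)" using V r that unfolding flag_def by simp
    then show ?thesis by auto
  qed
  define f where "f i = (SOME x. x \<in> V (Suc i) \<and> x \<notin> V i)" for i
  have f: "f i \<in> V (Suc i)" "f i \<notin> V i" if "i \<le> D" for i
    using someI_ex[OF ex[OF that]] unfolding f_def by auto
  have sub: "left_sub (V i)" if "i \<le> Suc D" for i using V r that unfolding flag_def by simp
  have "f i \<in> A" if "i \<le> D" for i using f(1)[OF that] left_subD(1)[OF sub[of "Suc i"]] that by auto
  then obtain c where c: "\<exists>i\<le>D. c i \<noteq> 0" "(\<Sum>i\<le>D. c i *\<^sub>C f i) = 0" using dependent[of f] by auto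
  define m where "m = (GREATEST i. i \<le> D \<and> c i \<noteq> 0)"
  have ex': "\<exists>i. i \<le> D \<and> c i \<noteq> 0" using c(1) by simp
  have m: "m \<le> D \<and> c m \<noteq> 0"
    unfolding m_def by (rule GreatestI_ex_nat[OF ex', of D]) simp
  have above: "c i = 0" if i: "i \<le> D" "m < i" for i
  proof (rule ccontr)
    assume "c i \<noteq> 0"
    then have "i \<le> D \<and> c i \<noteq> 0" using i by simp
    then have "i \<le> m" unfolding m_def by (rule Greatest_le_nat[of _ _ D]) simp
    then show False using i by simp
  qed
  have "0 = (\<Sum>i\<in>{..m}. c i *\<^sub>C f i)"
    unfolding c(2)[symmetric] by (rule sum.mono_neutral_right) (use m above in \<open>auto simp: scaleC_zero_left not_le\<close>)
  then have "(\<Sum>i<m. c i *\<^sub>C f i) + c m *\<^sub>C f m = 0"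
    by (simp only: lessThan_Suc_atMost[symmetric] sum.lessThan_Suc)
  then have "c m *\<^sub>C f m = 0 - (\<Sum>i\<in>{..<m}. c i *\<^sub>C f i)"
    unfolding eq_diff_eq by (subst add.commute)
  moreover have "\<dots> \<in> V m"
  proof (intro left_sub_diff left_sub_sum left_sub_scale left_subD(2))
    fix i assume i: "i \<in> {..<m}"
    then have "f i \<in> V (Suc i)" using f(1)[of i] m by simp
    moreover have "V (Suc i) \<subseteq> V m" using flag_mono[OF V, of "Suc i" m] i m r by simp
    ultimately show "f i \<in> V m" by auto
  qed (use sub m in simp_all)
  ultimately have "c m *\<^sub>C f m \<in> V m" by simp
  then have "(1 / c m) *\<^sub>C c m *\<^sub>C f m \<in> V m" using left_sub_scale sub m by simp
  then show False using f(2)[of m] m by (simp add: scaleC_scaleC scaleC_one)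
qed

text \<open>A flag of greatest length is a composition series: a left ideal strictly between two
  neighbours could be inserted.\<close>

lemma maximal_flag:
  obtains r V where "flag r V"
    "\<And>i U. i < r \<Longrightarrow> left_sub U \<Longrightarrow> V i \<subseteq> U \<Longrightarrow> U \<subseteq> V (Suc i) \<Longrightarrow> U = V i \<or> U = V (Suc i)"
proof -
  have "flag 1 (\<lambda>i. if i = 0 then {0} else A)"
  proof -
    have "left_sub {0}" "left_sub A" unfolding left_sub_def using zero add mult by auto
    moreover have "{0} \<subset> A" using one zero by auto
    ultimately show ?thesis unfolding flag_def by auto
  qed
  then have ex: "\<exists>V. flag 1 V" by blast
  define r where "r = (GREATEST r. \<exists>V. flag r V)"
  have "\<exists>V. flag r V"
    unfolding r_def by (rule GreatestI_nat[of "\<lambda>r. \<exists>V. flag r V" 1 D, OF ex]) (auto dest: flag_bound)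
  then obtain V where V: "flag r V" by blast
  have max: "r' \<le> r" if "flag r' V'" for r' V'
    unfolding r_def by (rule Greatest_le_nat[of _ _ D]) (use that in \<open>auto dest: flag_bound\<close>)
  show thesis
  proof (rule that[OF V])
    fix i U assume i: "i < r" and U: "left_sub U" "V i \<subseteq> U" "U \<subseteq> V (Suc i)"
    show "U = V i \<or> U = V (Suc i)"
    proof (rule ccontr)
      assume ne: "\<not> (U = V i \<or> U = V (Suc i))"
      define V' where "V' j = (if j \<le> i then V j else if j = Suc i then U else V (j - 1))" for j
      have "flag (Suc r) V'"
        unfolding flag_def
      proof (intro conjI allI impI)
        show "V' 0 = {0}" using V by (simp add: V'_def flag_def)
        show "V' (Suc r) = A" using V i by (simp add: V'_def flag_def)
        show "left_sub (V' j)" if "j \<le> Suc r" for j using that V U(1) i by (auto simp: V'_def flag_def)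
        show "V' j \<subset> V' (Suc j)" if j: "j < Suc r" for j
        proof -
          consider "j < i" | "j = i" | "j = Suc i" | "j > Suc i" by linarith
          then show ?thesis
          proof cases
            case 1
            then show ?thesis using V i by (simp add: V'_def flag_def)
          next
            case 2
            then show ?thesis using U ne by (auto simp: V'_def)
          next
            case 3
            then show ?thesis using U ne by (auto simp: V'_def)
          next
            case 4
            then obtain k where k: "j = Suc k" by (cases j) auto
            then have "V k \<subset> V (Suc k)" using V j unfolding flag_def by simp
            then show ?thesis using 4 k by (simp add: V'_def)
          qed
        qed
      qed
      from max[OF this] show False by simp
    qed
  qed
qed

section \<open>Polynomials in an algebra element, and the radical filtration\<close>

definition poly_at :: "complex poly \<Rightarrow> 'r \<Rightarrow> 'r" where
  "poly_at p a = (\<Sum>j\<le>degree p. coeff p j *\<^sub>C a ^ j)"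

lemma poly_at_bound: "degree p \<le> N \<Longrightarrow> poly_at p a = (\<Sum>j\<le>N. coeff p j *\<^sub>C a ^ j)"
  unfolding poly_at_def by (rule sum.mono_neutral_left) (auto simp: coeff_eq_0 scaleC_zero_left)

lemma poly_at_linear_factor: "poly_at ([:- z, 1:] * p) a = poly_at p a * (a - z *\<^sub>C 1)"
proof -
  define N where "N = degree p"
  have p: "[:- z, 1:] * p = pCons 0 p + Polynomial.smult (- z) p" by simp
  have "degree ([:- z, 1:] * p) \<le> Suc N"
    using degree_mult_le[of "[:- z, 1:]" p] by (simp add: N_def)
  then have "poly_at ([:- z, 1:] * p) a = (\<Sum>j\<le>Suc N. coeff (pCons 0 p) j *\<^sub>C a ^ j) + (\<Sum>j\<le>Suc N. (- z * coeff p j) *\<^sub>C a ^ j)"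
    by (subst poly_at_bound[of _ "Suc N"]) (simp_all only: p coeff_add coeff_smult scaleC_add_left sum.distrib)
  also have "(\<Sum>j\<le>Suc N. coeff (pCons 0 p) j *\<^sub>C a ^ j) = (\<Sum>j\<le>N. coeff p j *\<^sub>C a ^ Suc j)"
    by (subst sum.atMost_Suc_shift) (simp add: scaleC_zero_left)
  also have "\<dots> = poly_at p a * a"
    by (simp add: poly_at_def N_def sum_distrib_right scaleC_mult_left power_commutes)
  also have "(\<Sum>j\<le>Suc N. (- z * coeff p j) *\<^sub>C a ^ j) = (- z) *\<^sub>C (\<Sum>j\<le>Suc N. coeff p j *\<^sub>C a ^ j)"
    by (simp only: scaleC_sum_right scaleC_scaleC)
  also have "(\<Sum>j\<le>Suc N. coeff p j *\<^sub>C a ^ j) = poly_at p a"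
    by (rule poly_at_bound[symmetric]) (simp add: N_def)
  finally show ?thesis by (simp add: right_diff_distrib scaleC_mult_right scaleC_minus_left)
qed

text \<open>Elements are graded by how far they lower a composition series of the left regular
  module. On each simple factor nilpotents act as 0, idempotents as 0 or 1, and general elements
  therefore as scalars, so commutators lower the series by a step. The last layer is zero because an
  element a is recovered from its action as a times 1.\<close>

theorem radical_filtration:
  obtains r J where "J 0 = A" "J r = {0}" "\<And>m. J (Suc m) \<subseteq> J m"
    "\<And>m a b. a \<in> J m \<Longrightarrow> b \<in> J m \<Longrightarrow> a + b \<in> J m"
    "\<And>m a c. a \<in> J m \<Longrightarrow> c *\<^sub>C a \<in> J m"
    "\<And>m a b. a \<in> J m \<Longrightarrow> b \<in> A \<Longrightarrow> a * b \<in> J m"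
    "\<And>m a b. a \<in> J m \<Longrightarrow> b \<in> J m \<Longrightarrow> a * b - b * a \<in> J (Suc m)"
proof -
  obtain r V where V: "flag r V" and simple: "\<And>i U. i < r \<Longrightarrow> left_sub U \<Longrightarrow> V i \<subseteq> U \<Longrightarrow> U \<subseteq> V (Suc i) \<Longrightarrow> U = V i \<or> U = V (Suc i)"
    by (rule maximal_flag) (rule that)
  have sub: "left_sub (V i)" if "i \<le> r" for i using V that by (simp add: flag_def)
  note lD = left_subD[OF sub]
  have step: "V i \<subset> V (Suc i)" if "i < r" for i using V that by (simp add: flag_def)
  \<comment> \<open>If \<nu> w were outside V i, simplicity would give w = v + a \<nu> w with v in V
    i. But a \<nu> is nilpotent, so 1 - a \<nu> is invertible and w would lie in V i.\<close>
  have lower: "\<nu> * w \<in> V i" if i: "i < r" and \<nu>: "\<nu> \<in> A" "nilpotent \<nu>" and w: "w \<in> V (Suc i)" for i \<nu> w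
  proof (rule ccontr)
    assume notin: "\<nu> * w \<notin> V i"
    define U where "U = {v + a * (\<nu> * w) | v a. v \<in> V i \<and> a \<in> A}"
    have ViS: "V i \<subseteq> V (Suc i)" using step[OF i] by auto
    have \<nu>w: "\<nu> * w \<in> V (Suc i)" by (rule lD(4)[OF _ \<nu>(1) w]) (use i in simp)
    have "left_sub U"
      unfolding left_sub_def
    proof (intro conjI ballI)
      show "U \<subseteq> A"
        unfolding U_def using lD(1)[of i] lD(1)[of "Suc i"] \<nu>(1) w i by (auto intro!: add mult)
      show "0 \<in> U" unfolding U_def using lD(2)[of i] zero i by (intro CollectI exI[of _ 0]) simp
    next
      fix x y assume "x \<in> U" "y \<in> U"
      then obtain v a v' a' where "x = v + a * (\<nu> * w)" "v \<in> V i" "a \<in> A" "y = v' + a' * (\<nu> * w)" "v' \<in> V i" "a' \<in> A"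
        unfolding U_def by auto
      then have "x + y = (v + v') + (a + a') * (\<nu> * w) \<and> v + v' \<in> V i \<and> a + a' \<in> A"
        using lD(3)[of i v v'] add i by (simp add: algebra_simps)
      then show "x + y \<in> U" unfolding U_def by blast
    next
      fix b x assume "b \<in> A" "x \<in> U"
      then obtain v a where "x = v + a * (\<nu> * w)" "v \<in> V i" "a \<in> A" unfolding U_def by auto
      then have "b * x = b * v + (b * a) * (\<nu> * w) \<and> b * v \<in> V i \<and> b * a \<in> A"
        using lD(4)[of i b v] mult i \<open>b \<in> A\<close> by (simp add: algebra_simps)
      then show "b * x \<in> U" unfolding U_def by blast
    qed
    moreover have "V i \<subseteq> U"
    proof
      fix v assume "v \<in> V i"
      then show "v \<in> U" unfolding U_def using zero by (intro CollectI exI[of _ v] exI[of _ 0]) simp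
    qed
    moreover have "U \<subseteq> V (Suc i)"
    proof
      fix x assume "x \<in> U"
      then obtain v a where x: "x = v + a * (\<nu> * w)" "v \<in> V i" "a \<in> A" unfolding U_def by auto
      show "x \<in> V (Suc i)" unfolding x(1) by (intro lD(3) lD(4) \<nu>w x(3)) (use x ViS i in auto)
    qed
    moreover have "\<nu> * w \<in> U"
      unfolding U_def using lD(2)[of i] one i by (intro CollectI exI[of _ 0] exI[of _ 1]) simp
    ultimately have "U = V (Suc i)" using simple[OF i] notin by blast
    then have "w \<in> U" using w by simp
    then obtain v a where va: "w = v + a * (\<nu> * w)" "v \<in> V i" "a \<in> A" unfolding U_def by auto
    then have eq: "(1 - a * \<nu>) * w = v" by (simp add: algebra_simps)
    obtain k where k: "(a * \<nu>) ^ k = 0" using nilpotent_mult_left[OF \<nu> va(3)] unfolding nilpotent_def by blast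
    have "w = (\<Sum>j<k. (a * \<nu>) ^ j) * v"
      unfolding eq[symmetric] mult.assoc[symmetric] nilpotent_one_minus_inverse(2)[OF k] by simp
    moreover have "(\<Sum>j<k. (a * \<nu>) ^ j) * v \<in> V i"
      by (rule lD(4)) (use i va \<nu> in \<open>auto intro!: sum power mult\<close>)
    ultimately have "w \<in> V i" by simp
    then have "\<nu> * w \<in> V i" by (intro lD(4) \<nu>) (use i in simp_all)
    with notin show False by simp
  qed
  \<comment> \<open>The set V i + e V (i + 1) turns out to be a left ideal, so by simplicity it is
    one end of the step.\<close>
  have idem: "(\<forall>w\<in>V (Suc i). e * w \<in> V i) \<or> (\<forall>w\<in>V (Suc i). w - e * w \<in> V i)"
    if i: "i < r" and e: "e \<in> A" "e * e = e" for i e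
  proof -
    define U where "U = {v + e * w | v w. v \<in> V i \<and> w \<in> V (Suc i)}"
    have ViS: "V i \<subseteq> V (Suc i)" using step[OF i] by auto
    have ew: "e * w \<in> V (Suc i)" if "w \<in> V (Suc i)" for w by (rule lD(4)) (use i e that in simp_all)
    have 1: "left_sub U"
      unfolding left_sub_def
    proof (intro conjI ballI)
      show "U \<subseteq> A"
        unfolding U_def using lD(1)[of i] lD(1)[of "Suc i"] i e by (auto intro!: add mult)
      show "0 \<in> U" unfolding U_def using lD(2)[of i] lD(2)[of "Suc i"] i by (intro CollectI exI[of _ 0]) simp
    next
      fix x y assume "x \<in> U" "y \<in> U"
      then obtain v w v' w' where "x = v + e * w" "v \<in> V i" "w \<in> V (Suc i)" "y = v' + e * w'" "v' \<in> V i" "w' \<in> V (Suc i)"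
        unfolding U_def by auto
      then have "x + y = (v + v') + e * (w + w') \<and> v + v' \<in> V i \<and> w + w' \<in> V (Suc i)"
        using lD(3)[of i v v'] lD(3)[of "Suc i" w w'] i by (simp add: algebra_simps)
      then show "x + y \<in> U" unfolding U_def by blast
    next
      fix b x assume b: "b \<in> A" and "x \<in> U"
      then obtain v w where x: "x = v + e * w" "v \<in> V i" "w \<in> V (Suc i)" unfolding U_def by auto
      \<comment> \<open>From b e = e b e + (1 - e) b e; the second part squares to zero and so falls
        under \<open>lower\<close>.\<close>
      define \<nu> where "\<nu> = (1 - e) * b * e"
      have \<nu>: "\<nu> \<in> A" unfolding \<nu>_def by (intro mult minus one e b)
      have "e * (1 - e) = 0" by (simp add: right_diff_distrib e)
      then have "\<nu> * \<nu> = 0" unfolding \<nu>_def by (metis mult.assoc mult_zero_left mult_zero_right)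
      then have "nilpotent \<nu>" unfolding nilpotent_def by (intro exI[of _ 2]) (simp add: power2_eq_square)
      then have "\<nu> * w \<in> V i" by (intro lower i \<nu> x)
      moreover have "b * v \<in> V i" by (rule lD(4)) (use i b x in simp_all)
      ultimately have "b * v + \<nu> * w \<in> V i" by (intro lD(3)) (use i in simp_all)
      moreover have "b * (e * w) \<in> V (Suc i)" by (rule lD(4)) (use i b ew x in simp_all)
      moreover have "b * x = (b * v + \<nu> * w) + e * (b * (e * w))"
        unfolding x(1) \<nu>_def by (simp add: algebra_simps)
      ultimately show "b * x \<in> U" unfolding U_def by blast
    qed
    have 2: "V i \<subseteq> U"
    proof
      fix v assume "v \<in> V i"
      then show "v \<in> U" unfolding U_def using lD(2)[of "Suc i"] i by (intro CollectI exI[of _ v] exI[of _ 0]) simp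
    qed
    have 3: "U \<subseteq> V (Suc i)"
    proof
      fix x assume "x \<in> U"
      then obtain v w where x: "x = v + e * w" "v \<in> V i" "w \<in> V (Suc i)" unfolding U_def by auto
      show "x \<in> V (Suc i)" unfolding x(1) by (intro lD(3) ew x(3)) (use x ViS i in auto)
    qed
    have ewU: "e * w \<in> U" if "w \<in> V (Suc i)" for w
      unfolding U_def using lD(2)[of i] that i by (intro CollectI exI[of _ 0] exI[of _ w]) simp
    from simple[OF i 1 2 3] show ?thesis
    proof
      assume "U = V i"
      then show ?thesis using ewU by auto
    next
      assume U: "U = V (Suc i)"
      have "w - e * w \<in> V i" if "w \<in> V (Suc i)" for w
      proof -
        have "w \<in> U" using that U by simp
        then obtain v w' where vw: "w = v + e * w'" "v \<in> V i" "w' \<in> V (Suc i)" unfolding U_def by auto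
        have "e * (e * w') = e * w'" by (simp add: mult.assoc[symmetric] e)
        then have "w - e * w = v - e * v" unfolding vw(1) by (simp add: algebra_simps)
        moreover have "v - e * v \<in> V i" by (intro left_sub_diff sub lD(4) e vw) (use i in simp_all)
        ultimately show ?thesis by simp
      qed
      then show ?thesis by blast
    qed
  qed
  \<comment> \<open>A form of Schur's lemma. If no \<mu> worked, a - \<mu> would be injective on the
    factor for all \<mu>, hence so would every nonzero polynomial in a, against the polynomial
    relation that \<open>dependent\<close> provides.\<close>
  have scalar: "\<exists>\<mu>. \<forall>w\<in>V (Suc i). (a - \<mu> *\<^sub>C 1) * w \<in> V i" if i: "i < r" and a: "a \<in> A" for i a
  proof (rule ccontr)
    assume no: "\<not> ?thesis"
    \<comment> \<open>The idempotent e of the nilpotent part of a - \<mu> acts as 0 or as 1. In the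
      first case a - \<mu> has a left inverse on the factor; in the second it acts as 0, which
      \<open>no\<close> forbids.\<close>
    have inj: "w \<in> V i" if w: "w \<in> V (Suc i)" and xw: "(a - \<mu> *\<^sub>C 1) * w \<in> V i" for w \<mu>
    proof -
      define x where "x = a - \<mu> *\<^sub>C 1"
      have x: "x \<in> A" unfolding x_def by (intro minus scale one a)
      obtain l g u where l: "0 < l" and g: "g \<in> A" "u \<in> A" "g * g = g" "x * g = g * x" "u * x = x * u"
        "g = x ^ l * u" "x ^ l * g = x ^ l" by (rule fitting[OF x]) (rule that)
      obtain k where k: "l = Suc k" using l by (cases l) auto
      define e where "e = 1 - g"
      have e: "e \<in> A" "e * e = e" unfolding e_def using g by (auto intro: minus one simp: algebra_simps)
      have xe: "nilpotent (x * e)"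
      proof -
        have comm: "x * e = e * x" unfolding e_def using g(4) by (simp add: algebra_simps)
        have p: "(x * e) ^ Suc j = x ^ Suc j * e" for j
        proof (induction j)
          case (Suc j)
          have "(x * e) ^ Suc (Suc j) = (x * e) * (x * e) ^ Suc j" by (rule power_Suc)
          also have "\<dots> = x * (e * x ^ Suc j) * e" unfolding Suc by (simp only: mult.assoc)
          also have "e * x ^ Suc j = x ^ Suc j * e" using commuting_power[OF comm, of "Suc j"] by simp
          also have "x * (x ^ Suc j * e) * e = x ^ Suc (Suc j) * (e * e)" by (simp only: power_Suc[of x "Suc j"] mult.assoc)
          finally show ?case using e by simp
        qed simp
        have "x ^ l * e = 0" unfolding e_def using g(7) by (simp add: right_diff_distrib)
        then show ?thesis unfolding nilpotent_def using p[of k] k by (intro exI[of _ l]) simp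
      qed
      from idem[OF i e] show ?thesis
      proof
        assume e0: "\<forall>w\<in>V (Suc i). e * w \<in> V i"
        have "g * w = (x ^ k * u) * (x * w)"
          unfolding g(6) k using g(5) by (metis mult.assoc power_Suc2)
        moreover have "(x ^ k * u) * (x * w) \<in> V i"
          by (rule lD(4)) (use i xw x_def x g in \<open>auto intro: mult power\<close>)
        ultimately have "g * w \<in> V i" by simp
        then have "e * w + g * w \<in> V i" using e0 w i by (intro lD(3)) simp_all
        then show ?thesis by (simp add: e_def algebra_simps)
      next
        assume e1: "\<forall>w\<in>V (Suc i). w - e * w \<in> V i"
        have "\<forall>w\<in>V (Suc i). x * w \<in> V i"
        proof
          fix w assume w: "w \<in> V (Suc i)"
          have "(x * e) * w \<in> V i" by (intro lower i mult x e xe w)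
          moreover have "x * (w - e * w) \<in> V i" using e1 w i by (intro lD(4) x) simp_all
          ultimately have "(x * e) * w + x * (w - e * w) \<in> V i" using i by (intro lD(3)) simp_all
          then show "x * w \<in> V i" by (simp add: algebra_simps)
        qed
        then show ?thesis using no x_def by blast
      qed
    qed
    have key: "poly_at p a * w \<notin> V i" if "p \<noteq> 0" "w \<in> V (Suc i)" "w \<notin> V i" for p w
      using that
    proof (induction "degree p" arbitrary: p w)
      case 0
      then obtain c where c: "p = [:c:]" by (metis degree_eq_zeroE)
      then have "c \<noteq> 0" using 0 by simp
      have pw: "poly_at p a * w = c *\<^sub>C w" unfolding c by (simp add: poly_at_def scaleC_mult_left)
      show ?case
      proof
        assume "poly_at p a * w \<in> V i"
        then have "(1 / c) *\<^sub>C c *\<^sub>C w \<in> V i" unfolding pw by (rule left_sub_scale[OF sub, rotated]) (use i in simp)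
        then show False using 0 \<open>c \<noteq> 0\<close> by (simp add: scaleC_scaleC scaleC_one)
      qed
    next
      case (Suc m)
      have "\<not> constant (poly p)" using Suc.hyps(2) by (simp add: constant_degree)
      then obtain z where "poly p z = 0" using fundamental_theorem_of_algebra by blast
      then obtain p' where p': "p = [:- z, 1:] * p'" by (metis poly_eq_0_iff_dvd dvdE)
      have p'0: "p' \<noteq> 0" using Suc.prems p' by auto
      then have deg: "m = degree p'" using Suc.hyps(2) degree_mult_eq[of "[:- z, 1:]" p'] unfolding p' by simp
      define w' where "w' = (a - z *\<^sub>C 1) * w"
      have "w' \<in> V (Suc i)" unfolding w'_def by (intro lD(4) minus scale one a Suc.prems) (use i in simp)
      moreover have "w' \<notin> V i" unfolding w'_def using inj[of w z] Suc.prems by auto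
      ultimately have "poly_at p' a * w' \<notin> V i" by (rule Suc.hyps(1)[OF deg p'0])
      then show ?case unfolding p' poly_at_linear_factor w'_def by (simp add: mult.assoc)
    qed
    obtain c where c: "\<exists>j\<le>D. c j \<noteq> 0" "(\<Sum>j\<le>D. c j *\<^sub>C a ^ j) = 0"
      using dependent[of "\<lambda>j. a ^ j"] power[OF a] by auto
    define p where "p = (\<Sum>j\<le>D. monom (c j) j)"
    have coeff: "coeff p j = (if j \<le> D then c j else 0)" for j
      by (simp add: p_def coeff_sum)
    obtain j where "j \<le> D" "c j \<noteq> 0" using c(1) by auto
    then have "coeff p j \<noteq> 0" by (simp add: coeff)
    then have p0: "p \<noteq> 0" by auto
    have "degree p \<le> D" by (rule degree_le) (simp add: coeff)
    then have "poly_at p a = (\<Sum>j\<le>D. c j *\<^sub>C a ^ j)" by (subst poly_at_bound) (auto simp: coeff intro!: sum.cong)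
    then have pa: "poly_at p a = 0" using c(2) by simp
    obtain w where "w \<in> V (Suc i)" "w \<notin> V i" using step[OF i] by auto
    from key[OF p0 this] show False using pa lD(2)[of i] i by simp
  qed
  \<comment> \<open>Subtraction is truncated and V 0 is {0}, so an element of J m annihilates V i
    for all i \<le> m.\<close>
  define J where "J m = {a \<in> A. \<forall>i\<le>r. \<forall>w\<in>V i. a * w \<in> V (i - m)}" for m
  have Vr: "V r = A" "V 0 = {0}" using V by (auto simp: flag_def)
  show thesis
  proof (rule that[of J r])
    show "J 0 = A" unfolding J_def using lD(4) by auto
    show "J r = {0}"
    proof
      show "J r \<subseteq> {0}"
      proof
        fix a assume a: "a \<in> J r"
        then have "a * 1 \<in> V (r - r)" unfolding J_def using Vr one by blast
        then show "a \<in> {0}" using Vr by simp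
      qed
      show "{0} \<subseteq> J r" unfolding J_def using zero lD(2) by auto
    qed
    show "J (Suc m) \<subseteq> J m" for m
    proof
      fix a assume a: "a \<in> J (Suc m)"
      have "a * w \<in> V (i - m)" if "i \<le> r" "w \<in> V i" for i w
      proof -
        have "a * w \<in> V (i - Suc m)" using a that unfolding J_def by blast
        moreover have "V (i - Suc m) \<subseteq> V (i - m)" by (rule flag_mono[OF V]) (use that in auto)
        ultimately show ?thesis by blast
      qed
      then show "a \<in> J m" using a unfolding J_def by auto
    qed
    show "a + b \<in> J m" if "a \<in> J m" "b \<in> J m" for m a b
      using that lD(3) unfolding J_def by (auto simp: distrib_right intro: add)
    show "c *\<^sub>C a \<in> J m" if "a \<in> J m" for m a c
      using that left_sub_scale[OF sub] unfolding J_def by (auto simp: scaleC_mult_left intro: scale)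
    show "a * b \<in> J m" if "a \<in> J m" "b \<in> A" for m a b
      using that lD(4) unfolding J_def by (auto simp: mult.assoc intro: mult)
    show "a * b - b * a \<in> J (Suc m)" if ab: "a \<in> J m" "b \<in> J m" for m a b
    proof -
      have abA: "a \<in> A" "b \<in> A" using ab unfolding J_def by auto
      have "(a * b - b * a) * w \<in> V (i - Suc m)" if i: "i \<le> r" and w: "w \<in> V i" for i w
      proof (cases m)
        case 0
        show ?thesis
        proof (cases i)
          case 0
          then show ?thesis using w Vr by simp
        next
          case (Suc k)
          then have k: "k < r" using i by simp
          \<comment> \<open>Subtracting scalars leaves the commutator unchanged, and the shifted
            elements already map V (k + 1) into V k.\<close>
          obtain \<mu> where \<mu>: "\<forall>w\<in>V (Suc k). (a - \<mu> *\<^sub>C 1) * w \<in> V k" using scalar[OF k abA(1)] ..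
          obtain \<mu>' where \<mu>': "\<forall>w\<in>V (Suc k). (b - \<mu>' *\<^sub>C 1) * w \<in> V k" using scalar[OF k abA(2)] ..
          have aA: "a - \<mu> *\<^sub>C 1 \<in> A" "b - \<mu>' *\<^sub>C 1 \<in> A" by (intro minus scale one abA)+
          have w': "w \<in> V (Suc k)" using w Suc by simp
          have "(a - \<mu> *\<^sub>C 1) * ((b - \<mu>' *\<^sub>C 1) * w) \<in> V k" "(b - \<mu>' *\<^sub>C 1) * ((a - \<mu> *\<^sub>C 1) * w) \<in> V k"
            using lD(4)[of k, OF _ aA(1) \<mu>'[rule_format, OF w']] lD(4)[of k, OF _ aA(2) \<mu>[rule_format, OF w']] k by simp_all
          then have "(a - \<mu> *\<^sub>C 1) * ((b - \<mu>' *\<^sub>C 1) * w) - (b - \<mu>' *\<^sub>C 1) * ((a - \<mu> *\<^sub>C 1) * w) \<in> V k"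
            by (intro left_sub_diff sub) (use k in simp_all)
          also have "(a - \<mu> *\<^sub>C 1) * ((b - \<mu>' *\<^sub>C 1) * w) - (b - \<mu>' *\<^sub>C 1) * ((a - \<mu> *\<^sub>C 1) * w) = (a * b - b * a) * w"
            by (simp add: algebra_simps scaleC_mult_left scaleC_mult_right scaleC_scaleC scaleC_diff_right)
          finally show ?thesis using Suc \<open>m = 0\<close> by simp
        qed
      next
        case (Suc m')
        \<comment> \<open>For positive m each of the two products drops by 2 m \<ge> m + 1 steps on
          its own.\<close>
        have in1: "a * (b * w) \<in> V (i - m - m)" "b * (a * w) \<in> V (i - m - m)"
        proof -
          have Jd: "x * w \<in> V (i - m)" if "x \<in> J m" "i \<le> r" "w \<in> V i" for x i w
            using that unfolding J_def by blast
          have "i - m \<le> r" using i by simp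
          then show "a * (b * w) \<in> V (i - m - m)" "b * (a * w) \<in> V (i - m - m)"
            using Jd ab i w by blast+
        qed
        have "i - m - m \<le> i - Suc m" using Suc by simp
        then have "V (i - m - m) \<subseteq> V (i - Suc m)" by (rule flag_mono[OF V]) (use i in simp)
        then have "a * (b * w) - b * (a * w) \<in> V (i - Suc m)"
          using in1 by (intro left_sub_diff sub) (use i in auto)
        then show ?thesis by (simp add: left_diff_distrib mult.assoc)
      qed
      then show ?thesis unfolding J_def using abA by (auto intro: minus mult)
    qed
  qed
qed

end

section \<open>Matrix algebras\<close>

text \<open>D + 1 vectors of length D are the columns of a square matrix whose extra row is zero, so
  its determinant vanishes.\<close>

lemma linear_dependence:
  fixes v :: "nat \<Rightarrow> nat \<Rightarrow> complex"
  shows "\<exists>c. (\<exists>i\<le>D. c i \<noteq> 0) \<and> (\<forall>j<D. (\<Sum>i\<le>D. c i * v i j) = 0)"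
proof -
  define M where "M = mat (Suc D) (Suc D) (\<lambda>(j, i). if j < D then v i j else 0)"
  have M: "M \<in> carrier_mat (Suc D) (Suc D)" by (simp add: M_def)
  have "transpose_mat M *\<^sub>v unit_vec (Suc D) D = 0\<^sub>v (Suc D)"
    by (intro eq_vecI) (auto simp: M_def)
  moreover have "unit_vec (Suc D) D \<noteq> (0\<^sub>v (Suc D) :: complex vec)"
  proof
    assume "unit_vec (Suc D) D = (0\<^sub>v (Suc D) :: complex vec)"
    then have "unit_vec (Suc D) D $ D = (0\<^sub>v (Suc D) :: complex vec) $ D" by simp
    then show False by simp
  qed
  ultimately have "det (transpose_mat M) = 0"
    using M by (subst det_0_iff_vec_prod_zero[of _ "Suc D"]) (auto intro!: exI[of _ "unit_vec (Suc D) D"])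
  then have "det M = 0" using det_transpose[OF M] by simp
  then obtain w where w: "w \<in> carrier_vec (Suc D)" "w \<noteq> 0\<^sub>v (Suc D)" "M *\<^sub>v w = 0\<^sub>v (Suc D)"
    using det_0_iff_vec_prod_zero[OF M] by auto
  have "\<exists>i\<le>D. w $ i \<noteq> 0"
  proof (rule ccontr)
    assume "\<not> (\<exists>i\<le>D. w $ i \<noteq> 0)"
    then have "w = 0\<^sub>v (Suc D)" using w(1) by (intro eq_vecI) auto
    with w(2) show False by simp
  qed
  moreover have "(\<Sum>i\<le>D. w $ i * v i j) = 0" if j: "j < D" for j
  proof -
    have "(M *\<^sub>v w) $ j = (\<Sum>i\<le>D. v i j * w $ i)"
      using j w(1) by (auto simp: M_def scalar_prod_def atLeast0LessThan lessThan_Suc_atMost intro!: sum.cong)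
    then show ?thesis using w(3) j by (simp add: mult.commute)
  qed
  ultimately show ?thesis by blast
qed

text \<open>A single algebra into which matrices of every size embed, as operators on sequences:
  \<open>basic_algebra\<close> lives in a type with one unit, whereas matrices of different sizes
  share no unit.\<close>

typedef lin_op = "{f :: (nat \<Rightarrow> complex) \<Rightarrow> nat \<Rightarrow> complex.
    (\<forall>x y. f (x + y) = f x + f y) \<and> (\<forall>c x. f (c *\<^sub>C x) = c *\<^sub>C f x)}"
  morphisms lin_apply Lin_op
  by (rule exI[of _ "\<lambda>x. x"]) simp

setup_lifting type_definition_lin_op

instantiation lin_op :: complex_algebra
begin
lift_definition zero_lin_op :: lin_op is "\<lambda>_. 0" by (simp add: scaleC_zero_right)
lift_definition one_lin_op :: lin_op is "\<lambda>x. x" by simp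
lift_definition plus_lin_op :: "lin_op \<Rightarrow> lin_op \<Rightarrow> lin_op" is "\<lambda>f g x. f x + g x"
  by (simp add: scaleC_add_right ac_simps del: plus_fun_apply)
lift_definition minus_lin_op :: "lin_op \<Rightarrow> lin_op \<Rightarrow> lin_op" is "\<lambda>f g x. f x - g x"
  by (simp add: scaleC_diff_right algebra_simps del: plus_fun_apply minus_apply)
lift_definition uminus_lin_op :: "lin_op \<Rightarrow> lin_op" is "\<lambda>f x. - f x"
  by (simp add: scaleC_minus_right del: plus_fun_apply uminus_apply)
lift_definition times_lin_op :: "lin_op \<Rightarrow> lin_op \<Rightarrow> lin_op" is "\<lambda>f g x. f (g x)" by simp
lift_definition scaleC_lin_op :: "complex \<Rightarrow> lin_op \<Rightarrow> lin_op" is "\<lambda>c f x. c *\<^sub>C f x"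
  by (simp add: scaleC_add_right scaleC_scaleC mult.commute del: plus_fun_apply)
instance
proof
  show "(0 :: lin_op) \<noteq> 1"
  proof transfer
    show "(\<lambda>_. 0) \<noteq> (\<lambda>x :: nat \<Rightarrow> complex. x)"
    proof
      assume "(\<lambda>_. 0) = (\<lambda>x :: nat \<Rightarrow> complex. x)"
      from fun_cong[OF this, of "\<lambda>_. 1"] have "(0 :: nat \<Rightarrow> complex) 0 = 1" by metis
      then show False by simp
    qed
  qed
qed (transfer; simp add: algebra_simps scaleC_add_right scaleC_add_left scaleC_scaleC scaleC_one del: plus_fun_apply minus_apply uminus_apply; fail)+
end

text \<open>An n by n block, with the scalar c on all coordinates from n on. The identity block with
  c = 1 is the unit of the type, so a unital matrix algebra E gives the unital algebra of pairs in E
  and \<complex>.\<close>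

lift_definition block_op :: "nat \<Rightarrow> complex mat \<Rightarrow> complex \<Rightarrow> lin_op" is
  "\<lambda>n M c f i. if i < n then (\<Sum>j<n. M $$ (i, j) * f j) else c * f i"
  by (auto simp: fun_eq_iff scaleC_fun_apply scaleC_complex distrib_left sum.distrib sum_distrib_left algebra_simps)

lemma block_op_mult:
  assumes "M \<in> carrier_mat n n" "N \<in> carrier_mat n n"
  shows "block_op n M c * block_op n N k = block_op n (M * N) (c * k)"
proof -
  have "(\<Sum>j<n. M $$ (i, j) * (\<Sum>l<n. N $$ (j, l) * f l)) = (\<Sum>l<n. (M * N) $$ (i, l) * f l)" if "i < n" for i f
  proof -
    have "(\<Sum>j<n. M $$ (i, j) * (\<Sum>l<n. N $$ (j, l) * f l)) = (\<Sum>j<n. \<Sum>l<n. M $$ (i, j) * N $$ (j, l) * f l)"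
      by (simp add: sum_distrib_left mult.assoc)
    also have "\<dots> = (\<Sum>l<n. \<Sum>j<n. M $$ (i, j) * N $$ (j, l) * f l)" by (rule sum.swap)
    also have "\<dots> = (\<Sum>l<n. (M * N) $$ (i, l) * f l)"
      using assms that by (auto simp: scalar_prod_def atLeast0LessThan sum_distrib_right intro!: sum.cong)
    finally show ?thesis .
  qed
  then show ?thesis by transfer (auto simp: fun_eq_iff)
qed

lemma block_op_add:
  assumes "M \<in> carrier_mat n n" "N \<in> carrier_mat n n"
  shows "block_op n M c + block_op n N k = block_op n (M + N) (c + k)"
  using assms by transfer (auto simp: fun_eq_iff distrib_right sum.distrib)

lemma block_op_scaleC:
  assumes "M \<in> carrier_mat n n"
  shows "k *\<^sub>C block_op n M c = block_op n (k \<cdot>\<^sub>m M) (k * c)"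
  using assms by transfer (auto simp: fun_eq_iff scaleC_fun_apply scaleC_complex sum_distrib_left mult.assoc)

lemma block_op_one: "block_op n (1\<^sub>m n) 1 = 1"
proof -
  have "(\<Sum>j<n. 1\<^sub>m n $$ (i, j) * f j) = f i" if "i < n" for i and f :: "nat \<Rightarrow> complex"
  proof -
    have "(\<Sum>j<n. 1\<^sub>m n $$ (i, j) * f j) = (\<Sum>j<n. if j = i then f j else 0)"
      using that by (intro sum.cong) auto
    then show ?thesis using that by simp
  qed
  then show ?thesis by transfer (auto simp: fun_eq_iff)
qed

lemma block_op_inject:
  assumes "M \<in> carrier_mat n n" "N \<in> carrier_mat n n" "block_op n M c = block_op n N k"
  shows "M = N" "c = k"
proof -
  have eq: "(if i < n then (\<Sum>j<n. M $$ (i, j) * f j) else c * f i) = (if i < n then (\<Sum>j<n. N $$ (i, j) * f j) else k * f i)" for f i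
    using arg_cong[OF assms(3), of lin_apply] by (simp add: block_op.rep_eq fun_eq_iff)
  have unit: "(\<Sum>j<n. L $$ (i, j) * (if j = l then 1 else 0)) = L $$ (i, l)" if "l < n" for L :: "complex mat" and i l
    using that by (simp add: if_distrib[of "\<lambda>z. _ * z"] cong: if_cong)
  show "M = N"
  proof (rule eq_matI)
    fix i l assume "i < dim_row N" "l < dim_col N"
    then have il: "i < n" "l < n" using assms by auto
    show "M $$ (i, l) = N $$ (i, l)"
      using eq[of i "\<lambda>j. if j = l then 1 else 0"] il by (simp only: unit if_True)
  qed (use assms in auto)
  show "c = k" using eq[of n "\<lambda>_. 1"] by simp
qed

inductive_set mat_two_sided :: "nat \<Rightarrow> complex mat set \<Rightarrow> complex mat \<Rightarrow> complex mat set" for n E e where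
  zero: "0\<^sub>m n n \<in> mat_two_sided n E e"
| add: "x \<in> mat_two_sided n E e \<Longrightarrow> a \<in> E \<Longrightarrow> b \<in> E \<Longrightarrow> x + a * e * b \<in> mat_two_sided n E e"

text \<open>\<open>radical_filtration\<close> is applied to the product of E with \<complex>. The
  extra scalar does not spoil \<open>basic\<close>: an idempotent with scalar 1 is not in the ideal
  of its complement, whose scalar is 0.\<close>

theorem matrix_radical_filtration:
  assumes E: "E \<subseteq> carrier_mat n n" and one: "1\<^sub>m n \<in> E"
    and add: "\<And>a b. a \<in> E \<Longrightarrow> b \<in> E \<Longrightarrow> a + b \<in> E" and mult: "\<And>a b. a \<in> E \<Longrightarrow> b \<in> E \<Longrightarrow> a * b \<in> E"
    and smult: "\<And>a c. a \<in> E \<Longrightarrow> c \<cdot>\<^sub>m a \<in> E"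
    and basic: "\<And>g. g \<in> E \<Longrightarrow> g * g = g \<Longrightarrow> g \<in> mat_two_sided n E (1\<^sub>m n - g) \<Longrightarrow> g = 0\<^sub>m n n"
  obtains r J where "J 0 = E" "J r \<subseteq> {0\<^sub>m n n}" "\<And>m. J (Suc m) \<subseteq> J m"
    "\<And>m a b. a \<in> J m \<Longrightarrow> b \<in> J m \<Longrightarrow> a + b \<in> J m"
    "\<And>m a c. a \<in> J m \<Longrightarrow> c \<cdot>\<^sub>m a \<in> J m"
    "\<And>m a b. a \<in> J m \<Longrightarrow> b \<in> E \<Longrightarrow> a * b \<in> J m"
    "\<And>m a b. a \<in> J m \<Longrightarrow> b \<in> J m \<Longrightarrow> a * b - b * a \<in> J (Suc m)"
proof -
  define A where "A = {block_op n M c | M c. M \<in> E}"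
  \<comment> \<open>One dimension for each matrix entry and one for the scalar coordinate.\<close>
  define D where "D = Suc (n * n)"
  have Ec: "M \<in> carrier_mat n n" if "M \<in> E" for M using that E by auto
  have A: "block_op n M c \<in> A" if "M \<in> E" for M c using that unfolding A_def by auto
  have minus_block: "block_op n M c - block_op n N k = block_op n (M - N) (c - k)"
    if "M \<in> carrier_mat n n" "N \<in> carrier_mat n n" for M N c k
    using that by transfer (auto simp: fun_eq_iff left_diff_distrib sum_subtractf)
  have zero_block: "block_op n (0\<^sub>m n n) 0 = 0" by transfer (auto simp: fun_eq_iff)
  interpret alg: basic_algebra A D
  proof
    show "1 \<in> A" using A[OF one, of 1] by (simp add: block_op_one)
    show "x + y \<in> A" if xy: "x \<in> A" "y \<in> A" for x y
    proof -
      obtain M c N k where "x = block_op n M c" "M \<in> E" "y = block_op n N k" "N \<in> E" using xy unfolding A_def by auto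
      then show ?thesis using A[OF add[of M N]] by (simp add: block_op_add Ec)
    qed
    show "x * y \<in> A" if xy: "x \<in> A" "y \<in> A" for x y
    proof -
      obtain M c N k where "x = block_op n M c" "M \<in> E" "y = block_op n N k" "N \<in> E" using xy unfolding A_def by auto
      then show ?thesis using A[OF mult[of M N]] by (simp add: block_op_mult Ec)
    qed
    show "k *\<^sub>C x \<in> A" if x: "x \<in> A" for x k
    proof -
      obtain M c where "x = block_op n M c" "M \<in> E" using x unfolding A_def by auto
      then show ?thesis using A[OF smult[of M]] by (simp add: block_op_scaleC Ec)
    qed
    show "\<exists>c. (\<exists>i\<le>D. c i \<noteq> 0) \<and> (\<Sum>i\<le>D. c i *\<^sub>C f i) = 0" if f: "\<And>i. i \<le> D \<Longrightarrow> f i \<in> A" for f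
    proof -
      have "\<exists>M c. f i = block_op n M c \<and> M \<in> E" if "i \<le> D" for i using f[OF that] unfolding A_def by auto
      then obtain M k where Mk: "\<And>i. i \<le> D \<Longrightarrow> f i = block_op n (M i) (k i)" "\<And>i. i \<le> D \<Longrightarrow> M i \<in> E" by metis
      define v where "v i j = (if j < n * n then M i $$ (j div n, j mod n) else k i)" for i j
      obtain c where c: "\<exists>i\<le>D. c i \<noteq> 0" "\<forall>j<D. (\<Sum>i\<le>D. c i * v i j) = 0" using linear_dependence[of D v] by auto
      have M0: "(\<Sum>i\<le>D. c i * M i $$ (a, b)) = 0" if "a < n" "b < n" for a b
      proof -
        have lt: "a * n + b < n * n"
        proof -
          have "a * n + b < a * n + n" using that by simp
          also have "\<dots> = Suc a * n" by simp
          also have "\<dots> \<le> n * n" using that by (intro mult_right_mono) auto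
          finally show ?thesis .
        qed
        have "(\<Sum>i\<le>D. c i * v i (a * n + b)) = 0" using c(2) lt by (simp add: D_def)
        then show ?thesis using lt that by (simp add: v_def)
      qed
      have k0: "(\<Sum>i\<le>D. c i * k i) = 0" using c(2)[rule_format, of "n * n"] by (simp add: v_def D_def)
      have "(\<Sum>i\<in>I. c i *\<^sub>C f i) = block_op n (mat n n (\<lambda>p. \<Sum>i\<in>I. c i * M i $$ p)) (\<Sum>i\<in>I. c i * k i)"
        if "finite I" "I \<subseteq> {..D}" for I
        using that
      proof (induction I rule: finite_induct)
        case empty
        have "mat n n (\<lambda>p. 0) = (0\<^sub>m n n :: complex mat)" by (intro eq_matI) auto
        then show ?case using zero_block by simp
      next
        case (insert i I)
        have i: "i \<le> D" using insert by simp
        have "c i *\<^sub>C f i = block_op n (c i \<cdot>\<^sub>m M i) (c i * k i)" using Mk[OF i] by (simp add: block_op_scaleC Ec)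
        moreover have "c i \<cdot>\<^sub>m M i + mat n n (\<lambda>p. \<Sum>i\<in>I. c i * M i $$ p) = mat n n (\<lambda>p. \<Sum>i\<in>insert i I. c i * M i $$ p)"
          using insert Ec[OF Mk(2)[OF i]] by (intro eq_matI) auto
        ultimately show ?case using insert Ec[OF Mk(2)[OF i]] by (simp add: block_op_add)
      qed
      from this[of "{..D}"] have "(\<Sum>i\<le>D. c i *\<^sub>C f i) = block_op n (mat n n (\<lambda>p. \<Sum>i\<le>D. c i * M i $$ p)) 0"
        by (simp add: k0)
      also have "mat n n (\<lambda>p. \<Sum>i\<le>D. c i * M i $$ p) = 0\<^sub>m n n" by (intro eq_matI) (auto simp: M0)
      finally show ?thesis using c(1) zero_block by auto
    qed
    show "g = 0" if g: "g \<in> A" "g * g = g" "g \<in> two_sided A (1 - g)" for g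
    proof -
      obtain G c where Gc: "g = block_op n G c" "G \<in> E" using g(1) unfolding A_def by auto
      note Gm = Ec[OF Gc(2)]
      have "block_op n (G * G) (c * c) = block_op n G c" using g(2) Gc by (simp add: block_op_mult Gm)
      from block_op_inject[OF _ Gm this] have GG: "G * G = G" "c * c = c" using Gm by auto
      define e where "e = 1\<^sub>m n - G"
      have e: "e \<in> carrier_mat n n" unfolding e_def using minus_carrier_mat[OF Gm, of "1\<^sub>m n"] .
      have ge: "1 - g = block_op n e (1 - c)"
        unfolding Gc(1) e_def block_op_one[of n, symmetric] by (rule minus_block) (use Gm in simp_all)
      \<comment> \<open>Both coordinates of an element of the ideal are tracked: the block lies in
        the matrix ideal, and the scalar is a multiple of 1 - c.\<close>
      have "\<exists>X k. x = block_op n X (k * (1 - c)) \<and> X \<in> mat_two_sided n E e \<and> X \<in> carrier_mat n n"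
        if "x \<in> two_sided A (1 - g)" for x
        using that
      proof (induction rule: two_sided.induct)
        case zero
        then show ?case using zero_block mat_two_sided.zero[of n E e] by (intro exI[of _ "0\<^sub>m n n"] exI[of _ 0]) simp
      next
        case (add x a b)
        then obtain X k where X: "x = block_op n X (k * (1 - c))" "X \<in> mat_two_sided n E e" "X \<in> carrier_mat n n" by auto
        obtain M l where M: "a = block_op n M l" "M \<in> E" using add unfolding A_def by auto
        obtain N j where N: "b = block_op n N j" "N \<in> E" using add unfolding A_def by auto
        have c1: "M * e \<in> carrier_mat n n" "M * e * N \<in> carrier_mat n n"
          using mult_carrier_mat[OF Ec[OF M(2)] e] mult_carrier_mat[OF mult_carrier_mat[OF Ec[OF M(2)] e] Ec[OF N(2)]] by auto
        have "x + a * (1 - g) * b = block_op n (X + M * e * N) (k * (1 - c) + l * (1 - c) * j)"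
          unfolding ge X(1) M(1) N(1) using c1 X(3) e Ec[OF M(2)] Ec[OF N(2)] by (simp only: block_op_mult block_op_add)
        moreover have "k * (1 - c) + l * (1 - c) * j = (k + l * j) * (1 - c)" by (simp add: algebra_simps)
        moreover have "X + M * e * N \<in> mat_two_sided n E e" by (intro mat_two_sided.add X M N)
        moreover have "X + M * e * N \<in> carrier_mat n n" using X c1 by simp
        ultimately show ?case by metis
      qed
      from this[OF g(3)] obtain X k where X: "block_op n G c = block_op n X (k * (1 - c))" "X \<in> mat_two_sided n E e" "X \<in> carrier_mat n n"
        unfolding Gc(1) by auto
      from block_op_inject[OF Gm X(3) X(1)] have GX: "G = X" "c = k * (1 - c)" by auto
      have "c = 0"
      proof (rule ccontr)
        assume "c \<noteq> 0"
        then have "c = 1" using GG(2) by simp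
        then show False using GX(2) by simp
      qed
      moreover have "G = 0\<^sub>m n n" by (rule basic[OF Gc(2) GG(1)]) (use GX X(2) in \<open>simp add: e_def\<close>)
      ultimately show ?thesis using Gc zero_block by simp
    qed
  qed
  obtain r J' where J': "J' 0 = A" "J' r = {0}" "\<And>m. J' (Suc m) \<subseteq> J' m"
    "\<And>m a b. a \<in> J' m \<Longrightarrow> b \<in> J' m \<Longrightarrow> a + b \<in> J' m"
    "\<And>m a c. a \<in> J' m \<Longrightarrow> c *\<^sub>C a \<in> J' m"
    "\<And>m a b. a \<in> J' m \<Longrightarrow> b \<in> A \<Longrightarrow> a * b \<in> J' m"
    "\<And>m a b. a \<in> J' m \<Longrightarrow> b \<in> J' m \<Longrightarrow> a * b - b * a \<in> J' (Suc m)"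
    by (rule alg.radical_filtration) (rule that)
  \<comment> \<open>Scalar coordinate 0 is how E sits in the product, as an ideal.\<close>
  define J where "J m = {M \<in> E. block_op n M 0 \<in> J' m}" for m
  show thesis
  proof (rule that[of J r])
    show "J 0 = E" unfolding J_def J'(1) using A by auto
    show "J r \<subseteq> {0\<^sub>m n n}"
    proof
      fix M assume "M \<in> J r"
      then have "M \<in> E" "block_op n M 0 = block_op n (0\<^sub>m n n) 0" unfolding J_def J'(2) zero_block by auto
      then show "M \<in> {0\<^sub>m n n}" using block_op_inject(1)[OF Ec zero_carrier_mat] by auto
    qed
    show "J (Suc m) \<subseteq> J m" for m unfolding J_def using J'(3) by auto
    show "a + b \<in> J m" if "a \<in> J m" "b \<in> J m" for m a b
    proof -
      have "block_op n a 0 + block_op n b 0 \<in> J' m" using that by (intro J'(4)) (auto simp: J_def)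
      then show ?thesis using that unfolding J_def by (simp add: block_op_add Ec add)
    qed
    show "c \<cdot>\<^sub>m a \<in> J m" if "a \<in> J m" for m a c
    proof -
      have "c *\<^sub>C block_op n a 0 \<in> J' m" using that by (intro J'(5)) (auto simp: J_def)
      then show ?thesis using that unfolding J_def by (simp add: block_op_scaleC Ec smult)
    qed
    show "a * b \<in> J m" if "a \<in> J m" "b \<in> E" for m a b
    proof -
      have "block_op n a 0 * block_op n b 0 \<in> J' m" using that A by (intro J'(6)) (auto simp: J_def)
      then show ?thesis using that unfolding J_def by (simp add: block_op_mult Ec mult)
    qed
    show "a * b - b * a \<in> J (Suc m)" if "a \<in> J m" "b \<in> J m" for m a b
    proof -
      have ab: "a \<in> E" "b \<in> E" using that by (auto simp: J_def)
      have "block_op n a 0 * block_op n b 0 - block_op n b 0 * block_op n a 0 \<in> J' (Suc m)"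
        using that by (intro J'(7)) (auto simp: J_def)
      then have "block_op n (a * b - b * a) 0 \<in> J' (Suc m)"
        using ab by (simp add: block_op_mult minus_block Ec mult_carrier_mat[of _ n n _ n])
      moreover have "a * b - b * a = a * b + (- 1) \<cdot>\<^sub>m (b * a)"
        using Ec[OF ab(1)] Ec[OF ab(2)] by (intro eq_matI) auto
      then have "a * b - b * a \<in> E" using ab by (simp add: add mult smult)
      ultimately show ?thesis by (simp add: J_def)
    qed
  qed
qed

section \<open>Spreading a bimodular kernel\<close>

lemma sum_fun_apply: "(\<Sum>i\<in>I. f i) a = (\<Sum>i\<in>I. (f i a :: 'z::ab_group_add))"
  by (induction I rule: infinite_finite_induct) auto

section \<open>Morphisms that factor through copies of a point\<close>

context dominated_nc_kernel begin

text \<open>The morphisms from Z to Z' that factor through a finite multiple of W; they form an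
  ideal of the category.\<close>

inductive_set factor_sums :: "'p \<Rightarrow> 'p \<Rightarrow> 'p \<Rightarrow> complex mat set" for W Z Z' where
  zero: "0\<^sub>m (d Z') (d Z) \<in> factor_sums W Z Z'"
| add: "x \<in> factor_sums W Z Z' \<Longrightarrow> \<sigma> \<in> Hom Z W \<Longrightarrow> \<rho> \<in> Hom W Z' \<Longrightarrow> x + \<rho> * \<sigma> \<in> factor_sums W Z Z'"

lemma factor_sums_carrier: "x \<in> factor_sums W Z Z' \<Longrightarrow> x \<in> carrier_mat (d Z') (d Z)"
proof (induction rule: factor_sums.induct)
  case (add x \<sigma> \<rho>)
  then show ?case using mult_carrier_mat[OF Hom_carrier[OF add(3)] Hom_carrier[OF add(2)]] by simp
qed simp

lemma factor_sums_plus: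
  "y \<in> factor_sums W Z Z' \<Longrightarrow> x \<in> factor_sums W Z Z' \<Longrightarrow> x + y \<in> factor_sums W Z Z'"
proof (induction rule: factor_sums.induct)
  case zero
  then show ?case using factor_sums_carrier[OF zero] by simp
next
  case (add y \<sigma> \<rho>)
  have "x + (y + \<rho> * \<sigma>) = (x + y) + \<rho> * \<sigma>"
    using factor_sums_carrier[OF add(1)] factor_sums_carrier[OF add(5)]
      mult_carrier_mat[OF Hom_carrier[OF add(3)] Hom_carrier[OF add(2)]]
    by (subst assoc_add_mat[of _ "d Z'" "d Z"]) auto
  then show ?case using factor_sums.add[OF add(4)[OF add(5)] add(2,3)] by simp
qed

lemma factor_sums_mult:
  assumes "x \<in> factor_sums W Z Z'" and pts: "Z \<in> pts" "Z' \<in> pts" "W \<in> pts" "V \<in> pts" "V' \<in> pts"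
    and \<alpha>: "\<alpha> \<in> Hom Z' V'" and \<beta>: "\<beta> \<in> Hom V Z"
  shows "\<alpha> * x * \<beta> \<in> factor_sums W V V'"
  using assms(1)
proof (induction rule: factor_sums.induct)
  case zero
  then show ?case using Hom_carrier[OF \<alpha>] Hom_carrier[OF \<beta>] factor_sums.zero[of V' V W] by simp
next
  case (add x \<sigma> \<rho>)
  note c = Hom_carrier[OF \<alpha>] Hom_carrier[OF \<beta>] Hom_carrier[OF add(2)] Hom_carrier[OF add(3)] factor_sums_carrier[OF add(1)]
  have "\<alpha> * (x + \<rho> * \<sigma>) * \<beta> = (\<alpha> * x + \<alpha> * (\<rho> * \<sigma>)) * \<beta>"
    using mult_add_distrib_mat[OF c(1) c(5) mult_carrier_mat[OF c(4) c(3)]] by simp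
  also have "\<dots> = \<alpha> * x * \<beta> + \<alpha> * (\<rho> * \<sigma>) * \<beta>"
    by (rule add_mult_distrib_mat[OF mult_carrier_mat[OF c(1) c(5)] mult_carrier_mat[OF c(1) mult_carrier_mat[OF c(4) c(3)]] c(2)])
  also have "\<alpha> * (\<rho> * \<sigma>) * \<beta> = (\<alpha> * \<rho>) * (\<sigma> * \<beta>)"
    using assoc_mult_mat[OF c(1) c(4) c(3)] assoc_mult_mat[OF mult_carrier_mat[OF c(1) c(4)] c(3) c(2)] by simp
  finally have "\<alpha> * (x + \<rho> * \<sigma>) * \<beta> = \<alpha> * x * \<beta> + (\<alpha> * \<rho>) * (\<sigma> * \<beta>)" .
  moreover have "\<alpha> * \<rho> \<in> Hom W V'" "\<sigma> * \<beta> \<in> Hom V W"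
    using Hom_mult[OF pts(3) pts(2) pts(5) add(3) \<alpha>] Hom_mult[OF pts(4) pts(1) pts(3) \<beta> add(2)] by auto
  ultimately show ?case using factor_sums.add[OF add(4)] by simp
qed

lemma factor_sums_indexed:
  assumes "x \<in> factor_sums W Z Z'"
  shows "\<exists>k \<rho> \<sigma>. (\<forall>i<(k::nat). \<sigma> i \<in> Hom Z W \<and> \<rho> i \<in> Hom W Z') \<and>
    (\<forall>a<d Z'. \<forall>b<d Z. (\<Sum>i<k. (\<rho> i * \<sigma> i) $$ (a, b)) = x $$ (a, b))"
  using assms
proof (induction rule: factor_sums.induct)
  case zero
  then show ?case by (intro exI[of _ 0]) simp
next
  case (add x \<sigma>0 \<rho>0)
  then obtain k \<rho> \<sigma> where k: "\<forall>i<(k::nat). \<sigma> i \<in> Hom Z W \<and> \<rho> i \<in> Hom W Z'"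
    "\<forall>a<d Z'. \<forall>b<d Z. (\<Sum>i<k. (\<rho> i * \<sigma> i) $$ (a, b)) = x $$ (a, b)" by auto
  have c: "\<rho>0 * \<sigma>0 \<in> carrier_mat (d Z') (d Z)" using mult_carrier_mat[OF Hom_carrier[OF add(3)] Hom_carrier[OF add(2)]] .
  have "(\<Sum>i<Suc k. ((\<rho>(k := \<rho>0)) i * (\<sigma>(k := \<sigma>0)) i) $$ (a, b)) = (x + \<rho>0 * \<sigma>0) $$ (a, b)"
    if ab: "a < d Z'" "b < d Z" for a b
  proof -
    have "(x + \<rho>0 * \<sigma>0) $$ (a, b) = x $$ (a, b) + (\<rho>0 * \<sigma>0) $$ (a, b)"
      by (rule index_add_mat(1)) (use carrier_matD[OF c] ab in simp_all)
    then show ?thesis using k(2) ab by simp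
  qed
  moreover have "\<forall>i<Suc k. (\<sigma>(k := \<sigma>0)) i \<in> Hom Z W \<and> (\<rho>(k := \<rho>0)) i \<in> Hom W Z'"
    using k(1) add by (auto simp: less_Suc_eq)
  ultimately show ?case by blast
qed

text \<open>Expresses that Z is a retract of a direct sum of finitely many copies of Y, without
  forming that sum.\<close>

definition covers :: "'p \<Rightarrow> 'p \<Rightarrow> bool" where
  "covers Y Z \<longleftrightarrow> 1\<^sub>m (d Z) \<in> factor_sums Y Z Z"

definition intertwining :: "'p set \<Rightarrow> ('p, 'a, 'e) form_kernel \<Rightarrow> bool" where
  "intertwining F \<kappa> \<longleftrightarrow> (\<forall>Z\<in>F. \<forall>Z'\<in>F. \<forall>W\<in>F. \<forall>W'\<in>F. \<forall>\<alpha>\<in>Hom Z Z'. \<forall>\<beta>\<in>Hom W W'. \<forall>R x y.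
     \<kappa> Z' W' (sandwich \<alpha> \<beta> R) x y = \<kappa> Z W R (adj_vec \<alpha> x) (adj_vec \<beta> y))"

end

context kernel_at_point begin

text \<open>The two one-sided conditions compose, as \<alpha> acts on R from one side and \<beta>
  from the other.\<close>

lemma bimod_all:
  assumes ext: "ext \<kappa>" and c: "\<And>\<alpha>. \<alpha> \<in> E \<Longrightarrow> central \<kappa> \<alpha>" and E: "\<alpha> \<in> E" "\<beta> \<in> E"
  shows "\<kappa> Y Y (sandwich \<alpha> \<beta> R) x y = \<kappa> Y Y R (adj_vec \<alpha> x) (adj_vec \<beta> y)"
proof -
  note ab = E_carrier[OF E(1)] E_carrier[OF E(2)]
  have "\<kappa> Y Y (sandwich \<alpha> \<beta> R) x y = \<kappa> Y Y (sandwich \<alpha> (1\<^sub>m n) (sandwich (1\<^sub>m n) \<beta> R)) x y"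
  proof (rule ext_cong[OF ext])
    fix a b assume "a < n" "b < n"
    then show "sandwich \<alpha> \<beta> R a b = sandwich \<alpha> (1\<^sub>m n) (sandwich (1\<^sub>m n) \<beta> R) a b"
      using sandwich_sandwich[OF ab(1) one_carrier_mat[of n] one_carrier_mat[of n] ab(2), of a b R] ab by simp
  qed auto
  also have "\<dots> = \<kappa> Y Y R (adj_vec (1\<^sub>m n) (adj_vec \<alpha> x)) (adj_vec \<beta> (adj_vec (1\<^sub>m n) y))"
    using c[OF E(1)] c[OF E(2)] unfolding central_def bimod_def by simp
  also have "\<dots> = \<kappa> Y Y R (adj_vec \<alpha> x) (adj_vec \<beta> y)"
  proof (rule ext_cong[OF ext])
    have "adj_vec \<beta> (adj_vec (1\<^sub>m n) y) = adj_vec \<beta> y"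
      by (rule adj_vec_cong) (use ab in \<open>simp add: adj_vec_one\<close>)
    then show "\<And>a. a < n \<Longrightarrow> adj_vec \<beta> (adj_vec (1\<^sub>m n) y) a = adj_vec \<beta> y a" by simp
  qed (simp_all add: adj_vec_one)
  finally show ?thesis .
qed

lemma ext_sum:
  assumes "ext \<kappa>"
  shows "\<kappa> Y Y (\<Sum>i\<in>I. R i) x y = (\<Sum>i\<in>I. \<kappa> Y Y (R i) x y)"
  by (rule extends_sum[OF assms]) simp_all

text \<open>A bimodular kernel at \<open>Y\<close> spreads to every point that is a retract of copies of \<open>Y\<close>.\<close>

lemma spread:
  assumes ext: "ext \<kappa>" and c: "\<And>\<alpha>. \<alpha> \<in> E \<Longrightarrow> central \<kappa> \<alpha>"
    and F: "F \<subseteq> pts" "\<And>Z. Z \<in> F \<Longrightarrow> covers Y Z"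
  shows "\<exists>\<kappa>'. extends_on (F \<times> UNIV) \<kappa>' \<and> intertwining F \<kappa>'"
proof -
  have "\<forall>Z\<in>F. \<exists>t. (\<forall>i<(fst t::nat). fst (snd t) i \<in> Hom Z Y \<and> snd (snd t) i \<in> Hom Y Z) \<and>
    (\<forall>a<d Z. \<forall>b<d Z. (\<Sum>i<fst t. (snd (snd t) i * fst (snd t) i) $$ (a, b)) = 1\<^sub>m (d Z) $$ (a, b))"
  proof
    fix Z assume "Z \<in> F"
    from factor_sums_indexed[OF F(2)[OF this, unfolded covers_def]]
    obtain k \<rho> \<sigma> where "\<forall>i<(k::nat). \<sigma> i \<in> Hom Z Y \<and> \<rho> i \<in> Hom Y Z"
      "\<forall>a<d Z. \<forall>b<d Z. (\<Sum>i<k. (\<rho> i * \<sigma> i) $$ (a, b)) = 1\<^sub>m (d Z) $$ (a, b)" by auto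
    then show "\<exists>t. (\<forall>i<(fst t::nat). fst (snd t) i \<in> Hom Z Y \<and> snd (snd t) i \<in> Hom Y Z) \<and>
      (\<forall>a<d Z. \<forall>b<d Z. (\<Sum>i<fst t. (snd (snd t) i * fst (snd t) i) $$ (a, b)) = 1\<^sub>m (d Z) $$ (a, b))"
      by (intro exI[of _ "(k, \<sigma>, \<rho>)"]) simp
  qed
  from bchoice[OF this] obtain t where t: "\<forall>Z\<in>F. (\<forall>i<(fst (t Z)::nat). fst (snd (t Z)) i \<in> Hom Z Y \<and> snd (snd (t Z)) i \<in> Hom Y Z) \<and>
    (\<forall>a<d Z. \<forall>b<d Z. (\<Sum>i<fst (t Z). (snd (snd (t Z)) i * fst (snd (t Z)) i) $$ (a, b)) = 1\<^sub>m (d Z) $$ (a, b))" ..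
  define k where "k Z = fst (t Z)" for Z
  define \<sigma> where "\<sigma> Z = fst (snd (t Z))" for Z
  define \<rho> where "\<rho> Z = snd (snd (t Z))" for Z
  have \<sigma>: "\<sigma> Z i \<in> Hom Z Y" and \<rho>: "\<rho> Z i \<in> Hom Y Z" if "Z \<in> F" "i < k Z" for Z i
    using t that by (auto simp: k_def \<sigma>_def \<rho>_def)
  note \<sigma>c = Hom_carrier[OF \<sigma>] and \<rho>c = Hom_carrier[OF \<rho>]
  have unit: "(\<Sum>i<k Z. (\<rho> Z i * \<sigma> Z i) $$ (a, b)) = (if a = b then 1 else 0)" if "Z \<in> F" "a < d Z" "b < d Z" for Z a b
    using t that by (simp add: k_def \<sigma>_def \<rho>_def)
  have Fp: "Z \<in> pts" if "Z \<in> F" for Z using F(1) that by auto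
  \<comment> \<open>Forced by intertwining: inserting the sum of \<rho> \<sigma>, which is 1, on
    both sides of R expresses the value at (Z, W) through values at Y.\<close>
  define \<kappa>' where "\<kappa>' = (\<lambda>Z W R x y. \<Sum>i<k Z. \<Sum>j<k W. \<kappa> Y Y (sandwich (\<sigma> Z i) (\<sigma> W j) R) (adj_vec (\<rho> Z i) x) (adj_vec (\<rho> W j) y))"
  have vec_unit: "(\<Sum>i<k Z. adj_vec (\<sigma> Z i) (adj_vec (\<rho> Z i) x)) a = x a" if Z: "Z \<in> F" and a: "a < d Z" for Z a and x :: "nat \<Rightarrow> 'e"
  proof -
    have "(\<Sum>i<k Z. adj_vec (\<sigma> Z i) (adj_vec (\<rho> Z i) x)) a = (\<Sum>i<k Z. adj_vec (\<rho> Z i * \<sigma> Z i) x a)"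
      using adj_vec_mult[OF \<rho>c[OF Z] \<sigma>c[OF Z] a, of _ _ x] by (simp add: sum_fun_apply)
    also have "\<dots> = (\<Sum>i<k Z. \<Sum>b<d Z. cnj ((\<rho> Z i * \<sigma> Z i) $$ (b, a)) *\<^sub>C x b)"
      unfolding adj_vec_def using \<rho>c[OF Z] by (intro sum.cong) auto
    also have "\<dots> = (\<Sum>b<d Z. \<Sum>i<k Z. cnj ((\<rho> Z i * \<sigma> Z i) $$ (b, a)) *\<^sub>C x b)" by (rule sum.swap)
    also have "\<dots> = (\<Sum>b<d Z. cnj (if b = a then 1 else 0) *\<^sub>C x b)"
      using unit[OF Z _ a] by (intro sum.cong) (auto simp: scaleC_sum_left[symmetric] cnj_sum[symmetric] simp del: cnj_sum)
    also have "\<dots> = (\<Sum>b<d Z. if b = a then x b else 0)"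
      by (intro sum.cong) (auto simp: scaleC_one scaleC_zero_left)
    finally show ?thesis using a by simp
  qed
  have ext': "extends_on (F \<times> UNIV) \<kappa>'"
  proof (rule extends_onI)
    fix I :: "nat set" and p u and x :: "nat \<Rightarrow> nat \<Rightarrow> 'e"
    assume I: "finite I" and pX: "\<And>i. i \<in> I \<Longrightarrow> (p i, x i) \<in> F \<times> UNIV" and acc: "accretive I p u"
    have pF: "p i \<in> F" if "i \<in> I" for i using pX[OF that] by auto
    \<comment> \<open>Each block at a point is split into its copies of Y; positivity at Y is
      applied to the family indexed by these pairs.\<close>
    define L where "L = (SIGMA l:I. {..<k (p l)})"
    have L: "finite L" unfolding L_def using I by auto
    have sumL: "(\<Sum>v\<in>L. \<Sum>w\<in>L. f (fst v) (snd v) (fst w) (snd w)) = (\<Sum>l\<in>I. \<Sum>m\<in>I. \<Sum>i<k (p l). \<Sum>j<k (p m). f l i m j)" for f :: "nat \<Rightarrow> nat \<Rightarrow> nat \<Rightarrow> nat \<Rightarrow> complex"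
    proof -
      have "(\<Sum>v\<in>L. \<Sum>w\<in>L. f (fst v) (snd v) (fst w) (snd w)) = (\<Sum>l\<in>I. \<Sum>i<k (p l). \<Sum>m\<in>I. \<Sum>j<k (p m). f l i m j)"
      proof -
        have S: "(\<Sum>v\<in>L. h (fst v) (snd v)) = (\<Sum>l\<in>I. \<Sum>i<k (p l). h l i)" for h :: "nat \<Rightarrow> nat \<Rightarrow> complex"
          unfolding L_def by (subst sum.Sigma) (use I in \<open>auto simp: case_prod_unfold\<close>)
        show ?thesis unfolding S[of "\<lambda>m j. f _ _ m j"] by (rule S)
      qed
      also have "\<dots> = (\<Sum>l\<in>I. \<Sum>m\<in>I. \<Sum>i<k (p l). \<Sum>j<k (p m). f l i m j)"
        by (intro sum.cong refl sum.swap)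
      finally show ?thesis .
    qed
    define u' where "u' v w = sandwich (\<sigma> (p (fst v)) (snd v)) (\<sigma> (p (fst w)) (snd w)) (u (fst v) (fst w))" for v w
    have acc': "accretive L (\<lambda>_. Y) u'"
      unfolding accretive_def
    proof
      fix \<xi> :: "nat \<times> nat \<Rightarrow> nat \<Rightarrow> 'h"
      define \<eta> where "\<eta> l = (\<Sum>i<k (p l). 1 *\<^sub>C adj_vec (\<sigma> (p l) i) (\<xi> (l, i)))" for l
      have "bform act n n (u' v w) (\<xi> v) (\<xi> w) =
        bform act (d (p (fst v))) (d (p (fst w))) (u (fst v) (fst w)) (adj_vec (\<sigma> (p (fst v)) (snd v)) (\<xi> v)) (adj_vec (\<sigma> (p (fst w)) (snd w)) (\<xi> w))"
        if "v \<in> L" "w \<in> L" for v w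
      proof -
        have "\<sigma> (p (fst v)) (snd v) \<in> carrier_mat n (d (p (fst v)))" "\<sigma> (p (fst w)) (snd w) \<in> carrier_mat n (d (p (fst w)))"
          using that pF by (auto simp: L_def intro!: \<sigma>c)
        then show ?thesis using bform_sandwich[of "\<sigma> (p (fst v)) (snd v)" "\<sigma> (p (fst w)) (snd w)" "u (fst v) (fst w)" "\<xi> v" "\<xi> w"]
          by (simp add: u'_def)
      qed
      then have "(\<Sum>v\<in>L. \<Sum>w\<in>L. bform act n n (u' v w) (\<xi> v) (\<xi> w)) =
        (\<Sum>v\<in>L. \<Sum>w\<in>L. bform act (d (p (fst v))) (d (p (fst w))) (u (fst v) (fst w)) (adj_vec (\<sigma> (p (fst v)) (snd v)) (\<xi> (fst v, snd v))) (adj_vec (\<sigma> (p (fst w)) (snd w)) (\<xi> (fst w, snd w))))"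
        by simp
      also have "\<dots> = (\<Sum>l\<in>I. \<Sum>m\<in>I. \<Sum>i<k (p l). \<Sum>j<k (p m). bform act (d (p l)) (d (p m)) (u l m) (adj_vec (\<sigma> (p l) i) (\<xi> (l, i))) (adj_vec (\<sigma> (p m) j) (\<xi> (m, j))))"
        by (rule sumL)
      also have "\<dots> = (\<Sum>l\<in>I. \<Sum>m\<in>I. bform act (d (p l)) (d (p m)) (u l m) (\<eta> l) (\<eta> m))"
        unfolding \<eta>_def bform_lincomb_left bform_lincomb_right
        by (simp add: sum_distrib_left, rule sum.cong[OF refl], rule sum.cong[OF refl], rule sum.swap)
      finally show "0 \<le> Re (\<Sum>v\<in>L. \<Sum>w\<in>L. bform act n n (u' v w) (\<xi> v) (\<xi> w))"
        using acc[unfolded accretive_def, rule_format, of \<eta>] by simp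
    qed
    have "(\<Sum>l\<in>I. \<Sum>m\<in>I. \<kappa>' (p l) (p m) (u l m) (x l) (x m)) =
      (\<Sum>v\<in>L. \<Sum>w\<in>L. \<kappa> Y Y (u' v w) (adj_vec (\<rho> (p (fst v)) (snd v)) (x (fst v))) (adj_vec (\<rho> (p (fst w)) (snd w)) (x (fst w))))"
      unfolding \<kappa>'_def u'_def by (rule sumL[symmetric])
    also have "0 \<le> Re \<dots>"
      by (rule extends_pos[OF ext L _ acc']) simp
    finally show "0 \<le> Re (\<Sum>l\<in>I. \<Sum>m\<in>I. \<kappa>' (p l) (p m) (u l m) (x l) (x m))" .
  next
    fix Z W :: 'p and x y :: "nat \<Rightarrow> 'e" assume "(Z, x) \<in> F \<times> UNIV" "(W, y) \<in> F \<times> UNIV"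
    then have ZW: "Z \<in> F" "W \<in> F" by auto
    show "\<kappa>' Z W (R + T) x y = \<kappa>' Z W R x y + \<kappa>' Z W T x y" for R T
      unfolding \<kappa>'_def sandwich_add ext_linear[OF ext] sum.distrib ..
    show "\<kappa>' Z W (z *\<^sub>C R) x y = z * \<kappa>' Z W R x y" for z R
      unfolding \<kappa>'_def sandwich_scaleC ext_linear[OF ext] sum_distrib_left ..
    show "\<kappa>' Z W (q Z W P) x y = s Z W P x y" for P
    proof -
      have "\<kappa> Y Y (sandwich (\<sigma> Z i) (\<sigma> W j) (q Z W P)) (adj_vec (\<rho> Z i) x) (adj_vec (\<rho> W j) y) =
        s Z W P (adj_vec (\<sigma> Z i) (adj_vec (\<rho> Z i) x)) (adj_vec (\<sigma> W j) (adj_vec (\<rho> W j) y))" if ij: "i < k Z" "j < k W" for i j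
      proof -
        have "\<kappa> Y Y (sandwich (\<sigma> Z i) (\<sigma> W j) (q Z W P)) (adj_vec (\<rho> Z i) x) (adj_vec (\<rho> W j) y) =
          \<kappa> Y Y (q Y Y (sandwich (\<sigma> Z i) (\<sigma> W j) P)) (adj_vec (\<rho> Z i) x) (adj_vec (\<rho> W j) y)"
          by (rule ext_cong[OF ext]) (simp_all add: q_int[OF Fp[OF ZW(1)] Y Fp[OF ZW(2)] Y \<sigma>[OF ZW(1) ij(1)] \<sigma>[OF ZW(2) ij(2)]])
        also have "\<dots> = s Y Y (sandwich (\<sigma> Z i) (\<sigma> W j) P) (adj_vec (\<rho> Z i) x) (adj_vec (\<rho> W j) y)"
          by (rule extends_eq[OF ext]) simp_all
        also have "\<dots> = s Z W P (adj_vec (\<sigma> Z i) (adj_vec (\<rho> Z i) x)) (adj_vec (\<sigma> W j) (adj_vec (\<rho> W j) y))"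
          by (rule s_int[OF Fp[OF ZW(1)] Y Fp[OF ZW(2)] Y \<sigma>[OF ZW(1) ij(1)] \<sigma>[OF ZW(2) ij(2)]])
        finally show ?thesis .
      qed
      then have "\<kappa>' Z W (q Z W P) x y = (\<Sum>i<k Z. \<Sum>j<k W. s Z W P (adj_vec (\<sigma> Z i) (adj_vec (\<rho> Z i) x)) (adj_vec (\<sigma> W j) (adj_vec (\<rho> W j) y)))"
        unfolding \<kappa>'_def by (intro sum.cong refl) simp
      also have "\<dots> = s Z W P (\<Sum>i<k Z. adj_vec (\<sigma> Z i) (adj_vec (\<rho> Z i) x)) (\<Sum>j<k W. adj_vec (\<sigma> W j) (adj_vec (\<rho> W j) y))"
      proof -
        have z: "s Z W P 0 v = 0" "s Z W P v 0 = 0" for v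
          using s_scaleC_left[OF Fp Fp, OF ZW, of P 0 0 v] s_scaleC_right[OF Fp Fp, OF ZW, of P v 0 0] by (auto simp: scaleC_zero_left)
        have "s Z W P (\<Sum>i\<in>I. f i) v = (\<Sum>i\<in>I. s Z W P (f i) v)" "s Z W P v (\<Sum>i\<in>I. f i) = (\<Sum>i\<in>I. s Z W P v (f i))" for I :: "nat set" and f v
          by (induction I rule: infinite_finite_induct) (auto simp: z s_add_left[OF Fp Fp, OF ZW] s_add_right[OF Fp Fp, OF ZW] simp del: plus_fun_apply zero_fun_apply)
        then show ?thesis by (simp, subst sum.swap, simp)
      qed
      also have "\<dots> = s Z W P x y"
        by (rule s_cong[OF Fp Fp, OF ZW]) (simp_all only: vec_unit ZW)
      finally show ?thesis .
    qed
  qed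
  have lin: "\<kappa> Y Y R (\<Sum>i\<in>I. f i) v = (\<Sum>i\<in>I. \<kappa> Y Y R (f i) v)" "\<kappa> Y Y R v (\<Sum>i\<in>I. f i) = (\<Sum>i\<in>I. \<kappa> Y Y R v (f i))" for R and I :: "nat set" and f v
    using ext_linear(5)[OF ext, of R 0 0 v] ext_linear(6)[OF ext, of R v 0 0]
    by (induction I rule: infinite_finite_induct) (auto simp: ext_linear[OF ext] scaleC_zero_left simp del: plus_fun_apply zero_fun_apply)
  have lin': "\<kappa>' Z W R (\<Sum>i\<in>I. f i) (\<Sum>j\<in>I'. g j) = (\<Sum>i\<in>I. \<Sum>j\<in>I'. \<kappa>' Z W R (f i) (g j))" for Z W R and I I' :: "nat set" and f g
  proof -
    have z: "adj_vec \<alpha> 0 = (0 :: nat \<Rightarrow> 'e)" for \<alpha> by (rule HOL.ext) (simp add: adj_vec_def scaleC_zero_right)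
    have a: "adj_vec \<alpha> (\<Sum>i\<in>I. f i) = (\<Sum>i\<in>I. adj_vec \<alpha> (f i))" for \<alpha> and I :: "nat set" and f :: "nat \<Rightarrow> nat \<Rightarrow> 'e"
      by (induction I rule: infinite_finite_induct) (auto simp: adj_vec_add z simp del: plus_fun_apply zero_fun_apply)
    show ?thesis unfolding \<kappa>'_def a lin by (rule sum_swap_pairs)
  qed
  \<comment> \<open>Intertwining along morphisms into Y. Each \<tau> \<rho> is an endomorphism of Y,
    where bimodularity holds, and afterwards the sum of \<rho> \<sigma> collapses to the
    identity.\<close>
  have key: "\<kappa> Y Y (sandwich \<tau> \<tau>' R) v w = \<kappa>' Z W R (adj_vec \<tau> v) (adj_vec \<tau>' w)"
    if ZW: "Z \<in> F" "W \<in> F" and \<tau>: "\<tau> \<in> Hom Z Y" "\<tau>' \<in> Hom W Y" for Z W \<tau> \<tau>' R v w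
  proof -
    note \<tau>c = Hom_carrier[OF \<tau>(1)] Hom_carrier[OF \<tau>(2)]
    have "\<kappa>' Z W R (adj_vec \<tau> v) (adj_vec \<tau>' w) =
      (\<Sum>i<k Z. \<Sum>j<k W. \<kappa> Y Y (sandwich (\<tau> * (\<rho> Z i * \<sigma> Z i)) (\<tau>' * (\<rho> W j * \<sigma> W j)) R) v w)"
      unfolding \<kappa>'_def
    proof (intro sum.cong refl)
      fix i j assume "i \<in> {..<k Z}" "j \<in> {..<k W}"
      then have ij: "i < k Z" "j < k W" by auto
      note cc = \<sigma>c[OF ZW(1) ij(1)] \<rho>c[OF ZW(1) ij(1)] \<sigma>c[OF ZW(2) ij(2)] \<rho>c[OF ZW(2) ij(2)]
      have e: "\<tau> * \<rho> Z i \<in> E" "\<tau>' * \<rho> W j \<in> E"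
        using Hom_mult[OF Y Fp[OF ZW(1)] Y \<rho>[OF ZW(1) ij(1)] \<tau>(1)] Hom_mult[OF Y Fp[OF ZW(2)] Y \<rho>[OF ZW(2) ij(2)] \<tau>(2)] by auto
      have "\<kappa> Y Y (sandwich (\<sigma> Z i) (\<sigma> W j) R) (adj_vec (\<rho> Z i) (adj_vec \<tau> v)) (adj_vec (\<rho> W j) (adj_vec \<tau>' w)) =
        \<kappa> Y Y (sandwich (\<sigma> Z i) (\<sigma> W j) R) (adj_vec (\<tau> * \<rho> Z i) v) (adj_vec (\<tau>' * \<rho> W j) w)"
        by (rule ext_cong[OF ext]) (simp_all add: adj_vec_mult[OF \<tau>c(1) cc(2)] adj_vec_mult[OF \<tau>c(2) cc(4)])
      also have "\<dots> = \<kappa> Y Y (sandwich (\<tau> * \<rho> Z i) (\<tau>' * \<rho> W j) (sandwich (\<sigma> Z i) (\<sigma> W j) R)) v w"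
        by (rule bimod_all[OF ext c e, symmetric])
      also have "\<dots> = \<kappa> Y Y (sandwich (\<tau> * (\<rho> Z i * \<sigma> Z i)) (\<tau>' * (\<rho> W j * \<sigma> W j)) R) v w"
      proof (rule ext_cong[OF ext])
        fix a b assume "a < n" "b < n"
        then show "sandwich (\<tau> * \<rho> Z i) (\<tau>' * \<rho> W j) (sandwich (\<sigma> Z i) (\<sigma> W j) R) a b = sandwich (\<tau> * (\<rho> Z i * \<sigma> Z i)) (\<tau>' * (\<rho> W j * \<sigma> W j)) R a b"
          using sandwich_sandwich[OF mult_carrier_mat[OF \<tau>c(1) cc(2)] cc(1) mult_carrier_mat[OF \<tau>c(2) cc(4)] cc(3), of a b R]
            assoc_mult_mat[OF \<tau>c(1) cc(2) cc(1)] assoc_mult_mat[OF \<tau>c(2) cc(4) cc(3)] by simp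
      qed auto
      finally show "\<kappa> Y Y (sandwich (\<sigma> Z i) (\<sigma> W j) R) (adj_vec (\<rho> Z i) (adj_vec \<tau> v)) (adj_vec (\<rho> W j) (adj_vec \<tau>' w)) =
        \<kappa> Y Y (sandwich (\<tau> * (\<rho> Z i * \<sigma> Z i)) (\<tau>' * (\<rho> W j * \<sigma> W j)) R) v w" .
    qed
    also have "\<dots> = \<kappa> Y Y (\<Sum>i<k Z. \<Sum>j<k W. sandwich (\<tau> * (\<rho> Z i * \<sigma> Z i)) (\<tau>' * (\<rho> W j * \<sigma> W j)) R) v w"
      by (simp add: ext_sum[OF ext])
    also have "\<dots> = \<kappa> Y Y (sandwich \<tau> \<tau>' R) v w"
    proof (rule ext_cong[OF ext])
      fix a b assume ab: "a < n" "b < n"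
      have comp: "(\<Sum>i<k Z. (\<tau> * (\<rho> Z i * \<sigma> Z i)) $$ (a, b)) = \<tau> $$ (a, b)"
        if "Z \<in> F" "\<tau> \<in> carrier_mat n (d Z)" "a < n" "b < d Z" for Z \<tau> a b
      proof -
        have "(\<Sum>i<k Z. (\<tau> * (\<rho> Z i * \<sigma> Z i)) $$ (a, b)) = (\<Sum>i<k Z. \<Sum>l<d Z. \<tau> $$ (a, l) * (\<rho> Z i * \<sigma> Z i) $$ (l, b))"
        proof (intro sum.cong refl)
          fix i assume "i \<in> {..<k Z}"
          then have "\<rho> Z i * \<sigma> Z i \<in> carrier_mat (d Z) (d Z)" using mult_carrier_mat[OF \<rho>c \<sigma>c] that by auto
          then show "(\<tau> * (\<rho> Z i * \<sigma> Z i)) $$ (a, b) = (\<Sum>l<d Z. \<tau> $$ (a, l) * (\<rho> Z i * \<sigma> Z i) $$ (l, b))"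
            using that by (subst index_mult_mat) (auto simp: scalar_prod_def atLeast0LessThan simp del: index_mult_mat intro!: sum.cong)
        qed
        also have "\<dots> = (\<Sum>l<d Z. \<Sum>i<k Z. \<tau> $$ (a, l) * (\<rho> Z i * \<sigma> Z i) $$ (l, b))" by (rule sum.swap)
        also have "\<dots> = (\<Sum>l<d Z. \<tau> $$ (a, l) * (if l = b then 1 else 0))"
          unfolding sum_distrib_left[symmetric] using unit that by (intro sum.cong) auto
        also have "\<dots> = (\<Sum>l<d Z. if l = b then \<tau> $$ (a, l) else 0)" by (intro sum.cong) auto
        finally show ?thesis using that by simp
      qed
      have "(\<Sum>i<k Z. \<Sum>j<k W. sandwich (\<tau> * (\<rho> Z i * \<sigma> Z i)) (\<tau>' * (\<rho> W j * \<sigma> W j)) R) a b =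
        (\<Sum>i<k Z. \<Sum>j<k W. \<Sum>l<d Z. \<Sum>m<d W. ((\<tau> * (\<rho> Z i * \<sigma> Z i)) $$ (a, l) * cnj ((\<tau>' * (\<rho> W j * \<sigma> W j)) $$ (b, m))) *\<^sub>C R l m)"
        unfolding sum_fun_apply sandwich_def using \<sigma>c ZW by (intro sum.cong refl) auto
      also have "\<dots> = (\<Sum>l<d Z. \<Sum>m<d W. \<Sum>i<k Z. \<Sum>j<k W. ((\<tau> * (\<rho> Z i * \<sigma> Z i)) $$ (a, l) * cnj ((\<tau>' * (\<rho> W j * \<sigma> W j)) $$ (b, m))) *\<^sub>C R l m)"
        by (rule sum_swap_pairs)
      also have "\<dots> = (\<Sum>l<d Z. \<Sum>m<d W. (\<tau> $$ (a, l) * cnj (\<tau>' $$ (b, m))) *\<^sub>C R l m)"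
      proof (intro sum.cong refl)
        fix l m assume "l \<in> {..<d Z}" "m \<in> {..<d W}"
        then have lm: "l < d Z" "m < d W" by auto
        have "(\<Sum>i<k Z. \<Sum>j<k W. ((\<tau> * (\<rho> Z i * \<sigma> Z i)) $$ (a, l) * cnj ((\<tau>' * (\<rho> W j * \<sigma> W j)) $$ (b, m))) *\<^sub>C R l m) =
          ((\<Sum>i<k Z. (\<tau> * (\<rho> Z i * \<sigma> Z i)) $$ (a, l)) * cnj (\<Sum>j<k W. (\<tau>' * (\<rho> W j * \<sigma> W j)) $$ (b, m))) *\<^sub>C R l m"
          unfolding cnj_sum sum_product scaleC_sum_left ..
        then show "(\<Sum>i<k Z. \<Sum>j<k W. ((\<tau> * (\<rho> Z i * \<sigma> Z i)) $$ (a, l) * cnj ((\<tau>' * (\<rho> W j * \<sigma> W j)) $$ (b, m))) *\<^sub>C R l m) = (\<tau> $$ (a, l) * cnj (\<tau>' $$ (b, m))) *\<^sub>C R l m"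
          using comp[OF ZW(1) \<tau>c(1) ab(1) lm(1)] comp[OF ZW(2) \<tau>c(2) ab(2) lm(2)] by simp
      qed
      also have "\<dots> = sandwich \<tau> \<tau>' R a b" using \<tau>c by (simp add: sandwich_def)
      finally show "(\<Sum>i<k Z. \<Sum>j<k W. sandwich (\<tau> * (\<rho> Z i * \<sigma> Z i)) (\<tau>' * (\<rho> W j * \<sigma> W j)) R) a b = sandwich \<tau> \<tau>' R a b" .
    qed auto
    finally show ?thesis by simp
  qed
  have "intertwining F \<kappa>'"
    unfolding intertwining_def
  proof (intro ballI allI)
    fix Z Z' W W' \<alpha> \<beta> R and x y :: "nat \<Rightarrow> 'e"
    assume F': "Z \<in> F" "Z' \<in> F" "W \<in> F" "W' \<in> F" and \<alpha>: "\<alpha> \<in> Hom Z Z'" "\<beta> \<in> Hom W W'"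
    note \<alpha>c = Hom_carrier[OF \<alpha>(1)] Hom_carrier[OF \<alpha>(2)]
    \<comment> \<open>A general \<alpha> is reached through the morphisms \<sigma> \<alpha> into Y,
      to which \<open>key\<close> applies.\<close>
    have "\<kappa>' Z' W' (sandwich \<alpha> \<beta> R) x y = (\<Sum>i<k Z'. \<Sum>j<k W'. \<kappa>' Z W R (adj_vec \<alpha> (adj_vec (\<sigma> Z' i) (adj_vec (\<rho> Z' i) x))) (adj_vec \<beta> (adj_vec (\<sigma> W' j) (adj_vec (\<rho> W' j) y))))"
      unfolding \<kappa>'_def[of, THEN fun_cong, THEN fun_cong, THEN fun_cong, THEN fun_cong, THEN fun_cong, of Z' W']
    proof (intro sum.cong refl)
      fix i j assume "i \<in> {..<k Z'}" "j \<in> {..<k W'}"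
      then have ij: "i < k Z'" "j < k W'" by auto
      note cc = \<sigma>c[OF F'(2) ij(1)] \<sigma>c[OF F'(4) ij(2)]
      let ?v = "adj_vec (\<rho> Z' i) x" and ?w = "adj_vec (\<rho> W' j) y"
      have "\<kappa> Y Y (sandwich (\<sigma> Z' i) (\<sigma> W' j) (sandwich \<alpha> \<beta> R)) ?v ?w = \<kappa> Y Y (sandwich (\<sigma> Z' i * \<alpha>) (\<sigma> W' j * \<beta>) R) ?v ?w"
        by (rule ext_cong[OF ext]) (simp_all add: sandwich_sandwich[OF cc(1) \<alpha>c(1) cc(2) \<alpha>c(2)])
      also have "\<dots> = \<kappa>' Z W R (adj_vec (\<sigma> Z' i * \<alpha>) ?v) (adj_vec (\<sigma> W' j * \<beta>) ?w)"
        by (rule key[OF F'(1,3)]) (use Hom_mult[OF Fp Fp Y \<alpha>(1) \<sigma>[OF F'(2) ij(1)]] Hom_mult[OF Fp Fp Y \<alpha>(2) \<sigma>[OF F'(4) ij(2)]] F' in auto)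
      also have "\<dots> = \<kappa>' Z W R (adj_vec \<alpha> (adj_vec (\<sigma> Z' i) ?v)) (adj_vec \<beta> (adj_vec (\<sigma> W' j) ?w))"
        by (rule extends_cong[OF ext' F(1) F'(1,3)]) (simp_all add: adj_vec_mult[OF cc(1) \<alpha>c(1)] adj_vec_mult[OF cc(2) \<alpha>c(2)])
      finally show "\<kappa> Y Y (sandwich (\<sigma> Z' i) (\<sigma> W' j) (sandwich \<alpha> \<beta> R)) ?v ?w = \<kappa>' Z W R (adj_vec \<alpha> (adj_vec (\<sigma> Z' i) ?v)) (adj_vec \<beta> (adj_vec (\<sigma> W' j) ?w))" .
    qed
    also have "\<dots> = \<kappa>' Z W R (\<Sum>i<k Z'. adj_vec \<alpha> (adj_vec (\<sigma> Z' i) (adj_vec (\<rho> Z' i) x))) (\<Sum>j<k W'. adj_vec \<beta> (adj_vec (\<sigma> W' j) (adj_vec (\<rho> W' j) y)))"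
      by (rule lin'[symmetric])
    also have "\<dots> = \<kappa>' Z W R (adj_vec \<alpha> x) (adj_vec \<beta> y)"
    proof -
      have z: "adj_vec \<alpha> 0 = (0 :: nat \<Rightarrow> 'e)" for \<alpha> by (rule HOL.ext) (simp add: adj_vec_def scaleC_zero_right)
      have a: "(\<Sum>i\<in>I. adj_vec \<alpha> (f i)) = adj_vec \<alpha> (\<Sum>i\<in>I. f i)" for \<alpha> and I :: "nat set" and f :: "nat \<Rightarrow> nat \<Rightarrow> 'e"
        by (induction I rule: infinite_finite_induct) (auto simp: adj_vec_add z simp del: plus_fun_apply zero_fun_apply)
      have b: "(\<Sum>i<k Z. adj_vec \<gamma> (adj_vec (\<sigma> Z i) (adj_vec (\<rho> Z i) x))) = adj_vec \<gamma> x" if "Z \<in> F" "dim_row \<gamma> = d Z" for Z \<gamma> and x :: "nat \<Rightarrow> 'e"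
        unfolding a by (rule adj_vec_cong) (use vec_unit[OF that(1)] that(2) in simp)
      show ?thesis using b[OF F'(2), of \<alpha>] b[OF F'(4), of \<beta>] \<alpha>c by simp
    qed
    finally show "\<kappa>' Z' W' (sandwich \<alpha> \<beta> R) x y = \<kappa>' Z W R (adj_vec \<alpha> x) (adj_vec \<beta> y)" .
  qed
  with ext' show ?thesis by blast
qed

end

context dominated_nc_kernel begin

text \<open>The assumption \<open>basic\<close> of \<open>basic_algebra\<close>, for the
  endomorphism algebra of Y.\<close>

definition basic_at :: "'p \<Rightarrow> bool" where
  "basic_at Y \<longleftrightarrow> (\<forall>g\<in>Hom Y Y. g * g = g \<longrightarrow> g \<in> mat_two_sided (d Y) (Hom Y Y) (1\<^sub>m (d Y) - g) \<longrightarrow> g = 0\<^sub>m (d Y) (d Y))"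

lemma intertwiningD:
  assumes "intertwining F \<kappa>" "Z \<in> F" "Z' \<in> F" "W \<in> F" "W' \<in> F" "\<alpha> \<in> Hom Z Z'" "\<beta> \<in> Hom W W'"
  shows "\<kappa> Z' W' (sandwich \<alpha> \<beta> R) x y = \<kappa> Z W R (adj_vec \<alpha> x) (adj_vec \<beta> y)"
  using assms unfolding intertwining_def by blast

lemma extends_finite_intertwining:
  assumes Yp: "Y \<in> pts" and basic: "basic_at Y" and F: "F \<subseteq> pts" "\<And>Z. Z \<in> F \<Longrightarrow> covers Y Z"
  shows "\<exists>\<kappa>. extends_on (F \<times> UNIV) \<kappa> \<and> intertwining F \<kappa>"
proof -
  interpret kernel_at_point act pts d q s Hom Y by unfold_locales (rule Yp)
  obtain r J where J: "J 0 = Hom Y Y" "J r \<subseteq> {0\<^sub>m (d Y) (d Y)}" "\<And>m. J (Suc m) \<subseteq> J m"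
    "\<And>m a b. a \<in> J m \<Longrightarrow> b \<in> J m \<Longrightarrow> a + b \<in> J m"
    "\<And>m a c. a \<in> J m \<Longrightarrow> c \<cdot>\<^sub>m a \<in> J m"
    "\<And>m a b. a \<in> J m \<Longrightarrow> b \<in> Hom Y Y \<Longrightarrow> a * b \<in> J m"
    "\<And>m a b. a \<in> J m \<Longrightarrow> b \<in> J m \<Longrightarrow> a * b - b * a \<in> J (Suc m)"
  proof (rule matrix_radical_filtration[of "Hom Y Y" "d Y"])
    show "Hom Y Y \<subseteq> carrier_mat (d Y) (d Y)" using E_carrier by auto
    show "1\<^sub>m (d Y) \<in> Hom Y Y" by (rule E_one)
    show "a + b \<in> Hom Y Y" if "a \<in> Hom Y Y" "b \<in> Hom Y Y" for a b by (rule E_add[OF that])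
    show "a * b \<in> Hom Y Y" if "a \<in> Hom Y Y" "b \<in> Hom Y Y" for a b by (rule E_mem_mult[OF that(2,1)])
    show "c \<cdot>\<^sub>m a \<in> Hom Y Y" if "a \<in> Hom Y Y" for a c by (rule E_smult[OF that])
    show "g = 0\<^sub>m (d Y) (d Y)" if "g \<in> Hom Y Y" "g * g = g" "g \<in> mat_two_sided (d Y) (Hom Y Y) (1\<^sub>m (d Y) - g)" for g
      using basic that unfolding basic_at_def by blast
  qed (rule that)
  obtain \<kappa> where "extends_on ({Y} \<times> UNIV) \<kappa>" "\<forall>\<alpha>\<in>Hom Y Y. central \<kappa> \<alpha>"
    using bimodular_exists[OF J] by auto
  then show ?thesis by (intro spread[OF _ _ F]) auto
qed

text \<open>Each intertwining condition concerns at most four points and is closed, so extensions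
  over finite sets of points and a limit suffice.\<close>

theorem extends_intertwining:
  assumes cover: "\<And>F. finite F \<Longrightarrow> F \<noteq> {} \<Longrightarrow> F \<subseteq> pts \<Longrightarrow> \<exists>Y\<in>pts. basic_at Y \<and> (\<forall>Z\<in>F. covers Y Z)"
  shows "\<exists>\<kappa>. extends_on (pts \<times> UNIV) \<kappa> \<and> intertwining pts \<kappa>"
proof (cases "pts = {}")
  case True
  then show ?thesis using extends_exists by (auto simp: intertwining_def)
next
  case False
  then obtain Z0 where Z0: "Z0 \<in> pts" by auto
  have ex: "\<exists>\<kappa>. extends_on (F \<times> UNIV) \<kappa> \<and> intertwining F \<kappa>" if F: "finite F" "F \<noteq> {}" "F \<subseteq> pts" for F
  proof -
    obtain Y where "Y \<in> pts" "basic_at Y" "\<forall>Z\<in>F. covers Y Z" using cover[OF F] by auto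
    then show ?thesis by (intro extends_finite_intertwining F(3)) auto
  qed
  define \<kappa> where "\<kappa> F = (SOME \<kappa>. extends_on (F \<times> UNIV) \<kappa> \<and> intertwining F \<kappa>)" for F
  have \<kappa>: "extends_on (F \<times> UNIV) (\<kappa> F) \<and> intertwining F (\<kappa> F)" if "finite F" "F \<noteq> {}" "F \<subseteq> pts" for F
    unfolding \<kappa>_def by (rule someI_ex[OF ex[OF that]])
  define D where "D = finite_subsets_at_top pts"
  have D: "D \<noteq> bot" by (simp add: D_def)
  \<comment> \<open>The point Z0 keeps the finite sets nonempty, as \<open>cover\<close>
    requires.\<close>
  have ev0: "\<forall>\<^sub>F F in D. G \<subseteq> F \<and> extends_on (F \<times> UNIV) (\<kappa> F) \<and> intertwining F (\<kappa> F)" if "finite G" "G \<subseteq> pts" for G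
    unfolding D_def eventually_finite_subsets_at_top
    by (intro exI[of _ "insert Z0 G"]) (use that Z0 \<kappa> in auto)
  have ev: "\<forall>\<^sub>F F in D. extends_on X (\<kappa> F)" if X: "finite X" "X \<subseteq> pts \<times> UNIV" for X
  proof -
    have "\<forall>\<^sub>F F in D. fst ` X \<subseteq> F \<and> extends_on (F \<times> UNIV) (\<kappa> F) \<and> intertwining F (\<kappa> F)"
      by (rule ev0) (use X in auto)
    then show ?thesis
    proof (rule eventually_mono)
      fix F assume "fst ` X \<subseteq> F \<and> extends_on (F \<times> UNIV) (\<kappa> F) \<and> intertwining F (\<kappa> F)"
      then have "extends_on (F \<times> UNIV) (\<kappa> F)" "X \<subseteq> F \<times> UNIV" by force+
      then show "extends_on X (\<kappa> F)" by (rule extends_on_mono)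
    qed
  qed
  obtain D' \<kappa>' where D': "D' \<le> D" "D' \<noteq> bot" and ext': "extends_on (pts \<times> UNIV) \<kappa>'"
    and lim0: "\<And>Z x W y R. (Z, x) \<in> pts \<times> UNIV \<Longrightarrow> (W, y) \<in> pts \<times> UNIV \<Longrightarrow> ((\<lambda>F. \<kappa> F Z W R x y) \<longlongrightarrow> \<kappa>' Z W R x y) D'"
    by (rule extends_compact[OF order_refl D ev], assumption+, rule that)
  have lim: "((\<lambda>F. \<kappa> F Z W R x y) \<longlongrightarrow> \<kappa>' Z W R x y) D'" if "Z \<in> pts" "W \<in> pts" for Z W R x y
    by (rule lim0) (use that in simp_all)
  have "intertwining pts \<kappa>'"
    unfolding intertwining_def
  proof (intro ballI allI)
    fix Z Z' W W' \<alpha> \<beta> R and x y :: "nat \<Rightarrow> 'e"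
    assume p: "Z \<in> pts" "Z' \<in> pts" "W \<in> pts" "W' \<in> pts" and \<alpha>: "\<alpha> \<in> Hom Z Z'" "\<beta> \<in> Hom W W'"
    have "\<forall>\<^sub>F F in D. {Z, Z', W, W'} \<subseteq> F \<and> extends_on (F \<times> UNIV) (\<kappa> F) \<and> intertwining F (\<kappa> F)"
      by (rule ev0) (use p in auto)
    then have "\<forall>\<^sub>F F in D. \<kappa> F Z W R (adj_vec \<alpha> x) (adj_vec \<beta> y) = \<kappa> F Z' W' (sandwich \<alpha> \<beta> R) x y"
    proof (rule eventually_mono)
      fix F assume "{Z, Z', W, W'} \<subseteq> F \<and> extends_on (F \<times> UNIV) (\<kappa> F) \<and> intertwining F (\<kappa> F)"
      then show "\<kappa> F Z W R (adj_vec \<alpha> x) (adj_vec \<beta> y) = \<kappa> F Z' W' (sandwich \<alpha> \<beta> R) x y"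
        using intertwiningD[of F "\<kappa> F" Z Z' W W' \<alpha> \<beta> R x y] \<alpha> by simp
    qed
    then have "\<forall>\<^sub>F F in D'. \<kappa> F Z W R (adj_vec \<alpha> x) (adj_vec \<beta> y) = \<kappa> F Z' W' (sandwich \<alpha> \<beta> R) x y"
      using D'(1) by (rule filter_leD[rotated])
    then have "((\<lambda>F. \<kappa> F Z' W' (sandwich \<alpha> \<beta> R) x y) \<longlongrightarrow> \<kappa>' Z W R (adj_vec \<alpha> x) (adj_vec \<beta> y)) D'"
      by (rule Lim_transform_eventually[OF lim[OF p(1,3)]])
    then show "\<kappa>' Z' W' (sandwich \<alpha> \<beta> R) x y = \<kappa>' Z W R (adj_vec \<alpha> x) (adj_vec \<beta> y)"
      by (rule tendsto_unique[OF D'(2) lim[OF p(2,4)]])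
  qed
  with ext' show ?thesis by blast
qed

end

section \<open>Orthonormalization\<close>

text \<open>The value of u P v^* for row vectors. It is linear in the first vector and
  conjugate-linear in the second, the opposite of \<open>bform\<close>.\<close>

definition sesq :: "nat \<Rightarrow> (nat \<Rightarrow> nat \<Rightarrow> complex) \<Rightarrow> (nat \<Rightarrow> complex) \<Rightarrow> (nat \<Rightarrow> complex) \<Rightarrow> complex" where
  "sesq n P u v = (\<Sum>a<n. \<Sum>b<n. u a * P a b * cnj (v b))"

lemma sesq_lincomb_left: "sesq n P (\<lambda>a. \<Sum>i\<in>I. c i * k i a) v = (\<Sum>i\<in>I. c i * sesq n P (k i) v)"
proof -
  have "sesq n P (\<lambda>a. \<Sum>i\<in>I. c i * k i a) v = (\<Sum>a<n. \<Sum>b<n. \<Sum>i\<in>I. c i * (k i a * P a b * cnj (v b)))"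
    unfolding sesq_def sum_distrib_right by (intro sum.cong refl) (simp add: mult.assoc)
  also have "\<dots> = (\<Sum>a<n. \<Sum>i\<in>I. \<Sum>b<n. c i * (k i a * P a b * cnj (v b)))" by (intro sum.cong refl sum.swap)
  also have "\<dots> = (\<Sum>i\<in>I. \<Sum>a<n. \<Sum>b<n. c i * (k i a * P a b * cnj (v b)))" by (rule sum.swap)
  finally show ?thesis by (simp add: sesq_def sum_distrib_left)
qed

lemma sesq_diff_left: "sesq n P (\<lambda>a. u a - w a) v = sesq n P u v - sesq n P w v"
  by (simp add: sesq_def left_diff_distrib sum_subtractf)

lemma sesq_scale: "sesq n P (\<lambda>a. c * u a) (\<lambda>b. e * v b) = c * cnj e * sesq n P u v"
  by (simp add: sesq_def sum_distrib_left ac_simps)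

lemma sesq_zero_left: "(\<And>a. a < n \<Longrightarrow> u a = 0) \<Longrightarrow> sesq n P u v = 0"
  by (simp add: sesq_def)

lemma sesq_hermitian:
  assumes "\<And>a b. a < n \<Longrightarrow> b < n \<Longrightarrow> P b a = cnj (P a b)"
  shows "sesq n P v u = cnj (sesq n P u v)"
proof -
  have "cnj (sesq n P u v) = (\<Sum>a<n. \<Sum>b<n. v b * P b a * cnj (u a))"
    unfolding sesq_def cnj_sum by (intro sum.cong refl) (simp add: ac_simps assms[symmetric])
  also have "\<dots> = sesq n P v u" unfolding sesq_def by (rule sum.swap)
  finally show ?thesis ..
qed

text \<open>Gram-Schmidt by maximality: take an orthonormal system of greatest size in the row space
  of e. If a row of e were not its own projection, the normalized remainder would extend the system.
  The coefficients x record that the system stays in the row space.\<close>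

lemma orthonormal_rows:
  assumes herm: "\<And>a b. a < n \<Longrightarrow> b < n \<Longrightarrow> P b a = cnj (P a b)"
    and pos: "\<And>u. \<exists>a<n. u a \<noteq> 0 \<Longrightarrow> 0 < Re (sesq n P u u)"
  shows "\<exists>m\<le>n. \<exists>k x. (\<forall>i<m. \<forall>j<m. sesq n P (k i) (k j) = (if i = j then 1 else 0)) \<and>
    (\<forall>i<m. \<forall>b<n. k i b = (\<Sum>a<n. x i a * e a b)) \<and>
    (\<forall>a<n. \<forall>b<n. e a b = (\<Sum>i<m. sesq n P (e a) (k i) * k i b))"
proof -
  define good where "good m k x \<longleftrightarrow> (\<forall>i<m. \<forall>j<m. sesq n P (k i) (k j) = (if i = j then 1 else 0)) \<and>
    (\<forall>i<m. \<forall>b<n. k i b = (\<Sum>a<n. x i a * e a b))" for m :: nat and k x :: "nat \<Rightarrow> nat \<Rightarrow> complex"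
  \<comment> \<open>More than n orthonormal rows would satisfy a linear relation, and pairing it
    with k j isolates the coefficient c j.\<close>
  have bound: "m \<le> n" if g: "good m k x" for m k x
  proof (rule ccontr)
    assume "\<not> m \<le> n"
    then have mn: "n < m" by simp
    obtain c where c: "\<exists>i\<le>n. c i \<noteq> 0" "\<forall>b<n. (\<Sum>i\<le>n. c i * k i b) = 0" using linear_dependence[of n k] by auto
    then obtain j where j: "j \<le> n" "c j \<noteq> 0" by auto
    have "0 = sesq n P (\<lambda>a. \<Sum>i\<le>n. c i * k i a) (k j)" using c(2) by (subst sesq_zero_left) auto
    also have "\<dots> = (\<Sum>i\<le>n. c i * sesq n P (k i) (k j))" by (rule sesq_lincomb_left)
    also have "\<dots> = (\<Sum>i\<le>n. if i = j then c i else 0)" using g mn j unfolding good_def by (intro sum.cong) auto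
    also have "\<dots> = c j" using j by simp
    finally show False using j by simp
  qed
  define m where "m = (GREATEST m. \<exists>k x. good m k x)"
  have ex0: "\<exists>k x. good 0 k x" by (simp add: good_def)
  have "\<exists>k x. good m k x"
    unfolding m_def by (rule GreatestI_nat[of "\<lambda>m. \<exists>k x. good m k x" 0 n, OF ex0]) (auto dest: bound)
  then obtain k x where g: "good m k x" by auto
  have max: "m' \<le> m" if "good m' k' x'" for m' k' x'
    unfolding m_def by (rule Greatest_le_nat[of _ _ n]) (use that in \<open>auto dest: bound\<close>)
  have orth: "sesq n P (k i) (k j) = (if i = j then 1 else 0)" if "i < m" "j < m" for i j using g that by (simp add: good_def)
  have row: "k i b = (\<Sum>a<n. x i a * e a b)" if "i < m" "b < n" for i b using g that by (simp add: good_def)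
  have "e a b = (\<Sum>i<m. sesq n P (e a) (k i) * k i b)" if ab: "a < n" "b < n" for a b
  proof (rule ccontr)
    assume ne: "e a b \<noteq> (\<Sum>i<m. sesq n P (e a) (k i) * k i b)"
    define v where "v b = e a b - (\<Sum>i<m. sesq n P (e a) (k i) * k i b)" for b
    have v0: "0 < Re (sesq n P v v)" by (rule pos) (use ne ab in \<open>auto simp: v_def\<close>)
    have im: "Im (sesq n P v v) = 0" using sesq_hermitian[of n P v v, OF herm] by (simp add: complex_eq_iff)
    have vk: "sesq n P v (k j) = 0" if j: "j < m" for j
    proof -
      have "sesq n P v (k j) = sesq n P (e a) (k j) - (\<Sum>i<m. sesq n P (e a) (k i) * sesq n P (k i) (k j))"
        unfolding v_def sesq_diff_left sesq_lincomb_left ..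
      also have "(\<Sum>i<m. sesq n P (e a) (k i) * sesq n P (k i) (k j)) = (\<Sum>i<m. if i = j then sesq n P (e a) (k i) else 0)"
        using orth j by (intro sum.cong) auto
      finally show ?thesis using j by simp
    qed
    have kv: "sesq n P (k j) v = 0" if "j < m" for j using sesq_hermitian[of n P "k j" v, OF herm] vk[OF that] by simp
    define r where "r = complex_of_real (1 / sqrt (Re (sesq n P v v)))"
    define y where "y c = (if c = a then 1 else 0) - (\<Sum>i<m. sesq n P (e a) (k i) * x i c)" for c
    have vy: "v b = (\<Sum>c<n. y c * e c b)" if b: "b < n" for b
    proof -
      have "(\<Sum>c<n. y c * e c b) = (\<Sum>c<n. (if c = a then e c b else 0)) - (\<Sum>c<n. \<Sum>i<m. sesq n P (e a) (k i) * x i c * e c b)"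
        unfolding y_def left_diff_distrib sum_subtractf sum_distrib_right
        by (intro arg_cong2[where f = "(-)"] sum.cong refl) auto
      also have "(\<Sum>c<n. \<Sum>i<m. sesq n P (e a) (k i) * x i c * e c b) = (\<Sum>i<m. \<Sum>c<n. sesq n P (e a) (k i) * x i c * e c b)"
        by (rule sum.swap)
      also have "\<dots> = (\<Sum>i<m. sesq n P (e a) (k i) * k i b)"
        using row b by (intro sum.cong) (auto simp: sum_distrib_left mult.assoc)
      finally show ?thesis using ab by (simp add: v_def)
    qed
    define k' where "k' = k(m := (\<lambda>b. r * v b))"
    define x' where "x' = x(m := (\<lambda>c. r * y c))"
    have "sesq n P (\<lambda>b. r * v b) (\<lambda>b. r * v b) = 1"
    proof -
      have "sesq n P v v = complex_of_real (Re (sesq n P v v))" using im by (simp add: complex_eq_iff)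
      then obtain t where t: "sesq n P v v = complex_of_real t" "t = Re (sesq n P v v)" by blast
      have "sesq n P (\<lambda>b. r * v b) (\<lambda>b. r * v b) = r * cnj r * complex_of_real t"
        unfolding sesq_scale t(1) ..
      also have "\<dots> = complex_of_real (1 / sqrt t * (1 / sqrt t) * t)"
        unfolding r_def t(2)[symmetric] complex_cnj_complex_of_real of_real_mult ..
      finally have "sesq n P (\<lambda>b. r * v b) (\<lambda>b. r * v b) = complex_of_real (1 / sqrt (Re (sesq n P v v)) * (1 / sqrt (Re (sesq n P v v))) * Re (sesq n P v v))"
        unfolding t(2) .
      also have "1 / sqrt (Re (sesq n P v v)) * (1 / sqrt (Re (sesq n P v v))) * Re (sesq n P v v) = 1"
        using v0 by simp
      finally show ?thesis by simp
    qed
    moreover have "sesq n P (\<lambda>b. r * v b) (k j) = 0" "sesq n P (k j) (\<lambda>b. r * v b) = 0" if "j < m" for j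
      using sesq_scale[of n P r v 1 "k j"] sesq_scale[of n P 1 "k j" r v] vk[OF that] kv[OF that] by simp_all
    ultimately have o': "sesq n P (k' i) (k' j) = (if i = j then 1 else 0)" if "i < Suc m" "j < Suc m" for i j
      using that orth by (auto simp: k'_def less_Suc_eq)
    have "k' i b = (\<Sum>a<n. x' i a * e a b)" if "i < Suc m" "b < n" for i b
      using that row vy by (auto simp: k'_def x'_def less_Suc_eq sum_distrib_left mult.assoc)
    with o' have "good (Suc m) k' x'" unfolding good_def by simp
    from max[OF this] show False by simp
  qed
  then have c3: "\<forall>a<n. \<forall>b<n. e a b = (\<Sum>i<m. sesq n P (e a) (k i) * k i b)" by (intro allI impI)
  have c1: "\<forall>i<m. \<forall>j<m. sesq n P (k i) (k j) = (if i = j then 1 else 0)" by (intro allI impI orth)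
  have c2: "\<forall>i<m. \<forall>b<n. k i b = (\<Sum>a<n. x i a * e a b)" by (intro allI impI row)
  show ?thesis using bound[OF g] c1 c2 c3 by (intro exI[of _ m] conjI exI[of _ k] exI[of _ x])
qed

text \<open>The rows of K are an orthonormal basis of the row space of e, so K P K^* = 1, and the
  coefficients of e in this basis are T = e P K^*. This explicit T is what later gives K T = 1 for
  an idempotent e.\<close>

lemma orthonormal_factorization:
  fixes e :: "complex mat"
  assumes e: "e \<in> carrier_mat n n"
    and herm: "\<And>a b. a < n \<Longrightarrow> b < n \<Longrightarrow> P b a = cnj (P a b)"
    and pos: "\<And>u. \<exists>a<n. u a \<noteq> 0 \<Longrightarrow> 0 < Re (sesq n P u u)"
  obtains m K X T where "m \<le> n" "K \<in> carrier_mat m n" "X \<in> carrier_mat m n" "T \<in> carrier_mat n m"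
    "K = X * e" "e = T * K" "\<And>i j. i < m \<Longrightarrow> j < m \<Longrightarrow> sandwich K K P i j = unit_fun i j"
    "\<And>a i. a < n \<Longrightarrow> i < m \<Longrightarrow> T $$ (a, i) = (\<Sum>c<n. \<Sum>b<n. e $$ (a, c) * P c b * cnj (K $$ (i, b)))"
proof -
  have "\<exists>m\<le>n. \<exists>k x. (\<forall>i<m. \<forall>j<m. sesq n P (k i) (k j) = (if i = j then 1 else 0)) \<and>
    (\<forall>i<m. \<forall>b<n. k i b = (\<Sum>a<n. x i a * e $$ (a, b))) \<and>
    (\<forall>a<n. \<forall>b<n. e $$ (a, b) = (\<Sum>i<m. sesq n P (\<lambda>b. e $$ (a, b)) (k i) * k i b))"
    by (rule orthonormal_rows; (rule herm | rule pos); assumption)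
  then obtain m k x where m: "m \<le> n" and k: "\<forall>i<m. \<forall>j<m. sesq n P (k i) (k j) = (if i = j then 1 else 0)"
    "\<forall>i<m. \<forall>b<n. k i b = (\<Sum>a<n. x i a * e $$ (a, b))"
    "\<forall>a<n. \<forall>b<n. e $$ (a, b) = (\<Sum>i<m. sesq n P (\<lambda>b. e $$ (a, b)) (k i) * k i b)"
    by (elim exE conjE) (rule that)
  define K where "K = mat m n (\<lambda>(i, b). k i b)"
  define X where "X = mat m n (\<lambda>(i, a). x i a)"
  define T where "T = mat n m (\<lambda>(a, i). sesq n P (\<lambda>b. e $$ (a, b)) (k i))"
  show thesis
  proof (rule that[of m K X T])
    show "K = X * e" using e k(2) by (intro eq_matI) (auto simp: K_def X_def scalar_prod_def atLeast0LessThan intro!: sum.cong)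
    show "e = T * K" using e k(3) by (intro eq_matI) (auto simp: K_def T_def scalar_prod_def atLeast0LessThan intro!: sum.cong)
    show "sandwich K K P i j = unit_fun i j" if ij: "i < m" "j < m" for i j
    proof -
      have "sandwich K K P i j = sesq n P (k i) (k j)"
        unfolding sandwich_def sesq_def using ij by (auto simp: K_def scaleC_complex ac_simps intro!: sum.cong)
      then show ?thesis using k(1) ij by (simp add: unit_fun_def)
    qed
    show "T $$ (a, i) = (\<Sum>c<n. \<Sum>b<n. e $$ (a, c) * P c b * cnj (K $$ (i, b)))" if "a < n" "i < m" for a i
      using that by (auto simp: T_def K_def sesq_def intro!: sum.cong)
  qed (use m in \<open>auto simp: K_def X_def T_def\<close>)
qed

section \<open>Direct sums of Hilbert spaces and of the algebras acting on them\<close>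

instantiation prod :: (complex_vector, complex_vector) complex_vector
begin
definition "scaleC_prod c p = (c *\<^sub>C fst p, c *\<^sub>C snd p)"
instance
  by standard (simp_all add: scaleC_prod_def scaleC_add_right scaleC_add_left scaleC_scaleC scaleC_one)
end

instantiation prod :: (chilbert_space, chilbert_space) chilbert_space
begin
definition "cinner_prod p q = cinner (fst p) (fst q) + cinner (snd p) (snd q)"
instance
proof
  fix x y z :: "'a \<times> 'b" and r :: real and c :: complex
  show "r *\<^sub>R x = complex_of_real r *\<^sub>C x"
    by (simp add: scaleC_prod_def prod_eq_iff scaleR_scaleC)
  show "cinner (x + y) z = cinner x z + cinner y z" by (simp add: cinner_prod_def cinner_add_left)
  show "cinner (c *\<^sub>C x) y = c * cinner x y"
    by (simp add: cinner_prod_def scaleC_prod_def cinner_scaleC_left distrib_left)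
  show "cinner y x = cnj (cinner x y)"
    using cinner_commute[of "fst y" "fst x"] cinner_commute[of "snd y" "snd x"] by (simp add: cinner_prod_def)
  show "Re (cinner x y) = inner x y" by (simp add: cinner_prod_def Re_cinner inner_prod_def)
qed
end

definition prod_act :: "'n bop \<times> complex \<Rightarrow> 'n \<times> complex \<Rightarrow> 'n::chilbert_space \<times> complex" where
  "prod_act a x = (bop_apply (fst a) (fst x), snd a * snd x)"

lemma bop_apply_add: "bop_apply T (x + y) = bop_apply T x + bop_apply T y"
  using bounded_linear_bop_apply[of T] by (simp add: bounded_linear.linear linear_add)

interpretation bop: op_action bop_apply
proof
  fix a b :: "'a bop" and c x y
  show "bop_apply (a + b) x = bop_apply a x + bop_apply b x" by transfer simp
  show "bop_apply (c *\<^sub>C a) x = c *\<^sub>C bop_apply a x" by transfer simp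
  show "bop_apply a (x + y) = bop_apply a x + bop_apply a y" by (rule bop_apply_add)
  show "bop_apply a (c *\<^sub>C x) = c *\<^sub>C bop_apply a x" by (rule bop_apply_scaleC)
  obtain K where "\<And>x. norm (bop_apply a x) \<le> norm x * K"
    using bounded_linear.bounded[OF bounded_linear_bop_apply[of a]] by blast
  then show "\<exists>K. \<forall>x. norm (bop_apply a x) \<le> K * norm x" by (intro exI[of _ K]) (simp add: mult.commute)
qed

interpretation cmul: op_action "(*) :: complex \<Rightarrow> complex \<Rightarrow> complex"
  by standard (auto simp: scaleC_complex algebra_simps norm_mult intro: exI[of _ "norm _"])

interpretation pact: op_action prod_act
proof
  fix a b :: "'a bop \<times> complex" and c x y
  show "prod_act (a + b) x = prod_act a x + prod_act b x"
    by (simp add: prod_act_def bop.act_add_left distrib_right)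
  show "prod_act (c *\<^sub>C a) x = c *\<^sub>C prod_act a x"
    by (simp add: prod_act_def scaleC_prod_def bop.act_scaleC_left scaleC_complex)
  show "prod_act a (x + y) = prod_act a x + prod_act a y"
    by (simp add: prod_act_def bop.act_add_right distrib_left)
  show "prod_act a (c *\<^sub>C x) = c *\<^sub>C prod_act a x"
    by (simp add: prod_act_def scaleC_prod_def bop.act_scaleC_right scaleC_complex)
  obtain K where K: "\<And>x. norm (bop_apply (fst a) x) \<le> K * norm x" using bop.act_bounded[of "fst a"] by blast
  have "norm (prod_act a x) \<le> (\<bar>K\<bar> + norm (snd a)) * norm x" for x
  proof -
    have "norm (prod_act a x) \<le> norm (bop_apply (fst a) (fst x)) + norm (snd a * snd x)"
      unfolding prod_act_def by (rule norm_Pair_le)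
    also have "\<dots> \<le> \<bar>K\<bar> * norm (fst x) + norm (snd a) * norm (snd x)"
      by (intro add_mono order_trans[OF K] mult_right_mono) (auto simp: norm_mult)
    also have "\<dots> \<le> \<bar>K\<bar> * norm x + norm (snd a) * norm x"
      by (intro add_mono mult_left_mono)
        (use norm_fst_le[of "fst x" "snd x"] norm_snd_le[of "snd x" "fst x"] in simp_all)
    finally show ?thesis by (simp add: distrib_right)
  qed
  then show "\<exists>K. \<forall>x. norm (prod_act a x) \<le> K * norm x" by blast
qed

lemma bform_prod_act:
  "bform prod_act n m (\<lambda>a b. (A a b, B a b)) x y =
    bform bop_apply n m A (fst \<circ> x) (fst \<circ> y) + bform (*) n m B (snd \<circ> x) (snd \<circ> y)"
  by (simp add: bform_def prod_act_def cinner_prod_def sum.distrib)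

section \<open>Complex matrices acting on matrices over a vector space\<close>

lemma lact_carrier: "\<alpha> \<in> carrier_mat n m \<Longrightarrow> X \<in> carrier_mat l k \<Longrightarrow> \<alpha> \<cdot>\<^sub>L X \<in> carrier_mat n k"
  and ract_carrier: "\<alpha> \<in> carrier_mat n m \<Longrightarrow> X \<in> carrier_mat l k \<Longrightarrow> X \<cdot>\<^sub>R \<alpha> \<in> carrier_mat l m"
  by (auto simp: lact_def ract_def)

lemma lact_assoc:
  assumes "\<alpha> \<in> carrier_mat n m" "\<beta> \<in> carrier_mat m l" "X \<in> carrier_mat l p"
  shows "(\<alpha> * \<beta>) \<cdot>\<^sub>L X = \<alpha> \<cdot>\<^sub>L (\<beta> \<cdot>\<^sub>L X)"
proof (rule eq_matI)
  fix i j assume ij: "i < dim_row (\<alpha> \<cdot>\<^sub>L (\<beta> \<cdot>\<^sub>L X))" "j < dim_col (\<alpha> \<cdot>\<^sub>L (\<beta> \<cdot>\<^sub>L X))"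
  have "((\<alpha> * \<beta>) \<cdot>\<^sub>L X) $$ (i, j) = (\<Sum>k<l. \<Sum>r<m. (\<alpha> $$ (i, r) * \<beta> $$ (r, k)) *\<^sub>C X $$ (k, j))"
    using assms ij by (auto simp: lact_def scalar_prod_def scaleC_sum_left[symmetric] atLeast0LessThan intro!: sum.cong)
  also have "\<dots> = (\<Sum>r<m. \<Sum>k<l. (\<alpha> $$ (i, r) * \<beta> $$ (r, k)) *\<^sub>C X $$ (k, j))" by (rule sum.swap)
  also have "\<dots> = (\<alpha> \<cdot>\<^sub>L (\<beta> \<cdot>\<^sub>L X)) $$ (i, j)"
    using assms ij by (simp add: lact_def scaleC_sum_right scaleC_scaleC)
  finally show "((\<alpha> * \<beta>) \<cdot>\<^sub>L X) $$ (i, j) = (\<alpha> \<cdot>\<^sub>L (\<beta> \<cdot>\<^sub>L X)) $$ (i, j)" .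
qed (use assms in \<open>auto simp: lact_def\<close>)

lemma ract_assoc:
  assumes "X \<in> carrier_mat p n" "\<alpha> \<in> carrier_mat n m" "\<beta> \<in> carrier_mat m l"
  shows "X \<cdot>\<^sub>R (\<alpha> * \<beta>) = X \<cdot>\<^sub>R \<alpha> \<cdot>\<^sub>R \<beta>"
proof (rule eq_matI)
  fix i j assume ij: "i < dim_row (X \<cdot>\<^sub>R \<alpha> \<cdot>\<^sub>R \<beta>)" "j < dim_col (X \<cdot>\<^sub>R \<alpha> \<cdot>\<^sub>R \<beta>)"
  have "(X \<cdot>\<^sub>R (\<alpha> * \<beta>)) $$ (i, j) = (\<Sum>k<n. \<Sum>r<m. (\<alpha> $$ (k, r) * \<beta> $$ (r, j)) *\<^sub>C X $$ (i, k))"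
    using assms ij by (auto simp: ract_def scalar_prod_def scaleC_sum_left[symmetric] atLeast0LessThan intro!: sum.cong)
  also have "\<dots> = (\<Sum>r<m. \<Sum>k<n. (\<alpha> $$ (k, r) * \<beta> $$ (r, j)) *\<^sub>C X $$ (i, k))" by (rule sum.swap)
  also have "\<dots> = (X \<cdot>\<^sub>R \<alpha> \<cdot>\<^sub>R \<beta>) $$ (i, j)"
    using assms ij by (simp add: ract_def scaleC_sum_right scaleC_scaleC mult.commute)
  finally show "(X \<cdot>\<^sub>R (\<alpha> * \<beta>)) $$ (i, j) = (X \<cdot>\<^sub>R \<alpha> \<cdot>\<^sub>R \<beta>) $$ (i, j)" .
qed (use assms in \<open>auto simp: ract_def\<close>)

lemma lact_ract:
  assumes "\<alpha> \<in> carrier_mat n m" "X \<in> carrier_mat m p" "\<beta> \<in> carrier_mat p l"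
  shows "(\<alpha> \<cdot>\<^sub>L X) \<cdot>\<^sub>R \<beta> = \<alpha> \<cdot>\<^sub>L (X \<cdot>\<^sub>R \<beta>)"
proof (rule eq_matI)
  fix i j assume ij: "i < dim_row (\<alpha> \<cdot>\<^sub>L (X \<cdot>\<^sub>R \<beta>))" "j < dim_col (\<alpha> \<cdot>\<^sub>L (X \<cdot>\<^sub>R \<beta>))"
  have "((\<alpha> \<cdot>\<^sub>L X) \<cdot>\<^sub>R \<beta>) $$ (i, j) = (\<Sum>k<p. \<Sum>r<m. (\<beta> $$ (k, j) * \<alpha> $$ (i, r)) *\<^sub>C X $$ (r, k))"
    using assms ij by (simp add: lact_def ract_def scaleC_sum_right scaleC_scaleC)
  also have "\<dots> = (\<Sum>r<m. \<Sum>k<p. (\<beta> $$ (k, j) * \<alpha> $$ (i, r)) *\<^sub>C X $$ (r, k))" by (rule sum.swap)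
  also have "\<dots> = (\<alpha> \<cdot>\<^sub>L (X \<cdot>\<^sub>R \<beta>)) $$ (i, j)"
    using assms ij by (simp add: lact_def ract_def scaleC_sum_right scaleC_scaleC mult.commute)
  finally show "((\<alpha> \<cdot>\<^sub>L X) \<cdot>\<^sub>R \<beta>) $$ (i, j) = (\<alpha> \<cdot>\<^sub>L (X \<cdot>\<^sub>R \<beta>)) $$ (i, j)" .
qed (use assms in \<open>auto simp: lact_def ract_def\<close>)

lemma lact_one: "X \<in> carrier_mat n m \<Longrightarrow> 1\<^sub>m n \<cdot>\<^sub>L X = X"
proof (rule eq_matI)
  fix i j assume X: "X \<in> carrier_mat n m" and ij: "i < dim_row X" "j < dim_col X"
  have "(1\<^sub>m n \<cdot>\<^sub>L X) $$ (i, j) = (\<Sum>k<n. 1\<^sub>m n $$ (i, k) *\<^sub>C X $$ (k, j))"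
    using X ij by (simp add: lact_def)
  also have "\<dots> = (\<Sum>k<n. if k = i then X $$ (k, j) else 0)"
    using X ij by (intro sum.cong) (auto simp: scaleC_one scaleC_zero_left)
  finally show "(1\<^sub>m n \<cdot>\<^sub>L X) $$ (i, j) = X $$ (i, j)" using X ij by simp
qed (auto simp: lact_def)

lemma ract_one: "X \<in> carrier_mat n m \<Longrightarrow> X \<cdot>\<^sub>R 1\<^sub>m m = X"
proof (rule eq_matI)
  fix i j assume X: "X \<in> carrier_mat n m" and ij: "i < dim_row X" "j < dim_col X"
  have "(X \<cdot>\<^sub>R 1\<^sub>m m) $$ (i, j) = (\<Sum>k<m. 1\<^sub>m m $$ (k, j) *\<^sub>C X $$ (i, k))"
    using X ij by (simp add: ract_def)
  also have "\<dots> = (\<Sum>k<m. if k = j then X $$ (i, k) else 0)"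
    using X ij by (intro sum.cong) (auto simp: scaleC_one scaleC_zero_left)
  finally show "(X \<cdot>\<^sub>R 1\<^sub>m m) $$ (i, j) = X $$ (i, j)" using X ij by simp
qed (auto simp: ract_def)

definition intertwiners :: "'v::complex_vector mat \<Rightarrow> 'v mat \<Rightarrow> complex mat set" where
  "intertwiners Z W = {\<alpha> \<in> carrier_mat (dim_row W) (dim_row Z). \<alpha> \<cdot>\<^sub>L Z = W \<cdot>\<^sub>R \<alpha>}"

lemma intertwiners_one: "Z \<in> carrier_mat n n \<Longrightarrow> 1\<^sub>m n \<in> intertwiners Z Z"
  by (simp add: intertwiners_def lact_one ract_one)

lemma intertwiners_mult:
  assumes "Z \<in> carrier_mat n n" "W \<in> carrier_mat m m" "V \<in> carrier_mat l l"
    and \<alpha>: "\<alpha> \<in> intertwiners Z W" and \<beta>: "\<beta> \<in> intertwiners W V"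
  shows "\<beta> * \<alpha> \<in> intertwiners Z V"
proof -
  have c: "\<alpha> \<in> carrier_mat m n" "\<beta> \<in> carrier_mat l m" and e: "\<alpha> \<cdot>\<^sub>L Z = W \<cdot>\<^sub>R \<alpha>" "\<beta> \<cdot>\<^sub>L W = V \<cdot>\<^sub>R \<beta>"
    using \<alpha> \<beta> assms by (auto simp: intertwiners_def)
  have "(\<beta> * \<alpha>) \<cdot>\<^sub>L Z = \<beta> \<cdot>\<^sub>L (W \<cdot>\<^sub>R \<alpha>)" using lact_assoc[OF c(2,1) assms(1)] e by simp
  also have "\<dots> = V \<cdot>\<^sub>R \<beta> \<cdot>\<^sub>R \<alpha>" using lact_ract[OF c(2) assms(2) c(1)] e by simp
  also have "\<dots> = V \<cdot>\<^sub>R (\<beta> * \<alpha>)" using ract_assoc[OF assms(3) c(2,1)] by simp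
  finally show ?thesis using c assms by (simp add: intertwiners_def)
qed

lemma intertwiners_add:
  assumes "Z \<in> carrier_mat n n" "W \<in> carrier_mat m m" "\<alpha> \<in> intertwiners Z W" "\<beta> \<in> intertwiners Z W"
  shows "\<alpha> + \<beta> \<in> intertwiners Z W"
proof -
  have c: "\<alpha> \<in> carrier_mat m n" "\<beta> \<in> carrier_mat m n" and e: "\<alpha> \<cdot>\<^sub>L Z = W \<cdot>\<^sub>R \<alpha>" "\<beta> \<cdot>\<^sub>L Z = W \<cdot>\<^sub>R \<beta>"
    using assms by (auto simp: intertwiners_def)
  have "(\<alpha> + \<beta>) \<cdot>\<^sub>L Z = W \<cdot>\<^sub>R (\<alpha> + \<beta>)"
  proof (rule eq_matI)
    fix i j assume ij: "i < dim_row (W \<cdot>\<^sub>R (\<alpha> + \<beta>))" "j < dim_col (W \<cdot>\<^sub>R (\<alpha> + \<beta>))"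
    have "((\<alpha> + \<beta>) \<cdot>\<^sub>L Z) $$ (i, j) = (\<alpha> \<cdot>\<^sub>L Z) $$ (i, j) + (\<beta> \<cdot>\<^sub>L Z) $$ (i, j)"
      using c assms ij by (simp add: lact_def ract_def scaleC_add_left sum.distrib)
    also have "\<dots> = (W \<cdot>\<^sub>R (\<alpha> + \<beta>)) $$ (i, j)"
      unfolding e using c assms ij by (simp add: lact_def ract_def scaleC_add_left sum.distrib)
    finally show "((\<alpha> + \<beta>) \<cdot>\<^sub>L Z) $$ (i, j) = (W \<cdot>\<^sub>R (\<alpha> + \<beta>)) $$ (i, j)" .
  qed (use c assms in \<open>auto simp: lact_def ract_def\<close>)
  then show ?thesis using c assms by (simp add: intertwiners_def)
qed

lemma intertwiners_smult:
  assumes "Z \<in> carrier_mat n n" "W \<in> carrier_mat m m" "\<alpha> \<in> intertwiners Z W"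
  shows "c \<cdot>\<^sub>m \<alpha> \<in> intertwiners Z W"
proof -
  have c: "\<alpha> \<in> carrier_mat m n" and e: "\<alpha> \<cdot>\<^sub>L Z = W \<cdot>\<^sub>R \<alpha>"
    using assms by (auto simp: intertwiners_def)
  have "(c \<cdot>\<^sub>m \<alpha>) \<cdot>\<^sub>L Z = W \<cdot>\<^sub>R (c \<cdot>\<^sub>m \<alpha>)"
  proof (rule eq_matI)
    fix i j assume ij: "i < dim_row (W \<cdot>\<^sub>R (c \<cdot>\<^sub>m \<alpha>))" "j < dim_col (W \<cdot>\<^sub>R (c \<cdot>\<^sub>m \<alpha>))"
    have "((c \<cdot>\<^sub>m \<alpha>) \<cdot>\<^sub>L Z) $$ (i, j) = c *\<^sub>C (\<alpha> \<cdot>\<^sub>L Z) $$ (i, j)"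
      using c assms ij by (simp add: lact_def ract_def scaleC_sum_right scaleC_scaleC)
    also have "\<dots> = (W \<cdot>\<^sub>R (c \<cdot>\<^sub>m \<alpha>)) $$ (i, j)"
      unfolding e using c assms ij by (simp add: lact_def ract_def scaleC_sum_right scaleC_scaleC)
    finally show "((c \<cdot>\<^sub>m \<alpha>) \<cdot>\<^sub>L Z) $$ (i, j) = (W \<cdot>\<^sub>R (c \<cdot>\<^sub>m \<alpha>)) $$ (i, j)" .
  qed (use c assms in \<open>auto simp: lact_def ract_def\<close>)
  then show ?thesis using c assms by (simp add: intertwiners_def)
qed

lemma intertwiners_inverse:
  assumes Z: "Z \<in> carrier_mat n n" and W: "W \<in> carrier_mat m m" and \<alpha>: "\<alpha> \<in> intertwiners Z W"
    and \<beta>: "\<beta> \<in> carrier_mat n m" "\<alpha> * \<beta> = 1\<^sub>m m" "\<beta> * \<alpha> = 1\<^sub>m n"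
  shows "\<beta> \<in> intertwiners W Z"
proof -
  have c: "\<alpha> \<in> carrier_mat m n" and e: "\<alpha> \<cdot>\<^sub>L Z = W \<cdot>\<^sub>R \<alpha>"
    using assms by (auto simp: intertwiners_def)
  have "\<beta> \<cdot>\<^sub>L W = \<beta> \<cdot>\<^sub>L (W \<cdot>\<^sub>R \<alpha> \<cdot>\<^sub>R \<beta>)" using ract_assoc[OF W c \<beta>(1)] \<beta>(2) ract_one[OF W] by simp
  also have "\<dots> = (\<beta> \<cdot>\<^sub>L (\<alpha> \<cdot>\<^sub>L Z)) \<cdot>\<^sub>R \<beta>" unfolding e[symmetric]
    by (rule lact_ract[symmetric, OF \<beta>(1) lact_carrier[OF c Z] \<beta>(1)])
  also have "\<beta> \<cdot>\<^sub>L (\<alpha> \<cdot>\<^sub>L Z) = Z" using lact_assoc[OF \<beta>(1) c Z] \<beta>(3) lact_one[OF Z] by simp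
  finally show ?thesis using \<beta> Z W by (simp add: intertwiners_def)
qed

lemma sandwich_mat:
  fixes X :: "'a::complex_vector mat"
  assumes "X \<in> carrier_mat n m" "\<alpha> \<in> carrier_mat n' n" "\<beta> \<in> carrier_mat m' m"
  shows "(\<alpha> \<cdot>\<^sub>L X) \<cdot>\<^sub>R adj \<beta> = mat n' m' (\<lambda>(a, b). sandwich \<alpha> \<beta> (\<lambda>k l. X $$ (k, l)) a b)"
proof (rule eq_matI)
  fix a b assume "a < dim_row (mat n' m' (\<lambda>(a, b). sandwich \<alpha> \<beta> (\<lambda>k l. X $$ (k, l)) a b))"
    "b < dim_col (mat n' m' (\<lambda>(a, b). sandwich \<alpha> \<beta> (\<lambda>k l. X $$ (k, l)) a b))"
  then have ab: "a < n'" "b < m'" by auto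
  have "((\<alpha> \<cdot>\<^sub>L X) \<cdot>\<^sub>R adj \<beta>) $$ (a, b) = (\<Sum>l<m. \<Sum>k<n. (\<alpha> $$ (a, k) * cnj (\<beta> $$ (b, l))) *\<^sub>C X $$ (k, l))"
    using assms ab by (simp add: lact_def ract_def adj_def scaleC_sum_right scaleC_scaleC mult.commute conjugate_complex_def)
  also have "\<dots> = sandwich \<alpha> \<beta> (\<lambda>k l. X $$ (k, l)) a b"
    unfolding sandwich_def using assms by (subst sum.swap) simp
  finally show "((\<alpha> \<cdot>\<^sub>L X) \<cdot>\<^sub>R adj \<beta>) $$ (a, b) = mat n' m' (\<lambda>(a, b). sandwich \<alpha> \<beta> (\<lambda>k l. X $$ (k, l)) a b) $$ (a, b)"
    using ab by simp
qed (use assms in \<open>auto simp: lact_def ract_def adj_def\<close>)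

section \<open>Kernels as functions of matrix entries\<close>

abbreviation fun_mat :: "nat \<Rightarrow> nat \<Rightarrow> (nat \<Rightarrow> nat \<Rightarrow> 'a) \<Rightarrow> 'a mat" where
  "fun_mat n m P \<equiv> mat n m (\<lambda>(a, b). P a b)"

text \<open>Zero outside the block, so that additivity and homogeneity are equations between
  functions rather than entrywise statements.\<close>

definition kfun :: "('v, 'a, 'b::zero) kernel \<Rightarrow> 'v mat \<Rightarrow> 'v mat \<Rightarrow> (nat \<Rightarrow> nat \<Rightarrow> 'a) \<Rightarrow> nat \<Rightarrow> nat \<Rightarrow> 'b" where
  "kfun K Z W P a b = (if a < dim_row Z \<and> b < dim_row W
     then K Z W (fun_mat (dim_row Z) (dim_row W) P) $$ (a, b) else 0)"

lemma kfun_cong: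
  assumes "\<And>a b. a < dim_row Z \<Longrightarrow> b < dim_row W \<Longrightarrow> P a b = P' a b"
  shows "kfun K Z W P = kfun K Z W P'"
proof -
  have "fun_mat (dim_row Z) (dim_row W) P = fun_mat (dim_row Z) (dim_row W) P'"
    by (intro eq_matI) (auto simp: assms)
  then show ?thesis by (intro ext) (simp add: kfun_def)
qed

lemma
  fixes K :: "('v::complex_vector, 'a::complex_vector, 'b::complex_vector) kernel"
  assumes K: "nc_kernel \<Omega> K" and ZW: "Z \<in> \<Omega>" "W \<in> \<Omega>"
  shows kfun_carrier: "P \<in> carrier_mat (dim_row Z) (dim_row W) \<Longrightarrow> K Z W P \<in> carrier_mat (dim_row Z) (dim_row W)"
    and kfun_add: "kfun K Z W (R + T) = kfun K Z W R + kfun K Z W T"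
    and kfun_scaleC: "kfun K Z W (c *\<^sub>C R) = c *\<^sub>C kfun K Z W R"
proof -
  have l: "mat_clinear (dim_row Z) (dim_row W) (dim_row Z) (dim_row W) (K Z W)"
    using K ZW unfolding nc_kernel_def by blast
  have c: "P \<in> carrier_mat (dim_row Z) (dim_row W) \<Longrightarrow> K Z W P \<in> carrier_mat (dim_row Z) (dim_row W)" for P
    using l unfolding mat_clinear_def by blast
  show "P \<in> carrier_mat (dim_row Z) (dim_row W) \<Longrightarrow> K Z W P \<in> carrier_mat (dim_row Z) (dim_row W)" by (rule c)
  let ?m = "fun_mat (dim_row Z) (dim_row W)"
  have mc: "?m P \<in> carrier_mat (dim_row Z) (dim_row W)" for P :: "nat \<Rightarrow> nat \<Rightarrow> 'a" by simp
  have "?m (R + T) = ?m R + ?m T" by (intro eq_matI) auto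
  moreover have "K Z W (?m R + ?m T) = K Z W (?m R) + K Z W (?m T)"
    using l mc unfolding mat_clinear_def by blast
  ultimately have "K Z W (?m (R + T)) = K Z W (?m R) + K Z W (?m T)" by simp
  then show "kfun K Z W (R + T) = kfun K Z W R + kfun K Z W T"
    using carrier_matD[OF c[OF mc]] by (intro ext) (simp add: kfun_def)
  have "?m (c *\<^sub>C R) = map_mat ((*\<^sub>C) c) (?m R)" by (intro eq_matI) (auto simp: scaleC_fun_apply)
  moreover have "K Z W (map_mat ((*\<^sub>C) c) (?m R)) = map_mat ((*\<^sub>C) c) (K Z W (?m R))"
    using l mc unfolding mat_clinear_def by blast
  ultimately have "K Z W (?m (c *\<^sub>C R)) = map_mat ((*\<^sub>C) c) (K Z W (?m R))" by simp
  then show "kfun K Z W (c *\<^sub>C R) = c *\<^sub>C kfun K Z W R"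
    using carrier_matD[OF c[OF mc]] by (intro ext) (simp add: kfun_def scaleC_fun_apply scaleC_zero_right)
qed

lemma kfun_intertwine:
  fixes K :: "('v::complex_vector, 'a::complex_vector, 'b::complex_vector) kernel"
  assumes K: "nc_kernel \<Omega> K" and Z: "Z \<in> \<Omega>" "Z' \<in> \<Omega>" "W \<in> \<Omega>" "W' \<in> \<Omega>"
    and \<alpha>: "\<alpha> \<in> intertwiners Z Z'" and \<beta>: "\<beta> \<in> intertwiners W W'"
    and ab: "a < dim_row Z'" "b < dim_row W'"
  shows "kfun K Z' W' (sandwich \<alpha> \<beta> P) a b = sandwich \<alpha> \<beta> (kfun K Z W P) a b"
proof -
  have c: "\<alpha> \<in> carrier_mat (dim_row Z') (dim_row Z)" "\<beta> \<in> carrier_mat (dim_row W') (dim_row W)"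
    and e: "\<alpha> \<cdot>\<^sub>L Z = Z' \<cdot>\<^sub>R \<alpha>" "\<beta> \<cdot>\<^sub>L W = W' \<cdot>\<^sub>R \<beta>" using \<alpha> \<beta> by (auto simp: intertwiners_def)
  let ?P = "fun_mat (dim_row Z) (dim_row W) P"
  have P: "?P \<in> carrier_mat (dim_row Z) (dim_row W)" by simp
  have "(\<alpha> \<cdot>\<^sub>L K Z W ?P) \<cdot>\<^sub>R adj \<beta> = K Z' W' ((\<alpha> \<cdot>\<^sub>L ?P) \<cdot>\<^sub>R adj \<beta>)"
    using K Z c e P unfolding nc_kernel_def by blast
  moreover have "(\<alpha> \<cdot>\<^sub>L ?P) \<cdot>\<^sub>R adj \<beta> = fun_mat (dim_row Z') (dim_row W') (sandwich \<alpha> \<beta> P)"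
    unfolding sandwich_mat[OF P c] using c by (intro eq_matI) (auto intro!: fun_cong[OF fun_cong[OF sandwich_cong]])
  ultimately have "K Z' W' (fun_mat (dim_row Z') (dim_row W') (sandwich \<alpha> \<beta> P)) = (\<alpha> \<cdot>\<^sub>L K Z W ?P) \<cdot>\<^sub>R adj \<beta>" by simp
  also have "\<dots> = fun_mat (dim_row Z') (dim_row W') (sandwich \<alpha> \<beta> (\<lambda>k l. K Z W ?P $$ (k, l)))"
    by (rule sandwich_mat[OF kfun_carrier[OF K Z(1,3) P] c])
  also have "sandwich \<alpha> \<beta> (\<lambda>k l. K Z W ?P $$ (k, l)) = sandwich \<alpha> \<beta> (kfun K Z W P)"
    by (rule sandwich_cong) (use c in \<open>auto simp: kfun_def\<close>)
  finally show ?thesis using ab by (simp add: kfun_def)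
qed

lemma kfun_hermitian:
  fixes K :: "('v::complex_vector, complex, 'h::chilbert_space bop) kernel"
  assumes K: "nc_kernel \<Omega> K" "hermitian_kernel \<Omega> K" and ZW: "Z \<in> \<Omega>" "W \<in> \<Omega>"
  shows "bform bop_apply (dim_row W) (dim_row Z) (kfun K W Z (\<lambda>a b. cnj (P b a))) y x =
    cnj (bform bop_apply (dim_row Z) (dim_row W) (kfun K Z W P) x y)"
proof -
  let ?P = "fun_mat (dim_row Z) (dim_row W) P"
  have P: "?P \<in> carrier_mat (dim_row Z) (dim_row W)" by simp
  have "adj ?P = fun_mat (dim_row W) (dim_row Z) (\<lambda>a b. cnj (P b a))"
    by (intro eq_matI) (auto simp: adj_def conjugate_complex_def)
  then have h: "K W Z (fun_mat (dim_row W) (dim_row Z) (\<lambda>a b. cnj (P b a))) = adj (K Z W ?P)"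
    using K(2) ZW P unfolding hermitian_kernel_def by auto
  have e: "cinner (bop_apply (conjugate T) v) w = cnj (cinner (bop_apply T w) v)" for T :: "'h bop" and v w
    using cinner_adjoint[of T w v] cinner_commute[of "bop_apply (conjugate T) v" w] by simp
  have "bform bop_apply (dim_row W) (dim_row Z) (kfun K W Z (\<lambda>a b. cnj (P b a))) y x =
    (\<Sum>b<dim_row W. \<Sum>a<dim_row Z. cnj (cinner (bop_apply (kfun K Z W P a b) (y b)) (x a)))"
    unfolding bform_def using carrier_matD[OF kfun_carrier[OF K(1) ZW P]]
    by (intro sum.cong refl) (auto simp: kfun_def h adj_def e)
  also have "\<dots> = cnj (bform bop_apply (dim_row Z) (dim_row W) (kfun K Z W P) x y)"
    unfolding bform_def cnj_sum by (rule sum.swap)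
  finally show ?thesis .
qed

lemma bform_cong:
  "(\<And>a b. a < n \<Longrightarrow> b < m \<Longrightarrow> R a b = T a b) \<Longrightarrow> bform act n m R x y = bform act n m T x y"
  by (simp add: bform_def)

lemma bform_vec_cong:
  "(\<And>a. a < n \<Longrightarrow> x a = x' a) \<Longrightarrow> (\<And>b. b < m \<Longrightarrow> y b = y' b) \<Longrightarrow> bform act n m R x y = bform act n m R x' y'"
  by (simp add: bform_def)

lemma bform_kfun_intertwine:
  fixes K :: "('v::complex_vector, complex, 'h::chilbert_space bop) kernel"
  assumes K: "nc_kernel \<Omega> K" and Z: "Z \<in> \<Omega>" "Z' \<in> \<Omega>" "W \<in> \<Omega>" "W' \<in> \<Omega>"
    and \<alpha>: "\<alpha> \<in> intertwiners Z Z'" and \<beta>: "\<beta> \<in> intertwiners W W'"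
  shows "bform bop_apply (dim_row Z') (dim_row W') (kfun K Z' W' (sandwich \<alpha> \<beta> P)) x y =
    bform bop_apply (dim_row Z) (dim_row W) (kfun K Z W P) (adj_vec \<alpha> x) (adj_vec \<beta> y)"
proof -
  have c: "\<alpha> \<in> carrier_mat (dim_row Z') (dim_row Z)" "\<beta> \<in> carrier_mat (dim_row W') (dim_row W)"
    using \<alpha> \<beta> by (auto simp: intertwiners_def)
  have "bform bop_apply (dim_row Z') (dim_row W') (kfun K Z' W' (sandwich \<alpha> \<beta> P)) x y =
    bform bop_apply (dim_row Z') (dim_row W') (sandwich \<alpha> \<beta> (kfun K Z W P)) x y"
    by (rule bform_cong) (rule kfun_intertwine[OF assms])
  then show ?thesis using bop.bform_sandwich[of \<alpha> \<beta> "kfun K Z W P" x y] c by simp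
qed

section \<open>Full hulls and strictly positive points\<close>

text \<open>Fullness passes to intersections; containment in \<open>nc_space\<close> comes from
  \<Xi>, which is one of the full sets intersected.\<close>

lemma full_nc_hull:
  assumes "full_nc \<Xi>" "\<Omega> \<subseteq> \<Xi>"
  shows "full_hull \<Omega> \<subseteq> \<Xi>" "\<Omega> \<subseteq> full_hull \<Omega>" "full_nc (full_hull \<Omega>)"
proof -
  show 1: "full_hull \<Omega> \<subseteq> \<Xi>" unfolding full_hull_def by (rule hull_minimal) (use assms in auto)
  show "\<Omega> \<subseteq> full_hull \<Omega>" unfolding full_hull_def by (rule hull_subset)
  have mem: "A \<in> full_hull \<Omega> \<longleftrightarrow> (\<forall>t. full_nc t \<and> \<Omega> \<subseteq> t \<longrightarrow> A \<in> t)" for A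
    unfolding full_hull_def hull_def by auto
  show "full_nc (full_hull \<Omega>)"
    unfolding full_nc_def
  proof (intro conjI ballI impI)
    show "full_hull \<Omega> \<subseteq> nc_space" using 1 assms(1) unfolding full_nc_def by auto
    fix Z W assume "Z \<in> full_hull \<Omega>" "W \<in> full_hull \<Omega>"
    then show "diag_block_mat [Z, W] \<in> full_hull \<Omega>"
      unfolding mem by (intro allI impI) (simp add: full_nc_def)
  next
    fix Z Z' I assume Z: "Z \<in> full_hull \<Omega>" and Z': "Z' \<in> nc_space" "I \<in> carrier_mat (dim_row Z) (dim_row Z')"
      "inj_on ((*\<^sub>v) I) (carrier_vec (dim_row Z')) \<and> I \<cdot>\<^sub>L Z' = Z \<cdot>\<^sub>R I"
    show "Z' \<in> full_hull \<Omega>"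
      unfolding mem
    proof (intro allI impI)
      fix t assume t: "full_nc t \<and> \<Omega> \<subseteq> t"
      then have "Z \<in> t" using Z mem by blast
      then show "Z' \<in> t" using t Z' unfolding full_nc_def by blast
    qed
  qed
qed

text \<open>The left inverse K makes T injective, as closure of a full set requires.\<close>

lemma full_nc_compress:
  assumes H: "full_nc H" and D: "D \<in> H" and Z': "Z' \<in> carrier_mat m m" "m \<ge> 1"
    and T: "T \<in> intertwiners Z' D" and K: "K \<in> carrier_mat m (dim_row D)" "K * T = 1\<^sub>m m"
  shows "Z' \<in> H"
proof -
  have Tc: "T \<in> carrier_mat (dim_row D) m" and e: "T \<cdot>\<^sub>L Z' = D \<cdot>\<^sub>R T" using T Z' by (auto simp: intertwiners_def)
  have "inj_on ((*\<^sub>v) T) (carrier_vec m)"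
  proof (rule inj_onI)
    fix v w assume v: "v \<in> carrier_vec m" and w: "w \<in> carrier_vec m" and eq: "T *\<^sub>v v = T *\<^sub>v w"
    have "v = (K * T) *\<^sub>v v" using K(2) v by simp
    also have "\<dots> = K *\<^sub>v (T *\<^sub>v v)" by (rule assoc_mult_mat_vec[OF K(1) Tc v])
    also have "\<dots> = (K * T) *\<^sub>v w" unfolding eq by (rule assoc_mult_mat_vec[OF K(1) Tc w, symmetric])
    finally show "v = w" using K(2) w by simp
  qed
  moreover have "Z' \<in> nc_space" using Z' by (auto simp: nc_space_def)
  moreover have "dim_row Z' = m" using Z' by simp
  ultimately show ?thesis using H D Tc e unfolding full_nc_def by blast
qed

lemma scaleC_if: "(if b then 1 else 0) *\<^sub>C (x::'a::complex_vector) = (if b then x else 0)"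
  by (simp add: scaleC_one scaleC_zero_left)

text \<open>The inclusion of the coordinates r, ..., r + n - 1 into N coordinates;
  \<open>project\<close> is its transpose.\<close>

definition embed :: "nat \<Rightarrow> nat \<Rightarrow> nat \<Rightarrow> complex mat" where
  "embed N n r = mat N n (\<lambda>(i, j). if i = j + r then 1 else 0)"

definition project :: "nat \<Rightarrow> nat \<Rightarrow> nat \<Rightarrow> complex mat" where
  "project N n r = mat n N (\<lambda>(i, j). if j = i + r then 1 else 0)"

text \<open>Zeros of D above and below the block make the inclusion an intertwiner, and zeros to the
  left and right of it make the projection one.\<close>

lemma embed_project:
  fixes B D :: "'v::complex_vector mat"
  assumes D: "D \<in> carrier_mat N N" and B: "B \<in> carrier_mat n n" and r: "n + r \<le> N"
    and blk: "\<And>i j. i < n \<Longrightarrow> j < n \<Longrightarrow> D $$ (i + r, j + r) = B $$ (i, j)"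
    and off1: "\<And>i j. i < N \<Longrightarrow> j < n \<Longrightarrow> (\<And>k. k < n \<Longrightarrow> i \<noteq> k + r) \<Longrightarrow> D $$ (i, j + r) = 0"
    and off2: "\<And>i j. i < n \<Longrightarrow> j < N \<Longrightarrow> (\<And>k. k < n \<Longrightarrow> j \<noteq> k + r) \<Longrightarrow> D $$ (i + r, j) = 0"
  shows "embed N n r \<in> intertwiners B D \<and> project N n r \<in> intertwiners D B \<and> project N n r * embed N n r = 1\<^sub>m n"
proof (intro conjI)
  have "embed N n r \<cdot>\<^sub>L B = D \<cdot>\<^sub>R embed N n r"
  proof (rule eq_matI)
    fix i j assume "i < dim_row (D \<cdot>\<^sub>R embed N n r)" "j < dim_col (D \<cdot>\<^sub>R embed N n r)"
    then have ij: "i < N" "j < n" using D by (auto simp: ract_def embed_def)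
    have "(D \<cdot>\<^sub>R embed N n r) $$ (i, j) = (\<Sum>k<N. if k = j + r then D $$ (i, k) else 0)"
      using D ij by (simp add: ract_def embed_def scaleC_if)
    also have "\<dots> = D $$ (i, j + r)" using ij r by simp
    also have "\<dots> = (\<Sum>k<n. if i = k + r then B $$ (k, j) else 0)"
    proof (cases "\<exists>k<n. i = k + r")
      case True
      then obtain k0 where k0: "k0 < n" "i = k0 + r" by auto
      then have "(\<Sum>k<n. if i = k + r then B $$ (k, j) else 0) = (\<Sum>k<n. if k = k0 then B $$ (k, j) else 0)"
        by (intro sum.cong) auto
      then show ?thesis using k0 blk ij by simp
    next
      case False
      then have "(\<Sum>k<n. if i = k + r then B $$ (k, j) else 0) = 0" by (intro sum.neutral) auto
      then show ?thesis using off1[OF ij] False by auto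
    qed
    also have "\<dots> = (embed N n r \<cdot>\<^sub>L B) $$ (i, j)"
      using B ij by (simp add: lact_def embed_def scaleC_if)
    finally show "(embed N n r \<cdot>\<^sub>L B) $$ (i, j) = (D \<cdot>\<^sub>R embed N n r) $$ (i, j)" by simp
  qed (use B D in \<open>auto simp: lact_def ract_def embed_def\<close>)
  then show "embed N n r \<in> intertwiners B D" using B D by (simp add: intertwiners_def embed_def)
  have "project N n r \<cdot>\<^sub>L D = B \<cdot>\<^sub>R project N n r"
  proof (rule eq_matI)
    fix i j assume "i < dim_row (B \<cdot>\<^sub>R project N n r)" "j < dim_col (B \<cdot>\<^sub>R project N n r)"
    then have ij: "i < n" "j < N" using B by (auto simp: ract_def project_def)
    have "(project N n r \<cdot>\<^sub>L D) $$ (i, j) = (\<Sum>k<N. if k = i + r then D $$ (k, j) else 0)"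
      using D ij by (simp add: lact_def project_def scaleC_if)
    also have "\<dots> = D $$ (i + r, j)" using ij r by simp
    also have "\<dots> = (\<Sum>k<n. if j = k + r then B $$ (i, k) else 0)"
    proof (cases "\<exists>k<n. j = k + r")
      case True
      then obtain k0 where k0: "k0 < n" "j = k0 + r" by auto
      then have "(\<Sum>k<n. if j = k + r then B $$ (i, k) else 0) = (\<Sum>k<n. if k = k0 then B $$ (i, k) else 0)"
        by (intro sum.cong) auto
      then show ?thesis using k0 blk ij by simp
    next
      case False
      then have "(\<Sum>k<n. if j = k + r then B $$ (i, k) else 0) = 0" by (intro sum.neutral) auto
      then show ?thesis using off2[OF ij] False by auto
    qed
    also have "\<dots> = (B \<cdot>\<^sub>R project N n r) $$ (i, j)"
      using B ij by (simp add: ract_def project_def scaleC_if)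
    finally show "(project N n r \<cdot>\<^sub>L D) $$ (i, j) = (B \<cdot>\<^sub>R project N n r) $$ (i, j)" .
  qed (use B D in \<open>auto simp: lact_def ract_def project_def\<close>)
  then show "project N n r \<in> intertwiners D B" using B D by (simp add: intertwiners_def project_def)
  show "project N n r * embed N n r = 1\<^sub>m n"
  proof (rule eq_matI)
    fix i j assume ij: "i < dim_row (1\<^sub>m n :: complex mat)" "j < dim_col (1\<^sub>m n :: complex mat)"
    have "(project N n r * embed N n r) $$ (i, j) = (\<Sum>k<N. if k = i + r then (if k = j + r then 1 else 0) else 0)"
      using ij by (simp add: project_def embed_def scalar_prod_def atLeast0LessThan if_distrib[of "\<lambda>z. z * _"] cong: if_cong)
    also have "\<dots> = (if i = j then 1 else 0)" using ij r by simp
    finally show "(project N n r * embed N n r) $$ (i, j) = 1\<^sub>m n $$ (i, j)" using ij by simp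
  qed (auto simp: project_def embed_def)
qed

lemma adj_vec_embed: "k < n \<Longrightarrow> n + r \<le> N \<Longrightarrow> adj_vec (embed N n r) x k = (x (k + r) :: 'h::complex_vector)"
proof -
  assume k: "k < n" "n + r \<le> N"
  have "adj_vec (embed N n r) x k = (\<Sum>a<N. if a = k + r then x a else 0)"
    unfolding adj_vec_def using k by (intro sum.cong) (auto simp: embed_def scaleC_one scaleC_zero_left)
  then show ?thesis using k by simp
qed

lemma adj_vec_bounded:
  fixes \<alpha> :: "complex mat"
  obtains C where "C > 0" "\<And>x :: nat \<Rightarrow> 'h::chilbert_space.
    (\<Sum>k<dim_col \<alpha>. (norm (adj_vec \<alpha> x k))\<^sup>2) \<le> C * (\<Sum>a<dim_row \<alpha>. (norm (x a))\<^sup>2)"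
proof
  let ?C = "\<Sum>k<dim_col \<alpha>. \<Sum>a<dim_row \<alpha>. (cmod (\<alpha> $$ (a, k)))\<^sup>2"
  show "1 + ?C > 0" by (intro add_pos_nonneg sum_nonneg) auto
  fix x :: "nat \<Rightarrow> 'h"
  have "(norm (adj_vec \<alpha> x k))\<^sup>2 \<le> (\<Sum>a<dim_row \<alpha>. (cmod (\<alpha> $$ (a, k)))\<^sup>2) * (\<Sum>a<dim_row \<alpha>. (norm (x a))\<^sup>2)" for k
  proof -
    have "norm (adj_vec \<alpha> x k) \<le> (\<Sum>a<dim_row \<alpha>. cmod (\<alpha> $$ (a, k)) * norm (x a))"
      unfolding adj_vec_def by (rule order_trans[OF norm_sum]) (simp add: norm_scaleC)
    then have "(norm (adj_vec \<alpha> x k))\<^sup>2 \<le> (\<Sum>a<dim_row \<alpha>. cmod (\<alpha> $$ (a, k)) * norm (x a))\<^sup>2"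
      by (intro power_mono) auto
    also have "\<dots> \<le> (\<Sum>a<dim_row \<alpha>. (cmod (\<alpha> $$ (a, k)))\<^sup>2) * (\<Sum>a<dim_row \<alpha>. (norm (x a))\<^sup>2)"
      by (rule Cauchy_Schwarz_ineq_sum)
    finally show ?thesis .
  qed
  then have "(\<Sum>k<dim_col \<alpha>. (norm (adj_vec \<alpha> x k))\<^sup>2) \<le> ?C * (\<Sum>a<dim_row \<alpha>. (norm (x a))\<^sup>2)"
    unfolding sum_distrib_right by (intro sum_mono)
  also have "\<dots> \<le> (1 + ?C) * (\<Sum>a<dim_row \<alpha>. (norm (x a))\<^sup>2)"
    by (intro mult_right_mono sum_nonneg) auto
  finally show "(\<Sum>k<dim_col \<alpha>. (norm (adj_vec \<alpha> x k))\<^sup>2) \<le> (1 + ?C) * (\<Sum>a<dim_row \<alpha>. (norm (x a))\<^sup>2)" .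
qed

lemma fun_mat_unit: "fun_mat n n unit_fun = 1\<^sub>m n"
  by (intro eq_matI) (auto simp: unit_fun_def)

text \<open>The kernel is Hermitian, so its quadratic form at the identity is real and positivity
  can be read off the real part.\<close>

lemma strictly_pd_iff:
  fixes K :: "('v::complex_vector, complex, 'h::chilbert_space bop) kernel"
  assumes K: "nc_kernel \<Xi> K" "hermitian_kernel \<Xi> K" and Z: "Z \<in> \<Xi>"
  shows "strictly_pd (K Z Z (1\<^sub>m (dim_row Z))) \<longleftrightarrow> (\<exists>\<epsilon>>0. \<forall>x. \<epsilon> * (\<Sum>a<dim_row Z. (norm (x a))\<^sup>2) \<le>
     Re (bform bop_apply (dim_row Z) (dim_row Z) (kfun K Z Z unit_fun) x x))"
    and psd_iff: "psd bop_apply (K Z Z (1\<^sub>m (dim_row Z))) \<longleftrightarrow>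
     (\<forall>x. 0 \<le> Re (bform bop_apply (dim_row Z) (dim_row Z) (kfun K Z Z unit_fun) x x))"
proof -
  let ?n = "dim_row Z" let ?A = "K Z Z (1\<^sub>m (dim_row Z))"
  have A: "?A \<in> carrier_mat ?n ?n" by (rule kfun_carrier[OF K(1) Z Z]) simp
  note Ad = carrier_matD[OF A]
  have im: "Im (bform bop_apply ?n ?n (kfun K Z Z unit_fun) x x) = 0" for x
  proof -
    have u: "(\<lambda>a b. cnj (unit_fun b a)) = unit_fun" by (intro ext) (auto simp: unit_fun_def)
    have "bform bop_apply ?n ?n (kfun K Z Z unit_fun) x x = cnj (bform bop_apply ?n ?n (kfun K Z Z unit_fun) x x)"
      using kfun_hermitian[OF K Z Z, where P = unit_fun and x = x and y = x] unfolding u .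
    from arg_cong[OF this, of Im] show ?thesis by simp
  qed
  have eq: "(\<Sum>i<?n. \<Sum>j<?n. cinner (bop_apply (?A $$ (i, j)) (x j)) (x i)) =
    bform bop_apply ?n ?n (kfun K Z Z unit_fun) x x" for x
    by (simp add: bform_def kfun_def fun_mat_unit)
  show "psd bop_apply ?A \<longleftrightarrow> (\<forall>x. 0 \<le> Re (bform bop_apply ?n ?n (kfun K Z Z unit_fun) x x))"
    unfolding psd_def Ad(1) eq using im A by (auto simp: less_eq_complex_def)
  have "psd bop_apply (?A - map_mat ((*\<^sub>C) (complex_of_real \<epsilon>)) (1\<^sub>m ?n)) \<longleftrightarrow>
    (\<forall>x. \<epsilon> * (\<Sum>a<?n. (norm (x a))\<^sup>2) \<le> Re (bform bop_apply ?n ?n (kfun K Z Z unit_fun) x x))" for \<epsilon>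
  proof -
    let ?E = "map_mat ((*\<^sub>C) (complex_of_real \<epsilon>)) (1\<^sub>m ?n) :: 'h bop mat"
    have "(\<Sum>i<?n. \<Sum>j<?n. cinner (bop_apply ((?A - ?E) $$ (i, j)) (x j)) (x i)) =
      bform bop_apply ?n ?n (kfun K Z Z unit_fun) x x - complex_of_real (\<epsilon> * (\<Sum>a<?n. (norm (x a))\<^sup>2))" for x
    proof -
      have "(\<Sum>i<?n. \<Sum>j<?n. cinner (bop_apply ((?A - ?E) $$ (i, j)) (x j)) (x i)) =
        (\<Sum>i<?n. \<Sum>j<?n. cinner (bop_apply (?A $$ (i, j)) (x j)) (x i) -
           (if j = i then complex_of_real \<epsilon> * cinner (x i) (x i) else 0))"
      proof (intro sum.cong refl)
        fix i j assume ij: "i \<in> {..<?n}" "j \<in> {..<?n}"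
        have m: "bop_apply (S - T) v = bop_apply S v - bop_apply T v" for S T :: "'h bop" and v by transfer simp
        have o: "bop_apply (1 :: 'h bop) v = v" for v by transfer simp
        have z: "bop_apply (0 :: 'h bop) v = 0" for v by transfer simp
        have c: "cinner (u - v) w = cinner u w - cinner v w" for u v w :: 'h
          using cinner_add_left[of "u - v" v w] by simp
        show "cinner (bop_apply ((?A - ?E) $$ (i, j)) (x j)) (x i) = cinner (bop_apply (?A $$ (i, j)) (x j)) (x i) -
           (if j = i then complex_of_real \<epsilon> * cinner (x i) (x i) else 0)"
          using ij by (simp add: Ad m c bop.act_scaleC_left o z cinner_scaleC_left scaleC_zero_right cinner_zero_left)
      qed
      also have "\<dots> = bform bop_apply ?n ?n (kfun K Z Z unit_fun) x x - (\<Sum>i<?n. complex_of_real \<epsilon> * cinner (x i) (x i))"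
        by (simp add: eq[symmetric] sum_subtractf)
      also have "(\<Sum>i<?n. complex_of_real \<epsilon> * cinner (x i) (x i)) = complex_of_real (\<epsilon> * (\<Sum>a<?n. (norm (x a))\<^sup>2))"
      proof -
        have "cinner v v = complex_of_real ((norm v)\<^sup>2)" for v :: 'h
          using arg_cong[OF cinner_commute[of v v], of Im] Re_cinner[of v v]
          by (simp add: complex_eq_iff power2_norm_eq_inner)
        then show ?thesis by (simp add: sum_distrib_left)
      qed
      finally show ?thesis .
    qed
    then show ?thesis unfolding psd_def using im A by (auto simp: less_eq_complex_def)
  qed
  then show "strictly_pd ?A \<longleftrightarrow> (\<exists>\<epsilon>>0. \<forall>x. \<epsilon> * (\<Sum>a<?n. (norm (x a))\<^sup>2) \<le>
     Re (bform bop_apply ?n ?n (kfun K Z Z unit_fun) x x))"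
    unfolding strictly_pd_def Ad by simp
qed

section \<open>The point set of the theorem\<close>

lemma sum_lessThan_add: "(\<Sum>a<N + M. f a) = (\<Sum>a<N. f a) + (\<Sum>a<M. f (N + a) :: 'a::comm_monoid_add)" for N M :: nat
  by (induction M) (simp_all add: add.assoc)

lemma sandwich_unit: "sandwich \<alpha> \<beta> unit_fun a b = (\<Sum>k<dim_col \<alpha>. if k < dim_col \<beta> then \<alpha> $$ (a, k) * cnj (\<beta> $$ (b, k)) else 0)"
  unfolding sandwich_def unit_fun_def scaleC_complex
  by (intro sum.cong refl) (simp add: if_distrib[of "\<lambda>z. _ * z"] cong: if_cong)

lemma sandwich_embed:
  assumes "a < N" "b < N"
  shows "sandwich (embed N n r) (embed N n r) unit_fun a b = (if a = b \<and> r \<le> a \<and> a < n + r then 1 else 0)"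
proof -
  have "sandwich (embed N n r) (embed N n r) unit_fun a b = (\<Sum>k<n. if k = a - r then (if a = b \<and> r \<le> a then 1 else 0) else 0)"
    unfolding sandwich_unit using assms by (intro sum.cong) (auto simp: embed_def)
  also have "\<dots> = (if a = b \<and> r \<le> a \<and> a < n + r then 1 else 0)" by (simp, linarith)
  finally show ?thesis .
qed

locale nc_pair =
  fixes \<Xi> \<Omega> \<Omega>' :: "'v::complex_vector mat set"
    and Q :: "('v, complex, 'n::chilbert_space bop) kernel"
    and S :: "('v, complex, 'e::chilbert_space bop) kernel"
  assumes full: "full_nc \<Xi>" and Q: "nc_kernel \<Xi> Q" "hermitian_kernel \<Xi> Q"
    and sub: "\<Omega> \<subseteq> pos_set \<Xi> Q" and pts_def: "\<Omega>' = full_hull \<Omega> \<inter> pos_set \<Xi> Q"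
    and S: "nc_kernel \<Omega>' S" "hermitian_kernel \<Omega>' S" "\<And>Z. Z \<in> \<Omega>' \<Longrightarrow> psd bop_apply (S Z Z (1\<^sub>m (dim_row Z)))"
begin

abbreviation Qform :: "'v mat \<Rightarrow> 'v mat \<Rightarrow> (nat \<Rightarrow> nat \<Rightarrow> complex) \<Rightarrow> (nat \<Rightarrow> 'n) \<Rightarrow> (nat \<Rightarrow> 'n) \<Rightarrow> complex" where
  "Qform Z W P \<equiv> bform bop_apply (dim_row Z) (dim_row W) (kfun Q Z W P)"

abbreviation Sform :: "'v mat \<Rightarrow> 'v mat \<Rightarrow> (nat \<Rightarrow> nat \<Rightarrow> complex) \<Rightarrow> (nat \<Rightarrow> 'e) \<Rightarrow> (nat \<Rightarrow> 'e) \<Rightarrow> complex" where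
  "Sform Z W P \<equiv> bform bop_apply (dim_row Z) (dim_row W) (kfun S Z W P)"

lemma sub_\<Xi>: "\<Omega> \<subseteq> \<Xi>" using sub by (auto simp: pos_set_def)

lemmas hull = full_nc_hull[OF full sub_\<Xi>]

lemma pts_iff: "Z \<in> \<Omega>' \<longleftrightarrow> Z \<in> full_hull \<Omega> \<and>
  (\<exists>\<epsilon>>0. \<forall>x. \<epsilon> * (\<Sum>a<dim_row Z. (norm (x a))\<^sup>2) \<le> Re (Qform Z Z unit_fun x x))"
proof (cases "Z \<in> full_hull \<Omega>")
  case True
  then have "Z \<in> \<Xi>" using hull(1) by auto
  then show ?thesis using True strictly_pd_iff[OF Q \<open>Z \<in> \<Xi>\<close>] by (simp add: pts_def pos_set_def)
qed (simp add: pts_def)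

lemma pts_pos:
  assumes "Z \<in> \<Omega>'"
  obtains \<epsilon> where "\<epsilon> > 0" "\<And>x. \<epsilon> * (\<Sum>a<dim_row Z. (norm (x a))\<^sup>2) \<le> Re (Qform Z Z unit_fun x x)"
proof -
  obtain \<epsilon> where "\<epsilon> > 0 \<and> (\<forall>x. \<epsilon> * (\<Sum>a<dim_row Z. (norm (x a))\<^sup>2) \<le> Re (Qform Z Z unit_fun x x))"
    using assms[unfolded pts_iff, THEN conjunct2] by (rule exE)
  note this[THEN conjunct1] this[THEN conjunct2, THEN spec]
  then show thesis by (rule that)
qed

lemma ptsD: "Z \<in> \<Omega>' \<Longrightarrow> Z \<in> \<Xi>" "Z \<in> \<Omega>' \<Longrightarrow> Z \<in> full_hull \<Omega>" "Z \<in> \<Omega>' \<Longrightarrow> Z \<in> carrier_mat (dim_row Z) (dim_row Z)"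
  "Z \<in> \<Omega>' \<Longrightarrow> dim_row Z \<ge> 1"
proof -
  have nc: "\<Xi> \<subseteq> nc_space" using full by (simp add: full_nc_def)
  assume Z: "Z \<in> \<Omega>'"
  then show 1: "Z \<in> \<Xi>" "Z \<in> full_hull \<Omega>" by (auto simp: pts_def pos_set_def)
  then have "Z \<in> nc_space" using nc by auto
  then show "Z \<in> carrier_mat (dim_row Z) (dim_row Z)" "dim_row Z \<ge> 1" by (auto simp: nc_space_def)
qed

lemma \<Omega>_pts: "\<Omega> \<subseteq> \<Omega>'" using hull(2) sub by (auto simp: pts_def)

lemmas Q_int = bform_kfun_intertwine[OF Q(1)]
lemmas S_int = bform_kfun_intertwine[OF S(1)]

text \<open>The identity at Z' is K P K^*, so its Q-form at x is that of P at D, taken at the vector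
  K^* x. That vector controls x because T^* K^* = 1, so strict positivity survives.\<close>

lemma compress:
  assumes D: "D \<in> \<Omega>'" and K: "K \<in> carrier_mat m (dim_row D)" and T: "T \<in> carrier_mat (dim_row D) m"
    and KT: "K * T = 1\<^sub>m m" and m: "m \<ge> 1"
    and Z': "Z' \<in> carrier_mat m m" and TZ: "T \<in> intertwiners Z' D" and KD: "K \<in> intertwiners D Z'"
    and \<delta>: "\<delta> > 0" "\<And>x. \<delta> * (\<Sum>a<dim_row D. (norm (x a))\<^sup>2) \<le> Re (Qform D D P x x)"
    and P: "\<And>i j. i < m \<Longrightarrow> j < m \<Longrightarrow> sandwich K K P i j = unit_fun i j"
  shows "Z' \<in> \<Omega>'"
proof -
  have H: "Z' \<in> full_hull \<Omega>" by (rule full_nc_compress[OF hull(3) ptsD(2)[OF D] Z' m TZ K KT])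
  then have \<Xi>: "Z' \<in> \<Xi>" using hull(1) by auto
  have d: "dim_row Z' = m" using Z' by simp
  obtain C where C: "C > 0" "\<And>x :: nat \<Rightarrow> 'n. (\<Sum>k<m. (norm (adj_vec T x k))\<^sup>2) \<le> C * (\<Sum>a<dim_row D. (norm (x a))\<^sup>2)"
    using adj_vec_bounded[of T] T by auto
  have "\<delta> / C * (\<Sum>a<m. (norm (x a))\<^sup>2) \<le> Re (Qform Z' Z' unit_fun x x)" for x
  proof -
    have "(\<Sum>a<m. (norm (x a))\<^sup>2) = (\<Sum>a<m. (norm (adj_vec T (adj_vec K x) a))\<^sup>2)"
    proof (intro sum.cong refl)
      fix a assume a: "a \<in> {..<m}"
      have "adj_vec T (adj_vec K x) a = adj_vec (K * T) x a" using a by (intro adj_vec_mult[symmetric, OF K T]) simp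
      also have "\<dots> = x a" using a by (simp add: KT adj_vec_one)
      finally show "(norm (x a))\<^sup>2 = (norm (adj_vec T (adj_vec K x) a))\<^sup>2" by simp
    qed
    also have "\<dots> \<le> C * (\<Sum>a<dim_row D. (norm (adj_vec K x a))\<^sup>2)" by (rule C)
    finally have "\<delta> / C * (\<Sum>a<m. (norm (x a))\<^sup>2) \<le> \<delta> / C * (C * (\<Sum>a<dim_row D. (norm (adj_vec K x a))\<^sup>2))"
      using \<delta>(1) C(1) by (intro mult_left_mono) auto
    also have "\<dots> = \<delta> * (\<Sum>a<dim_row D. (norm (adj_vec K x a))\<^sup>2)" using C(1) by simp
    also have "\<dots> \<le> Re (Qform D D P (adj_vec K x) (adj_vec K x))" by (rule \<delta>)
    also have "Qform D D P (adj_vec K x) (adj_vec K x) = Qform Z' Z' (sandwich K K P) x x"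
      by (rule Q_int[OF ptsD(1)[OF D] \<Xi> ptsD(1)[OF D] \<Xi> KD KD, symmetric])
    also have "kfun Q Z' Z' (sandwich K K P) = kfun Q Z' Z' unit_fun" by (rule kfun_cong) (simp add: d P)
    finally show ?thesis .
  qed
  moreover have "\<delta> / C > 0" using \<delta> C by simp
  ultimately show ?thesis unfolding pts_iff d using H by blast
qed

text \<open>The identity of the sum is the sum of the two block identities, so its Q-form is bounded
  below with the smaller of the two constants. The last conclusion lets prescribed vectors at both
  summands come from a single vector.\<close>

lemma direct_sum:
  assumes D: "D \<in> \<Omega>'" and Z: "Z \<in> \<Omega>'"
  obtains D' \<iota>1 \<pi>1 \<iota>2 \<pi>2 where "D' \<in> \<Omega>'" "\<iota>1 \<in> intertwiners D D'" "\<pi>1 \<in> intertwiners D' D" "\<pi>1 * \<iota>1 = 1\<^sub>m (dim_row D)"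
    "\<iota>2 \<in> intertwiners Z D'" "\<pi>2 \<in> intertwiners D' Z" "\<pi>2 * \<iota>2 = 1\<^sub>m (dim_row Z)"
    "\<And>(x :: nat \<Rightarrow> 'e) y. \<exists>w. (\<forall>a<dim_row D. adj_vec \<iota>1 w a = x a) \<and> (\<forall>a<dim_row Z. adj_vec \<iota>2 w a = y a)"
proof -
  define N M where "N = dim_row D" and "M = dim_row Z"
  define D' where "D' = diag_block_mat [D, Z]"
  have c: "D \<in> carrier_mat N N" "Z \<in> carrier_mat M M"
    unfolding N_def M_def by (rule ptsD(3)[OF D], rule ptsD(3)[OF Z])
  note cd = carrier_matD[OF c(1)] carrier_matD[OF c(2)]
  have D'b: "D' = four_block_mat D (0\<^sub>m N M) (0\<^sub>m M N) Z"
    unfolding D'_def by (simp only: diag_block_mat.simps(2)[of D "[Z]"] diag_block_mat_singleton Let_def cd)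
  have D'c: "D' \<in> carrier_mat (N + M) (N + M)" unfolding D'b by (rule four_block_carrier_mat[OF c])
  have ix: "D' $$ (i, j) = (if i < N then if j < N then D $$ (i, j) else 0 else if j < N then 0 else Z $$ (i - N, j - N))"
    if "i < N + M" "j < N + M" for i j
    using that index_mat_four_block(1)[of i D Z j "0\<^sub>m N M" "0\<^sub>m M N"] unfolding D'b cd by simp
  have H: "D' \<in> full_hull \<Omega>" using hull(3) ptsD(2)[OF D] ptsD(2)[OF Z] unfolding D'_def full_nc_def by blast
  then have \<Xi>: "D' \<in> \<Xi>" using hull(1) by auto
  define \<iota>1 \<pi>1 \<iota>2 \<pi>2 where "\<iota>1 = embed (N + M) N 0" and "\<pi>1 = project (N + M) N 0"
    and "\<iota>2 = embed (N + M) M N" and "\<pi>2 = project (N + M) M N"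
  have 1: "\<iota>1 \<in> intertwiners D D' \<and> \<pi>1 \<in> intertwiners D' D \<and> \<pi>1 * \<iota>1 = 1\<^sub>m N"
    unfolding \<iota>1_def \<pi>1_def
  proof (rule embed_project[OF D'c c(1)])
    fix i j assume ij: "i < N + M" "j < N" and ne: "\<And>k. k < N \<Longrightarrow> i \<noteq> k + 0"
    have "\<not> i < N" using ne[of i] by auto
    then show "D' $$ (i, j + 0) = 0" using ij by (simp add: ix)
  next
    fix i j assume ij: "i < N" "j < N + M" and ne: "\<And>k. k < N \<Longrightarrow> j \<noteq> k + 0"
    have "\<not> j < N" using ne[of j] by auto
    then show "D' $$ (i + 0, j) = 0" using ij by (simp add: ix)
  qed (simp_all add: ix)
  have far: "i < N" if "i < N + M" "\<And>k. k < M \<Longrightarrow> i \<noteq> k + N" for i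
  proof (rule ccontr)
    assume "\<not> i < N"
    then have "i - N < M" "i = i - N + N" using that(1) by auto
    then show False using that(2)[of "i - N"] by blast
  qed
  have 2: "\<iota>2 \<in> intertwiners Z D' \<and> \<pi>2 \<in> intertwiners D' Z \<and> \<pi>2 * \<iota>2 = 1\<^sub>m M"
    unfolding \<iota>2_def \<pi>2_def
  proof (rule embed_project[OF D'c c(2)])
    fix i j assume ij: "i < N + M" "j < M" and ne: "\<And>k. k < M \<Longrightarrow> i \<noteq> k + N"
    show "D' $$ (i, j + N) = 0" using ij far[OF ij(1) ne] by (simp add: ix)
  next
    fix i j assume ij: "i < M" "j < N + M" and ne: "\<And>k. k < M \<Longrightarrow> j \<noteq> k + N"
    show "D' $$ (i + N, j) = 0" using ij far[OF ij(2) ne] by (simp add: ix)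
  qed (simp_all add: ix)
  note 1 = 1[THEN conjunct1] 1[THEN conjunct2, THEN conjunct1] 1[THEN conjunct2, THEN conjunct2]
  note 2 = 2[THEN conjunct1] 2[THEN conjunct2, THEN conjunct1] 2[THEN conjunct2, THEN conjunct2]
  have a1: "adj_vec \<iota>1 x k = x k" if "k < N" for x :: "nat \<Rightarrow> 'h::complex_vector" and k
    unfolding \<iota>1_def using adj_vec_embed[of k N 0 "N + M" x] that by simp
  have a2: "adj_vec \<iota>2 x k = x (k + N)" if "k < M" for x :: "nat \<Rightarrow> 'h::complex_vector" and k
    unfolding \<iota>2_def using adj_vec_embed[of k M N "N + M" x] that by simp
  obtain \<epsilon>1 where \<epsilon>1: "\<epsilon>1 > 0" "\<And>x. \<epsilon>1 * (\<Sum>a<dim_row D. (norm (x a))\<^sup>2) \<le> Re (Qform D D unit_fun x x)"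
    by (rule pts_pos[OF D]) (rule that)
  note \<epsilon>1 = \<epsilon>1(1) \<epsilon>1(2)[folded N_def]
  obtain \<epsilon>2 where \<epsilon>2: "\<epsilon>2 > 0" "\<And>x. \<epsilon>2 * (\<Sum>a<dim_row Z. (norm (x a))\<^sup>2) \<le> Re (Qform Z Z unit_fun x x)"
    by (rule pts_pos[OF Z]) (rule that)
  note \<epsilon>2 = \<epsilon>2(1) \<epsilon>2(2)[folded M_def]
  have dD': "dim_row D' = N + M" using D'c by simp
  have split: "kfun Q D' D' unit_fun = kfun Q D' D' (sandwich \<iota>1 \<iota>1 unit_fun + sandwich \<iota>2 \<iota>2 unit_fun)"
  proof (rule kfun_cong)
    fix a b assume "a < dim_row D'" "b < dim_row D'"
    then have ab: "a < N + M" "b < N + M" by (auto simp: dD')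
    have s1: "sandwich \<iota>1 \<iota>1 unit_fun a b = (if a = b \<and> a < N then 1 else 0)"
      unfolding \<iota>1_def using sandwich_embed[of a "N + M" b N 0] ab by simp
    have s2: "sandwich \<iota>2 \<iota>2 unit_fun a b = (if a = b \<and> N \<le> a then 1 else 0)"
      unfolding \<iota>2_def using sandwich_embed[of a "N + M" b M N] ab by (simp add: add.commute)
    show "unit_fun a b = (sandwich \<iota>1 \<iota>1 unit_fun + sandwich \<iota>2 \<iota>2 unit_fun) a b"
      using ab by (auto simp: s1 s2 unit_fun_def)
  qed
  have "min \<epsilon>1 \<epsilon>2 * (\<Sum>a<dim_row D'. (norm (x a))\<^sup>2) \<le> Re (Qform D' D' unit_fun x x)" for x
  proof -
    have e: "(\<Sum>a<N + M. (norm (x a))\<^sup>2) = (\<Sum>a<N. (norm (adj_vec \<iota>1 x a))\<^sup>2) + (\<Sum>a<M. (norm (adj_vec \<iota>2 x a))\<^sup>2)"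
    proof -
      have "(\<Sum>a<N + M. (norm (x a))\<^sup>2) = (\<Sum>a<N. (norm (x a))\<^sup>2) + (\<Sum>a<M. (norm (x (N + a)))\<^sup>2)" by (rule sum_lessThan_add)
      then show ?thesis by (simp add: a1 a2 add.commute)
    qed
    have "min \<epsilon>1 \<epsilon>2 * (\<Sum>a<dim_row D'. (norm (x a))\<^sup>2) \<le> \<epsilon>1 * (\<Sum>a<N. (norm (adj_vec \<iota>1 x a))\<^sup>2) + \<epsilon>2 * (\<Sum>a<M. (norm (adj_vec \<iota>2 x a))\<^sup>2)"
      unfolding dD' e distrib_left by (intro add_mono mult_right_mono sum_nonneg) auto
    also have "\<dots> \<le> Re (Qform D D unit_fun (adj_vec \<iota>1 x) (adj_vec \<iota>1 x)) + Re (Qform Z Z unit_fun (adj_vec \<iota>2 x) (adj_vec \<iota>2 x))"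
      using \<epsilon>1(2)[of "adj_vec \<iota>1 x"] \<epsilon>2(2)[of "adj_vec \<iota>2 x"] unfolding N_def M_def by (rule add_mono)
    also have "\<dots> = Re (Qform D' D' (sandwich \<iota>1 \<iota>1 unit_fun) x x) + Re (Qform D' D' (sandwich \<iota>2 \<iota>2 unit_fun) x x)"
      using Q_int[OF ptsD(1)[OF D] \<Xi> ptsD(1)[OF D] \<Xi> 1(1) 1(1)] Q_int[OF ptsD(1)[OF Z] \<Xi> ptsD(1)[OF Z] \<Xi> 2(1) 2(1)] by simp
    also have "\<dots> = Re (Qform D' D' unit_fun x x)"
      unfolding split kfun_add[OF Q(1) \<Xi> \<Xi>] bop.bform_add by simp
    finally show ?thesis .
  qed
  moreover have "min \<epsilon>1 \<epsilon>2 > 0" using \<epsilon>1 \<epsilon>2 by simp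
  ultimately have D': "D' \<in> \<Omega>'" unfolding pts_iff using H by blast
  show thesis
  proof (rule that[OF D' 1(1,2) 1(3)[unfolded N_def] 2(1,2) 2(3)[unfolded M_def]])
    fix x y :: "nat \<Rightarrow> 'e"
    show "\<exists>w. (\<forall>a<dim_row D. adj_vec \<iota>1 w a = x a) \<and> (\<forall>a<dim_row Z. adj_vec \<iota>2 w a = y a)"
      by (intro exI[of _ "\<lambda>k. if k < N then x k else y (k - N)"]) (simp add: N_def[symmetric] M_def[symmetric] a1 a2)
  qed
qed

text \<open>The clause on w serves to replace a family of test vectors, one at each point, by a
  single vector at D.\<close>

lemma finite_direct_sum:
  assumes "finite I" "I \<noteq> {}" "\<And>i. i \<in> I \<Longrightarrow> p i \<in> \<Omega>'"
  shows "\<exists>D\<in>\<Omega>'. \<exists>\<iota> \<pi>. (\<forall>i\<in>I. \<iota> i \<in> intertwiners (p i) D \<and> \<pi> i \<in> intertwiners D (p i) \<and> \<pi> i * \<iota> i = 1\<^sub>m (dim_row (p i))) \<and>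
    (\<forall>x :: 'i \<Rightarrow> nat \<Rightarrow> 'e. \<exists>w. \<forall>i\<in>I. \<forall>a<dim_row (p i). adj_vec (\<iota> i) w a = x i a)"
  using assms
proof (induction I rule: finite_ne_induct)
  case (singleton i)
  then have p: "p i \<in> \<Omega>'" by simp
  note o = intertwiners_one[OF ptsD(3)[OF p]]
  show ?case
    by (rule bexI[OF _ p], intro exI[of _ "\<lambda>_. 1\<^sub>m (dim_row (p i))"] conjI allI)
      (use o in \<open>auto intro!: exI[of _ "x i" for x] simp: adj_vec_one\<close>)
next
  case (insert i I)
  have "\<exists>D\<in>\<Omega>'. \<exists>\<iota> \<pi>. (\<forall>i\<in>I. \<iota> i \<in> intertwiners (p i) D \<and> \<pi> i \<in> intertwiners D (p i) \<and> \<pi> i * \<iota> i = 1\<^sub>m (dim_row (p i))) \<and>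
    (\<forall>x :: 'i \<Rightarrow> nat \<Rightarrow> 'e. \<exists>w. \<forall>i\<in>I. \<forall>a<dim_row (p i). adj_vec (\<iota> i) w a = x i a)"
    by (rule insert.IH) (use insert.prems in simp)
  then obtain D \<iota> \<pi> where D: "D \<in> \<Omega>'" and IH0: "(\<forall>i\<in>I. \<iota> i \<in> intertwiners (p i) D \<and> \<pi> i \<in> intertwiners D (p i) \<and> \<pi> i * \<iota> i = 1\<^sub>m (dim_row (p i))) \<and>
    (\<forall>x :: 'i \<Rightarrow> nat \<Rightarrow> 'e. \<exists>w. \<forall>i\<in>I. \<forall>a<dim_row (p i). adj_vec (\<iota> i) w a = x i a)"
    by (elim bexE exE) (rule that)
  have IH: "\<And>j. j \<in> I \<Longrightarrow> \<iota> j \<in> intertwiners (p j) D" "\<And>j. j \<in> I \<Longrightarrow> \<pi> j \<in> intertwiners D (p j)"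
      "\<And>j. j \<in> I \<Longrightarrow> \<pi> j * \<iota> j = 1\<^sub>m (dim_row (p j))"
      "\<And>x :: 'i \<Rightarrow> nat \<Rightarrow> 'e. \<exists>w. \<forall>j\<in>I. \<forall>a<dim_row (p j). adj_vec (\<iota> j) w a = x j a"
    using IH0 by simp_all
  have p: "p i \<in> \<Omega>'" using insert.prems by simp
  have pj: "p j \<in> \<Omega>'" if "j \<in> I" for j using insert.prems that by simp
  obtain D' \<iota>1 \<pi>1 \<iota>2 \<pi>2 where D': "D' \<in> \<Omega>'" "\<iota>1 \<in> intertwiners D D'" "\<pi>1 \<in> intertwiners D' D" "\<pi>1 * \<iota>1 = 1\<^sub>m (dim_row D)"
    "\<iota>2 \<in> intertwiners (p i) D'" "\<pi>2 \<in> intertwiners D' (p i)" "\<pi>2 * \<iota>2 = 1\<^sub>m (dim_row (p i))"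
    and w: "\<And>(x :: nat \<Rightarrow> 'e) y. \<exists>w. (\<forall>a<dim_row D. adj_vec \<iota>1 w a = x a) \<and> (\<forall>a<dim_row (p i). adj_vec \<iota>2 w a = y a)"
    by (rule direct_sum[OF D p]) (rule that)
  define \<iota>' where "\<iota>' j = (if j = i then \<iota>2 else \<iota>1 * \<iota> j)" for j
  define \<pi>' where "\<pi>' j = (if j = i then \<pi>2 else \<pi> j * \<pi>1)" for j
  have ne: "j \<noteq> i" if "j \<in> I" for j using insert.hyps that by auto
  note cD = ptsD(3)[OF D] and cD' = ptsD(3)[OF D'(1)]
  have car: "\<alpha> \<in> intertwiners Z W \<Longrightarrow> \<alpha> \<in> carrier_mat (dim_row W) (dim_row Z)" for \<alpha> Z W by (simp add: intertwiners_def)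
  have 1: "\<iota>' j \<in> intertwiners (p j) D' \<and> \<pi>' j \<in> intertwiners D' (p j) \<and> \<pi>' j * \<iota>' j = 1\<^sub>m (dim_row (p j))" if j: "j \<in> I" for j
  proof -
    have "\<pi> j * \<pi>1 * (\<iota>1 * \<iota> j) = \<pi> j * (\<pi>1 * (\<iota>1 * \<iota> j))"
      by (rule assoc_mult_mat[OF car[OF IH(2)[OF j]] car[OF D'(3)] mult_carrier_mat[OF car[OF D'(2)] car[OF IH(1)[OF j]]]])
    also have "\<pi>1 * (\<iota>1 * \<iota> j) = (\<pi>1 * \<iota>1) * \<iota> j"
      by (rule assoc_mult_mat[OF car[OF D'(3)] car[OF D'(2)] car[OF IH(1)[OF j]], symmetric])
    also have "\<dots> = \<iota> j" unfolding D'(4) by (rule left_mult_one_mat[OF car[OF IH(1)[OF j]]])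
    finally show ?thesis
      using intertwiners_mult[OF ptsD(3)[OF pj[OF j]] cD cD' IH(1)[OF j] D'(2)]
        intertwiners_mult[OF cD' cD ptsD(3)[OF pj[OF j]] D'(3) IH(2)[OF j]] ne[OF j] IH(3)[OF j]
      by (simp add: \<iota>'_def \<pi>'_def)
  qed
  have 2: "\<exists>w. \<forall>j\<in>insert i I. \<forall>a<dim_row (p j). adj_vec (\<iota>' j) w a = x j a" for x :: "'i \<Rightarrow> nat \<Rightarrow> 'e"
  proof -
    obtain v where v: "\<forall>j\<in>I. \<forall>a<dim_row (p j). adj_vec (\<iota> j) v a = x j a" using IH(4) by blast
    obtain u where u: "\<forall>a<dim_row D. adj_vec \<iota>1 u a = v a" "\<forall>a<dim_row (p i). adj_vec \<iota>2 u a = x i a"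
      using w[of v "x i"] by blast
    have "adj_vec (\<iota>' j) u a = x j a" if j: "j \<in> insert i I" and a: "a < dim_row (p j)" for j a
    proof (cases "j = i")
      case True
      then show ?thesis using u(2) a by (simp add: \<iota>'_def)
    next
      case False
      then have jI: "j \<in> I" using j by simp
      have "adj_vec (\<iota>' j) u a = adj_vec (\<iota> j) (adj_vec \<iota>1 u) a"
        using adj_vec_mult[OF car[OF D'(2)] car[OF IH(1)[OF jI]] a] False by (simp add: \<iota>'_def)
      also have "adj_vec (\<iota> j) (adj_vec \<iota>1 u) = adj_vec (\<iota> j) v"
        by (rule adj_vec_cong) (use u(1) car[OF IH(1)[OF jI]] in simp)
      finally show ?thesis using v jI a by simp
    qed
    then show ?thesis by blast
  qed
  have 3: "\<iota>' i \<in> intertwiners (p i) D' \<and> \<pi>' i \<in> intertwiners D' (p i) \<and> \<pi>' i * \<iota>' i = 1\<^sub>m (dim_row (p i))"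
    using D' by (simp add: \<iota>'_def \<pi>'_def)
  show ?case
  proof (rule bexI[OF _ D'(1)], rule exI[of _ \<iota>'], rule exI[of _ \<pi>'], intro conjI ballI allI)
    fix j assume "j \<in> insert i I"
    then show "\<iota>' j \<in> intertwiners (p j) D'" "\<pi>' j \<in> intertwiners D' (p j)" "\<pi>' j * \<iota>' j = 1\<^sub>m (dim_row (p j))"
      using 1 3 by auto
  qed (rule 2)
qed

end

section \<open>Domination of S by the pair formed from Q and the identity kernel\<close>

definition hermitian_part :: "(nat \<Rightarrow> nat \<Rightarrow> complex) \<Rightarrow> nat \<Rightarrow> nat \<Rightarrow> complex" where
  "hermitian_part P = (1 / 2) *\<^sub>C (P + (\<lambda>a b. cnj (P b a)))"

text \<open>K is Hermitian, so passing to the Hermitian part of P affects only the imaginary part of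
  the form.\<close>

lemma kfun_hermitian_part:
  fixes K :: "('v::complex_vector, complex, 'h::chilbert_space bop) kernel"
  assumes K: "nc_kernel X K" "hermitian_kernel X K" and Z: "Z \<in> X"
  shows "Re (bform bop_apply (dim_row Z) (dim_row Z) (kfun K Z Z (hermitian_part P)) x x) =
      Re (bform bop_apply (dim_row Z) (dim_row Z) (kfun K Z Z P) x x)"
proof -
  have "bform bop_apply (dim_row Z) (dim_row Z) (kfun K Z Z (hermitian_part P)) x x =
    (1 / 2) * (bform bop_apply (dim_row Z) (dim_row Z) (kfun K Z Z P) x x +
      cnj (bform bop_apply (dim_row Z) (dim_row Z) (kfun K Z Z P) x x))"
    unfolding hermitian_part_def kfun_scaleC[OF K(1) Z Z] kfun_add[OF K(1) Z Z] bop.bform_add bop.bform_scaleC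
      kfun_hermitian[OF K Z Z, where P = P and x = x and y = x] ..
  then show ?thesis by (simp only: complex_add_cnj) simp
qed

lemma bform_hermitian_part: "Re (bform (*) n n (hermitian_part P) w w) = Re (bform (*) n n P w w)"
proof -
  have "bform (*) n n (\<lambda>a b. cnj (P b a)) w w = (\<Sum>a<n. \<Sum>b<n. cnj (P b a * w a * cnj (w b)))"
    unfolding bform_def by (intro sum.cong refl) (simp add: cinner_complex_def)
  also have "\<dots> = (\<Sum>b<n. \<Sum>a<n. cnj (P b a * w a * cnj (w b)))" by (rule sum.swap)
  also have "\<dots> = cnj (bform (*) n n P w w)" by (simp add: bform_def cinner_complex_def)
  finally have "bform (*) n n (hermitian_part P) w w = (1 / 2) * (bform (*) n n P w w + cnj (bform (*) n n P w w))"
    unfolding hermitian_part_def cmul.bform_add cmul.bform_scaleC by simp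
  then show ?thesis by (simp only: complex_add_cnj) simp
qed

context nc_pair begin

definition qpair :: "'v mat \<Rightarrow> 'v mat \<Rightarrow> (nat \<Rightarrow> nat \<Rightarrow> complex) \<Rightarrow> nat \<Rightarrow> nat \<Rightarrow> 'n bop \<times> complex" where
  "qpair Z W P a b = (kfun Q Z W P a b, if a < dim_row Z \<and> b < dim_row W then P a b else 0)"

lemma bform_qpair: "bform prod_act (dim_row Z) (dim_row W) (qpair Z W P) x y =
    Qform Z W P (fst \<circ> x) (fst \<circ> y) + bform (*) (dim_row Z) (dim_row W) P (snd \<circ> x) (snd \<circ> y)"
proof -
  have "bform prod_act (dim_row Z) (dim_row W) (qpair Z W P) x y =
    bform prod_act (dim_row Z) (dim_row W) (\<lambda>a b. (kfun Q Z W P a b, P a b)) x y"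
    by (rule bform_cong) (simp add: qpair_def)
  then show ?thesis by (simp add: bform_prod_act)
qed

lemma qpair_int:
  assumes Z: "Z \<in> \<Omega>'" "Z' \<in> \<Omega>'" "W \<in> \<Omega>'" "W' \<in> \<Omega>'" and \<alpha>: "\<alpha> \<in> intertwiners Z Z'" and \<beta>: "\<beta> \<in> intertwiners W W'"
    and ab: "a < dim_row Z'" "b < dim_row W'"
  shows "qpair Z' W' (sandwich \<alpha> \<beta> P) a b = sandwich \<alpha> \<beta> (qpair Z W P) a b"
proof -
  have c: "\<alpha> \<in> carrier_mat (dim_row Z') (dim_row Z)" "\<beta> \<in> carrier_mat (dim_row W') (dim_row W)"
    using \<alpha> \<beta> by (auto simp: intertwiners_def)
  have fs: "sandwich \<alpha> \<beta> R a b = (sandwich \<alpha> \<beta> (\<lambda>k l. fst (R k l)) a b, sandwich \<alpha> \<beta> (\<lambda>k l. snd (R k l)) a b)"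
    for R :: "nat \<Rightarrow> nat \<Rightarrow> 'n bop \<times> complex"
    by (simp add: sandwich_def prod_eq_iff fst_sum snd_sum scaleC_prod_def)
  have "sandwich \<alpha> \<beta> (\<lambda>k l. snd (qpair Z W P k l)) = sandwich \<alpha> \<beta> P"
    by (rule sandwich_cong) (use c in \<open>simp add: qpair_def\<close>)
  then show ?thesis
    unfolding fs using kfun_intertwine[OF Q(1) ptsD(1)[OF Z(1)] ptsD(1)[OF Z(2)] ptsD(1)[OF Z(3)] ptsD(1)[OF Z(4)] \<alpha> \<beta> ab, of P] ab
    by (simp add: qpair_def)
qed

lemma bform_mult_unit: "bform (*) n n unit_fun x x = complex_of_real (\<Sum>a<n. (cmod (x a))\<^sup>2)"
proof -
  have "bform (*) n n unit_fun x x = (\<Sum>a<n. \<Sum>b<n. if b = a then x a * cnj (x a) else 0)"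
    unfolding bform_def by (intro sum.cong refl) (simp add: unit_fun_def cinner_complex_def)
  also have "\<dots> = (\<Sum>a<n. x a * cnj (x a))" by simp
  also have "\<dots> = complex_of_real (\<Sum>a<n. (cmod (x a))\<^sup>2)" unfolding of_real_sum
    by (intro sum.cong refl) (simp only: complex_norm_square)
  finally show ?thesis .
qed

text \<open>Compressing \<open>D\<close> to the range of an idempotent \<open>e\<close>, in a basis that is orthonormal for \<open>P\<close>. The
  case \<open>e = 1\<close> turns any strictly positive \<open>P\<close> into the identity.\<close>

lemma compress_idempotent:
  assumes D: "D \<in> \<Omega>'" and e: "e \<in> intertwiners D D" "e * e = e" "e \<noteq> 0\<^sub>m (dim_row D) (dim_row D)"
    and herm: "\<And>a b. a < dim_row D \<Longrightarrow> b < dim_row D \<Longrightarrow> P b a = cnj (P a b)"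
    and \<delta>: "\<delta> > 0" "\<And>x. \<delta> * (\<Sum>a<dim_row D. (norm (x a))\<^sup>2) \<le> Re (Qform D D P x x)"
    and pos: "\<And>u. \<exists>a<dim_row D. u a \<noteq> 0 \<Longrightarrow> 0 < Re (sesq (dim_row D) P u u)"
  obtains Z' K T where "Z' \<in> \<Omega>'" "dim_row Z' \<le> dim_row D" "T \<in> intertwiners Z' D" "K \<in> intertwiners D Z'" "T * K = e"
    "K * T = 1\<^sub>m (dim_row Z')" "\<And>i j. i < dim_row Z' \<Longrightarrow> j < dim_row Z' \<Longrightarrow> sandwich K K P i j = unit_fun i j"
proof -
  define N where "N = dim_row D"
  have Dc: "D \<in> carrier_mat N N" unfolding N_def by (rule ptsD(3)[OF D])
  have ec: "e \<in> carrier_mat N N" and eD: "e \<cdot>\<^sub>L D = D \<cdot>\<^sub>R e" using e(1) by (auto simp: intertwiners_def N_def)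
  obtain m K X T where m: "m \<le> N" and K: "K \<in> carrier_mat m N" and X: "X \<in> carrier_mat m N" and T: "T \<in> carrier_mat N m"
    and KX: "K = X * e" and TK: "e = T * K" and KK: "\<And>i j. i < m \<Longrightarrow> j < m \<Longrightarrow> sandwich K K P i j = unit_fun i j"
    and Tai: "\<And>a i. a < N \<Longrightarrow> i < m \<Longrightarrow> T $$ (a, i) = (\<Sum>c<N. \<Sum>b<N. e $$ (a, c) * P c b * cnj (K $$ (i, b)))"
    by (rule orthonormal_factorization[OF ec herm[folded N_def] pos[folded N_def]]) (assumption+, rule that)
  have Ke: "K * e = K" unfolding KX using assoc_mult_mat[OF X ec ec] e(2) by simp
  \<comment> \<open>As T = e P K^* and K e = K, the product K T equals K P K^*, which is the
    identity by orthonormality.\<close>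
  have KT: "K * T = 1\<^sub>m m"
  proof (rule eq_matI)
    fix i j assume "i < dim_row (1\<^sub>m m :: complex mat)" "j < dim_col (1\<^sub>m m :: complex mat)"
    then have ij: "i < m" "j < m" by auto
    have "(K * T) $$ (i, j) = (\<Sum>a<N. K $$ (i, a) * T $$ (a, j))"
      using K T ij by (simp add: scalar_prod_def atLeast0LessThan)
    also have "\<dots> = (\<Sum>a<N. \<Sum>c<N. \<Sum>b<N. K $$ (i, a) * e $$ (a, c) * P c b * cnj (K $$ (j, b)))"
      by (intro sum.cong refl) (simp add: Tai[OF _ ij(2)] sum_distrib_left mult.assoc)
    also have "\<dots> = (\<Sum>c<N. \<Sum>a<N. \<Sum>b<N. K $$ (i, a) * e $$ (a, c) * P c b * cnj (K $$ (j, b)))" by (rule sum.swap)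
    also have "\<dots> = (\<Sum>c<N. \<Sum>b<N. \<Sum>a<N. K $$ (i, a) * e $$ (a, c) * P c b * cnj (K $$ (j, b)))"
      by (intro sum.cong refl sum.swap)
    also have "\<dots> = (\<Sum>c<N. \<Sum>b<N. (K * e) $$ (i, c) * P c b * cnj (K $$ (j, b)))"
      using K ec ij by (intro sum.cong refl) (simp add: scalar_prod_def atLeast0LessThan sum_distrib_right)
    also have "\<dots> = sandwich K K P i j" unfolding sandwich_def Ke using K by (simp add: scaleC_complex ac_simps)
    finally show "(K * T) $$ (i, j) = 1\<^sub>m m $$ (i, j)" using KK[OF ij] ij by (simp add: unit_fun_def)
  qed (use K T in auto)
  \<comment> \<open>Points have positive size, and size 0 would force e = 0.\<close>
  have m1: "m \<ge> 1"
  proof (rule ccontr)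
    assume "\<not> m \<ge> 1"
    then have "m = 0" by simp
    then have "e = 0\<^sub>m N N" unfolding TK by (intro eq_matI) (use T K in \<open>auto simp: scalar_prod_def\<close>)
    then show False using e(3) N_def by simp
  qed
  \<comment> \<open>D on the range of e, written in the new basis. T and K intertwine because e = T
    K commutes with D.\<close>
  define Z' where "Z' = (K \<cdot>\<^sub>L D) \<cdot>\<^sub>R T"
  have Z'c: "Z' \<in> carrier_mat m m" unfolding Z'_def by (rule ract_carrier[OF T lact_carrier[OF K Dc]])
  have Z'd: "dim_row Z' = m" using Z'c by simp
  have "T \<cdot>\<^sub>L Z' = T \<cdot>\<^sub>L (K \<cdot>\<^sub>L (D \<cdot>\<^sub>R T))" unfolding Z'_def lact_ract[OF K Dc T] ..
  also have "\<dots> = e \<cdot>\<^sub>L (D \<cdot>\<^sub>R T)" unfolding TK by (rule lact_assoc[OF T K ract_carrier[OF T Dc], symmetric])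
  also have "\<dots> = D \<cdot>\<^sub>R e \<cdot>\<^sub>R T" unfolding lact_ract[OF ec Dc T, symmetric] eD ..
  also have "\<dots> = D \<cdot>\<^sub>R (e * T)" by (rule ract_assoc[OF Dc ec T, symmetric])
  also have "e * T = T" unfolding TK assoc_mult_mat[OF T K T] KT by (rule right_mult_one_mat[OF T])
  finally have TZ: "T \<in> intertwiners Z' D" using T Z'c Dc by (simp add: intertwiners_def)
  have "Z' \<cdot>\<^sub>R K = (K \<cdot>\<^sub>L D) \<cdot>\<^sub>R e" unfolding Z'_def TK by (rule ract_assoc[OF lact_carrier[OF K Dc] T K, symmetric])
  also have "\<dots> = K \<cdot>\<^sub>L (e \<cdot>\<^sub>L D)" unfolding eD by (rule lact_ract[OF K Dc ec])
  also have "\<dots> = K \<cdot>\<^sub>L D" unfolding lact_assoc[OF K ec Dc, symmetric] Ke ..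
  finally have KD: "K \<in> intertwiners D Z'" using K Z'c Dc by (simp add: intertwiners_def)
  have Z': "Z' \<in> \<Omega>'"
    by (rule compress[OF D K[unfolded N_def] T[unfolded N_def] KT m1 Z'c TZ KD \<delta> KK])
  show thesis
    by (rule that[OF Z' _ TZ KD TK[symmetric]]) (unfold Z'd, rule m[unfolded N_def], rule KT, rule KK)
qed

text \<open>Definiteness of P gives P = T T^* with T a change of basis from another point Z'; strict
  positivity of Q(D,D)(P) is what puts Z' into \<Omega>'. Then S(D,D)(P) = T S(Z',Z')(1) T^* is
  positive.\<close>

lemma Sform_nonneg_strict:
  assumes D: "D \<in> \<Omega>'" and herm: "\<And>a b. a < dim_row D \<Longrightarrow> b < dim_row D \<Longrightarrow> P b a = cnj (P a b)"
    and \<delta>: "\<delta> > 0" "\<And>x. \<delta> * (\<Sum>a<dim_row D. (norm (x a))\<^sup>2) \<le> Re (Qform D D P x x)"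
      "\<And>w. \<delta> * (\<Sum>a<dim_row D. (cmod (w a))\<^sup>2) \<le> Re (bform (*) (dim_row D) (dim_row D) P w w)"
  shows "0 \<le> Re (Sform D D P x x)"
proof -
  define N where "N = dim_row D"
  have N: "N \<ge> 1" unfolding N_def by (rule ptsD(4)[OF D])
  \<comment> \<open>The form of P on row vectors is its operator form at the conjugate
    vector.\<close>
  have pos: "0 < Re (sesq N P u u)" if u: "\<exists>a<N. u a \<noteq> 0" for u
  proof -
    have "sesq N P u u = bform (*) N N P (\<lambda>a. cnj (u a)) (\<lambda>a. cnj (u a))"
      unfolding sesq_def bform_def by (intro sum.cong refl) (simp add: cinner_complex_def ac_simps)
    moreover have "0 < \<delta> * (\<Sum>a<N. (cmod (cnj (u a)))\<^sup>2)"
    proof -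
      obtain a where a: "a < N" "u a \<noteq> 0" using u by auto
      have "0 < (cmod (cnj (u a)))\<^sup>2" using a by simp
      also have "\<dots> \<le> (\<Sum>a<N. (cmod (cnj (u a)))\<^sup>2)" by (rule member_le_sum) (use a in auto)
      finally show ?thesis using \<delta>(1) by simp
    qed
    ultimately show ?thesis using less_le_trans[OF _ \<delta>(3)[of "\<lambda>a. cnj (u a)", folded N_def]] by metis
  qed
  have one: "1\<^sub>m N \<in> intertwiners D D" unfolding N_def by (rule intertwiners_one[OF ptsD(3)[OF D]])
  have ne: "1\<^sub>m N \<noteq> (0\<^sub>m (dim_row D) (dim_row D) :: complex mat)"
    unfolding N_def[symmetric]
  proof
    assume "1\<^sub>m N = (0\<^sub>m N N :: complex mat)"
    then have "1\<^sub>m N $$ (0, 0) = (0\<^sub>m N N $$ (0, 0) :: complex)" by simp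
    then show False using N by simp
  qed
  obtain Z' K T where Z': "Z' \<in> \<Omega>'" and TZ: "T \<in> intertwiners Z' D" and KD: "K \<in> intertwiners D Z'" and TK: "T * K = 1\<^sub>m N"
    and KK: "\<And>i j. i < dim_row Z' \<Longrightarrow> j < dim_row Z' \<Longrightarrow> sandwich K K P i j = unit_fun i j"
    by (rule compress_idempotent[OF D one left_mult_one_mat[OF one_carrier_mat] ne herm \<delta>(1,2) pos[unfolded N_def]])
      (assumption+, rule that)
  have T: "T \<in> carrier_mat N (dim_row Z')" and K: "K \<in> carrier_mat (dim_row Z') N"
    using TZ KD by (auto simp: intertwiners_def N_def)
  have "kfun S D D P = kfun S D D (sandwich T T unit_fun)"
  proof (rule kfun_cong)
    fix a b assume "a < dim_row D" "b < dim_row D"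
    then have ab: "a < N" "b < N" by (auto simp: N_def)
    have "sandwich T T unit_fun = sandwich T T (sandwich K K P)"
      by (rule sandwich_cong) (simp add: KK carrier_matD(2)[OF T])
    then have "sandwich T T unit_fun a b = sandwich (1\<^sub>m N) (1\<^sub>m N) P a b"
      using sandwich_sandwich[OF T K T K ab, of P] TK by simp
    also have "\<dots> = P a b" by (rule sandwich_one[OF ab])
    finally show "P a b = sandwich T T unit_fun a b" by simp
  qed
  then have "Sform D D P x x = Sform Z' Z' unit_fun (adj_vec T x) (adj_vec T x)"
    using S_int[OF Z' D Z' D TZ TZ] by simp
  then show ?thesis using S(3)[OF Z'] psd_iff[OF S(1,2) Z'] by simp
qed

text \<open>The Hermitian part of P plus a positive multiple t of the identity satisfies the strict
  hypotheses; then t is taken small.\<close>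

lemma Sform_nonneg:
  assumes D: "D \<in> \<Omega>'" and P: "\<And>x. 0 \<le> Re (Qform D D P x x)"
      "\<And>w. 0 \<le> Re (bform (*) (dim_row D) (dim_row D) P w w)"
  shows "0 \<le> Re (Sform D D P x x)"
proof -
  define Ph where "Ph = hermitian_part P"
  note D\<Xi> = ptsD(1)[OF D]
  obtain \<epsilon> where \<epsilon>: "\<epsilon> > 0" "\<And>x. \<epsilon> * (\<Sum>a<dim_row D. (norm (x a))\<^sup>2) \<le> Re (Qform D D unit_fun x x)"
    by (rule pts_pos[OF D]) (rule that)
  have *: "0 \<le> Re (Sform D D P x x) + t * Re (Sform D D unit_fun x x)" if t: "t > 0" for t
  proof -
    let ?P = "Ph + complex_of_real t *\<^sub>C unit_fun"
    have "0 \<le> Re (Sform D D ?P x x)"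
    proof (rule Sform_nonneg_strict[OF D, where \<delta> = "t * min \<epsilon> 1"])
      show "?P b a = cnj (?P a b)" for a b
        by (simp add: Ph_def hermitian_part_def scaleC_fun_apply scaleC_complex unit_fun_def)
      show "t * min \<epsilon> 1 > 0" using t \<epsilon>(1) by simp
      show "t * min \<epsilon> 1 * (\<Sum>a<dim_row D. (norm (x a))\<^sup>2) \<le> Re (Qform D D ?P x x)" for x
      proof -
        have "t * min \<epsilon> 1 * (\<Sum>a<dim_row D. (norm (x a))\<^sup>2) \<le> t * (\<epsilon> * (\<Sum>a<dim_row D. (norm (x a))\<^sup>2))"
          unfolding mult.assoc by (intro mult_left_mono mult_right_mono sum_nonneg) (use t in auto)
        also have "\<dots> \<le> t * Re (Qform D D unit_fun x x)" using t by (intro mult_left_mono \<epsilon>(2)) simp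
        also have "\<dots> \<le> Re (Qform D D Ph x x) + t * Re (Qform D D unit_fun x x)"
          unfolding Ph_def kfun_hermitian_part[OF Q D\<Xi>] using P(1)[of x] by simp
        also have "\<dots> = Re (Qform D D ?P x x)"
          unfolding kfun_add[OF Q(1) D\<Xi> D\<Xi>] kfun_scaleC[OF Q(1) D\<Xi> D\<Xi>] bop.bform_add bop.bform_scaleC by simp
        finally show ?thesis .
      qed
      show "t * min \<epsilon> 1 * (\<Sum>a<dim_row D. (cmod (w a))\<^sup>2) \<le> Re (bform (*) (dim_row D) (dim_row D) ?P w w)" for w
      proof -
        have "t * min \<epsilon> 1 * (\<Sum>a<dim_row D. (cmod (w a))\<^sup>2) \<le> t * (\<Sum>a<dim_row D. (cmod (w a))\<^sup>2)"
          by (intro mult_right_mono sum_nonneg) (use t in \<open>auto simp: mult_le_cancel_left1\<close>)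
        also have "\<dots> \<le> Re (bform (*) (dim_row D) (dim_row D) Ph w w) + t * (\<Sum>a<dim_row D. (cmod (w a))\<^sup>2)"
          unfolding Ph_def bform_hermitian_part using P(2)[of w] by simp
        also have "\<dots> = Re (bform (*) (dim_row D) (dim_row D) ?P w w)"
          unfolding cmul.bform_add cmul.bform_scaleC bform_mult_unit by simp
        finally show ?thesis .
      qed
    qed
    also have "Re (Sform D D ?P x x) = Re (Sform D D Ph x x) + t * Re (Sform D D unit_fun x x)"
      unfolding kfun_add[OF S(1) D D] kfun_scaleC[OF S(1) D D] bop.bform_add bop.bform_scaleC by simp
    also have "Re (Sform D D Ph x x) = Re (Sform D D P x x)"
      unfolding Ph_def by (rule kfun_hermitian_part[OF S(1,2) D])
    finally show ?thesis .
  qed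
  show ?thesis
  proof (rule ccontr)
    assume neg: "\<not> 0 \<le> Re (Sform D D P x x)"
    let ?s = "Re (Sform D D P x x)" and ?u = "\<bar>Re (Sform D D unit_fun x x)\<bar> + 1"
    \<comment> \<open>Small enough that t times the form of the identity makes up for at most half
      of the supposed negative value.\<close>
    define t where "t = - ?s / (2 * ?u)"
    have t: "t > 0" unfolding t_def using neg by (intro divide_pos_pos) auto
    have "t * Re (Sform D D unit_fun x x) \<le> t * ?u" using t by (intro mult_left_mono) auto
    also have "\<dots> = - ?s / 2" unfolding t_def by (simp add: field_simps)
    finally show False using *[OF t] neg by simp
  qed
qed

lemma bform_zero_vec: "bform act n m R (\<lambda>a. 0) y = 0"
  by (simp add: bform_def cinner_zero_right)

text \<open>At the direct sum D the family \<open>PP\<close> becomes the single matrix P, assembled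
  by the inclusions \<iota>, and the domination statement for the family becomes
  \<open>Sform_nonneg\<close> for P.\<close>

lemma Sform_dominated:
  assumes I: "finite (I::nat set)" and p: "\<And>i. i \<in> I \<Longrightarrow> p i \<in> \<Omega>'"
    and pos: "\<And>\<xi>. 0 \<le> Re (\<Sum>i\<in>I. \<Sum>j\<in>I. bform prod_act (dim_row (p i)) (dim_row (p j)) (qpair (p i) (p j) (PP i j)) (\<xi> i) (\<xi> j))"
  shows "0 \<le> Re (\<Sum>i\<in>I. \<Sum>j\<in>I. Sform (p i) (p j) (PP i j) (xx i) (xx j))"
proof (cases "I = {}")
  case False
  have "\<exists>D\<in>\<Omega>'. \<exists>\<iota> \<pi>. (\<forall>i\<in>I. \<iota> i \<in> intertwiners (p i) D \<and> \<pi> i \<in> intertwiners D (p i) \<and> \<pi> i * \<iota> i = 1\<^sub>m (dim_row (p i))) \<and>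
    (\<forall>x :: nat \<Rightarrow> nat \<Rightarrow> 'e. \<exists>w. \<forall>i\<in>I. \<forall>a<dim_row (p i). adj_vec (\<iota> i) w a = x i a)"
    by (rule finite_direct_sum[OF I False p])
  then obtain D \<iota> \<pi> where D: "D \<in> \<Omega>'" and \<iota>0: "(\<forall>i\<in>I. \<iota> i \<in> intertwiners (p i) D \<and> \<pi> i \<in> intertwiners D (p i) \<and> \<pi> i * \<iota> i = 1\<^sub>m (dim_row (p i))) \<and>
    (\<forall>x :: nat \<Rightarrow> nat \<Rightarrow> 'e. \<exists>w. \<forall>i\<in>I. \<forall>a<dim_row (p i). adj_vec (\<iota> i) w a = x i a)"
    by (elim bexE exE) (rule that)
  have \<iota>: "\<And>i. i \<in> I \<Longrightarrow> \<iota> i \<in> intertwiners (p i) D" using \<iota>0 by simp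
  obtain w where w: "\<forall>i\<in>I. \<forall>a<dim_row (p i). adj_vec (\<iota> i) w a = xx i a" using \<iota>0[THEN conjunct2, THEN spec, of xx] by (rule exE)
  define P where "P = (\<Sum>i\<in>I. \<Sum>j\<in>I. sandwich (\<iota> i) (\<iota> j) (PP i j))"
  have c: "dim_row (\<iota> i) = dim_row D" "dim_col (\<iota> i) = dim_row (p i)" if "i \<in> I" for i
    using \<iota>[OF that] by (auto simp: intertwiners_def)
  have sumP: "bform bop_apply (dim_row D) (dim_row D) (kfun K D D P) x x =
    (\<Sum>i\<in>I. \<Sum>j\<in>I. bform bop_apply (dim_row (p i)) (dim_row (p j)) (kfun K (p i) (p j) (PP i j)) (adj_vec (\<iota> i) x) (adj_vec (\<iota> j) x))"
    if K: "nc_kernel X K" and sub: "\<Omega>' \<subseteq> X" for X and K :: "('v, complex, 'h::chilbert_space bop) kernel" and x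
  proof -
    have DX: "D \<in> X" and pX: "\<And>i. i \<in> I \<Longrightarrow> p i \<in> X" using sub D p by auto
    have z: "kfun K D D 0 = 0" using kfun_scaleC[OF K DX DX, of 0 0] by (simp add: scaleC_zero_left)
    have s: "kfun K D D (\<Sum>i\<in>J. R i) = (\<Sum>i\<in>J. kfun K D D (R i))" for J :: "nat set" and R
      by (induction J rule: infinite_finite_induct) (simp_all add: z kfun_add[OF K DX DX] del: plus_fun_apply zero_fun_apply)
    show ?thesis
      unfolding P_def s bop.bform_sum
      by (intro sum.cong refl bform_kfun_intertwine[OF K] pX DX \<iota>)
  qed
  have sumC: "bform (*) (dim_row D) (dim_row D) P x x =
    (\<Sum>i\<in>I. \<Sum>j\<in>I. bform (*) (dim_row (p i)) (dim_row (p j)) (PP i j) (adj_vec (\<iota> i) x) (adj_vec (\<iota> j) x))" for x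
    unfolding P_def cmul.bform_sum
  proof (intro sum.cong refl)
    fix i j assume ij: "i \<in> I" "j \<in> I"
    show "bform (*) (dim_row D) (dim_row D) (sandwich (\<iota> i) (\<iota> j) (PP i j)) x x =
      bform (*) (dim_row (p i)) (dim_row (p j)) (PP i j) (adj_vec (\<iota> i) x) (adj_vec (\<iota> j) x)"
      using cmul.bform_sandwich[of "\<iota> i" "\<iota> j" "PP i j" x x] c[OF ij(1)] c[OF ij(2)] by simp
  qed
  have "0 \<le> Re (Sform D D P w w)"
  proof (rule Sform_nonneg[OF D])
    \<comment> \<open>Test vectors with one zero component separate the two summands: here the
      operator part, next the scalar part.\<close>
    show "0 \<le> Re (Qform D D P x x)" for x
    proof -
      have "0 \<le> Re (\<Sum>i\<in>I. \<Sum>j\<in>I. bform prod_act (dim_row (p i)) (dim_row (p j)) (qpair (p i) (p j) (PP i j))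
        (\<lambda>a. (adj_vec (\<iota> i) x a, 0)) (\<lambda>a. (adj_vec (\<iota> j) x a, 0)))" by (rule pos)
      also have "(\<Sum>i\<in>I. \<Sum>j\<in>I. bform prod_act (dim_row (p i)) (dim_row (p j)) (qpair (p i) (p j) (PP i j))
        (\<lambda>a. (adj_vec (\<iota> i) x a, 0)) (\<lambda>a. (adj_vec (\<iota> j) x a, 0))) = Qform D D P x x"
        by (simp add: sumP[OF Q(1) subsetI[OF ptsD(1)]] bform_qpair o_def bform_zero_vec)
      finally show ?thesis .
    qed
    show "0 \<le> Re (bform (*) (dim_row D) (dim_row D) P x x)" for x
    proof -
      have "0 \<le> Re (\<Sum>i\<in>I. \<Sum>j\<in>I. bform prod_act (dim_row (p i)) (dim_row (p j)) (qpair (p i) (p j) (PP i j))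
        (\<lambda>a. (0, adj_vec (\<iota> i) x a)) (\<lambda>a. (0, adj_vec (\<iota> j) x a)))" by (rule pos)
      also have "(\<Sum>i\<in>I. \<Sum>j\<in>I. bform prod_act (dim_row (p i)) (dim_row (p j)) (qpair (p i) (p j) (PP i j))
        (\<lambda>a. (0, adj_vec (\<iota> i) x a)) (\<lambda>a. (0, adj_vec (\<iota> j) x a))) = bform (*) (dim_row D) (dim_row D) P x x"
        by (simp add: sumC bform_qpair o_def bform_zero_vec)
      finally show ?thesis .
    qed
  qed
  also have "Sform D D P w w = (\<Sum>i\<in>I. \<Sum>j\<in>I. Sform (p i) (p j) (PP i j) (xx i) (xx j))"
    unfolding sumP[OF S(1) subset_refl]
    by (intro sum.cong refl bform_vec_cong) (use w in simp_all)
  finally show ?thesis .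
qed simp

end

sublocale nc_pair \<subseteq> dominated_nc_kernel prod_act \<Omega>' dim_row qpair Sform intertwiners
proof
  fix Z W :: "'v mat" and P P' :: "nat \<Rightarrow> nat \<Rightarrow> complex" and c :: complex
  assume Z: "Z \<in> \<Omega>'" and W: "W \<in> \<Omega>'"
  show "qpair Z W (P + P') = qpair Z W P + qpair Z W P'"
    by (intro ext) (simp add: qpair_def kfun_add[OF Q(1) ptsD(1)[OF Z] ptsD(1)[OF W]])
  show "qpair Z W (c *\<^sub>C P) = c *\<^sub>C qpair Z W P"
    by (intro ext) (simp add: qpair_def kfun_scaleC[OF Q(1) ptsD(1)[OF Z] ptsD(1)[OF W]] scaleC_fun_apply scaleC_prod_def scaleC_zero_right)
  fix x y x' y' :: "nat \<Rightarrow> 'e"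
  show "Sform Z W (P + P') x y = Sform Z W P x y + Sform Z W P' x y"
    unfolding kfun_add[OF S(1) Z W] bop.bform_add ..
  show "Sform Z W (c *\<^sub>C P) x y = c * Sform Z W P x y"
    unfolding kfun_scaleC[OF S(1) Z W] bop.bform_scaleC ..
  show "Sform Z W P (x + x') y = Sform Z W P x y + Sform Z W P x' y" by (rule bop.bform_add_left)
  show "Sform Z W P (c *\<^sub>C x) y = cnj c * Sform Z W P x y" by (rule bop.bform_scaleC_left)
  show "Sform Z W P x (y + y') = Sform Z W P x y + Sform Z W P x y'" by (rule bop.bform_add_right)
  show "Sform Z W P x (c *\<^sub>C y) = c * Sform Z W P x y" by (rule bop.bform_scaleC_right)
  show "Sform Z W P x y = Sform Z W P x' y'" if "\<And>a. a < dim_row Z \<Longrightarrow> x a = x' a" "\<And>b. b < dim_row W \<Longrightarrow> y b = y' b"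
    using that by (rule bform_vec_cong)
next
  fix Z :: "'v mat" assume Z: "Z \<in> \<Omega>'"
  obtain \<epsilon> where \<epsilon>: "\<epsilon> > 0" "\<And>x. \<epsilon> * (\<Sum>a<dim_row Z. (norm (x a))\<^sup>2) \<le> Re (Qform Z Z unit_fun x x)"
    by (rule pts_pos[OF Z]) (rule that)
  \<comment> \<open>The scalar summand of \<open>qpair\<close> at the identity is the plain sum of
    squares, whence the constant 1.\<close>
  have "min \<epsilon> 1 * (\<Sum>a<dim_row Z. (norm (\<xi> a))\<^sup>2) \<le> Re (bform prod_act (dim_row Z) (dim_row Z) (qpair Z Z unit_fun) \<xi> \<xi>)" for \<xi> :: "nat \<Rightarrow> 'n \<times> complex"
  proof -
    have n: "(norm (\<xi> a))\<^sup>2 = (norm ((fst \<circ> \<xi>) a))\<^sup>2 + (cmod ((snd \<circ> \<xi>) a))\<^sup>2" for a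
      by (cases "\<xi> a") (simp add: norm_Pair)
    have "min \<epsilon> 1 * (\<Sum>a<dim_row Z. (norm (\<xi> a))\<^sup>2) =
      min \<epsilon> 1 * (\<Sum>a<dim_row Z. (norm ((fst \<circ> \<xi>) a))\<^sup>2) + min \<epsilon> 1 * (\<Sum>a<dim_row Z. (cmod ((snd \<circ> \<xi>) a))\<^sup>2)"
      unfolding n sum.distrib distrib_left ..
    also have "\<dots> \<le> \<epsilon> * (\<Sum>a<dim_row Z. (norm ((fst \<circ> \<xi>) a))\<^sup>2) + 1 * (\<Sum>a<dim_row Z. (cmod ((snd \<circ> \<xi>) a))\<^sup>2)"
      by (intro add_mono mult_right_mono sum_nonneg) auto
    also have "\<dots> \<le> Re (Qform Z Z unit_fun (fst \<circ> \<xi>) (fst \<circ> \<xi>)) + 1 * (\<Sum>a<dim_row Z. (cmod ((snd \<circ> \<xi>) a))\<^sup>2)"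
      by (intro add_mono \<epsilon>(2) order_refl)
    also have "\<dots> = Re (bform prod_act (dim_row Z) (dim_row Z) (qpair Z Z unit_fun) \<xi> \<xi>)"
      unfolding bform_qpair bform_mult_unit by simp
    finally show ?thesis .
  qed
  then show "\<exists>\<epsilon>>0. \<forall>\<xi>. \<epsilon> * (\<Sum>a<dim_row Z. (norm (\<xi> a))\<^sup>2) \<le> Re (bform prod_act (dim_row Z) (dim_row Z) (qpair Z Z unit_fun) \<xi> \<xi>)"
    by (intro exI[of _ "min \<epsilon> 1"]) (simp add: \<epsilon>(1))
next
  fix I :: "nat set" and p PP and xx :: "nat \<Rightarrow> nat \<Rightarrow> 'e"
  assume "finite I" "\<And>i. i \<in> I \<Longrightarrow> p i \<in> \<Omega>'"
    "\<And>\<xi>. 0 \<le> Re (\<Sum>i\<in>I. \<Sum>j\<in>I. bform prod_act (dim_row (p i)) (dim_row (p j)) (qpair (p i) (p j) (PP i j)) (\<xi> i) (\<xi> j))"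
  then show "0 \<le> Re (\<Sum>i\<in>I. \<Sum>j\<in>I. Sform (p i) (p j) (PP i j) (xx i) (xx j))" by (rule Sform_dominated)
next
  fix Z W V :: "'v mat" and \<alpha> \<beta> c
  assume Z: "Z \<in> \<Omega>'" and W: "W \<in> \<Omega>'" and \<alpha>: "\<alpha> \<in> intertwiners Z W"
  show "\<beta> * \<alpha> \<in> intertwiners Z V" if "V \<in> \<Omega>'" "\<beta> \<in> intertwiners W V"
    by (rule intertwiners_mult[OF ptsD(3)[OF Z] ptsD(3)[OF W] ptsD(3)[OF that(1)] \<alpha> that(2)])
  show "\<alpha> + \<beta> \<in> intertwiners Z W" if "\<beta> \<in> intertwiners Z W"
    by (rule intertwiners_add[OF ptsD(3)[OF Z] ptsD(3)[OF W] \<alpha> that])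
  show "c \<cdot>\<^sub>m \<alpha> \<in> intertwiners Z W"
    by (rule intertwiners_smult[OF ptsD(3)[OF Z] ptsD(3)[OF W] \<alpha>])
  show "\<beta> \<in> intertwiners W Z" if "\<beta> \<in> carrier_mat (dim_row Z) (dim_row W)" "\<alpha> * \<beta> = 1\<^sub>m (dim_row W)" "\<beta> * \<alpha> = 1\<^sub>m (dim_row Z)"
    by (rule intertwiners_inverse[OF ptsD(3)[OF Z] ptsD(3)[OF W] \<alpha> that])
next
  show "\<alpha> \<in> carrier_mat (dim_row W) (dim_row Z)" if "\<alpha> \<in> intertwiners Z W" for \<alpha> and Z W :: "'v mat"
    using that by (simp add: intertwiners_def)
  show "1\<^sub>m (dim_row Z) \<in> intertwiners Z Z" if "Z \<in> \<Omega>'" for Z by (rule intertwiners_one[OF ptsD(3)[OF that]])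
qed (rule qpair_int S_int; assumption)+

section \<open>Covering points of least size\<close>

context nc_pair begin

text \<open>The range of e = 1 - g is a proper summand Y' of Y. Since e factors through Y' and g
  lies in the ideal of e, the identity g + e is a sum of maps through Y'; hence Y' covers Y and
  everything that Y covers.\<close>

lemma covers_compress:
  assumes Y: "Y \<in> \<Omega>'" and g: "g \<in> intertwiners Y Y" "g * g = g" "g \<noteq> 0\<^sub>m (dim_row Y) (dim_row Y)"
    "g \<in> mat_two_sided (dim_row Y) (intertwiners Y Y) (1\<^sub>m (dim_row Y) - g)"
  obtains Y' where "Y' \<in> \<Omega>'" "dim_row Y' < dim_row Y" "\<And>Z. Z \<in> \<Omega>' \<Longrightarrow> covers Y Z \<Longrightarrow> covers Y' Z"
proof -
  define n where "n = dim_row Y"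
  define e where "e = 1\<^sub>m n - g"
  have gc: "g \<in> carrier_mat n n" using g(1) by (simp add: intertwiners_def n_def)
  have ec: "e \<in> carrier_mat n n" unfolding e_def using gc by (rule minus_carrier_mat)
  have eg: "g + e = 1\<^sub>m n" unfolding e_def using gc by (intro eq_matI) auto
  have one: "1\<^sub>m n \<in> intertwiners Y Y" unfolding n_def by (rule Hom_one[OF Y])
  have e_alt: "e = 1\<^sub>m n + (- 1) \<cdot>\<^sub>m g" unfolding e_def using gc by (intro eq_matI) auto
  have eE: "e \<in> intertwiners Y Y" unfolding e_alt by (rule Hom_add[OF Y Y one Hom_smult[OF Y Y g(1)]])
  have ge: "g * e = 0\<^sub>m n n"
    unfolding e_def using mult_minus_distrib_mat[OF gc one_carrier_mat gc] g(2) right_mult_one_mat[OF gc] gc by simp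
  have ee: "e * e = e"
  proof -
    have "(g + e) * e = g * e + e * e" by (rule add_mult_distrib_mat[OF gc ec ec])
    then have "e = 0\<^sub>m n n + e * e" unfolding eg ge using left_mult_one_mat[OF ec] by simp
    then show ?thesis using left_add_zero_mat[OF mult_carrier_mat[OF ec ec]] by simp
  qed
  have g2: "g \<in> mat_two_sided n (intertwiners Y Y) e" using g(4) by (simp add: e_def n_def)
  \<comment> \<open>Otherwise the ideal generated by e would be 0, and with it g.\<close>
  have ne: "e \<noteq> 0\<^sub>m n n"
  proof
    assume e0: "e = 0\<^sub>m n n"
    have "x = 0\<^sub>m n n" if "x \<in> mat_two_sided n (intertwiners Y Y) e" for x
      using that
    proof (induction rule: mat_two_sided.induct)
      case (add x a b)
      have a: "a \<in> carrier_mat n n" and b: "b \<in> carrier_mat n n" using add(2,3) by (auto simp: intertwiners_def n_def)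
      show ?case unfolding add.IH e0 using a b by simp
    qed simp
    then show False using g2 g(3) n_def by blast
  qed
  obtain \<epsilon> where \<epsilon>: "\<epsilon> > 0" "\<And>x. \<epsilon> * (\<Sum>a<dim_row Y. (norm (x a))\<^sup>2) \<le> Re (Qform Y Y unit_fun x x)"
    by (rule pts_pos[OF Y]) (rule that)
  have pos: "0 < Re (sesq (dim_row Y) unit_fun u u)" if "\<exists>a<dim_row Y. u a \<noteq> 0" for u
  proof -
    obtain a where a: "a < dim_row Y" "u a \<noteq> 0" using \<open>\<exists>a<dim_row Y. u a \<noteq> 0\<close> by (elim exE conjE) (rule that)
    have "sesq (dim_row Y) unit_fun u u = (\<Sum>a<dim_row Y. \<Sum>b<dim_row Y. if b = a then u a * cnj (u a) else 0)"
      unfolding sesq_def by (intro sum.cong refl) (simp add: unit_fun_def)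
    also have "\<dots> = (\<Sum>a<dim_row Y. u a * cnj (u a))" by simp
    also have "\<dots> = complex_of_real (\<Sum>a<dim_row Y. (cmod (u a))\<^sup>2)" unfolding of_real_sum
      by (intro sum.cong refl) (simp only: complex_norm_square)
    finally have 1: "Re (sesq (dim_row Y) unit_fun u u) = (\<Sum>a<dim_row Y. (cmod (u a))\<^sup>2)" by simp
    have "0 < (cmod (u a))\<^sup>2" using a by simp
    also have "\<dots> \<le> (\<Sum>a<dim_row Y. (cmod (u a))\<^sup>2)" by (rule member_le_sum) (use a in auto)
    finally show ?thesis unfolding 1 .
  qed
  obtain Y' K T where Y': "Y' \<in> \<Omega>'" and le: "dim_row Y' \<le> dim_row Y" and T: "T \<in> intertwiners Y' Y" and K: "K \<in> intertwiners Y Y'"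
    and TK: "T * K = e" and KT: "K * T = 1\<^sub>m (dim_row Y')"
  proof (rule compress_idempotent[OF Y eE ee ne[unfolded n_def], of unit_fun \<epsilon>])
    show "unit_fun b a = cnj (unit_fun a b)" for a b by (simp add: unit_fun_def)
    show "0 < Re (sesq (dim_row Y) unit_fun u u)" if "\<exists>a<dim_row Y. u a \<noteq> 0" for u by (rule pos[OF that])
    show "\<epsilon> > 0" by (rule \<epsilon>(1))
    show "\<epsilon> * (\<Sum>a<dim_row Y. (norm (x a))\<^sup>2) \<le> Re (Qform Y Y unit_fun x x)" for x by (rule \<epsilon>(2))
  qed (rule that)
  have Tc: "T \<in> carrier_mat n (dim_row Y')" and Kc: "K \<in> carrier_mat (dim_row Y') n"
    using T K by (auto simp: intertwiners_def n_def)
  \<comment> \<open>Equal sizes would make K and T mutually inverse, so e would be 1 and g = g e =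
    0.\<close>
  have lt: "dim_row Y' < dim_row Y"
  proof (rule ccontr)
    assume "\<not> dim_row Y' < dim_row Y"
    then have d: "dim_row Y' = n" using le by (simp add: n_def)
    have "T * K = 1\<^sub>m n" by (rule mat_mult_left_right_inverse[OF Kc[unfolded d] Tc[unfolded d] KT[unfolded d]])
    then have "g * e = g" using TK right_mult_one_mat[OF gc] by simp
    then show False using ge g(3) n_def by simp
  qed
  have eF: "e \<in> factor_sums Y' Y Y"
  proof -
    have "0\<^sub>m (dim_row Y) (dim_row Y) + T * K \<in> factor_sums Y' Y Y" by (rule factor_sums.add[OF factor_sums.zero K T])
    then show ?thesis unfolding TK using left_add_zero_mat[OF ec] n_def by simp
  qed
  have two: "x \<in> factor_sums Y' Y Y" if "x \<in> mat_two_sided n (intertwiners Y Y) e" for x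
    using that
  proof (induction rule: mat_two_sided.induct)
    case zero
    then show ?case unfolding n_def by (rule factor_sums.zero)
  next
    case (add x a b)
    show ?case by (rule factor_sums_plus[OF factor_sums_mult[OF eF Y Y Y' Y Y add(2,3)] add.IH])
  qed
  have one': "1\<^sub>m n \<in> factor_sums Y' Y Y" unfolding eg[symmetric] by (rule factor_sums_plus[OF eF two[OF g2]])
  have "covers Y' Z" if Z: "Z \<in> \<Omega>'" and cov: "covers Y Z" for Z
  proof -
    have "x \<in> factor_sums Y' Z Z" if "x \<in> factor_sums Y Z Z" for x
      using that
    proof (induction rule: factor_sums.induct)
      case zero
      show ?case by (rule factor_sums.zero)
    next
      case (add x \<sigma> \<rho>)
      have "\<rho> \<in> carrier_mat (dim_row Z) n" using add(3) by (simp add: intertwiners_def n_def)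
      then have "\<rho> * 1\<^sub>m n * \<sigma> = \<rho> * \<sigma>" by simp
      moreover have "\<rho> * 1\<^sub>m n * \<sigma> \<in> factor_sums Y' Z Z" by (rule factor_sums_mult[OF one' Y Y Y' Z Z add(3,2)])
      ultimately show ?case by (intro factor_sums_plus[OF _ add.IH]) simp
    qed
    then show ?thesis using cov unfolding covers_def .
  qed
  with Y' lt show thesis by (rule that)
qed

text \<open>The direct sum of the given points covers them all, so a covering point of least size
  exists; a violation of \<open>basic_at\<close> would yield a smaller one by
  \<open>covers_compress\<close>.\<close>

lemma basic_cover:
  assumes F: "finite F" "F \<noteq> {}" "F \<subseteq> \<Omega>'"
  shows "\<exists>Y\<in>\<Omega>'. basic_at Y \<and> (\<forall>Z\<in>F. covers Y Z)"
proof -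
  have "\<exists>D\<in>\<Omega>'. \<exists>\<iota> \<pi>. (\<forall>i\<in>F. \<iota> i \<in> intertwiners i D \<and> \<pi> i \<in> intertwiners D i \<and> \<pi> i * \<iota> i = 1\<^sub>m (dim_row i)) \<and>
    (\<forall>x :: 'v mat \<Rightarrow> nat \<Rightarrow> 'e. \<exists>w. \<forall>i\<in>F. \<forall>a<dim_row i. adj_vec (\<iota> i) w a = x i a)"
    by (rule finite_direct_sum[OF F(1,2), of "\<lambda>i. i"]) (use F(3) in auto)
  then obtain D \<iota> \<pi> where D: "D \<in> \<Omega>'" and \<iota>: "\<forall>i\<in>F. \<iota> i \<in> intertwiners i D \<and> \<pi> i \<in> intertwiners D i \<and> \<pi> i * \<iota> i = 1\<^sub>m (dim_row i)"
    by (elim bexE exE conjE) (rule that)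
  have "covers D Z" if Z: "Z \<in> F" for Z
  proof -
    have "0\<^sub>m (dim_row Z) (dim_row Z) + \<pi> Z * \<iota> Z \<in> factor_sums D Z Z"
      by (rule factor_sums.add[OF factor_sums.zero]) (use \<iota> Z in simp_all)
    then show ?thesis using \<iota> Z by (simp add: covers_def)
  qed
  then have "D \<in> \<Omega>' \<and> (\<forall>Z\<in>F. covers D Z)" using D by simp
  from ex_has_least_nat[of "\<lambda>Y. Y \<in> \<Omega>' \<and> (\<forall>Z\<in>F. covers Y Z)", OF this, of dim_row]
  obtain Y where Y: "Y \<in> \<Omega>'" "\<forall>Z\<in>F. covers Y Z" and min: "\<forall>Y'. Y' \<in> \<Omega>' \<and> (\<forall>Z\<in>F. covers Y' Z) \<longrightarrow> dim_row Y \<le> dim_row Y'"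
    by (elim exE conjE) (rule that)
  have "basic_at Y"
    unfolding basic_at_def
  proof (intro ballI impI, rule ccontr)
    fix g assume g: "g \<in> intertwiners Y Y" "g * g = g" "g \<in> mat_two_sided (dim_row Y) (intertwiners Y Y) (1\<^sub>m (dim_row Y) - g)"
      "g \<noteq> 0\<^sub>m (dim_row Y) (dim_row Y)"
    obtain Y' where Y': "Y' \<in> \<Omega>'" "dim_row Y' < dim_row Y" "\<And>Z. Z \<in> \<Omega>' \<Longrightarrow> covers Y Z \<Longrightarrow> covers Y' Z"
      by (rule covers_compress[OF Y(1) g(1,2,4,3)]) (rule that)
    have "covers Y' Z" if "Z \<in> F" for Z by (rule Y'(3)) (use that Y(2) F(3) in auto)
    then have "dim_row Y \<le> dim_row Y'" using min Y'(1) by simp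
    then show False using Y'(2) by simp
  qed
  then show ?thesis using Y by blast
qed

theorem extension: "\<exists>\<kappa>. extends_on (\<Omega>' \<times> UNIV) \<kappa> \<and> intertwining \<Omega>' \<kappa>"
  by (rule extends_intertwining) (rule basic_cover)

end

section \<open>From forms to operator-valued kernels\<close>

text \<open>Riesz representation of the real part in u, for each v; replacing u by i u recovers the
  imaginary part. The additive bound becomes a bound by the product of the norms once both vectors
  are normalized.\<close>

lemma bounded_sesquilinear_operator:
  fixes \<beta> :: "'e::chilbert_space \<Rightarrow> 'e \<Rightarrow> complex"
  assumes add1: "\<And>u u' v. \<beta> (u + u') v = \<beta> u v + \<beta> u' v" and sc1: "\<And>c u v. \<beta> (c *\<^sub>C u) v = cnj c * \<beta> u v"
    and add2: "\<And>u v v'. \<beta> u (v + v') = \<beta> u v + \<beta> u v'" and sc2: "\<And>c u v. \<beta> u (c *\<^sub>C v) = c * \<beta> u v"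
    and bound: "\<And>u v. cmod (\<beta> u v) \<le> M * ((norm u)\<^sup>2 + (norm v)\<^sup>2)"
  shows "\<exists>T. \<forall>u v. cinner (bop_apply T v) u = \<beta> u v"
proof -
  have zero: "\<beta> 0 v = 0" "\<beta> u 0 = 0" for u v using sc1[of 0 0 v] sc2[of u 0 0] by (simp_all add: scaleC_zero_left)
  have b: "cmod (\<beta> u v) \<le> 2 * M * (norm u * norm v)" for u v
  proof (cases "u = 0 \<or> v = 0")
    case True
    then show ?thesis by (auto simp: zero)
  next
    case False
    let ?u = "complex_of_real (1 / norm u) *\<^sub>C u" and ?v = "complex_of_real (1 / norm v) *\<^sub>C v"
    have "cmod (\<beta> ?u ?v) \<le> M * ((norm ?u)\<^sup>2 + (norm ?v)\<^sup>2)" by (rule bound)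
    moreover have "norm ?u = 1" "norm ?v = 1" using False by (simp_all add: norm_scaleC norm_divide)
    moreover have "cmod (\<beta> ?u ?v) = cmod (\<beta> u v) / (norm u * norm v)"
      by (simp add: sc1 sc2 norm_mult norm_divide)
    ultimately have "cmod (\<beta> u v) / (norm u * norm v) \<le> 2 * M" by simp
    then show ?thesis using False by (simp add: pos_divide_le_eq)
  qed
  have "\<exists>z. \<forall>u. cinner z u = \<beta> u v" for v
  proof -
    have "bounded_linear (\<lambda>u. Re (\<beta> u v))"
    proof (rule bounded_linear_intro[where K = "2 * M * norm v"])
      show "Re (\<beta> (r *\<^sub>R u) v) = r *\<^sub>R Re (\<beta> u v)" for r u by (simp add: scaleR_scaleC sc1)
      show "norm (Re (\<beta> u v)) \<le> norm u * (2 * M * norm v)" for u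
        using order_trans[OF abs_Re_le_cmod b[of u v]] by (simp add: ac_simps)
    qed (simp add: add1)
    then obtain z where "\<forall>u. Re (\<beta> u v) = inner u z" using riesz_real by blast
    then have z: "Re (\<beta> u v) = Re (cinner z u)" for u by (simp add: Re_cinner inner_commute)
    have "cinner z u = \<beta> u v" for u
      using z[of u] z[of "\<i> *\<^sub>C u"] by (simp add: complex_eq_iff sc1 cinner_scaleC_right)
    then show ?thesis by blast
  qed
  then have "\<exists>f. \<forall>v u. cinner (f v) u = \<beta> u v" by (intro choice allI)
  then obtain f where f: "\<And>v u. cinner (f v) u = \<beta> u v" by (elim exE) (rule that, elim allE)
  have ex: "x = y" if "\<And>u. cinner x u = cinner y u" for x y :: 'e
    by (rule cinner_ext) (metis that cinner_commute)
  have fa: "f (v + v') = f v + f v'" for v v' by (rule ex) (simp add: f cinner_add_left add2)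
  have fs: "f (c *\<^sub>C v) = c *\<^sub>C f v" for c v by (rule ex) (simp add: f cinner_scaleC_left sc2)
  have "norm (f v) \<le> norm v * (2 * M)" for v
  proof (cases "f v = 0")
    case True
    have "0 \<le> 2 * M * (norm v * norm v)" using order_trans[OF norm_ge_zero b[of v v]] .
    then have "v = 0 \<or> 0 \<le> M" by (auto simp: zero_le_mult_iff mult_le_0_iff)
    then show ?thesis using True by auto
  next
    case False
    have "norm (f v) * norm (f v) = Re (\<beta> (f v) v)"
      using f[of v "f v"] by (metis Re_cinner power2_norm_eq_inner power2_eq_square)
    also have "\<dots> \<le> 2 * M * (norm (f v) * norm v)" by (rule order_trans[OF complex_Re_le_cmod b])
    finally have "norm (f v) * norm (f v) \<le> norm (f v) * (norm v * (2 * M))" by (simp add: ac_simps)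
    then show ?thesis using False by simp
  qed
  then have "bounded_linear f" by (intro bounded_linear_intro[where K = "2 * M"]) (simp_all add: fa fs scaleR_scaleC)
  then have "bop_apply (Bop f) = f" by (intro Bop_inverse) (simp add: fs)
  then show ?thesis using f by (intro exI[of _ "Bop f"]) simp
qed

lemma bop_eqI: "(\<And>u v. cinner (bop_apply S v) u = cinner (bop_apply T v) u) \<Longrightarrow> S = T"
proof -
  assume e: "\<And>u v. cinner (bop_apply S v) u = cinner (bop_apply T v) u"
  have "cinner u (bop_apply S v) = cinner u (bop_apply T v)" for u v
    using arg_cong[OF e[where u = u and v = v], of cnj] cinner_commute[of u "bop_apply S v"] cinner_commute[of u "bop_apply T v"]
    by (metis cinner_commute)
  then show ?thesis by (intro adjoint_unique)
qed

section \<open>Operators as entries of a form\<close>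

definition vec_at :: "nat \<Rightarrow> 'a \<Rightarrow> nat \<Rightarrow> 'a::zero" where
  "vec_at a u k = (if k = a then u else 0)"

lemma vec_at_add: "vec_at a (u + v) = vec_at a u + vec_at a (v :: 'a::complex_vector)"
  by (intro ext) (simp add: vec_at_def)

lemma vec_at_scaleC: "vec_at a (c *\<^sub>C u) = c *\<^sub>C vec_at a (u :: 'a::complex_vector)"
  by (intro ext) (simp add: vec_at_def scaleC_fun_apply scaleC_zero_right)

lemma vec_at_norm: "(\<Sum>k<n. (norm (vec_at a u k))\<^sup>2) \<le> (norm (u :: 'h::chilbert_space))\<^sup>2"
proof -
  have "(\<Sum>k<n. (norm (vec_at a u k))\<^sup>2) = (\<Sum>k<n. if k = a then (norm u)\<^sup>2 else 0)"
    by (intro sum.cong refl) (simp add: vec_at_def)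
  then show ?thesis by simp
qed

lemma (in op_action) bform_vec_at: "a < n \<Longrightarrow> b < m \<Longrightarrow> bform act n m R (vec_at a u) (vec_at b v) = cinner (act (R a b) v) u"
proof -
  assume ab: "a < n" "b < m"
  have "bform act n m R (vec_at a u) (vec_at b v) = (\<Sum>i<n. \<Sum>j<m. if j = b then (if i = a then cinner (act (R a b) v) u else 0) else 0)"
    unfolding bform_def by (intro sum.cong refl) (auto simp: vec_at_def cinner_zero_right cinner_zero_left act_zero_right)
  also have "\<dots> = cinner (act (R a b) v) u" using ab by simp
  finally show ?thesis .
qed

context nc_pair begin

context
  fixes \<kappa> :: "('v mat, 'n bop \<times> complex, 'e) form_kernel"
  assumes exK: "extends_on (\<Omega>' \<times> UNIV) \<kappa>" and int: "intertwining \<Omega>' \<kappa>"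
begin

lemma mem: "Z \<in> \<Omega>' \<Longrightarrow> (Z, x) \<in> \<Omega>' \<times> UNIV" by simp

lemma operator_entry_exists:
  \<comment> \<open>\<open>extends_bounded_form\<close> bounds \<kappa> by forms of \<open>s\<close>
    at the identity, and these are bounded operator forms; so the form of a single entry is bounded
    in the sense that the Riesz argument needs.\<close>
  assumes Z: "Z \<in> \<Omega>'" and W: "W \<in> \<Omega>'"
  shows "\<exists>T. \<forall>u v. cinner (bop_apply T v) u = \<kappa> Z W R (vec_at a u) (vec_at b v)"
proof -
  obtain t where t: "t \<ge> 0" and bd0: "\<forall>X \<kappa> x y. extends_on X \<kappa> \<longrightarrow> (Z, x) \<in> X \<longrightarrow> (W, y) \<in> X \<longrightarrow>
    cmod (\<kappa> Z W R x y) \<le> t * (Re (Sform Z Z unit_fun x x) + Re (Sform W W unit_fun y y))"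
    using extends_bounded_form[OF Z W, of R] by (elim exE conjE) (rule that)
  have bd: "cmod (\<kappa> Z W R x y) \<le> t * (Re (Sform Z Z unit_fun x x) + Re (Sform W W unit_fun y y))" for x y
    by (rule bd0[rule_format, OF exK mem[OF Z] mem[OF W]])
  have sb: "\<exists>K\<ge>0. \<forall>a u. Re (Sform V V unit_fun (vec_at a u) (vec_at a u)) \<le> K * (norm u)\<^sup>2" if V: "V \<in> \<Omega>'" for V
  proof -
    obtain K where K: "K \<ge> 0" "\<forall>x y. cmod (Sform V V unit_fun x y) \<le> K * ((\<Sum>a<dim_row V. (norm (x a))\<^sup>2) + (\<Sum>b<dim_row V. (norm (y b))\<^sup>2))"
      using bop.bform_bounded[of "dim_row V" "dim_row V" "kfun S V V unit_fun"] by (elim exE conjE) (rule that)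
    have "Re (Sform V V unit_fun (vec_at a u) (vec_at a u)) \<le> (2 * K) * (norm u)\<^sup>2" for a u
    proof -
      have "Re (Sform V V unit_fun (vec_at a u) (vec_at a u)) \<le> K * ((\<Sum>k<dim_row V. (norm (vec_at a u k))\<^sup>2) + (\<Sum>k<dim_row V. (norm (vec_at a u k))\<^sup>2))"
        by (rule order_trans[OF complex_Re_le_cmod K(2)[rule_format]])
      also have "\<dots> \<le> K * ((norm u)\<^sup>2 + (norm u)\<^sup>2)" by (intro mult_left_mono add_mono vec_at_norm K(1))
      finally show ?thesis by simp
    qed
    then show ?thesis using K(1) by (intro exI[of _ "2 * K"]) simp
  qed
  obtain K where K: "K \<ge> 0" "\<forall>a u. Re (Sform Z Z unit_fun (vec_at a u) (vec_at a u)) \<le> K * (norm u)\<^sup>2"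
    using sb[OF Z] by (elim exE conjE) (rule that)
  obtain L where L: "L \<ge> 0" "\<forall>a u. Re (Sform W W unit_fun (vec_at a u) (vec_at a u)) \<le> L * (norm u)\<^sup>2"
    using sb[OF W] by (elim exE conjE) (rule that)
  note av = extends_add_vec[OF exK Z W mem[OF Z] mem[OF Z] mem[OF Z] mem[OF W]] extends_add_vec[OF exK W Z mem[OF W] mem[OF W] mem[OF W] mem[OF Z]]
  note cv = extends_scaleC_vec[OF exK Z W mem[OF Z] mem[OF Z] mem[OF W]] extends_scaleC_vec[OF exK W Z mem[OF W] mem[OF W] mem[OF Z]]
  show ?thesis
  proof (rule bounded_sesquilinear_operator[where M = "t * (K + L)"])
    show "cmod (\<kappa> Z W R (vec_at a u) (vec_at b v)) \<le> t * (K + L) * ((norm u)\<^sup>2 + (norm v)\<^sup>2)" for u v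
    proof -
      have "cmod (\<kappa> Z W R (vec_at a u) (vec_at b v)) \<le> t * (K * (norm u)\<^sup>2 + L * (norm v)\<^sup>2)"
        by (rule order_trans[OF bd]) (intro mult_left_mono add_mono K(2)[rule_format] L(2)[rule_format] t)
      also have "\<dots> \<le> t * ((K + L) * ((norm u)\<^sup>2 + (norm v)\<^sup>2))"
        by (intro mult_left_mono t) (use K(1) L(1) in \<open>simp add: algebra_simps\<close>)
      finally show ?thesis by (simp add: mult.assoc)
    qed
  qed (simp_all add: vec_at_add vec_at_scaleC av cv del: plus_fun_apply)
qed

text \<open>Choice of the Riesz operator for the entry (a, b); \<open>bop_eqI\<close> makes it
  unique.\<close>

definition operator_entry :: "'v mat \<Rightarrow> 'v mat \<Rightarrow> (nat \<Rightarrow> nat \<Rightarrow> 'n bop \<times> complex) \<Rightarrow> nat \<Rightarrow> nat \<Rightarrow> 'e bop" where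
  "operator_entry Z W R a b = (SOME T. \<forall>u v. cinner (bop_apply T v) u = \<kappa> Z W R (vec_at a u) (vec_at b v))"

context
  fixes Z W assumes Z: "Z \<in> \<Omega>'" and W: "W \<in> \<Omega>'"
begin

lemma operator_entry: "cinner (bop_apply (operator_entry Z W R a b) v) u = \<kappa> Z W R (vec_at a u) (vec_at b v)"
  unfolding operator_entry_def using someI_ex[OF operator_entry_exists[OF Z W]] by blast

lemma operator_entry_add: "operator_entry Z W (R + T) = operator_entry Z W R + operator_entry Z W T"
  by (intro ext bop_eqI) (simp add: operator_entry extends_add[OF exK mem[OF Z] mem[OF W]] bop.act_add_left cinner_add_left)

lemma operator_entry_scaleC: "operator_entry Z W (c *\<^sub>C R) = c *\<^sub>C operator_entry Z W R"
  by (intro ext bop_eqI) (simp add: operator_entry extends_scaleC[OF exK mem[OF Z] mem[OF W]] scaleC_fun_apply bop.act_scaleC_left cinner_scaleC_left)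

text \<open>On its block a vector is the sum of its \<open>vec_at\<close> components, and \<kappa>
  is sesquilinear and ignores entries outside the block.\<close>

lemma bform_operator_entry: "bform bop_apply (dim_row Z) (dim_row W) (operator_entry Z W R) x y = \<kappa> Z W R x y"
proof -
  note av1 = extends_add_vec(1)[OF exK Z W mem[OF Z] mem[OF Z] mem[OF Z] mem[OF W]]
  note av2 = extends_add_vec(2)[OF exK W Z mem[OF W] mem[OF W] mem[OF W] mem[OF Z]]
  have z1: "\<kappa> Z W R 0 y = 0" for y
    using extends_scaleC_vec(1)[OF exK Z W mem[OF Z] mem[OF Z] mem[OF W], of R 0 0 y] by (simp add: scaleC_zero_left)
  have z2: "\<kappa> Z W R x 0 = 0" for x
    using extends_scaleC_vec(2)[OF exK W Z mem[OF W] mem[OF W] mem[OF Z], of R x 0 0] by (simp add: scaleC_zero_left)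
  have s1: "\<kappa> Z W R (\<Sum>a\<in>A. f a) y = (\<Sum>a\<in>A. \<kappa> Z W R (f a) y)" for A :: "nat set" and f y
    by (induction A rule: infinite_finite_induct) (simp_all add: z1 av1 del: plus_fun_apply zero_fun_apply)
  have s2: "\<kappa> Z W R x (\<Sum>a\<in>A. f a) = (\<Sum>a\<in>A. \<kappa> Z W R x (f a))" for A :: "nat set" and f x
    by (induction A rule: infinite_finite_induct) (simp_all add: z2 av2 del: plus_fun_apply zero_fun_apply)
  have dec: "(\<Sum>a<n. vec_at a (x a)) k = x k" if "k < n" for n k and x :: "nat \<Rightarrow> 'e"
    using that by (simp add: sum_fun_apply vec_at_def)
  have "bform bop_apply (dim_row Z) (dim_row W) (operator_entry Z W R) x y =
    \<kappa> Z W R (\<Sum>a<dim_row Z. vec_at a (x a)) (\<Sum>b<dim_row W. vec_at b (y b))"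
    unfolding bform_def s1 operator_entry by (simp add: s2)
  also have "\<dots> = \<kappa> Z W R x y"
    by (rule extends_cong[OF exK subset_refl Z W]) (simp_all add: dec)
  finally show ?thesis .
qed

lemma operator_entry_cong:
  "(\<And>a b. a < dim_row Z \<Longrightarrow> b < dim_row W \<Longrightarrow> R a b = T a b) \<Longrightarrow> operator_entry Z W R = operator_entry Z W T"
  by (intro ext bop_eqI) (simp add: operator_entry, rule extends_cong[OF exK subset_refl Z W], simp_all)

end

lemma operator_entry_int:
  assumes Z: "Z \<in> \<Omega>'" "Z' \<in> \<Omega>'" and W: "W \<in> \<Omega>'" "W' \<in> \<Omega>'" and \<alpha>: "\<alpha> \<in> intertwiners Z Z'" and \<beta>: "\<beta> \<in> intertwiners W W'"
    and ab: "a < dim_row Z'" "b < dim_row W'"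
  shows "operator_entry Z' W' (sandwich \<alpha> \<beta> R) a b = sandwich \<alpha> \<beta> (operator_entry Z W R) a b"
proof (rule bop_eqI)
  fix u v
  have c: "\<alpha> \<in> carrier_mat (dim_row Z') (dim_row Z)" "\<beta> \<in> carrier_mat (dim_row W') (dim_row W)"
    using \<alpha> \<beta> by (auto simp: intertwiners_def)
  have "cinner (bop_apply (operator_entry Z' W' (sandwich \<alpha> \<beta> R) a b) v) u =
    \<kappa> Z W R (adj_vec \<alpha> (vec_at a u)) (adj_vec \<beta> (vec_at b v))"
    unfolding operator_entry[OF Z(2) W(2)] by (rule intertwiningD[OF int Z W \<alpha> \<beta>])
  also have "\<dots> = bform bop_apply (dim_row Z) (dim_row W) (operator_entry Z W R) (adj_vec \<alpha> (vec_at a u)) (adj_vec \<beta> (vec_at b v))"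
    by (rule bform_operator_entry[OF Z(1) W(1), symmetric])
  also have "\<dots> = bform bop_apply (dim_row Z') (dim_row W') (sandwich \<alpha> \<beta> (operator_entry Z W R)) (vec_at a u) (vec_at b v)"
    using bop.bform_sandwich[of \<alpha> \<beta> "operator_entry Z W R" "vec_at a u" "vec_at b v"] c by simp
  also have "\<dots> = cinner (bop_apply (sandwich \<alpha> \<beta> (operator_entry Z W R) a b) v) u"
    by (rule bop.bform_vec_at[OF ab])
  finally show "cinner (bop_apply (operator_entry Z' W' (sandwich \<alpha> \<beta> R) a b) v) u = cinner (bop_apply (sandwich \<alpha> \<beta> (operator_entry Z W R) a b) v) u" .
qed

end

end

section \<open>Complete positivity\<close>

lemma locate_offset:
  "i < length ns \<Longrightarrow> a < ns ! i \<Longrightarrow> locate ns (sum_list (take i ns) + a) = (i, a)"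
proof (induction ns arbitrary: i)
  case (Cons n ns)
  then show ?case by (cases i) auto
qed simp

lemma locate_bounds:
  "p < sum_list ns \<Longrightarrow> fst (locate ns p) < length ns \<and> snd (locate ns p) < ns ! fst (locate ns p)"
proof (induction ns arbitrary: p)
  case (Cons n ns)
  show ?case
  proof (cases "p < n")
    case False
    then have "p - n < sum_list ns" using Cons.prems by auto
    from Cons.IH[OF this] show ?thesis using False by simp
  qed simp
qed simp

lemma offset_bound: "i < length ns \<Longrightarrow> sum_list (take i ns) + ns ! i \<le> sum_list (ns :: nat list)"
proof (induction ns arbitrary: i)
  case (Cons n ns)
  then show ?case by (cases i) auto
qed simp

lemma sum_blocks:
  "(\<Sum>p<sum_list ns. f p) = (\<Sum>i<length ns. \<Sum>a<ns ! i. f (sum_list (take i ns) + a) :: 'a::comm_monoid_add)" for ns :: "nat list"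
proof (induction ns arbitrary: f)
  case (Cons n ns)
  have "(\<Sum>p<sum_list (n # ns). f p) = (\<Sum>a<n. f a) + (\<Sum>p<sum_list ns. f (n + p))"
    by (simp add: sum_lessThan_add)
  also have "(\<Sum>p<sum_list ns. f (n + p)) = (\<Sum>i<length ns. \<Sum>a<ns ! i. f (n + (sum_list (take i ns) + a)))"
    by (rule Cons.IH)
  finally show ?case by (simp add: sum.lessThan_Suc_shift add.assoc del: sum.lessThan_Suc)
qed simp

lemma sum_repeat: "(\<Sum>p<r * N. f p) = (\<Sum>k<r. \<Sum>q<N. f (k * N + q) :: 'a::comm_monoid_add)" for N :: nat
  by (induction r) (simp_all add: sum_lessThan_add add.commute[of N])

lemma psd_zero_le: "0 \<le> (z::complex) \<longleftrightarrow> 0 \<le> Re z \<and> Im z = 0"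
  by (auto simp: less_eq_complex_def)

context nc_pair begin

text \<open>Both summands of the direct sum are treated at once: J embeds one of the two algebras
  and \<pi> projects onto its Hilbert space, so that the form of J a is that of a at the projected
  vectors.\<close>

context
  fixes \<kappa> :: "('v mat, 'n bop \<times> complex, 'e) form_kernel"
    and J :: "'b::complex_vector \<Rightarrow> 'n bop \<times> complex" and actB :: "'b \<Rightarrow> 'k \<Rightarrow> 'k::chilbert_space"
    and \<pi> :: "'n \<times> complex \<Rightarrow> 'k"
  assumes exK: "extends_on (\<Omega>' \<times> UNIV) \<kappa>" and int: "intertwining \<Omega>' \<kappa>"
    and J_add: "\<And>a b. J (a + b) = J a + J b" and J_scaleC: "\<And>c a. J (c *\<^sub>C a) = c *\<^sub>C J a"
    and J_act: "\<And>a \<xi> \<eta>. cinner (prod_act (J a) \<xi>) \<eta> = cinner (actB a (\<pi> \<xi>)) (\<pi> \<eta>)"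
begin

definition pad :: "nat \<Rightarrow> nat \<Rightarrow> 'b mat \<Rightarrow> nat \<Rightarrow> nat \<Rightarrow> 'n bop \<times> complex" where
  "pad n m P a b = (if a < n \<and> b < m then J (P $$ (a, b)) else 0)"

definition lifted_kernel :: "('v, 'b, 'e bop) kernel" where
  "lifted_kernel Z W P = fun_mat (dim_row Z) (dim_row W) (operator_entry \<kappa> Z W (pad (dim_row Z) (dim_row W) P))"

lemma lifted_kernel_carrier: "lifted_kernel Z W P \<in> carrier_mat (dim_row Z) (dim_row W)"
  by (simp add: lifted_kernel_def)

lemma lifted_kernel_dims: "dim_row (lifted_kernel Z W P) = dim_row Z" "dim_col (lifted_kernel Z W P) = dim_row W"
  by (simp_all add: lifted_kernel_def)

lemma pad_add: "P \<in> carrier_mat n m \<Longrightarrow> R \<in> carrier_mat n m \<Longrightarrow> pad n m (P + R) = pad n m P + pad n m R"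
  by (intro ext) (auto simp: pad_def J_add)

lemma pad_scaleC: "P \<in> carrier_mat n m \<Longrightarrow> pad n m (map_mat ((*\<^sub>C) c) P) = c *\<^sub>C pad n m P"
  by (intro ext) (auto simp: pad_def J_scaleC scaleC_fun_apply scaleC_zero_right)

lemma
  assumes Z: "Z \<in> \<Omega>'" and W: "W \<in> \<Omega>'" and P: "P \<in> carrier_mat (dim_row Z) (dim_row W)"
  shows lifted_kernel_add: "R \<in> carrier_mat (dim_row Z) (dim_row W) \<Longrightarrow> lifted_kernel Z W (P + R) = lifted_kernel Z W P + lifted_kernel Z W R"
    and lifted_kernel_scaleC: "lifted_kernel Z W (map_mat ((*\<^sub>C) c) P) = map_mat ((*\<^sub>C) c) (lifted_kernel Z W P)"
proof -
  show "lifted_kernel Z W (P + R) = lifted_kernel Z W P + lifted_kernel Z W R" if R: "R \<in> carrier_mat (dim_row Z) (dim_row W)"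
    unfolding lifted_kernel_def pad_add[OF P R] operator_entry_add[OF exK int Z W] by (intro eq_matI) auto
  show "lifted_kernel Z W (map_mat ((*\<^sub>C) c) P) = map_mat ((*\<^sub>C) c) (lifted_kernel Z W P)"
    unfolding lifted_kernel_def pad_scaleC[OF P] operator_entry_scaleC[OF exK int Z W] by (intro eq_matI) (auto simp: scaleC_fun_apply)
qed

lemma J_zero: "J 0 = 0"
  using J_scaleC[of 0 0] by (simp add: scaleC_zero_left)

lemma J_sum: "J (\<Sum>i\<in>A. f i) = (\<Sum>i\<in>A. J (f i))" for A :: "nat set"
  by (induction A rule: infinite_finite_induct) (simp_all add: J_zero J_add)

lemma lifted_kernel_nc: "X \<subseteq> \<Omega>' \<Longrightarrow> nc_kernel X lifted_kernel"
  unfolding nc_kernel_def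
proof (intro conjI ballI impI)
  fix Z W assume X: "X \<subseteq> \<Omega>'" and "Z \<in> X" "W \<in> X"
  then have ZW: "Z \<in> \<Omega>'" "W \<in> \<Omega>'" by auto
  show "mat_clinear (dim_row Z) (dim_row W) (dim_row Z) (dim_row W) (lifted_kernel Z W)"
    unfolding mat_clinear_def
    by (intro conjI ballI allI lifted_kernel_carrier lifted_kernel_add[OF ZW] lifted_kernel_scaleC[OF ZW])
next
  fix Z Z' W W' \<alpha> \<beta> and P :: "'b mat"
  assume X: "X \<subseteq> \<Omega>'" and "Z \<in> X" "Z' \<in> X" "W \<in> X" "W' \<in> X"
    and c: "\<alpha> \<in> carrier_mat (dim_row Z') (dim_row Z)" "\<beta> \<in> carrier_mat (dim_row W') (dim_row W)"
    and P: "P \<in> carrier_mat (dim_row Z) (dim_row W)" and e: "\<alpha> \<cdot>\<^sub>L Z = Z' \<cdot>\<^sub>R \<alpha> \<and> \<beta> \<cdot>\<^sub>L W = W' \<cdot>\<^sub>R \<beta>"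
  then have p: "Z \<in> \<Omega>'" "Z' \<in> \<Omega>'" "W \<in> \<Omega>'" "W' \<in> \<Omega>'" by auto
  have ab: "\<alpha> \<in> intertwiners Z Z'" "\<beta> \<in> intertwiners W W'" using c e by (auto simp: intertwiners_def)
  let ?n = "dim_row Z" and ?m = "dim_row W" and ?n' = "dim_row Z'" and ?m' = "dim_row W'"
  have "(\<alpha> \<cdot>\<^sub>L lifted_kernel Z W P) \<cdot>\<^sub>R adj \<beta> = fun_mat ?n' ?m' (sandwich \<alpha> \<beta> (\<lambda>k l. lifted_kernel Z W P $$ (k, l)))"
    by (rule sandwich_mat[OF lifted_kernel_carrier c])
  also have "sandwich \<alpha> \<beta> (\<lambda>k l. lifted_kernel Z W P $$ (k, l)) = sandwich \<alpha> \<beta> (operator_entry \<kappa> Z W (pad ?n ?m P))"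
    by (rule sandwich_cong) (simp add: lifted_kernel_def carrier_matD(2)[OF c(1)] carrier_matD(2)[OF c(2)])
  also have "fun_mat ?n' ?m' \<dots> = fun_mat ?n' ?m' (operator_entry \<kappa> Z' W' (sandwich \<alpha> \<beta> (pad ?n ?m P)))"
    by (intro eq_matI) (simp_all add: operator_entry_int[OF exK int p ab])
  also have "operator_entry \<kappa> Z' W' (sandwich \<alpha> \<beta> (pad ?n ?m P)) = operator_entry \<kappa> Z' W' (pad ?n' ?m' ((\<alpha> \<cdot>\<^sub>L P) \<cdot>\<^sub>R adj \<beta>))"
  proof (rule operator_entry_cong[OF exK int p(2,4)])
    fix a b assume a: "a < ?n'" "b < ?m'"
    have "pad ?n' ?m' ((\<alpha> \<cdot>\<^sub>L P) \<cdot>\<^sub>R adj \<beta>) a b = J (sandwich \<alpha> \<beta> (\<lambda>k l. P $$ (k, l)) a b)"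
      unfolding sandwich_mat[OF P c] pad_def using a by simp
    also have "\<dots> = sandwich \<alpha> \<beta> (pad ?n ?m P) a b"
      unfolding sandwich_def J_sum J_scaleC carrier_matD(2)[OF c(1)] carrier_matD(2)[OF c(2)] by (intro sum.cong refl) (simp add: pad_def)
    finally show "sandwich \<alpha> \<beta> (pad ?n ?m P) a b = pad ?n' ?m' ((\<alpha> \<cdot>\<^sub>L P) \<cdot>\<^sub>R adj \<beta>) a b" by simp
  qed
  finally show "(\<alpha> \<cdot>\<^sub>L lifted_kernel Z W P) \<cdot>\<^sub>R adj \<beta> = lifted_kernel Z' W' ((\<alpha> \<cdot>\<^sub>L P) \<cdot>\<^sub>R adj \<beta>)"
    unfolding lifted_kernel_def .
qed

text \<open>Nonnegativity in \<complex> includes being real. The block matrix is positive, so its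
  multiples by 1, i and -i are accretive; the last two force the imaginary part of the value to
  vanish.\<close>

lemma lifted_kernel_positive:
  assumes I: "finite (I :: 'i set)" and p: "\<And>i. i \<in> I \<Longrightarrow> p i \<in> \<Omega>'"
    and pos: "\<And>y. 0 \<le> (\<Sum>i\<in>I. \<Sum>j\<in>I. bform actB (dim_row (p i)) (dim_row (p j)) (\<lambda>a b. R i j $$ (a, b)) (y i) (y j))"
  shows "0 \<le> (\<Sum>i\<in>I. \<Sum>j\<in>I. bform bop_apply (dim_row (p i)) (dim_row (p j)) (\<lambda>a b. lifted_kernel (p i) (p j) (R i j) $$ (a, b)) (x i) (x j))"
proof -
  define u where "u i j = pad (dim_row (p i)) (dim_row (p j)) (R i j)" for i j
  have eq: "(\<Sum>i\<in>I. \<Sum>j\<in>I. bform bop_apply (dim_row (p i)) (dim_row (p j)) (\<lambda>a b. lifted_kernel (p i) (p j) (R i j) $$ (a, b)) (x i) (x j)) =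
    (\<Sum>i\<in>I. \<Sum>j\<in>I. \<kappa> (p i) (p j) (u i j) (x i) (x j))"
  proof (intro sum.cong refl)
    fix i j assume ij: "i \<in> I" "j \<in> I"
    have "bform bop_apply (dim_row (p i)) (dim_row (p j)) (\<lambda>a b. lifted_kernel (p i) (p j) (R i j) $$ (a, b)) (x i) (x j) =
      bform bop_apply (dim_row (p i)) (dim_row (p j)) (operator_entry \<kappa> (p i) (p j) (u i j)) (x i) (x j)"
      by (rule bform_cong) (simp add: lifted_kernel_def u_def)
    then show "bform bop_apply (dim_row (p i)) (dim_row (p j)) (\<lambda>a b. lifted_kernel (p i) (p j) (R i j) $$ (a, b)) (x i) (x j) =
      \<kappa> (p i) (p j) (u i j) (x i) (x j)" using bform_operator_entry[OF exK int p[OF ij(1)] p[OF ij(2)]] by simp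
  qed
  have 1: "0 \<le> Re (\<Sum>i\<in>I. \<Sum>j\<in>I. c * \<kappa> (p i) (p j) (u i j) (x i) (x j))" if c: "\<And>z. 0 \<le> z \<Longrightarrow> 0 \<le> Re (c * z)" for c
  proof -
    have "accretive I p (\<lambda>i j. c *\<^sub>C u i j)"
      unfolding accretive_def
    proof
      fix \<xi>
      have "(\<Sum>i\<in>I. \<Sum>j\<in>I. bform prod_act (dim_row (p i)) (dim_row (p j)) (c *\<^sub>C u i j) (\<xi> i) (\<xi> j)) =
        c * (\<Sum>i\<in>I. \<Sum>j\<in>I. bform actB (dim_row (p i)) (dim_row (p j)) (\<lambda>a b. R i j $$ (a, b)) (\<pi> \<circ> \<xi> i) (\<pi> \<circ> \<xi> j))"
        unfolding sum_distrib_left pact.bform_scaleC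
        by (simp add: bform_def u_def pad_def J_act)
      then show "0 \<le> Re (\<Sum>i\<in>I. \<Sum>j\<in>I. bform prod_act (dim_row (p i)) (dim_row (p j)) (c *\<^sub>C u i j) (\<xi> i) (\<xi> j))"
        using c[OF pos] by simp
    qed
    then have "0 \<le> Re (\<Sum>i\<in>I. \<Sum>j\<in>I. \<kappa> (p i) (p j) (c *\<^sub>C u i j) (x i) (x j))"
      by (intro extends_pos[OF exK I]) (simp_all add: p)
    then show ?thesis by (simp add: extends_scaleC[OF exK mem[OF exK int p] mem[OF exK int p]])
  qed
  have "0 \<le> Re (\<Sum>i\<in>I. \<Sum>j\<in>I. \<kappa> (p i) (p j) (u i j) (x i) (x j))"
    using 1[of 1] by (simp add: psd_zero_le)
  moreover have "Im (\<Sum>i\<in>I. \<Sum>j\<in>I. \<kappa> (p i) (p j) (u i j) (x i) (x j)) = 0"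
    using 1[of \<i>] 1[of "- \<i>"] unfolding sum_distrib_left[symmetric] by (simp add: psd_zero_le)
  ultimately show ?thesis unfolding eq psd_zero_le by simp
qed

text \<open>Amplifying r-fold only repeats each point of the list r times. A positive matrix of the
  amplification is a positive family of blocks indexed by copy and list position, and positivity of
  extensions already covers families with repeated points.\<close>

lemma lifted_kernel_cp:
  assumes X: "X \<subseteq> \<Omega>'"
  shows "cp_nc_kernel actB bop_apply X lifted_kernel"
  unfolding cp_nc_kernel_def Let_def
proof (intro conjI allI impI lifted_kernel_nc[OF X])
  fix Zs :: "'v mat list" assume Zs0: "set Zs \<subseteq> X"
  define ns where "ns = map dim_row Zs"
  define N where "N = sum_list ns"
  define off where "off i = sum_list (take i ns)" for i
  have len: "length ns = length Zs" and nsi: "\<And>i. i < length Zs \<Longrightarrow> ns ! i = dim_row (Zs ! i)" by (simp_all add: ns_def)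
  have Zs: "Zs ! i \<in> \<Omega>'" if "i < length Zs" for i
    using nth_mem[OF that] Zs0 X by (meson subsetD)
  have bm: "block_map lifted_kernel Zs P = mat N N (\<lambda>(p, q). lifted_kernel (Zs ! fst (locate ns p)) (Zs ! fst (locate ns q))
      (subblock P (off (fst (locate ns p))) (off (fst (locate ns q))) (ns ! fst (locate ns p)) (ns ! fst (locate ns q))) $$
      (snd (locate ns p), snd (locate ns q)))" for P
    unfolding block_map_def Let_def ns_def[symmetric] N_def[symmetric] off_def
    by (intro eq_matI) (auto simp: split_beta)
  have loc1: "fst (locate ns p) < length Zs" if "p < N" for p
    using locate_bounds[of p ns] that len by (simp add: N_def)
  have loc2: "snd (locate ns p) < dim_row (Zs ! fst (locate ns p))" if "p < N" for p
    using locate_bounds[of p ns] that nsi[OF loc1[OF that]] by (simp add: N_def)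
  note loc = loc1 loc2
  have offb: "off i + dim_row (Zs ! i) \<le> N" if "i < length Zs" for i
    using offset_bound[of i ns] that len nsi by (simp add: off_def N_def)
  have sc: "subblock P r c n m \<in> carrier_mat n m" for P :: "'b mat" and r c n m by (simp add: subblock_def)
  have "completely_positive actB bop_apply N N (block_map lifted_kernel Zs)"
    unfolding completely_positive_def
  proof (intro conjI allI ballI impI)
    show "mat_clinear N N N N (block_map lifted_kernel Zs)"
      unfolding mat_clinear_def
    proof (intro conjI ballI allI)
      fix P R :: "'b mat" and c assume P: "P \<in> carrier_mat N N"
      show "block_map lifted_kernel Zs P \<in> carrier_mat N N" by (simp add: bm)
      show "block_map lifted_kernel Zs (P + R) = block_map lifted_kernel Zs P + block_map lifted_kernel Zs R" if R: "R \<in> carrier_mat N N"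
      proof (rule eq_matI)
        fix p q assume "p < dim_row (block_map lifted_kernel Zs P + block_map lifted_kernel Zs R)"
          "q < dim_col (block_map lifted_kernel Zs P + block_map lifted_kernel Zs R)"
        then have pq: "p < N" "q < N" by (simp_all add: bm)
        let ?i = "fst (locate ns p)" and ?j = "fst (locate ns q)"
        have "subblock (P + R) (off ?i) (off ?j) (dim_row (Zs ! ?i)) (dim_row (Zs ! ?j)) =
          subblock P (off ?i) (off ?j) (dim_row (Zs ! ?i)) (dim_row (Zs ! ?j)) + subblock R (off ?i) (off ?j) (dim_row (Zs ! ?i)) (dim_row (Zs ! ?j))"
          by (intro eq_matI) (use offb[OF loc(1)[OF pq(1)]] offb[OF loc(1)[OF pq(2)]] P R in \<open>auto simp: subblock_def\<close>)
        then show "block_map lifted_kernel Zs (P + R) $$ (p, q) = (block_map lifted_kernel Zs P + block_map lifted_kernel Zs R) $$ (p, q)"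
          using pq loc(2)[OF pq(1)] loc(2)[OF pq(2)]
          by (simp add: bm nsi loc(1) lifted_kernel_add[OF Zs Zs sc sc] lifted_kernel_dims)
      qed (simp_all add: bm)
      show "block_map lifted_kernel Zs (map_mat ((*\<^sub>C) c) P) = map_mat ((*\<^sub>C) c) (block_map lifted_kernel Zs P)"
      proof (rule eq_matI)
        fix p q assume "p < dim_row (map_mat ((*\<^sub>C) c) (block_map lifted_kernel Zs P))" "q < dim_col (map_mat ((*\<^sub>C) c) (block_map lifted_kernel Zs P))"
        then have pq: "p < N" "q < N" by (simp_all add: bm)
        let ?i = "fst (locate ns p)" and ?j = "fst (locate ns q)"
        have "subblock (map_mat ((*\<^sub>C) c) P) (off ?i) (off ?j) (dim_row (Zs ! ?i)) (dim_row (Zs ! ?j)) =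
          map_mat ((*\<^sub>C) c) (subblock P (off ?i) (off ?j) (dim_row (Zs ! ?i)) (dim_row (Zs ! ?j)))"
          by (intro eq_matI) (use offb[OF loc(1)[OF pq(1)]] offb[OF loc(1)[OF pq(2)]] P in \<open>auto simp: subblock_def\<close>)
        then show "block_map lifted_kernel Zs (map_mat ((*\<^sub>C) c) P) $$ (p, q) = map_mat ((*\<^sub>C) c) (block_map lifted_kernel Zs P) $$ (p, q)"
          using pq loc(2)[OF pq(1)] loc(2)[OF pq(2)]
          by (simp add: bm nsi loc(1) lifted_kernel_scaleC[OF Zs Zs sc] lifted_kernel_dims)
      qed (simp_all add: bm)
    qed
    fix r :: nat and P :: "'b mat" assume P: "P \<in> carrier_mat (r * N) (r * N)" and psdP: "psd actB P"
    define I where "I = {..<r} \<times> {..<length Zs}"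
    \<comment> \<open>The global index of entry a in the block for copy \<open>fst t\<close> and
      list position \<open>snd t\<close>.\<close>
    define pos where "pos t a = fst t * N + (off (snd t) + a)" for t :: "nat \<times> nat" and a
    define B where "B s t = subblock P (fst s * N + off (snd s)) (fst t * N + off (snd t)) (dim_row (Zs ! snd s)) (dim_row (Zs ! snd t))" for s t :: "nat \<times> nat"
    have reindex: "(\<Sum>p<r * N. f p) = (\<Sum>t\<in>I. \<Sum>a<dim_row (Zs ! snd t). f (pos t a))" for f :: "nat \<Rightarrow> complex"
    proof -
      have "(\<Sum>p<r * N. f p) = (\<Sum>k<r. \<Sum>i<length Zs. \<Sum>a<dim_row (Zs ! i). f (k * N + (off i + a)))"
        unfolding sum_repeat N_def sum_blocks[of _ ns] off_def len by (intro sum.cong refl) (simp add: nsi)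
      also have "\<dots> = (\<Sum>t\<in>I. \<Sum>a<dim_row (Zs ! snd t). f (pos t a))"
        unfolding I_def pos_def by (simp add: sum.cartesian_product split_beta)
      finally show ?thesis .
    qed
    have quad: "(\<Sum>p<r * N. \<Sum>q<r * N. cinner (act (A p q) (x q)) (x p)) =
      (\<Sum>s\<in>I. \<Sum>t\<in>I. bform act (dim_row (Zs ! snd s)) (dim_row (Zs ! snd t)) (\<lambda>a b. A (pos s a) (pos t b)) (x \<circ> pos s) (x \<circ> pos t))"
      for act :: "'c \<Rightarrow> 'l \<Rightarrow> 'l::chilbert_space" and A x
      unfolding reindex bform_def o_def by (intro sum.cong refl sum.swap)
    have posb: "pos t a < r * N" "pos t a div N = fst t" "pos t a mod N = off (snd t) + a" "locate ns (pos t a mod N) = (snd t, a)"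
      if t: "t \<in> I" and a: "a < dim_row (Zs ! snd t)" for t a
    proof -
      have i: "snd t < length Zs" and k: "fst t < r" using t by (auto simp: I_def)
      have lt: "off (snd t) + a < N" using offb[OF i] a by simp
      show d: "pos t a div N = fst t" and m: "pos t a mod N = off (snd t) + a" using lt by (simp_all add: pos_def)
      have "pos t a < Suc (fst t) * N" using lt by (simp add: pos_def)
      also have "\<dots> \<le> r * N" using k by (intro mult_le_mono1) simp
      finally show "pos t a < r * N" .
      show "locate ns (pos t a mod N) = (snd t, a)"
        unfolding m off_def by (rule locate_offset) (use i a len nsi in simp_all)
    qed
    let ?A = "amplify r N N (block_map lifted_kernel Zs) P"
    have entry: "?A $$ (pos s a, pos t b) = lifted_kernel (Zs ! snd s) (Zs ! snd t) (B s t) $$ (a, b)"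
      if s: "s \<in> I" "a < dim_row (Zs ! snd s)" and t: "t \<in> I" "b < dim_row (Zs ! snd t)" for s t a b
    proof -
      have i: "snd s < length Zs" "snd t < length Zs" using s(1) t(1) by (auto simp: I_def)
      have mN: "pos s a mod N < N" "pos t b mod N < N" using posb(3)[OF s] posb(3)[OF t] offb[OF i(1)] offb[OF i(2)] s(2) t(2) by simp_all
      have "?A $$ (pos s a, pos t b) = block_map lifted_kernel Zs (subblock P (fst s * N) (fst t * N) N N) $$ (pos s a mod N, pos t b mod N)"
        unfolding amplify_def using posb(1,2)[OF s] posb(1,2)[OF t] by simp
      also have "\<dots> = lifted_kernel (Zs ! snd s) (Zs ! snd t)
        (subblock (subblock P (fst s * N) (fst t * N) N N) (off (snd s)) (off (snd t)) (dim_row (Zs ! snd s)) (dim_row (Zs ! snd t))) $$ (a, b)"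
        unfolding bm using mN posb(4)[OF s] posb(4)[OF t] i by (simp add: nsi)
      also have "subblock (subblock P (fst s * N) (fst t * N) N N) (off (snd s)) (off (snd t)) (dim_row (Zs ! snd s)) (dim_row (Zs ! snd t)) = B s t"
        unfolding B_def by (intro eq_matI) (use offb[OF i(1)] offb[OF i(2)] in \<open>auto simp: subblock_def add.assoc\<close>)
      finally show ?thesis .
    qed
    have dP: "dim_row P = r * N" using P by simp
    have "0 \<le> (\<Sum>p<r * N. \<Sum>q<r * N. cinner (bop_apply (?A $$ (p, q)) (x q)) (x p))" for x
    proof -
      have "0 \<le> (\<Sum>s\<in>I. \<Sum>t\<in>I. bform bop_apply (dim_row (Zs ! snd s)) (dim_row (Zs ! snd t))
        (\<lambda>a b. lifted_kernel (Zs ! snd s) (Zs ! snd t) (B s t) $$ (a, b)) (x \<circ> pos s) (x \<circ> pos t))"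
      proof (rule lifted_kernel_positive)
        show "finite I" by (simp add: I_def)
        show "Zs ! snd s \<in> \<Omega>'" if "s \<in> I" for s using that by (intro Zs) (auto simp: I_def)
        fix y :: "nat \<times> nat \<Rightarrow> nat \<Rightarrow> 'k"
        \<comment> \<open>Assembles the block vectors y into one vector over all global indices, by
          inverting \<open>pos\<close>.\<close>
        define w where "w p = y (p div N, fst (locate ns (p mod N))) (snd (locate ns (p mod N)))" for p
        have "0 \<le> (\<Sum>p<r * N. \<Sum>q<r * N. cinner (actB (P $$ (p, q)) (w q)) (w p))"
          using psdP unfolding psd_def dP by blast
        also have "\<dots> = (\<Sum>s\<in>I. \<Sum>t\<in>I. bform actB (dim_row (Zs ! snd s)) (dim_row (Zs ! snd t)) (\<lambda>a b. P $$ (pos s a, pos t b)) (w \<circ> pos s) (w \<circ> pos t))"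
          by (rule quad)
        also have "\<dots> = (\<Sum>s\<in>I. \<Sum>t\<in>I. bform actB (dim_row (Zs ! snd s)) (dim_row (Zs ! snd t)) (\<lambda>a b. B s t $$ (a, b)) (y s) (y t))"
        proof (intro sum.cong refl)
          fix s t assume st: "s \<in> I" "t \<in> I"
          have "bform actB (dim_row (Zs ! snd s)) (dim_row (Zs ! snd t)) (\<lambda>a b. P $$ (pos s a, pos t b)) (w \<circ> pos s) (w \<circ> pos t) =
            bform actB (dim_row (Zs ! snd s)) (dim_row (Zs ! snd t)) (\<lambda>a b. P $$ (pos s a, pos t b)) (y s) (y t)"
            by (rule bform_vec_cong) (simp_all add: w_def posb(2,4)[OF st(1)] posb(2,4)[OF st(2)])
          also have "\<dots> = bform actB (dim_row (Zs ! snd s)) (dim_row (Zs ! snd t)) (\<lambda>a b. B s t $$ (a, b)) (y s) (y t)"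
            by (rule bform_cong) (simp add: B_def subblock_def pos_def add.assoc)
          finally show "bform actB (dim_row (Zs ! snd s)) (dim_row (Zs ! snd t)) (\<lambda>a b. P $$ (pos s a, pos t b)) (w \<circ> pos s) (w \<circ> pos t) =
            bform actB (dim_row (Zs ! snd s)) (dim_row (Zs ! snd t)) (\<lambda>a b. B s t $$ (a, b)) (y s) (y t)" .
        qed
        finally show "0 \<le> (\<Sum>s\<in>I. \<Sum>t\<in>I. bform actB (dim_row (Zs ! snd s)) (dim_row (Zs ! snd t)) (\<lambda>a b. B s t $$ (a, b)) (y s) (y t))" .
      qed
      also have "\<dots> = (\<Sum>s\<in>I. \<Sum>t\<in>I. bform bop_apply (dim_row (Zs ! snd s)) (dim_row (Zs ! snd t)) (\<lambda>a b. ?A $$ (pos s a, pos t b)) (x \<circ> pos s) (x \<circ> pos t))"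
        by (intro sum.cong refl bform_cong) (simp add: entry)
      also have "\<dots> = (\<Sum>p<r * N. \<Sum>q<r * N. cinner (bop_apply (?A $$ (p, q)) (x q)) (x p))" by (rule quad[symmetric])
      finally show ?thesis .
    qed
    then show "psd bop_apply ?A" by (simp add: psd_def amplify_def)
  qed
  then show "completely_positive actB bop_apply (sum_list (map dim_row Zs)) (sum_list (map dim_row Zs)) (block_map lifted_kernel Zs)"
    unfolding N_def ns_def .
qed

end

end

context nc_pair begin

lemma decomposition:
  obtains \<Gamma>1 :: "('v, 'n bop, 'e bop) kernel" and \<Gamma>2 :: "('v, complex, 'e bop) kernel"
  where "cp_nc_kernel bop_apply bop_apply \<Omega> \<Gamma>1" "cp_nc_kernel (*) bop_apply \<Omega> \<Gamma>2"
    "\<And>Z W P. Z \<in> \<Omega> \<Longrightarrow> W \<in> \<Omega> \<Longrightarrow> P \<in> carrier_mat (dim_row Z) (dim_row W) \<Longrightarrow> S Z W P = \<Gamma>1 Z W (Q Z W P) + \<Gamma>2 Z W P"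
proof -
  obtain \<kappa> where exK: "extends_on (\<Omega>' \<times> UNIV) \<kappa>" and int: "intertwining \<Omega>' \<kappa>"
    using extension by (elim exE conjE) (rule that)
  define J1 where "J1 = (\<lambda>a :: 'n bop. (a, 0 :: complex))"
  define J2 where "J2 = (\<lambda>c :: complex. (0 :: 'n bop, c))"
  have J1: "J1 (a + b) = J1 a + J1 b" "J1 (c *\<^sub>C a) = c *\<^sub>C J1 a"
    "cinner (prod_act (J1 a) \<xi>) \<eta> = cinner (bop_apply a (fst \<xi>)) (fst \<eta>)" for a b c \<xi> \<eta>
    by (simp_all add: J1_def scaleC_prod_def scaleC_zero_right prod_act_def cinner_prod_def cinner_zero_left)
  have J2: "J2 (a + b) = J2 a + J2 b" "J2 (c *\<^sub>C a) = c *\<^sub>C J2 a"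
    "cinner (prod_act (J2 a) \<xi>) \<eta> = cinner (a * snd \<xi>) (snd \<eta>)" for a b c \<xi> \<eta>
    by (simp_all add: J2_def scaleC_prod_def scaleC_zero_right prod_act_def cinner_prod_def cinner_zero_left bop.act_zero_left)
  define \<Gamma>1 where "\<Gamma>1 = lifted_kernel \<kappa> J1"
  define \<Gamma>2 where "\<Gamma>2 = lifted_kernel \<kappa> J2"
  have 1: "cp_nc_kernel bop_apply bop_apply \<Omega> \<Gamma>1"
    unfolding \<Gamma>1_def by (rule lifted_kernel_cp[OF exK int J1 \<Omega>_pts])
  have 2: "cp_nc_kernel (*) bop_apply \<Omega> \<Gamma>2"
    unfolding \<Gamma>2_def by (rule lifted_kernel_cp[OF exK int J2 \<Omega>_pts])
  have "S Z W P = \<Gamma>1 Z W (Q Z W P) + \<Gamma>2 Z W P" if "Z \<in> \<Omega>" "W \<in> \<Omega>" and P: "P \<in> carrier_mat (dim_row Z) (dim_row W)" for Z W P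
  proof (rule eq_matI)
    have Z: "Z \<in> \<Omega>'" and W: "W \<in> \<Omega>'" using that(1,2) \<Omega>_pts by auto
    let ?P = "\<lambda>a b. P $$ (a, b)"
    have fP': "mat (dim_row Z) (dim_row W) (($$) P) = P" by (intro eq_matI) (use P in auto)
    have Sc: "S Z W P \<in> carrier_mat (dim_row Z) (dim_row W)" by (rule kfun_carrier[OF S(1) Z W P])
    show "dim_row (S Z W P) = dim_row (\<Gamma>1 Z W (Q Z W P) + \<Gamma>2 Z W P)"
      "dim_col (S Z W P) = dim_col (\<Gamma>1 Z W (Q Z W P) + \<Gamma>2 Z W P)"
      using carrier_matD[OF Sc] by (simp_all add: \<Gamma>2_def lifted_kernel_def[OF exK int J2])
    fix a b assume "a < dim_row (\<Gamma>1 Z W (Q Z W P) + \<Gamma>2 Z W P)" "b < dim_col (\<Gamma>1 Z W (Q Z W P) + \<Gamma>2 Z W P)"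
    then have ab: "a < dim_row Z" "b < dim_row W" by (simp_all add: \<Gamma>2_def lifted_kernel_def[OF exK int J2])
    \<comment> \<open>The pair q(P) is the sum of its two embedded coordinates; additivity of the
      extension then splits S into the two kernels.\<close>
    have "qpair Z W ?P = pad J1 (dim_row Z) (dim_row W) (Q Z W P) + pad J2 (dim_row Z) (dim_row W) P"
    proof (intro ext)
      fix i j
      have "pad J1 (dim_row Z) (dim_row W) R i j = (if i < dim_row Z \<and> j < dim_row W then (R $$ (i, j), 0) else 0)" for R
        unfolding pad_def[OF exK int J1] by (simp add: J1_def)
      moreover have "pad J2 (dim_row Z) (dim_row W) R i j = (if i < dim_row Z \<and> j < dim_row W then (0, R $$ (i, j)) else 0)" for R
        unfolding pad_def[OF exK int J2] by (simp add: J2_def)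
      ultimately show "qpair Z W ?P i j = (pad J1 (dim_row Z) (dim_row W) (Q Z W P) + pad J2 (dim_row Z) (dim_row W) P) i j"
        by (simp add: qpair_def kfun_def fP' zero_prod_def)
    qed
    then have "operator_entry \<kappa> Z W (qpair Z W ?P) a b = (\<Gamma>1 Z W (Q Z W P) + \<Gamma>2 Z W P) $$ (a, b)"
      using ab by (simp add: operator_entry_add[OF exK int Z W] \<Gamma>1_def \<Gamma>2_def lifted_kernel_def[OF exK int J1] lifted_kernel_def[OF exK int J2])
    moreover have "S Z W P $$ (a, b) = operator_entry \<kappa> Z W (qpair Z W ?P) a b"
    proof (rule bop_eqI)
      fix u v
      have "cinner (bop_apply (operator_entry \<kappa> Z W (qpair Z W ?P) a b) v) u = Sform Z W ?P (vec_at a u) (vec_at b v)"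
        unfolding operator_entry[OF exK int Z W] by (rule extends_eq[OF exK]) (simp_all add: Z W)
      also have "\<dots> = cinner (bop_apply (kfun S Z W ?P a b) v) u" by (rule bop.bform_vec_at[OF ab])
      also have "kfun S Z W ?P a b = S Z W P $$ (a, b)" using ab by (simp add: kfun_def fP')
      finally show "cinner (bop_apply (S Z W P $$ (a, b)) v) u = cinner (bop_apply (operator_entry \<kappa> Z W (qpair Z W ?P) a b) v) u" ..
    qed
    ultimately show "S Z W P $$ (a, b) = (\<Gamma>1 Z W (Q Z W P) + \<Gamma>2 Z W P) $$ (a, b)" by simp
  qed
  with 1 2 show thesis by (rule that)
qed

end

theorem theorem5p1:
  fixes \<Xi> \<Omega> \<Omega>' :: "'v::complex_vector mat set"
    and Q :: "('v, complex, 'n::chilbert_space bop) kernel"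
    and S :: "('v, complex, 'e::chilbert_space bop) kernel"
  assumes "full_nc \<Xi>"
    and "nc_kernel \<Xi> Q" and "hermitian_kernel \<Xi> Q"
    and "\<Omega> \<subseteq> pos_set \<Xi> Q"
    and "\<Omega>' = full_hull \<Omega> \<inter> pos_set \<Xi> Q"
    and "nc_kernel \<Omega>' S" and "hermitian_kernel \<Omega>' S"
    and "\<forall>Z \<in> \<Omega>'. psd bop_apply (S Z Z (1\<^sub>m (dim_row Z)))"
    and "\<forall>F. finite F \<and> F \<subseteq> \<Xi> \<longrightarrow> decomposable (*) bop_apply F Q"
    and "\<forall>F. finite F \<and> F \<subseteq> \<Omega>' \<longrightarrow> decomposable (*) bop_apply F S"
  shows "\<exists>(\<Gamma>1 :: ('v, 'n bop, 'e bop) kernel) (\<Gamma>2 :: ('v, complex, 'e bop) kernel).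
           cp_nc_kernel bop_apply bop_apply \<Omega> \<Gamma>1 \<and>
           cp_nc_kernel (*) bop_apply \<Omega> \<Gamma>2 \<and>
           (\<forall>Z \<in> \<Omega>. \<forall>W \<in> \<Omega>. \<forall>P \<in> carrier_mat (dim_row Z) (dim_row W).
              S Z W P = \<Gamma>1 Z W (Q Z W P) + \<Gamma>2 Z W P)"
proof -
  interpret nc_pair \<Xi> \<Omega> \<Omega>' Q S
    by unfold_locales (use assms in \<open>simp_all\<close>)
  show ?thesis by (rule decomposition) (intro exI conjI ballI)
qed

end
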